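(* A $\mathbf{Ger}^+_\infty$-algebra structure on the pair of cochain complexes $(V,A)$ is a triple: (1) a $\mathbf{Ger}_\infty$-structure on $V$; (2) an $A_\infty$-structure on $A$; and (3) an $L_\infty$-morphism from $V$ (with the $\Lambda\mathbf{Lie}_\infty$-structure underlying its $\mathbf{Ger}_\infty$-structure) to the Hochschild cochain complex $C^\bullet(A,A)$ of the $A_\infty$-algebra $A$ (with its $\Lambda\mathbf{Lie}$-algebra structure given by the Hochschild differential and the Gerstenhaber bracket).
   Context: Conventions. The ground field $\mathbb K$ has characteristic zero. For a graded vector space $V$, $\mathbf s V$ is the suspension (degrees raised by $1$); $S(V)$, $T(V)$ are the symmetric and tensor algebras and $\underline S(V)=\bigoplus_{k\ge1}S^k(V)$, $\underline T(V)=\bigoplus_{k\ge 1}V^{\otimes k}$ their truncations. For a (co)operad $\mathcal O$, $\Lambda\mathcal O(m)=\mathbf s^{1-m}\mathcal O(m)\otimes \mathrm{sgn}_m$. $\mathbf{Ger}$ is the operad of Gerstenhaber algebras, $\mathbf{Ger}^\vee=\Lambda^2\mathbf{Ger}^*$ is its Koszul dual cooperad ($\mathbf{Ger}^*$ the linear dual), and $\mathbf{Ger}_\infty=\mathrm{Cobar}(\mathbf{Ger}^\vee)$. The degree of a cooperation is the degree of the corresponding vector of the cooperad; the corresponding map has the opposite degree. The cooperad $\mathbf S$. An $\mathbf S$-coalgebra is a pair $(V,A)$ where $V$ is a $\mathbf{Ger}^\vee$-coalgebra (with cocommutative comultiplication $\Delta_{\mathfrak c}$ and cobracket $\delta_{\mathfrak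 c}$) and $A$ is a $\Lambda\mathbf{coassoc}$-coalgebra (with coassociative comultiplication $\Delta_{\mathfrak o}$ of degree $-1$), together with a unary operation $\rho:A\to V$ of degree $-1$ such that $\delta_{\mathfrak c}\circ\rho=0$, $\Delta_{\mathfrak c}\circ\rho=(\rho\otimes\rho)\circ\Delta_{\mathfrak o}$, and $(\rho\otimes \mathrm{id})\circ\Delta_{\mathfrak o}=\sigma\circ(\mathrm{id}\otimes\rho)\circ\Delta_{\mathfrak o}$ as maps $A\to V\otimes A$, where $\sigma:A\otimes V\to V\otimes A$ switches the tensor factors. $\mathbf S$ is the 2-colored cooperad (color $\mathfrak c$ for $V$, color $\mathfrak o$ for $A$) governing $\mathbf S$-coalgebras. The cofree $\mathbf S$-coalgebra cogenerated by $(V,A)$ is $\mathbf S(V,A)=\mathbf S^{\mathfrak c}(V,A)\oplus\mathbf S^{\mathfrak o}(V,A)$ with $\mathbf S^{\mathfrak c}(V,A)=\mathbf{Ger}^\vee(V)$ (the cofree $\mathbf{Ger}^\vee$-coalgebra) and $\mathbf S^{\mathfrak o}(V,A)=\mathbf s\big(\underline S(\mathbf s^{-2}V)\otimes T(\mathbf s^{-1}A)\big)\oplus\mathbf s\,\underline T(\mathbf s^{-1}A)$. $\mathbf{Ger}^+_\infty=\mathrm{Cobar}(\mathbf S)$, a 2-colored DG operad. A $\mathbf{Ger}^+_\infty$-algebra structure on $(V,A)$ is a degree $1$ codifferential $\hat Q$ on the cofree $\mathbf S$-coalgebra $\mathbf S(V,A)$ (extending the differentials of $V$ and $A$). It is determined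 by $Q=p\circ\hat Q$, where $p:\mathbf S(V,A)\to V\oplus A$ is the projection, with components $Q^{\mathfrak c}:\mathbf{Ger}^\vee(V)\to V$ and $Q^{\mathfrak o}:\mathbf S^{\mathfrak o}(V,A)\to A$. Similarly a $\mathbf{Ger}_\infty$-structure on $V$ is a degree $1$ codifferential on $\mathbf{Ger}^\vee(V)$. Hochschild cochains. For a graded vector space $A$, $\bigoplus_{k\ge0}\mathbf s^k\mathrm{Hom}(A^{\otimes k},A)$ is a $\Lambda\mathbf{Lie}$-algebra (graded Lie algebra with bracket of degree $-1$) under the Gerstenhaber bracket $[\,,]_G$ (the signed sum of insertions of one cochain into the slots of the other, antisymmetrized in the graded sense). An $A_\infty$-structure on $A$ is an element $m\in\bigoplus_{k\ge1}\mathbf s^k\mathrm{Hom}(A^{\otimes k},A)$ (of degree $2$) satisfying $[m,m]_G=0$; its component in $\mathbf s\,\mathrm{Hom}(A,A)$ is the differential of $A$. The Hochschild cochain complex $C^\bullet(A,A)$ of the $A_\infty$-algebra $(A,m)$ is $\bigoplus_{k\ge0}\mathbf s^k\mathrm{Hom}(A^{\otimes k},A)$ with the differential $\partial^{Hoch}=[m,\cdot]_G$; with $[\,,]_G$ it is a DG $\Lambda\mathbf{Lie}$-algebra. $L_\infty$-morphisms. A $\Lambda\mathbf{Lie}_\infty$-structure on $\mathcal L$ is a degree $1$ codifferential on the cofree $\Lambda^2\mathbf{cocomm}$-coalgebra $\Lambda^2\mathbf{cocomm}(\mathcal L)=\mathbf s^2\underline S(\mathbf s^{-2}\mathcal L)$.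 An $L_\infty$-morphism between $\Lambda\mathbf{Lie}_\infty$-algebras is a morphism of these coalgebras compatible with codifferentials; it is determined by its composition with the projection onto the cogenerators of the target. A $\mathbf{Ger}_\infty$-structure on $V$ yields a $\Lambda\mathbf{Lie}_\infty$-structure by restricting the codifferential to $\Lambda^2\mathbf{cocomm}(V)\subset\mathbf{Ger}^\vee(V)$. The correspondence meant in the claim (with $\mathfrak o$-components desuspended): the $\mathbf{Ger}_\infty$-structure is $Q^{\mathfrak c}$, the $A_\infty$-structure is $m(a_1,\dots,a_n)=Q^{\mathfrak o}(a_1,\dots,a_n)$, and the $L_\infty$-morphism is given by $U:\Lambda^2\mathbf{cocomm}(V)\to C^\bullet(A,A)$, $U(v_1,\dots,v_k)(a_1,\dots,a_n)=Q^{\mathfrak o}(v_1,\dots,v_k;a_1,\dots,a_n)$ for $k\ge1$.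
   Formalization: Hochschild cochains, and hence A∞-structures, are taken in the direct product over the number k of inputs rather than the direct sum; with the direct sum the claim fails for A∞-structures having infinitely many nonzero operations (already for V = 0). *)

theory Defs
  imports Complex_Main "HOL-Library.Function_Algebras"
begin

section \<open>Graded vector spaces and Koszul signs\<close>

text \<open>
  A graded vector space is a family of subspaces \<open>cmp V n\<close> of an ambient vector space, whose sum
  is direct. The ambient type may be larger than the total space \<open>tot V\<close>. The degree of a
  homogeneous element is determined unless the element is 0; the value of \<open>deg V 0\<close> never matters,
  since it only enters through signs in front of expressions that vanish.
\<close>

record ('k, 'x) gvs =
  scl :: "'k \<Rightarrow> 'x \<Rightarrow> 'x"
  cmp :: "int \<Rightarrow> 'x set"

definition graded_space :: "('k::field_char_0, 'x::ab_group_add) gvs \<Rightarrow> bool" where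
  "graded_space V \<longleftrightarrow> vector_space (scl V) \<and> (\<forall>n. module.subspace (scl V) (cmp V n)) \<and>
     (\<forall>N x. finite N \<longrightarrow> (\<forall>n\<in>N. x n \<in> cmp V n) \<longrightarrow> (\<Sum>n\<in>N. x n) = 0 \<longrightarrow> (\<forall>n\<in>N. x n = 0))"

definition hmg :: "('k, 'x) gvs \<Rightarrow> 'x set" where
  "hmg V = (\<Union>n. cmp V n)"

definition tot :: "('k::field_char_0, 'x::ab_group_add) gvs \<Rightarrow> 'x set" where
  "tot V = module.span (scl V) (hmg V)"

definition deg :: "('k, 'x) gvs \<Rightarrow> 'x \<Rightarrow> int" where
  "deg V x = (THE n. x \<in> cmp V n)"

abbreviation words :: "('k, 'x) gvs \<Rightarrow> 'x list set" where
  "words V \<equiv> lists (hmg V)"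

text \<open>\<open>ksign n x\<close> is \<open>(-1)^n x\<close>.\<close>

definition ksign :: "int \<Rightarrow> 'x::ab_group_add \<Rightarrow> 'x" where
  "ksign n x = (if even n then x else - x)"

text \<open>
  Linear maps are only of interest on the total space, and are normalised to be 0 outside it, so that
  equality of maps is equality of functions. \<open>Hom V W n\<close> is the set of linear maps of degree \<open>n\<close>.
\<close>

definition linear_map ::
  "('k::field_char_0, 'x::ab_group_add) gvs \<Rightarrow> ('k \<Rightarrow> 'w \<Rightarrow> 'w) \<Rightarrow> ('x \<Rightarrow> 'w::ab_group_add) \<Rightarrow> bool"
where
  "linear_map V s f \<longleftrightarrow>
     (\<forall>x\<in>tot V. \<forall>y\<in>tot V. \<forall>c. f (x + scl V c y) = f x + s c (f y)) \<and> (\<forall>x. x \<notin> tot V \<longrightarrow> f x = 0)"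

definition Hom ::
  "('k::field_char_0, 'x::ab_group_add) gvs \<Rightarrow> ('k, 'w::ab_group_add) gvs \<Rightarrow> int \<Rightarrow> ('x \<Rightarrow> 'w) set"
where
  "Hom V W n = {f. linear_map V (scl W) f \<and> (\<forall>k. f ` cmp V k \<subseteq> cmp W (k + n))}"

definition cochain_complex :: "('k::field_char_0, 'x::ab_group_add) gvs \<Rightarrow> ('x \<Rightarrow> 'x) \<Rightarrow> bool" where
  "cochain_complex V d \<longleftrightarrow> graded_space V \<and> d \<in> Hom V V 1 \<and> (\<forall>x. d (d x) = 0)"

text \<open>Linearity on each homogeneous component, the building block of multilinearity.\<close>

definition slot_linear ::
  "('k::field_char_0, 'x::ab_group_add) gvs \<Rightarrow> ('k \<Rightarrow> 'w \<Rightarrow> 'w) \<Rightarrow> ('x \<Rightarrow> 'w::ab_group_add) \<Rightarrow> bool"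
where
  "slot_linear V s f \<longleftrightarrow>
     (\<forall>n. \<forall>u\<in>cmp V n. \<forall>v\<in>cmp V n. \<forall>c. f (u + scl V c v) = f u + s c (f v))"

section \<open>Spaces given by generators and relations\<close>

text \<open>
  Tensor products, symmetric powers etc. are quotients of the free vector space on a set \<open>G\<close> of
  formal monomials. Let \<open>\<Phi>\<close> be the set of all forms (scalar functions of monomials) that respect
  the relations. Over a field, the quotient embeds into the dual of \<open>\<Phi>\<close>, the class of a monomial
  \<open>g\<close> going to evaluation at \<open>g\<close>. We take the image of this embedding as the definition of the
  quotient.
\<close>

type_synonym ('g, 'k) functional = "('g \<Rightarrow> 'k) \<Rightarrow> 'k"

definition fscl :: "'k::field_char_0 \<Rightarrow> ('g, 'k) functional \<Rightarrow> ('g, 'k) functional" where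
  "fscl c t = (\<lambda>\<phi>. c * t \<phi>)"

definition pure :: "('g \<Rightarrow> 'k::field_char_0) set \<Rightarrow> 'g \<Rightarrow> ('g, 'k) functional" where
  "pure \<Phi> g = (\<lambda>\<phi>. if \<phi> \<in> \<Phi> then \<phi> g else 0)"

definition presented ::
  "('g \<Rightarrow> 'k::field_char_0) set \<Rightarrow> 'g set \<Rightarrow> ('g \<Rightarrow> int) \<Rightarrow> ('k, ('g, 'k) functional) gvs"
where
  "presented \<Phi> G d = \<lparr>scl = fscl, cmp = (\<lambda>n. module.span fscl (pure \<Phi> ` {g \<in> G. d g = n}))\<rparr>"

text \<open>The linear map on \<open>X\<close> with prescribed values \<open>f g\<close> on the spanning vectors \<open>e g\<close>, \<open>g \<in> G\<close>.\<close>

definition lin_extension ::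
  "('k::field_char_0, 'x::ab_group_add) gvs \<Rightarrow> ('g \<Rightarrow> 'x) \<Rightarrow> 'g set \<Rightarrow>
   ('k \<Rightarrow> 'w \<Rightarrow> 'w) \<Rightarrow> ('g \<Rightarrow> 'w::ab_group_add) \<Rightarrow> 'x \<Rightarrow> 'w"
where
  "lin_extension X e G s f = (THE F. linear_map X s F \<and> (\<forall>g\<in>G. F (e g) = f g))"

subsection \<open>Tensor products of graded spaces, coderivations\<close>

definition bilinear_forms ::
  "('k::field_char_0, 'x::ab_group_add) gvs \<Rightarrow> ('k, 'y::ab_group_add) gvs \<Rightarrow> ('x \<times> 'y \<Rightarrow> 'k) set"
where
  "bilinear_forms X Y = {\<beta>.
     (\<forall>x\<in>hmg X. slot_linear Y (*) (\<lambda>y. \<beta> (x, y))) \<and> (\<forall>y\<in>hmg Y. slot_linear X (*) (\<lambda>x. \<beta> (x, y)))}"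

definition tensor ::
  "('k::field_char_0, 'x::ab_group_add) gvs \<Rightarrow> ('k, 'y::ab_group_add) gvs \<Rightarrow>
   ('k, ('x \<times> 'y, 'k) functional) gvs"
where
  "tensor X Y = presented (bilinear_forms X Y) (hmg X \<times> hmg Y) (\<lambda>(x, y). deg X x + deg Y y)"

definition tens ::
  "('k::field_char_0, 'x::ab_group_add) gvs \<Rightarrow> 'x \<Rightarrow> 'x \<Rightarrow> ('x \<times> 'x, 'k) functional"
where
  "tens X x y = pure (bilinear_forms X X) (x, y)"

text \<open>\<open>Q \<otimes> 1 + 1 \<otimes> Q\<close> for \<open>Q\<close> of degree 1 on \<open>X\<close>, and \<open>F \<otimes> F\<close> for \<open>F\<close> of degree 0.\<close>

definition tensor_leibniz ::
  "('k::field_char_0, 'x::ab_group_add) gvs \<Rightarrow> ('x \<Rightarrow> 'x) \<Rightarrow>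
   ('x \<times> 'x, 'k) functional \<Rightarrow> ('x \<times> 'x, 'k) functional"
where
  "tensor_leibniz X Q =
     lin_extension (tensor X X) (\<lambda>(x, y). tens X x y) (hmg X \<times> hmg X) fscl
       (\<lambda>(x, y). tens X (Q x) y + ksign (deg X x) (tens X x (Q y)))"

definition tensor_square ::
  "('k::field_char_0, 'x::ab_group_add) gvs \<Rightarrow> ('k, 'y::ab_group_add) gvs \<Rightarrow> ('x \<Rightarrow> 'y) \<Rightarrow>
   ('x \<times> 'x, 'k) functional \<Rightarrow> ('y \<times> 'y, 'k) functional"
where
  "tensor_square X Y F =
     lin_extension (tensor X X) (\<lambda>(x, y). tens X x y) (hmg X \<times> hmg X) fscl
       (\<lambda>(x, y). tens Y (F x) (F y))"

text \<open>
  \<open>Q\<close>, of degree 1, is a coderivation with respect to a binary cooperation \<open>\<omega> : X \<rightarrow> X \<otimes> X\<close> that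
  has degree \<open>e\<close> as a map: \<open>\<omega> Q = (-1)^e (Q \<otimes> 1 + 1 \<otimes> Q) \<omega>\<close>.
\<close>

definition coderivation ::
  "('k::field_char_0, 'x::ab_group_add) gvs \<Rightarrow> int \<Rightarrow> ('x \<Rightarrow> ('x \<times> 'x, 'k) functional) \<Rightarrow>
   ('x \<Rightarrow> 'x) \<Rightarrow> bool"
where
  "coderivation X e \<omega> Q \<longleftrightarrow> (\<forall>t\<in>tot X. \<omega> (Q t) = ksign e (tensor_leibniz X Q (\<omega> t)))"

subsection \<open>Signed sums over shuffles and unshuffles\<close>

text \<open>\<open>wt d xs\<close> is the degree of a monomial whose letters \<open>x\<close> have degree \<open>d x\<close>.\<close>

definition wt :: "('e \<Rightarrow> int) \<Rightarrow> 'e list \<Rightarrow> int" where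
  "wt d xs = (\<Sum>x\<leftarrow>xs. d x)"

text \<open>
  Sum of \<open>\<plusminus> h l r\<close> over all ways to distribute the letters of a monomial over an ordered pair of
  submonomials \<open>(l, r)\<close>, with the Koszul sign of the rearrangement; the cases where \<open>l\<close> or \<open>r\<close> is
  empty are included.
\<close>

fun unshuffle_sum ::
  "('e \<Rightarrow> int) \<Rightarrow> ('e list \<Rightarrow> 'e list \<Rightarrow> 'm::ab_group_add) \<Rightarrow> 'e list \<Rightarrow> 'm"
where
  "unshuffle_sum d h [] = h [] []"
| "unshuffle_sum d h (x # xs) =
     unshuffle_sum d (\<lambda>l r. h (x # l) r) xs +
     unshuffle_sum d (\<lambda>l r. ksign (d x * wt d l) (h l (x # r))) xs"

text \<open>Sum of \<open>\<plusminus> h w\<close> over all shuffles \<open>w\<close> of two words, with Koszul signs.\<close>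

fun shuffle_sum ::
  "('e \<Rightarrow> int) \<Rightarrow> ('e list \<Rightarrow> 'm::ab_group_add) \<Rightarrow> 'e list \<Rightarrow> 'e list \<Rightarrow> 'm"
where
  "shuffle_sum d h [] ys = h ys"
| "shuffle_sum d h (x # xs) [] = h (x # xs)"
| "shuffle_sum d h (x # xs) (y # ys) =
     shuffle_sum d (\<lambda>w. h (x # w)) xs (y # ys) +
     ksign (d y * wt d (x # xs)) (shuffle_sum d (\<lambda>w. h (y # w)) (x # xs) ys)"

section \<open>The coalgebra \<open>\<Lambda>\<^sup>2cocomm(L)\<close> and \<open>\<Lambda>Lie\<^sub>\<infinity>\<close>-structures\<close>

text \<open>
  The elements of \<open>s\<^sup>2 S(s\<^sup>-\<^sup>2 L)\<close> (truncated symmetric algebra) are spanned by monomials, written as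
  nonempty lists of homogeneous elements of \<open>L\<close>; \<open>s\<^sup>-\<^sup>2 v\<close> has degree \<open>deg v - 2\<close>.
\<close>

definition sdeg2 :: "('k, 'v) gvs \<Rightarrow> 'v \<Rightarrow> int" where
  "sdeg2 V v = deg V v - 2"

definition sdeg1 :: "('k, 'v) gvs \<Rightarrow> 'v \<Rightarrow> int" where
  "sdeg1 V v = deg V v - 1"

definition sym_forms :: "('k::field_char_0, 'v::ab_group_add) gvs \<Rightarrow> ('v list \<Rightarrow> 'k) set" where
  "sym_forms L = {\<phi>.
     (\<forall>xs\<in>words L. \<forall>ys\<in>words L. slot_linear L (*) (\<lambda>u. \<phi> (xs @ u # ys))) \<and>
     (\<forall>xs\<in>words L. \<forall>ys\<in>words L. \<forall>u\<in>hmg L. \<forall>v\<in>hmg L.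
        \<phi> (xs @ u # v # ys) = ksign (sdeg2 L u * sdeg2 L v) (\<phi> (xs @ v # u # ys)))}"

definition cocomm_mon ::
  "('k::field_char_0, 'v::ab_group_add) gvs \<Rightarrow> 'v list \<Rightarrow> ('v list, 'k) functional" where
  "cocomm_mon L = pure (sym_forms L)"

definition cocomm_gens :: "('k, 'v) gvs \<Rightarrow> 'v list set" where
  "cocomm_gens L = words L - {[]}"

definition cocomm ::
  "('k::field_char_0, 'v::ab_group_add) gvs \<Rightarrow> ('k, ('v list, 'k) functional) gvs" where
  "cocomm L = presented (sym_forms L) (cocomm_gens L) (\<lambda>vs. wt (sdeg2 L) vs + 2)"

definition cocomm_Delta ::
  "('k::field_char_0, 'v::ab_group_add) gvs \<Rightarrow> ('v list, 'k) functional \<Rightarrow>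
   (('v list, 'k) functional \<times> ('v list, 'k) functional, 'k) functional" where
  "cocomm_Delta L = lin_extension (cocomm L) (cocomm_mon L) (cocomm_gens L) fscl
     (unshuffle_sum (sdeg2 L) (\<lambda>l r.
        if l = [] \<or> r = [] then 0 else tens (cocomm L) (cocomm_mon L l) (cocomm_mon L r)))"

definition cocomm_proj ::
  "('k::field_char_0, 'v::ab_group_add) gvs \<Rightarrow> ('v list, 'k) functional \<Rightarrow> 'v" where
  "cocomm_proj L = lin_extension (cocomm L) (cocomm_mon L) (cocomm_gens L) (scl L)
     (\<lambda>vs. case vs of [v] \<Rightarrow> v | _ \<Rightarrow> 0)"

definition LambdaLie_infinity ::
  "('k::field_char_0, 'v::ab_group_add) gvs \<Rightarrow>
   (('v list, 'k) functional \<Rightarrow> ('v list, 'k) functional) \<Rightarrow> bool" where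
  "LambdaLie_infinity L Q \<longleftrightarrow>
     Q \<in> Hom (cocomm L) (cocomm L) 1 \<and>
     coderivation (cocomm L) 2 (cocomm_Delta L) Q \<and>
     (\<forall>t. Q (Q t) = 0)"

definition Linfinity_morphism ::
  "('k::field_char_0, 'v::ab_group_add) gvs \<Rightarrow>
   (('v list, 'k) functional \<Rightarrow> ('v list, 'k) functional) \<Rightarrow>
   ('k, 'w::ab_group_add) gvs \<Rightarrow>
   (('w list, 'k) functional \<Rightarrow> ('w list, 'k) functional) \<Rightarrow>
   (('v list, 'k) functional \<Rightarrow> ('w list, 'k) functional) \<Rightarrow> bool" where
  "Linfinity_morphism L Q L' Q' F \<longleftrightarrow>
     LambdaLie_infinity L Q \<and> LambdaLie_infinity L' Q' \<and>
     F \<in> Hom (cocomm L) (cocomm L') 0 \<and>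
     (\<forall>t\<in>tot (cocomm L).
        cocomm_Delta L' (F t) = tensor_square (cocomm L) (cocomm L') F (cocomm_Delta L t)) \<and>
     (\<forall>t\<in>tot (cocomm L). F (Q t) = Q' (F t))"

section \<open>The cofree \<open>Ger\<^sup>\<or>\<close>-coalgebra\<close>

text \<open>
  Since \<open>Ger = Com \<circ> \<Lambda>Lie\<close>, we have \<open>Ger\<^sup>\<or> = \<Lambda>\<^sup>2Ger\<^sup>* = \<Lambda>\<^sup>2cocomm \<circ> \<Lambda>coLie\<close>. The cofree
  \<open>\<Lambda>coLie\<close>-coalgebra on \<open>V\<close> is \<open>s coLie(s\<^sup>-\<^sup>1 V)\<close>, and \<open>coLie(X)\<close> is the truncated tensor algebra of
  \<open>X\<close> modulo shuffle products, with the antisymmetrised deconcatenation as cobracket. So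
    \<open>Ger\<^sup>\<or>(V) = s\<^sup>2 S(s\<^sup>-\<^sup>1 coLie(s\<^sup>-\<^sup>1 V))\<close>  (truncated symmetric algebra).
  A generating monomial is a nonempty list of blocks; a block \<open>[v\<^sub>1, ..., v\<^sub>p]\<close>, \<open>p \<ge> 1\<close>, stands for
  \<open>s\<^sup>-\<^sup>1 (s\<^sup>-\<^sup>1 v\<^sub>1 | ... | s\<^sup>-\<^sup>1 v\<^sub>p)\<close>. A block \<open>[v]\<close> is \<open>s\<^sup>-\<^sup>2 v\<close>, and the monomials all of whose
  blocks have length one span \<open>\<Lambda>\<^sup>2cocomm(V)\<close>.
\<close>

definition block_deg :: "('e \<Rightarrow> int) \<Rightarrow> 'e list \<Rightarrow> int" where
  "block_deg d B = wt d B - 1"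

definition blocks :: "('k, 'v) gvs \<Rightarrow> 'v list set" where
  "blocks V = words V - {[]}"

definition ger_forms :: "('k::field_char_0, 'v::ab_group_add) gvs \<Rightarrow> ('v list list \<Rightarrow> 'k) set" where
  "ger_forms V = {\<phi>.
     (\<forall>bs\<in>lists (blocks V). \<forall>cs\<in>lists (blocks V). \<forall>xs\<in>words V. \<forall>ys\<in>words V.
        slot_linear V (*) (\<lambda>u. \<phi> (bs @ (xs @ u # ys) # cs))) \<and>
     (\<forall>bs\<in>lists (blocks V). \<forall>cs\<in>lists (blocks V). \<forall>B\<in>blocks V. \<forall>C\<in>blocks V.
        \<phi> (bs @ B # C # cs) =
        ksign (block_deg (sdeg1 V) B * block_deg (sdeg1 V) C) (\<phi> (bs @ C # B # cs))) \<and>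
     (\<forall>bs\<in>lists (blocks V). \<forall>cs\<in>lists (blocks V). \<forall>xs\<in>blocks V. \<forall>ys\<in>blocks V.
        shuffle_sum (sdeg1 V) (\<lambda>w. \<phi> (bs @ w # cs)) xs ys = 0)}"

definition ger_mon ::
  "('k::field_char_0, 'v::ab_group_add) gvs \<Rightarrow> 'v list list \<Rightarrow> ('v list list, 'k) functional" where
  "ger_mon V = pure (ger_forms V)"

definition ger_gens :: "('k, 'v) gvs \<Rightarrow> 'v list list set" where
  "ger_gens V = lists (blocks V) - {[]}"

definition Ger_dual ::
  "('k::field_char_0, 'v::ab_group_add) gvs \<Rightarrow> ('k, ('v list list, 'k) functional) gvs" where
  "Ger_dual V =
     presented (ger_forms V) (ger_gens V) (\<lambda>Bs. wt (block_deg (sdeg1 V)) Bs + 2)"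

definition ger_Delta ::
  "('k::field_char_0, 'v::ab_group_add) gvs \<Rightarrow> ('v list list, 'k) functional \<Rightarrow>
   (('v list list, 'k) functional \<times> ('v list list, 'k) functional, 'k) functional" where
  "ger_Delta V = lin_extension (Ger_dual V) (ger_mon V) (ger_gens V) fscl
     (unshuffle_sum (block_deg (sdeg1 V)) (\<lambda>l r.
        if l = [] \<or> r = [] then 0 else tens (Ger_dual V) (ger_mon V l) (ger_mon V r)))"

text \<open>
  The cobracket deconcatenates one block \<open>s\<^sup>-\<^sup>1(x|y)\<close>, where it is
    \<open>s\<^sup>-\<^sup>1(x|y) \<mapsto> (s\<^sup>-\<^sup>1 \<otimes> s\<^sup>-\<^sup>1)(x \<otimes> y - (-1)^(deg x deg y) y \<otimes> x)\<close>,
  and distributes the remaining blocks over the two tensor factors (co-Leibniz rule). All signs are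
  Koszul signs, for the operation of degree -1 that passes the blocks preceding the split one, and
  for the rearrangement. In the equation for a nonempty list the first summand splits the
  first block, the second one splits a later block.
\<close>

fun cobracket_sum ::
  "('e \<Rightarrow> int) \<Rightarrow> ('e list list \<Rightarrow> 'e list list \<Rightarrow> 'm::ab_group_add) \<Rightarrow> 'e list list \<Rightarrow> 'm"
where
  "cobracket_sum d h [] = 0"
| "cobracket_sum d h (B # Bs) =
     (\<Sum>i = 1..<length B.
        let x = take i B; y = drop i B in
        unshuffle_sum (block_deg d) (\<lambda>l r.
            ksign (wt d x + wt (block_deg d) l * block_deg d y) (h (x # l) (y # r))
          - ksign (wt d x * wt d y + wt d y + wt (block_deg d) l * block_deg d x)
              (h (y # l) (x # r))) Bs)
     + ksign (block_deg d B)
         (cobracket_sum d (\<lambda>l r. h (B # l) r) Bs +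
          cobracket_sum d (\<lambda>l r. ksign (block_deg d B * wt (block_deg d) l) (h l (B # r))) Bs)"

definition ger_delta ::
  "('k::field_char_0, 'v::ab_group_add) gvs \<Rightarrow> ('v list list, 'k) functional \<Rightarrow>
   (('v list list, 'k) functional \<times> ('v list list, 'k) functional, 'k) functional" where
  "ger_delta V = lin_extension (Ger_dual V) (ger_mon V) (ger_gens V) fscl
     (cobracket_sum (sdeg1 V) (\<lambda>l r. tens (Ger_dual V) (ger_mon V l) (ger_mon V r)))"

definition ger_proj ::
  "('k::field_char_0, 'v::ab_group_add) gvs \<Rightarrow> ('v list list, 'k) functional \<Rightarrow> 'v" where
  "ger_proj V = lin_extension (Ger_dual V) (ger_mon V) (ger_gens V) (scl V)
     (\<lambda>Bs. case Bs of [[v]] \<Rightarrow> v | _ \<Rightarrow> 0)"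

text \<open>
  As maps, the comultiplication has degree 2 and the cobracket has degree 1 (the cooperations have
  the opposite degrees).
\<close>

definition Ger_infinity ::
  "('k::field_char_0, 'v::ab_group_add) gvs \<Rightarrow> ('v \<Rightarrow> 'v) \<Rightarrow>
   (('v list list, 'k) functional \<Rightarrow> ('v list list, 'k) functional) \<Rightarrow> bool" where
  "Ger_infinity V dV Q \<longleftrightarrow>
     Q \<in> Hom (Ger_dual V) (Ger_dual V) 1 \<and>
     coderivation (Ger_dual V) 2 (ger_Delta V) Q \<and>
     coderivation (Ger_dual V) 1 (ger_delta V) Q \<and>
     (\<forall>t. Q (Q t) = 0) \<and>
     (\<forall>v\<in>hmg V. ger_proj V (Q (ger_mon V [[v]])) = dV v)"

text \<open>The inclusion of \<open>\<Lambda>\<^sup>2cocomm(V)\<close> into \<open>Ger\<^sup>\<or>(V)\<close>.\<close>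

definition cocomm_incl ::
  "('k::field_char_0, 'v::ab_group_add) gvs \<Rightarrow>
   ('v list, 'k) functional \<Rightarrow> ('v list list, 'k) functional" where
  "cocomm_incl V = lin_extension (cocomm V) (cocomm_mon V) (cocomm_gens V) fscl
     (\<lambda>vs. ger_mon V (map (\<lambda>v. [v]) vs))"

text \<open>\<open>Qs\<close> is the restriction of \<open>Q\<close> to \<open>\<Lambda>\<^sup>2cocomm(V)\<close>; the inclusion is injective.\<close>

definition restricts_to_cocomm ::
  "('k::field_char_0, 'v::ab_group_add) gvs \<Rightarrow>
   (('v list list, 'k) functional \<Rightarrow> ('v list list, 'k) functional) \<Rightarrow>
   (('v list, 'k) functional \<Rightarrow> ('v list, 'k) functional) \<Rightarrow> bool" where
  "restricts_to_cocomm V Q Qs \<longleftrightarrow>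
     Qs \<in> Hom (cocomm V) (cocomm V) 1 \<and>
     (\<forall>t\<in>tot (cocomm V). cocomm_incl V (Qs t) = Q (cocomm_incl V t))"

section \<open>The cofree \<open>S\<close>-coalgebra and \<open>Ger\<^sub>\<infinity>\<^sup>+\<close>-structures\<close>

text \<open>
  The component of colour c is \<open>Ger\<^sup>\<or>(V)\<close>. The component of colour o is \<open>s D\<close>, where
  \<open>D = S(s\<^sup>-\<^sup>2 V) \<otimes> T(s\<^sup>-\<^sup>1 A)\<close> without the component \<open>S\<^sup>0 \<otimes> T\<^sup>0\<close>. A monomial is a pair \<open>(vs, as)\<close>
  of lists, not both empty.
\<close>

definition so_forms ::
  "('k::field_char_0, 'v::ab_group_add) gvs \<Rightarrow> ('k, 'a::ab_group_add) gvs \<Rightarrow>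
   ('v list \<times> 'a list \<Rightarrow> 'k) set" where
  "so_forms V A = {\<phi>.
     (\<forall>as\<in>words A. (\<lambda>vs. \<phi> (vs, as)) \<in> sym_forms V) \<and>
     (\<forall>vs\<in>words V. \<forall>xs\<in>words A. \<forall>ys\<in>words A. slot_linear A (*) (\<lambda>a. \<phi> (vs, xs @ a # ys)))}"

definition so_mon ::
  "('k::field_char_0, 'v::ab_group_add) gvs \<Rightarrow> ('k, 'a::ab_group_add) gvs \<Rightarrow>
   'v list \<times> 'a list \<Rightarrow> ('v list \<times> 'a list, 'k) functional" where
  "so_mon V A = pure (so_forms V A)"

definition so_gens :: "('k, 'v) gvs \<Rightarrow> ('k, 'a) gvs \<Rightarrow> ('v list \<times> 'a list) set" where
  "so_gens V A = words V \<times> words A - {([], [])}"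

definition So ::
  "('k::field_char_0, 'v::ab_group_add) gvs \<Rightarrow> ('k, 'a::ab_group_add) gvs \<Rightarrow>
   ('k, ('v list \<times> 'a list, 'k) functional) gvs" where
  "So V A = presented (so_forms V A) (so_gens V A)
     (\<lambda>(vs, as). wt (sdeg2 V) vs + wt (sdeg1 A) as + 1)"

text \<open>
  \<open>D\<close> is a coassociative coalgebra (unshuffling of the \<open>V\<close>-part, deconcatenation of the \<open>A\<close>-part,
  reduced), with the cocentral coalgebra morphism \<open>D \<rightarrow> S(s\<^sup>-\<^sup>2 V) \<subseteq> s\<^sup>-\<^sup>2 Ger\<^sup>\<or>(V)\<close> induced by
  the augmentation of \<open>T(s\<^sup>-\<^sup>1 A)\<close>. The comultiplication of \<open>s D\<close> is \<open>(s \<otimes> s) \<circ> \<Delta> \<circ> s\<^sup>-\<^sup>1\<close>, which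
  produces the sign \<open>(-1)^(deg x')\<close> on \<open>s x' \<otimes> s x''\<close>; the operation \<open>\<rho>\<close> is the above morphism
  composed with suspensions. As maps both have degree 1.
\<close>

definition so_Delta ::
  "('k::field_char_0, 'v::ab_group_add) gvs \<Rightarrow> ('k, 'a::ab_group_add) gvs \<Rightarrow>
   ('v list \<times> 'a list, 'k) functional \<Rightarrow>
   (('v list \<times> 'a list, 'k) functional \<times> ('v list \<times> 'a list, 'k) functional, 'k) functional"
where
  "so_Delta V A = lin_extension (So V A) (so_mon V A) (so_gens V A) fscl
     (\<lambda>(vs, as). unshuffle_sum (sdeg2 V) (\<lambda>l r. \<Sum>i\<le>length as.
        let x = take i as; y = drop i as in
        if (l, x) = ([], []) \<or> (r, y) = ([], []) then 0
        else ksign (wt (sdeg2 V) r * wt (sdeg1 A) x + (wt (sdeg2 V) l + wt (sdeg1 A) x))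
               (tens (So V A) (so_mon V A (l, x)) (so_mon V A (r, y)))) vs)"

definition so_rho ::
  "('k::field_char_0, 'v::ab_group_add) gvs \<Rightarrow> ('k, 'a::ab_group_add) gvs \<Rightarrow>
   ('v list \<times> 'a list, 'k) functional \<Rightarrow> ('v list list, 'k) functional" where
  "so_rho V A = lin_extension (So V A) (so_mon V A) (so_gens V A) fscl
     (\<lambda>(vs, as). if as = [] then ger_mon V (map (\<lambda>v. [v]) vs) else 0)"

definition so_proj ::
  "('k::field_char_0, 'v::ab_group_add) gvs \<Rightarrow> ('k, 'a::ab_group_add) gvs \<Rightarrow>
   ('v list \<times> 'a list, 'k) functional \<Rightarrow> 'a" where
  "so_proj V A = lin_extension (So V A) (so_mon V A) (so_gens V A) (scl A)
     (\<lambda>p. case p of ([], [a]) \<Rightarrow> a | _ \<Rightarrow> 0)"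

text \<open>
  Codifferentials of degree 1 on the cofree \<open>S\<close>-coalgebra: compatible with all operations
  (\<open>\<rho>\<close> has odd degree, hence the sign), of square zero, and extending the differentials.
\<close>

definition Ger_infinity_plus ::
  "('k::field_char_0, 'v::ab_group_add) gvs \<Rightarrow> ('v \<Rightarrow> 'v) \<Rightarrow>
   ('k, 'a::ab_group_add) gvs \<Rightarrow> ('a \<Rightarrow> 'a) \<Rightarrow>
   (('v list list, 'k) functional \<Rightarrow> ('v list list, 'k) functional) \<times>
   (('v list \<times> 'a list, 'k) functional \<Rightarrow> ('v list \<times> 'a list, 'k) functional) \<Rightarrow> bool" where
  "Ger_infinity_plus V dV A dA = (\<lambda>(Qc, Qo).
     Qc \<in> Hom (Ger_dual V) (Ger_dual V) 1 \<and>
     Qo \<in> Hom (So V A) (So V A) 1 \<and>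
     coderivation (Ger_dual V) 2 (ger_Delta V) Qc \<and>
     coderivation (Ger_dual V) 1 (ger_delta V) Qc \<and>
     coderivation (So V A) 1 (so_Delta V A) Qo \<and>
     (\<forall>t\<in>tot (So V A). so_rho V A (Qo t) = - Qc (so_rho V A t)) \<and>
     (\<forall>t. Qc (Qc t) = 0) \<and> (\<forall>t. Qo (Qo t) = 0) \<and>
     (\<forall>v\<in>hmg V. ger_proj V (Qc (ger_mon V [[v]])) = dV v) \<and>
     (\<forall>a\<in>hmg A. so_proj V A (Qo (so_mon V A ([], [a]))) = dA a))"

section \<open>Hochschild cochains and \<open>A\<^sub>\<infinity>\<close>-structures\<close>

text \<open>
  A cochain of degree \<open>n\<close> is a family, over all \<open>k \<ge> 0\<close>, of \<open>k\<close>-linear maps of degree \<open>n - k\<close>, i.e.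
  the degree \<open>n\<close> component is the product (not the sum) over \<open>k\<close>. A cochain is encoded as a
  function on words of homogeneous elements of \<open>A\<close>, with value 0 on other lists. Values are in
  desuspended form: \<open>s\<^sup>k Hom(A\<^sup>k, A)\<close> is identified with \<open>s Hom((s\<^sup>-\<^sup>1 A)\<^sup>k, s\<^sup>-\<^sup>1 A)\<close>, and
  \<open>f [a\<^sub>1, ..., a\<^sub>k]\<close> is the value of the latter map on \<open>s\<^sup>-\<^sup>1 a\<^sub>1, ..., s\<^sup>-\<^sup>1 a\<^sub>k\<close>. So the signs of the
  insertions are Koszul signs for letters of degree \<open>deg a - 1\<close> and cochains of degree \<open>deg g - 1\<close>.
\<close>

definition hoch ::
  "('k::field_char_0, 'a::ab_group_add) gvs \<Rightarrow> ('k, 'a list \<Rightarrow> 'a) gvs" where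
  "hoch A = \<lparr>scl = (\<lambda>c f as. scl A c (f as)),
     cmp = (\<lambda>n. {f.
       (\<forall>as. as \<notin> words A \<longrightarrow> f as = 0) \<and>
       (\<forall>xs\<in>words A. \<forall>ys\<in>words A. slot_linear A (scl A) (\<lambda>a. f (xs @ a # ys))) \<and>
       (\<forall>ks as. list_all2 (\<lambda>k a. a \<in> cmp A k) ks as \<longrightarrow>
          f as \<in> cmp A (sum_list ks + n - int (length as)))})\<rparr>"

definition insertion ::
  "('k::field_char_0, 'a::ab_group_add) gvs \<Rightarrow> ('a list \<Rightarrow> 'a) \<Rightarrow> ('a list \<Rightarrow> 'a) \<Rightarrow> 'a list \<Rightarrow> 'a"
where
  "insertion A f g = (\<lambda>as. \<Sum>i\<le>length as. \<Sum>j\<le>length as - i.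
     ksign ((deg (hoch A) g - 1) * wt (sdeg1 A) (take i as))
       (f (take i as @ g (take j (drop i as)) # drop (i + j) as)))"

definition gerst_bracket ::
  "('k::field_char_0, 'a::ab_group_add) gvs \<Rightarrow> ('a list \<Rightarrow> 'a) \<Rightarrow> ('a list \<Rightarrow> 'a) \<Rightarrow> 'a list \<Rightarrow> 'a"
where
  "gerst_bracket A f g = insertion A f g -
     ksign ((deg (hoch A) f - 1) * (deg (hoch A) g - 1)) (insertion A g f)"

definition A_infinity ::
  "('k::field_char_0, 'a::ab_group_add) gvs \<Rightarrow> ('a \<Rightarrow> 'a) \<Rightarrow> ('a list \<Rightarrow> 'a) \<Rightarrow> bool" where
  "A_infinity A dA m \<longleftrightarrow>
     m \<in> cmp (hoch A) 2 \<and> m [] = 0 \<and> gerst_bracket A m m = 0 \<and> (\<forall>a\<in>hmg A. m [a] = dA a)"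

text \<open>
  The \<open>\<Lambda>Lie\<^sub>\<infinity>\<close>-structure defined by the DG \<open>\<Lambda>Lie\<close>-algebra of Hochschild cochains: the
  coderivation of \<open>\<Lambda>\<^sup>2cocomm(C(A,A))\<close> whose composition with the projection has the linear
  component \<open>[m, f]\<close> and the quadratic component \<open>(-1)^(deg f) [f, g]\<close>, which is graded symmetric in
  \<open>f, g\<close> because of the sign.
\<close>

definition hoch_codiff ::
  "('k::field_char_0, 'a::ab_group_add) gvs \<Rightarrow> ('a list \<Rightarrow> 'a) \<Rightarrow>
   (('a list \<Rightarrow> 'a) list, 'k) functional \<Rightarrow> (('a list \<Rightarrow> 'a) list, 'k) functional" where
  "hoch_codiff A m =
     lin_extension (cocomm (hoch A)) (cocomm_mon (hoch A)) (cocomm_gens (hoch A)) fscl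
       (unshuffle_sum (sdeg2 (hoch A)) (\<lambda>l r. case l of
            [f] \<Rightarrow> cocomm_mon (hoch A) (gerst_bracket A m f # r)
          | [f, g] \<Rightarrow> ksign (deg (hoch A) f) (cocomm_mon (hoch A) (gerst_bracket A f g # r))
          | _ \<Rightarrow> 0))"

section \<open>The triples\<close>

definition Ger_Ainf_morphism_triple ::
  "('k::field_char_0, 'v::ab_group_add) gvs \<Rightarrow> ('v \<Rightarrow> 'v) \<Rightarrow>
   ('k, 'a::ab_group_add) gvs \<Rightarrow> ('a \<Rightarrow> 'a) \<Rightarrow>
   (('v list list, 'k) functional \<Rightarrow> ('v list list, 'k) functional) \<times>
   ('a list \<Rightarrow> 'a) \<times>
   (('v list, 'k) functional \<Rightarrow> (('a list \<Rightarrow> 'a) list, 'k) functional) \<Rightarrow> bool" where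
  "Ger_Ainf_morphism_triple V dV A dA = (\<lambda>(Q, m, F).
     Ger_infinity V dV Q \<and> A_infinity A dA m \<and>
     (\<exists>Qs. restricts_to_cocomm V Q Qs \<and>
           Linfinity_morphism V Qs (hoch A) (hoch_codiff A m) F))"

text \<open>
  The triple corresponding to a \<open>Ger\<^sub>\<infinity>\<^sup>+\<close>-structure; \<open>F\<close> is specified through its composition
  \<open>U = cocomm_proj (hoch A) \<circ> F\<close> with the projection to cogenerators.
\<close>

definition corresponds ::
  "('k::field_char_0, 'v::ab_group_add) gvs \<Rightarrow> ('k, 'a::ab_group_add) gvs \<Rightarrow>
   (('v list list, 'k) functional \<Rightarrow> ('v list list, 'k) functional) \<times>
   (('v list \<times> 'a list, 'k) functional \<Rightarrow> ('v list \<times> 'a list, 'k) functional) \<Rightarrow>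
   (('v list list, 'k) functional \<Rightarrow> ('v list list, 'k) functional) \<times>
   ('a list \<Rightarrow> 'a) \<times>
   (('v list, 'k) functional \<Rightarrow> (('a list \<Rightarrow> 'a) list, 'k) functional) \<Rightarrow> bool" where
  "corresponds V A = (\<lambda>(Qc, Qo) (Q, m, F).
     Q = Qc \<and>
     (\<forall>as\<in>words A - {[]}. m as = so_proj V A (Qo (so_mon V A ([], as)))) \<and>
     (\<forall>vs\<in>words V - {[]}. \<forall>as\<in>words A.
        cocomm_proj (hoch A) (F (cocomm_mon V vs)) as = so_proj V A (Qo (so_mon V A (vs, as)))))"

end

theory Submission
  imports Defs
begin

text \<open>
  A coderivation of a cofree coalgebra is determined by its composition with the projection to the
  cogenerators, and so is a coalgebra morphism. For \<open>S(V, A)\<close> this composition consists of the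
  components of \<open>Q\<^sup>c\<close> and a family \<open>u(v\<^sub>1, ..., v\<^sub>k)\<close>, \<open>k \<ge> 0\<close>, of Hochschild cochains: \<open>u()\<close> is the
  \<open>A\<^sub>\<infinity>\<close>-structure and the components with \<open>k \<ge> 1\<close> are those of the \<open>L\<^sub>\<infinity>\<close>-morphism. By compatibility
  with \<open>\<rho>\<close>, the components of \<open>Q\<^sup>c\<close> enter \<open>Q\<^sup>o\<close> only through their restriction \<open>q\<close> to
  \<open>\<Lambda>\<^sup>2cocomm(V)\<close>. Both the square-zero condition for \<open>Q\<^sup>o\<close> and the conditions on the
  \<open>A\<^sub>\<infinity>\<close>-structure and the morphism become the single Maurer-Cartan equation
    \<open>\<Sum> \<plusminus> u(q(v'), v'') = \<Sum> \<plusminus> u(v') \<circ> u(v'')\<close>  (sums over unshuffles, insertion of cochains).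

  A linear map out of a space given by generators and relations is dual to a pullback of forms, so
  identities between such maps are verified on scalar forms, where they become identities of signed
  sums over unshuffles, deconcatenations and insertions. Characteristic zero enters through the fact
  that the composition of multiplication and comultiplication is \<open>2^n - 2\<close> on monomials of length
  \<open>n\<close>, so that a primitive element with vanishing projection to the cogenerators is 0.
\<close>

section \<open>Signed sums over words\<close>

text \<open>The coderivation conditions over \<open>Ger_dual V\<close> read the same on both sides
  and transfer verbatim. What remains to be known about the colour-c component is that it maps
  \<open>cocomm V\<close> to itself by the coderivation with corestriction \<open>q\<close>: for a
  \<open>Ger_infinity_plus\<close> structure this is extracted from anticommutation with
  \<open>so_rho\<close>, for a triple it is contained in \<open>restricts_to_cocomm\<close>.

  The two sources of the Maurer-Cartan equation have different combinatorics. The square of the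
  colour-o component gives ordered unshuffles, including those with an empty part. The morphism
  condition gives \<open>[m, -]\<close> on one block and a bracket on unordered pairs of blocks.
  They match because a bracket is the sum of both ordered insertions, and because
  \<open>[m, u(vs)]\<close> supplies the two unshuffles with an empty part once \<open>u []\<close>
  is taken to be \<open>m\<close>.

  A recurrent obstacle is that the zero vector has no degree. Signs are expressed by weights of
  words, and whenever words are replaced by a letter such as \<open>q l\<close>, the case that this
  letter is 0 is settled by showing that the term vanishes.\<close>

lemma ksign_zero [simp]: "ksign n 0 = 0"
  by (simp add: ksign_def)

lemma ksign_0 [simp]: "ksign 0 x = x"
  by (simp add: ksign_def)

lemma ksign_add: "ksign n (x + y) = ksign n x + ksign n y"
  by (simp add: ksign_def)

lemma ksign_uminus: "ksign n (- x) = - ksign n x"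
  by (simp add: ksign_def)

lemma ksign_ksign [simp]: "ksign m (ksign n x) = ksign (m + n) x"
  by (simp add: ksign_def)

lemma ksign_parity: "even m = even n \<Longrightarrow> ksign m x = ksign n x"
  by (simp add: ksign_def)

lemma ksign_mult_right: "ksign n (c * x) = c * ksign n (x :: 'k::ring)"
  by (simp add: ksign_def)

lemma ksign_apply: "ksign n f x = ksign n (f x)"
  by (simp add: ksign_def)

lemma wt_Nil [simp]: "wt d [] = 0"
  by (simp add: wt_def)

lemma wt_Cons [simp]: "wt d (x # xs) = d x + wt d xs"
  by (simp add: wt_def)

lemma wt_append [simp]: "wt d (xs @ ys) = wt d xs + wt d ys"
  by (simp add: wt_def)

text \<open>The subset \<open>S\<close> is carried along because most maps here are additive only on
  part of their type: on \<open>tot X\<close>, or on one component \<open>cmp V n\<close>. With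
  \<open>T = id\<close> the notion says that \<open>S\<close> is closed, so the same lemmas move
  maps through signed sums and prove membership of such sums.\<close>

definition additive_on :: "'m::ab_group_add set \<Rightarrow> ('m \<Rightarrow> 'n::ab_group_add) \<Rightarrow> bool" where
  "additive_on S T \<longleftrightarrow>
     0 \<in> S \<and> (\<forall>x\<in>S. - x \<in> S \<and> (\<forall>y\<in>S. x + y \<in> S \<and> T (x + y) = T x + T y))"

lemma additive_on_0: "additive_on S T \<Longrightarrow> 0 \<in> S \<and> T 0 = 0"
  unfolding additive_on_def by (metis add.right_neutral add_left_cancel)

lemma additive_on_uminus: "additive_on S T \<Longrightarrow> x \<in> S \<Longrightarrow> - x \<in> S \<and> T (- x) = - T x"
  using additive_on_0[of S T] unfolding additive_on_def
  by (metis add.right_inverse minus_unique)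

lemma additive_on_add:
  "additive_on S T \<Longrightarrow> x \<in> S \<Longrightarrow> y \<in> S \<Longrightarrow> x + y \<in> S \<and> T (x + y) = T x + T y"
  unfolding additive_on_def by blast

lemma additive_on_diff:
  "additive_on S T \<Longrightarrow> x \<in> S \<Longrightarrow> y \<in> S \<Longrightarrow> x - y \<in> S \<and> T (x - y) = T x - T y"
  using additive_on_add[of S T x "- y"] additive_on_uminus[of S T y] by simp

lemma additive_on_ksign:
  "additive_on S T \<Longrightarrow> x \<in> S \<Longrightarrow> ksign n x \<in> S \<and> T (ksign n x) = ksign n (T x)"
  using additive_on_uminus[of S T x] by (simp add: ksign_def)

lemma additive_onI: "(\<And>x y. T (x + y) = T x + T y) \<Longrightarrow> additive_on UNIV T"
  by (simp add: additive_on_def)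

subsection \<open>Unshuffles\<close>

text \<open>Collects what holds for every pair \<open>(l, r)\<close> that
  \<open>unshuffle_sum\<close> produces, to be available in congruence arguments. The length
  equation also gives the descent in inductions over one of the parts.\<close>

definition usplit :: "('e \<Rightarrow> int) \<Rightarrow> 'e list \<Rightarrow> 'e list \<Rightarrow> 'e list \<Rightarrow> bool" where
  "usplit d xs l r \<longleftrightarrow> set l \<subseteq> set xs \<and> set r \<subseteq> set xs \<and> length l + length r = length xs \<and>
     wt d l + wt d r = wt d xs"

lemma usplit_left: "usplit d xs l r \<Longrightarrow> usplit d (x # xs) (x # l) r"
  and usplit_right: "usplit d xs l r \<Longrightarrow> usplit d (x # xs) l (x # r)"
  by (auto simp: usplit_def)

lemma usplit_wt: "usplit d xs l r \<Longrightarrow> wt d xs = wt d l + wt d r"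
  by (simp add: usplit_def)

lemma usplit_lists: "usplit d xs l r \<Longrightarrow> xs \<in> lists H \<Longrightarrow> l \<in> lists H \<and> r \<in> lists H"
  unfolding usplit_def in_lists_conv_set by blast

lemma unsh_cong:
  "(\<And>l r. usplit d xs l r \<Longrightarrow> h l r = k l r) \<Longrightarrow> unshuffle_sum d h xs = unshuffle_sum d k xs"
proof (induction xs arbitrary: h k)
  case Nil then show ?case by (simp add: usplit_def)
next
  case (Cons x xs)
  have "unshuffle_sum d (\<lambda>l r. h (x # l) r) xs = unshuffle_sum d (\<lambda>l r. k (x # l) r) xs"
    by (rule Cons.IH) (rule Cons.prems, erule usplit_left)
  moreover have "unshuffle_sum d (\<lambda>l r. ksign (d x * wt d l) (h l (x # r))) xs =
      unshuffle_sum d (\<lambda>l r. ksign (d x * wt d l) (k l (x # r))) xs"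
    by (rule Cons.IH, rule arg_cong[where f = "ksign _"]) (rule Cons.prems, erule usplit_right)
  ultimately show ?case by simp
qed

text \<open>Exposes \<open>usplit\<close> to the termination proof of \<open>Fw\<close>, whose
  recursive call sits under \<open>unshuffle_sum\<close>.\<close>

lemma unsh_cong' [fundef_cong]:
  "xs = ys \<Longrightarrow> d = d' \<Longrightarrow> (\<And>l r. usplit d' ys l r \<Longrightarrow> h l r = k l r) \<Longrightarrow>
   unshuffle_sum d h xs = unshuffle_sum d' k ys"
  by (metis unsh_cong)

lemma unsh_additive_on:
  assumes "additive_on S T" and "\<And>l r. usplit d xs l r \<Longrightarrow> h l r \<in> S"
  shows "unshuffle_sum d h xs \<in> S \<and> T (unshuffle_sum d h xs) = unshuffle_sum d (\<lambda>l r. T (h l r)) xs"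
  using assms(2)
proof (induction xs arbitrary: h)
  case Nil then show ?case by (simp add: usplit_def)
next
  case (Cons x xs)
  have 1: "unshuffle_sum d (\<lambda>l r. h (x # l) r) xs \<in> S \<and>
      T (unshuffle_sum d (\<lambda>l r. h (x # l) r) xs) = unshuffle_sum d (\<lambda>l r. T (h (x # l) r)) xs"
    by (rule Cons.IH) (auto intro: Cons.prems usplit_left)
  have 2: "unshuffle_sum d (\<lambda>l r. ksign (d x * wt d l) (h l (x # r))) xs \<in> S \<and>
      T (unshuffle_sum d (\<lambda>l r. ksign (d x * wt d l) (h l (x # r))) xs) =
      unshuffle_sum d (\<lambda>l r. T (ksign (d x * wt d l) (h l (x # r)))) xs"
    by (rule Cons.IH) (metis Cons.prems usplit_right additive_on_ksign assms(1))
  have 3: "unshuffle_sum d (\<lambda>l r. T (ksign (d x * wt d l) (h l (x # r)))) xs =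
      unshuffle_sum d (\<lambda>l r. ksign (d x * wt d l) (T (h l (x # r)))) xs"
    by (rule unsh_cong) (metis Cons.prems usplit_right additive_on_ksign assms(1))
  show ?case using 1 2 3 additive_on_add[OF assms(1)] by simp
qed

lemma unsh_additive:
  "(\<And>x y. T (x + y) = T x + T y) \<Longrightarrow>
   T (unshuffle_sum d h xs) = unshuffle_sum d (\<lambda>l r. T (h l r)) xs"
  using unsh_additive_on[OF additive_onI] by blast

lemma unsh_zero [simp]: "unshuffle_sum d (\<lambda>l r. 0) xs = 0"
  by (induction xs) auto

lemma unsh_zeroI: "(\<And>l r. usplit d xs l r \<Longrightarrow> h l r = 0) \<Longrightarrow> unshuffle_sum d h xs = 0"
  using unsh_cong[of d xs h "\<lambda>l r. 0"] by simp

lemma unsh_add: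
  "unshuffle_sum d (\<lambda>l r. h l r + k l r) xs = unshuffle_sum d h xs + unshuffle_sum d k xs"
  by (induction xs arbitrary: h k) (simp_all add: ksign_add algebra_simps)

lemma unsh_ksign: "unshuffle_sum d (\<lambda>l r. ksign n (h l r)) xs = ksign n (unshuffle_sum d h xs)"
  by (rule unsh_additive[symmetric]) (rule ksign_add)

lemma unsh_uminus: "unshuffle_sum d (\<lambda>l r. - h l r) xs = - unshuffle_sum d h xs"
  by (rule unsh_additive[symmetric]) simp

lemma unsh_apply: "unshuffle_sum d h xs \<phi> = unshuffle_sum d (\<lambda>l r. h l r \<phi>) xs"
  by (rule unsh_additive[where T = "\<lambda>f. f \<phi>"]) simp

lemma unsh_mult:
  "unshuffle_sum d (\<lambda>l r. c * h l r) xs = c * unshuffle_sum d h (xs) " for c :: "'k::ring"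
  by (rule unsh_additive[symmetric]) (simp add: algebra_simps)

lemma unsh_left_all: "unshuffle_sum d (\<lambda>l r. if r = [] then h l r else 0) xs = h xs []"
proof (induction xs arbitrary: h)
  case (Cons x xs)
  then show ?case using Cons.IH[of "\<lambda>l r. h (x # l) r"] by simp
qed simp

lemma unsh_right_all: "unshuffle_sum d (\<lambda>l r. if l = [] then h l r else 0) xs = h [] xs"
proof (induction xs arbitrary: h)
  case (Cons x xs)
  have "unshuffle_sum d (\<lambda>l r. ksign (d x * wt d l) (if l = [] then h l (x # r) else 0)) xs =
    unshuffle_sum d (\<lambda>l r. if l = [] then h l (x # r) else 0) xs"
    by (rule unsh_cong) simp
  then show ?case using Cons.IH[of "\<lambda>l r. h l (x # r)"] by simp
qed simp

lemma unsh_proper: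
  assumes "xs \<noteq> []"
  shows "unshuffle_sum d h xs =
    h [] xs + h xs [] + unshuffle_sum d (\<lambda>l r. if l = [] \<or> r = [] then 0 else h l r) xs"
proof -
  have "unshuffle_sum d h xs =
     unshuffle_sum d (\<lambda>l r. (if l = [] then h l r else 0) + ((if r = [] then h l r else 0) +
       (if l = [] \<or> r = [] then 0 else h l r))) xs"
    using assms by (intro unsh_cong) (auto simp: usplit_def)
  then show ?thesis by (simp add: unsh_add unsh_left_all unsh_right_all)
qed

text \<open>Coassociativity of the unshuffle coproduct: both sides distribute the letters over three
  words \<open>l\<close>, \<open>s\<close>, \<open>c\<close>. A letter sent to \<open>c\<close>
  passes \<open>l\<close> and \<open>s\<close>, and \<open>wt d a\<close> is the sum of their
  weights, so the signs agree.\<close>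

lemma unsh_assoc:
  "unshuffle_sum d (\<lambda>a c. unshuffle_sum d (\<lambda>l s. K l s c) a) xs =
   unshuffle_sum d (\<lambda>l b. unshuffle_sum d (\<lambda>s c. K l s c) b) xs"
proof (induction xs arbitrary: K)
  case (Cons x xs)
  have 3: "unshuffle_sum d (\<lambda>a c. unshuffle_sum d (\<lambda>l s. ksign (d x * wt d a) (K l s (x # c))) a) xs
    = unshuffle_sum d (\<lambda>a c. unshuffle_sum d (\<lambda>l s. ksign (d x * wt d l + d x * wt d s) (K l s (x # c))) a) xs"
    by (intro unsh_cong) (simp add: usplit_wt distrib_left)
  show ?case
    by (simp add: unsh_add Cons.IH[symmetric] 3 unsh_ksign[symmetric] ksign_add)
qed simp

text \<open>Graded cocommutativity: exchanging the two parts costs the Koszul sign of moving one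
  past the other.\<close>

lemma unsh_comm:
  "unshuffle_sum d h xs = unshuffle_sum d (\<lambda>l r. ksign (wt d l * wt d r) (h r l)) xs"
proof (induction xs arbitrary: h)
  case (Cons x xs)
  have 1: "unshuffle_sum d (\<lambda>l r. h (x # l) r) xs =
      unshuffle_sum d (\<lambda>l r. ksign (d x * wt d l + wt d l * (d x + wt d r)) (h (x # r) l)) xs"
    unfolding Cons.IH[of "\<lambda>l r. h (x # l) r"]
    by (intro unsh_cong ksign_parity) auto
  have 2: "unshuffle_sum d (\<lambda>l r. ksign (d x * wt d l) (h l (x # r))) xs =
      unshuffle_sum d (\<lambda>l r. ksign ((d x + wt d l) * wt d r) (h r (x # l))) xs"
    unfolding Cons.IH[of "\<lambda>l r. ksign (d x * wt d l) (h l (x # r))"] ksign_ksign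
    by (intro unsh_cong ksign_parity) auto
  show ?case using 1 2 by simp
qed simp

text \<open>Exchanges the second and third word of a threefold unshuffle: regroup, commute, regroup
  back.\<close>

lemma unsh_swap:
  "unshuffle_sum d (\<lambda>a r. unshuffle_sum d (\<lambda>L R. K L R r) a) xs =
   unshuffle_sum d (\<lambda>a R. unshuffle_sum d (\<lambda>L r. ksign (wt d r * wt d R) (K L R r)) a) xs"
proof -
  have "unshuffle_sum d (\<lambda>a r. unshuffle_sum d (\<lambda>L R. K L R r) a) xs =
    unshuffle_sum d (\<lambda>L b. unshuffle_sum d (\<lambda>R r. K L R r) b) xs"
    by (rule unsh_assoc)
  also have "\<dots> = unshuffle_sum d (\<lambda>L b. unshuffle_sum d (\<lambda>r R. ksign (wt d r * wt d R) (K L R r)) b) xs"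
    by (subst unsh_comm) simp
  also have "\<dots> = unshuffle_sum d (\<lambda>a R. unshuffle_sum d (\<lambda>L r. ksign (wt d r * wt d R) (K L R r)) a) xs"
    by (rule unsh_assoc[symmetric])
  finally show ?thesis .
qed

lemma unsh_map:
  "unshuffle_sum d h (map f xs) = unshuffle_sum (\<lambda>x. d (f x)) (\<lambda>l r. h (map f l) (map f r)) xs"
proof (induction xs arbitrary: h)
  case (Cons x xs)
  have [simp]: "wt d (map f l) = wt (\<lambda>x. d (f x)) l" for l by (simp add: wt_def comp_def)
  show ?case by (simp add: Cons.IH)
qed simp

lemma wt_cong: "(\<And>x. x \<in> set xs \<Longrightarrow> d x = d' x) \<Longrightarrow> wt d xs = wt d' xs"
  by (induction xs) auto

lemma unsh_deg_cong:
  "(\<And>x. x \<in> set xs \<Longrightarrow> d x = d' x) \<Longrightarrow> unshuffle_sum d h xs = unshuffle_sum d' h xs"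
proof (induction xs arbitrary: h)
  case (Cons x xs)
  have "unshuffle_sum d (\<lambda>l r. ksign (d x * wt d l) (h l (x # r))) xs =
    unshuffle_sum d (\<lambda>l r. ksign (d' x * wt d' l) (h l (x # r))) xs"
  proof (rule unsh_cong)
    fix l r assume "usplit d xs l r"
    then have "wt d l = wt d' l"
      using Cons.prems by (intro wt_cong) (auto simp: usplit_def)
    then show "ksign (d x * wt d l) (h l (x # r)) = ksign (d' x * wt d' l) (h l (x # r))"
      using Cons.prems by simp
  qed
  then show ?case using Cons by simp
qed simp

text \<open>The coderivation of the symmetric coalgebra with corestriction \<open>q\<close>, written
  as the dual operation on functions \<open>H\<close> of words. The contracted letter
  \<open>q l\<close> is placed in front.\<close>

definition coder :: "('e \<Rightarrow> int) \<Rightarrow> ('e list \<Rightarrow> 'e) \<Rightarrow> ('e list \<Rightarrow> 'm::ab_group_add) \<Rightarrow> 'e list \<Rightarrow> 'm" where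
  "coder d q H vs = unshuffle_sum d (\<lambda>l r. H (q l # r)) vs"

text \<open>The coderivation property in dual form: the contracted part lies in the left or in the
  right tensor factor, and in the second case \<open>q l\<close> passes \<open>L\<close>. The
  premise says that \<open>q\<close> has degree 1, but only as far as \<open>G\<close> sees it,
  because \<open>q l\<close> may be 0 and then has no degree.\<close>

lemma coder_unsh:
  assumes "\<And>l L R. set l \<subseteq> set vs \<Longrightarrow> set L \<subseteq> set vs \<Longrightarrow> set R \<subseteq> set vs \<Longrightarrow>
     ksign (d (q l) * wt d L) (G L (q l # R)) = ksign ((wt d l + 1) * wt d L) (G L (q l # R))"
  shows "coder d q (unshuffle_sum d G) vs =
     unshuffle_sum d (\<lambda>L R. coder d q (\<lambda>L. G L R) L + ksign (wt d L) (coder d q (G L) R)) vs"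
proof -
  have "coder d q (unshuffle_sum d G) vs =
    unshuffle_sum d (\<lambda>l b. unshuffle_sum d (\<lambda>L R. G (q l # L) R) b) vs +
    unshuffle_sum d (\<lambda>l b. unshuffle_sum d (\<lambda>L R. ksign (d (q l) * wt d L) (G L (q l # R))) b) vs"
    by (simp add: coder_def unsh_add)
  also have "unshuffle_sum d (\<lambda>l b. unshuffle_sum d (\<lambda>L R. ksign (d (q l) * wt d L) (G L (q l # R))) b) vs
    = unshuffle_sum d (\<lambda>l b. unshuffle_sum d (\<lambda>L R. ksign ((wt d l + 1) * wt d L) (G L (q l # R))) b) vs"
  proof (intro unsh_cong assms)
    fix l b L R assume "usplit d vs l b" "usplit d b L R"
    then show "set l \<subseteq> set vs" "set L \<subseteq> set vs" "set R \<subseteq> set vs"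
      by (auto simp: usplit_def)
  qed
  also have "\<dots> = unshuffle_sum d (\<lambda>a R. unshuffle_sum d (\<lambda>l L. ksign ((wt d l + 1) * wt d L) (G L (q l # R))) a) vs"
    by (rule unsh_assoc[symmetric])
  also have "\<dots> = unshuffle_sum d (\<lambda>a R. unshuffle_sum d (\<lambda>L l. ksign (wt d L) (G L (q l # R))) a) vs"
    by (subst unsh_comm) (auto intro!: unsh_cong ksign_parity)
  also have "\<dots> = unshuffle_sum d (\<lambda>L b. unshuffle_sum d (\<lambda>l R. ksign (wt d L) (G L (q l # R))) b) vs"
    by (rule unsh_assoc)
  also have "unshuffle_sum d (\<lambda>l b. unshuffle_sum d (\<lambda>L R. G (q l # L) R) b) vs =
    unshuffle_sum d (\<lambda>a R. unshuffle_sum d (\<lambda>l L. G (q l # L) R) a) vs"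
    by (rule unsh_assoc[symmetric])
  finally show ?thesis by (simp add: coder_def unsh_add unsh_ksign)
qed

subsection \<open>Deconcatenation and insertion\<close>

text \<open>Recursive form of the sum over cutting positions that occurs in the definitions, see
  \<open>dec_eq_sum\<close>. The recursion makes coassociativity and the interplay with insertion
  accessible to induction on the word.\<close>

fun dec :: "('e list \<Rightarrow> 'e list \<Rightarrow> 'm::ab_group_add) \<Rightarrow> 'e list \<Rightarrow> 'm" where
  "dec K [] = K [] []"
| "dec K (a # as) = K [] (a # as) + dec (\<lambda>x y. K (a # x) y) as"

lemma dec_cong: "(\<And>x y. as = x @ y \<Longrightarrow> K x y = L x y) \<Longrightarrow> dec K as = dec L as"
proof (induction as arbitrary: K L)
  case (Cons a as)
  have "dec (\<lambda>x y. K (a # x) y) as = dec (\<lambda>x y. L (a # x) y) as"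
    by (rule Cons.IH) (rule Cons.prems, simp)
  moreover have "K [] (a # as) = L [] (a # as)" by (rule Cons.prems) simp
  ultimately show ?case by simp
qed simp

lemma dec_additive_on:
  assumes "additive_on S T" and "\<And>x y. as = x @ y \<Longrightarrow> K x y \<in> S"
  shows "dec K as \<in> S \<and> T (dec K as) = dec (\<lambda>x y. T (K x y)) as"
  using assms(2)
proof (induction as arbitrary: K)
  case (Cons a as)
  have "K [] (a # as) \<in> S" by (rule Cons.prems) simp
  moreover have "dec (\<lambda>x y. K (a # x) y) as \<in> S \<and>
      T (dec (\<lambda>x y. K (a # x) y) as) = dec (\<lambda>x y. T (K (a # x) y)) as"
    by (rule Cons.IH) (rule Cons.prems, simp)
  ultimately show ?case using additive_on_add[OF assms(1)] by simp
qed simp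

lemma dec_additive:
  "(\<And>x y. T (x + y) = T x + T y) \<Longrightarrow> T (dec K as) = dec (\<lambda>x y. T (K x y)) as"
  using dec_additive_on[OF additive_onI] by blast

lemma dec_add: "dec (\<lambda>x y. K x y + L x y) as = dec K as + dec L as"
  by (induction as arbitrary: K L) simp_all

lemma dec_ksign: "dec (\<lambda>x y. ksign n (K x y)) as = ksign n (dec K as)"
  by (rule dec_additive[symmetric]) (rule ksign_add)

lemma dec_uminus: "dec (\<lambda>x y. - K x y) as = - dec K as"
  by (rule dec_additive[symmetric]) simp

lemma dec_zero [simp]: "dec (\<lambda>x y. 0) as = 0"
  by (induction as) auto

lemma dec_apply: "dec K as \<phi> = dec (\<lambda>x y. K x y \<phi>) as"
  by (rule dec_additive[where T = "\<lambda>f. f \<phi>"]) simp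

lemma dec_assoc: "dec (\<lambda>y z. dec (\<lambda>z1 z2. K y z1 z2) z) as = dec (\<lambda>x z. dec (\<lambda>y z1. K y z1 z) x) as"
  by (induction as arbitrary: K) (simp_all add: dec_add)

text \<open>A cut lies before or after the distinguished letter \<open>a\<close>; this form makes
  linearity in that letter visible.\<close>

lemma dec_snoc_mid:
  "dec K (xs @ a # ys) = dec (\<lambda>x y. K x (y @ a # ys)) xs + dec (\<lambda>x y. K (xs @ a # x) y) ys"
proof (induction xs arbitrary: K)
  case Nil
  show ?case by simp
next
  case (Cons x xs)
  show ?case by (simp add: Cons.IH)
qed

lemma dec_eq_sum: "(\<Sum>i\<le>length as. K (take i as) (drop i as)) = dec K as"
proof (induction as arbitrary: K)
  case (Cons a as)
  show ?case using Cons.IH[of "\<lambda>x y. K (a # x) y"] by (simp del: sum.atMost_Suc add: sum.atMost_Suc_shift)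
qed simp

lemma unsh_dec: "unshuffle_sum d (\<lambda>l r. dec (\<lambda>x y. K l r x y) as) vs =
   dec (\<lambda>x y. unshuffle_sum d (\<lambda>l r. K l r x y) vs) as"
proof -
  have "dec (unshuffle_sum d K vs) as = dec (\<lambda>x y. unshuffle_sum d (\<lambda>l r. K l r x y) vs) as"
    by (intro dec_cong) (simp add: unsh_apply)
  moreover have "dec (unshuffle_sum d K vs) as = unshuffle_sum d (\<lambda>l r. dec (K l r) as) vs"
    by (rule unsh_additive[where T = "\<lambda>h. dec h as"]) (simp add: dec_add[symmetric] plus_fun_def)
  ultimately show ?thesis by simp
qed

text \<open>\<open>K\<close> applied to the value of the coderivation of the tensor coalgebra with
  corestriction \<open>g\<close>. Here \<open>p\<close> is the degree of \<open>g\<close> between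
  desuspended words, and \<open>K\<close> may take values in any group, so that it can be a cochain
  as well as a scalar form. The clause for the empty word accounts for \<open>g\<close> without
  arguments.\<close>

fun Ins :: "('e \<Rightarrow> int) \<Rightarrow> int \<Rightarrow> ('e list \<Rightarrow> 'e) \<Rightarrow> ('e list \<Rightarrow> 'm::ab_group_add) \<Rightarrow> 'e list \<Rightarrow> 'm" where
  "Ins d p g K [] = K [g []]"
| "Ins d p g K (a # as) = dec (\<lambda>y z. K (g y # z)) (a # as) + ksign (p * d a) (Ins d p g (\<lambda>w. K (a # w)) as)"

lemma Ins_eq_dec:
  "Ins d p g K as = dec (\<lambda>x v. ksign (p * wt d x) (dec (\<lambda>y z. K (x @ g y # z)) v)) as"
proof (induction as arbitrary: K)
  case (Cons a as)
  have "ksign (p * d a) (dec (\<lambda>x v. ksign (p * wt d x) (dec (\<lambda>y z. K (a # x @ g y # z)) v)) as) =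
    dec (\<lambda>x v. ksign (p * wt d (a # x)) (dec (\<lambda>y z. K (a # x @ g y # z)) v)) as"
    unfolding dec_ksign[symmetric] by (intro dec_cong) (simp add: distrib_left)
  then show ?case by (simp add: Cons.IH)
qed simp

lemma Ins_cong:
  assumes "\<And>x y z. as = x @ y @ z \<Longrightarrow> K (x @ g y # z) = K' (x @ g' y # z)"
  shows "Ins d p g K as = Ins d p g' K' as"
  unfolding Ins_eq_dec by (intro dec_cong arg_cong[where f = "ksign _"]) (simp add: assms)

lemma Ins_additive_on:
  assumes "additive_on S T" and "\<And>x y z. as = x @ y @ z \<Longrightarrow> K (x @ g y # z) \<in> S"
  shows "Ins d p g K as \<in> S \<and> T (Ins d p g K as) = Ins d p g (\<lambda>w. T (K w)) as"
proof -
  have 1: "ksign (p * wt d x) (dec (\<lambda>y z. K (x @ g y # z)) v) \<in> S \<and>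
     T (ksign (p * wt d x) (dec (\<lambda>y z. K (x @ g y # z)) v)) =
     ksign (p * wt d x) (dec (\<lambda>y z. T (K (x @ g y # z))) v)" if "as = x @ v" for x v
  proof -
    have "dec (\<lambda>y z. K (x @ g y # z)) v \<in> S \<and>
      T (dec (\<lambda>y z. K (x @ g y # z)) v) = dec (\<lambda>y z. T (K (x @ g y # z))) v"
      by (rule dec_additive_on[OF assms(1)]) (rule assms(2), simp add: that)
    then show ?thesis using additive_on_ksign[OF assms(1)] by metis
  qed
  have "dec (\<lambda>x v. ksign (p * wt d x) (dec (\<lambda>y z. K (x @ g y # z)) v)) as \<in> S \<and>
     T (dec (\<lambda>x v. ksign (p * wt d x) (dec (\<lambda>y z. K (x @ g y # z)) v)) as) =
     dec (\<lambda>x v. T (ksign (p * wt d x) (dec (\<lambda>y z. K (x @ g y # z)) v))) as"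
    by (rule dec_additive_on[OF assms(1)]) (use 1 in blast)
  moreover have "dec (\<lambda>x v. T (ksign (p * wt d x) (dec (\<lambda>y z. K (x @ g y # z)) v))) as =
     dec (\<lambda>x v. ksign (p * wt d x) (dec (\<lambda>y z. T (K (x @ g y # z))) v)) as"
    by (rule dec_cong) (use 1 in blast)
  ultimately show ?thesis unfolding Ins_eq_dec by simp
qed

lemma Ins_additive:
  "(\<And>x y. T (x + y) = T x + T y) \<Longrightarrow> T (Ins d p g K as) = Ins d p g (\<lambda>w. T (K w)) as"
  using Ins_additive_on[OF additive_onI] by blast

lemma Ins_apply: "Ins d p g K as \<phi> = Ins d p g (\<lambda>w. K w \<phi>) as"
  by (rule Ins_additive[where T = "\<lambda>f. f \<phi>"]) simp

lemma Ins_ksign: "Ins d p g (\<lambda>w. ksign n (K w)) as = ksign n (Ins d p g K as)"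
  by (rule Ins_additive[symmetric]) (rule ksign_add)

lemma Ins_add: "Ins d p g (\<lambda>w. K w + L w) as = Ins d p g K as + Ins d p g L as"
  by (simp add: Ins_eq_dec dec_add ksign_add)

lemma Ins_uminus: "Ins d p g (\<lambda>w. - K w) as = - Ins d p g K as"
  by (rule Ins_additive[symmetric]) simp

lemma Ins_zero [simp]: "Ins d p g (\<lambda>w. 0) as = 0"
  by (simp add: Ins_eq_dec)

lemma Ins_zeroI: "(\<And>x y z. as = x @ y @ z \<Longrightarrow> K (x @ g y # z) = 0) \<Longrightarrow> Ins d p g K as = 0"
  using Ins_cong[of as K g "\<lambda>w. 0" g d p] by simp

lemma Ins_unsh: "Ins d' p g (\<lambda>w. unshuffle_sum d (\<lambda>l r. K l r w) vs) as =
   unshuffle_sum d (\<lambda>l r. Ins d' p g (\<lambda>w. K l r w) as) vs"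
proof -
  have "Ins d' p g (unshuffle_sum d K vs) as = Ins d' p g (\<lambda>w. unshuffle_sum d (\<lambda>l r. K l r w) vs) as"
    by (intro Ins_cong) (simp add: unsh_apply)
  moreover have "Ins d' p g (unshuffle_sum d K vs) as = unshuffle_sum d (\<lambda>l r. Ins d' p g (K l r) as) vs"
    by (rule unsh_additive[where T = "\<lambda>h. Ins d' p g h as"]) (simp add: Ins_add[symmetric] plus_fun_def)
  ultimately show ?thesis by simp
qed

text \<open>Insertion is a coderivation with respect to deconcatenation.\<close>

lemma Ins_dec:
  "Ins d p g (dec K) as =
   dec (\<lambda>x y. Ins d p g (\<lambda>x. K x y) x + ksign (p * wt d x) (Ins d p g (K x) y)) as"
proof (induction as arbitrary: K)
  case Nil
  show ?case by (simp add: algebra_simps)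
next
  case (Cons a as)
  have 1: "dec (\<lambda>y z. dec (\<lambda>z1 z2. K (g y # z1) z2) z) (a # as) =
     dec (\<lambda>x z. dec (\<lambda>y z1. K (g y # z1) z) x) (a # as)"
    by (rule dec_assoc)
  have 2: "dec (\<lambda>x y. ksign (p * d a + p * wt d x) (Ins d p g (K (a # x)) y)) as =
    ksign (p * d a) (dec (\<lambda>x y. ksign (p * wt d x) (Ins d p g (K (a # x)) y)) as)"
    unfolding dec_ksign[symmetric] by (intro dec_cong) simp
  show ?case using 1
    by (simp add: dec_add Ins_add Cons.IH 2 ksign_add dec_ksign algebra_simps)
qed

subsection \<open>The exponential of a family of multilinear maps\<close>

text \<open>\<open>Fw\<close> sums over the unordered partitions of a word into nonempty blocks, with Koszul signs. The
  recursion \<open>n F(vs) = \<Sum> \<plusminus> |l| l F(r)\<close>, where \<open>n\<close> is the length of \<open>vs\<close>, is the Euler derivation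
  applied to the exponential.\<close>

function Fw :: "('k::field_char_0 \<Rightarrow> 'm \<Rightarrow> 'm) \<Rightarrow> ('e \<Rightarrow> int) \<Rightarrow> ('e list list \<Rightarrow> 'm::ab_group_add) \<Rightarrow> 'e list \<Rightarrow> 'm"
where
  "Fw s d H vs = (if vs = [] then H [] else
     s (1 / of_nat (length vs)) (unshuffle_sum d (\<lambda>l r. if l = [] then 0 else
       s (of_nat (length l)) (Fw s d (\<lambda>P. H (l # P)) r)) vs))"
  by pat_completeness auto
termination
  proof (relation "measure (\<lambda>(s, d, H, vs). length vs)", goal_cases)
  case (2 s d H vs l r)
  then have "length l + length r = length vs" "l \<noteq> []" by (simp_all add: usplit_def)
  then show ?case by (cases l) auto
qed simp

declare Fw.simps [simp del]

text \<open>Collects what holds for every list of blocks at which \<open>Fw\<close> evaluates its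
  function argument; the analogue of \<open>usplit\<close> for partitions.\<close>

definition bpart :: "('e \<Rightarrow> int) \<Rightarrow> 'e list \<Rightarrow> 'e list list \<Rightarrow> bool" where
  "bpart d vs P \<longleftrightarrow> (\<forall>B\<in>set P. set B \<subseteq> set vs \<and> B \<noteq> []) \<and> wt (wt d) P = wt d vs \<and> (vs \<noteq> [] \<longrightarrow> P \<noteq> [])"

lemma bpart_Cons: "usplit d vs l r \<Longrightarrow> l \<noteq> [] \<Longrightarrow> bpart d r P \<Longrightarrow> bpart d vs (l # P)"
  by (auto simp: usplit_def bpart_def)

lemma Fw_Nil [simp]: "Fw s d H [] = H []"
  by (simp add: Fw.simps)

lemma Fw_cong:
  "(\<And>P. bpart d vs P \<Longrightarrow> H P = K P) \<Longrightarrow> Fw s d H vs = Fw s d K vs"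
proof (induction "length vs" arbitrary: vs H K rule: less_induct)
  case less
  show ?case
  proof (cases "vs = []")
    case True
    then show ?thesis using less.prems[of "[]"] by (simp add: bpart_def)
  next
    case False
    have "Fw s d (\<lambda>P. H (l # P)) r = Fw s d (\<lambda>P. K (l # P)) r" if "usplit d vs l r" "l \<noteq> []" for l r
    proof (rule less.hyps)
      show "length r < length vs" using that by (cases l) (auto simp: usplit_def)
    qed (use that less.prems bpart_Cons in blast)
    then have "unshuffle_sum d (\<lambda>l r. if l = [] then 0 else s (of_nat (length l)) (Fw s d (\<lambda>P. H (l # P)) r)) vs
      = unshuffle_sum d (\<lambda>l r. if l = [] then 0 else s (of_nat (length l)) (Fw s d (\<lambda>P. K (l # P)) r)) vs"
      by (intro unsh_cong) simp
    then show ?thesis using False by (simp add: Fw.simps[of _ _ _ vs])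
  qed
qed

lemma Fw_linear_on:
  assumes T: "additive_on S T" and s: "\<And>c x. x \<in> S \<Longrightarrow> s c x \<in> S \<and> T (s c x) = s' c (T x)"
  shows "(\<And>P. bpart d vs P \<Longrightarrow> H P \<in> S) \<Longrightarrow>
    Fw s d H vs \<in> S \<and> T (Fw s d H vs) = Fw s' d (\<lambda>P. T (H P)) vs"
proof (induction "length vs" arbitrary: vs H rule: less_induct)
  case less
  show ?case
  proof (cases "vs = []")
    case True
    then show ?thesis using less.prems[of "[]"] by (simp add: bpart_def)
  next
    case False
    let ?h = "\<lambda>l r. if l = [] then 0 else s (of_nat (length l)) (Fw s d (\<lambda>P. H (l # P)) r)"
    let ?k = "\<lambda>l r. if l = [] then 0 else s' (of_nat (length l)) (Fw s' d (\<lambda>P. T (H (l # P))) r)"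
    have 1: "?h l r \<in> S \<and> T (?h l r) = ?k l r" if "usplit d vs l r" for l r
    proof (cases "l = []")
      case True
      then show ?thesis using additive_on_0[OF T] by simp
    next
      case False
      have "Fw s d (\<lambda>P. H (l # P)) r \<in> S \<and>
        T (Fw s d (\<lambda>P. H (l # P)) r) = Fw s' d (\<lambda>P. T (H (l # P))) r"
      proof (rule less.hyps)
        show "length r < length vs" using that False by (cases l) (auto simp: usplit_def)
      qed (use that False less.prems bpart_Cons in blast)
      then show ?thesis using s False by simp
    qed
    have "unshuffle_sum d ?h vs \<in> S \<and> T (unshuffle_sum d ?h vs) = unshuffle_sum d (\<lambda>l r. T (?h l r)) vs"
      by (rule unsh_additive_on[OF T]) (use 1 in blast)
    moreover have "unshuffle_sum d (\<lambda>l r. T (?h l r)) vs = unshuffle_sum d ?k vs"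
      by (rule unsh_cong) (use 1 in blast)
    ultimately show ?thesis using False s by (simp add: Fw.simps[of _ _ _ vs])
  qed
qed

lemma Fw_linear:
  assumes "\<And>x y. T (x + y) = T x + T y" and "\<And>c x. T (s c x) = s' c (T x)"
  shows "T (Fw s d H vs) = Fw s' d (\<lambda>P. T (H P)) vs"
  using Fw_linear_on[OF additive_onI[of T], of s s'] assms by blast

section \<open>Partitions into one and into two blocks\<close>

context
  fixes s :: "'k::field_char_0 \<Rightarrow> 'm::ab_group_add \<Rightarrow> 'm" and d :: "'e \<Rightarrow> int"
  assumes vs: "vector_space s"
begin

interpretation vector_space s by (rule vs)

lemma Fw_zero: "Fw s d (\<lambda>P. 0) vs = 0"
proof (induction "length vs" arbitrary: vs rule: less_induct)
  case less
  have "unshuffle_sum d (\<lambda>l r. if l = [] then 0 else s (of_nat (length l)) (Fw s d (\<lambda>P. 0) r)) vs = 0"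
  proof (rule unsh_zeroI)
    fix l r assume "usplit d vs l r"
    then have "l \<noteq> [] \<Longrightarrow> length r < length vs" by (cases l) (auto simp: usplit_def)
    then show "(if l = [] then 0 else s (of_nat (length l)) (Fw s d (\<lambda>P. 0) r)) = 0"
      using less by simp
  qed
  then show ?case by (cases "vs = []") (simp_all add: Fw.simps[of _ _ _ vs])
qed

lemma Fw_zeroI: "(\<And>P. bpart d vs P \<Longrightarrow> H P = 0) \<Longrightarrow> Fw s d H vs = 0"
  using Fw_cong[of d vs H "\<lambda>P. 0" s] Fw_zero by simp

lemma Fw_scaled:
  "s (of_nat (length vs)) (Fw s d H vs) =
   unshuffle_sum d (\<lambda>l r. s (of_nat (length l)) (Fw s d (\<lambda>P. H (l # P)) r)) vs"
proof (cases "vs = []")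
  case False
  have "unshuffle_sum d (\<lambda>l r. if l = [] then 0 else s (of_nat (length l)) (Fw s d (\<lambda>P. H (l # P)) r)) vs
    = unshuffle_sum d (\<lambda>l r. s (of_nat (length l)) (Fw s d (\<lambda>P. H (l # P)) r)) vs"
    by (rule unsh_cong) simp
  then show ?thesis using False by (simp add: Fw.simps[of _ _ _ vs])
qed simp

text \<open>A single block must be the whole word; its factor \<open>length vs\<close> cancels the
  division in the recursion.\<close>

lemma Fw_single:
  assumes "vs \<noteq> []"
  shows "Fw s d (\<lambda>P. case P of [l] \<Rightarrow> h l | _ \<Rightarrow> 0) vs = h vs"
proof -
  have 1: "Fw s d (\<lambda>P. case l # P of [l] \<Rightarrow> h l | _ \<Rightarrow> 0) r = (if r = [] then h l else 0)" for l r
    by (auto intro!: Fw_zeroI simp: bpart_def split: list.splits)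
  have "s (of_nat (length vs)) (Fw s d (\<lambda>P. case P of [l] \<Rightarrow> h l | _ \<Rightarrow> 0) vs) =
    unshuffle_sum d (\<lambda>l r. if r = [] then s (of_nat (length l)) (h l) else 0) vs"
    unfolding Fw_scaled 1 by (rule unsh_cong) simp
  then show ?thesis using assms by (simp add: unsh_left_all)
qed

text \<open>Resums unordered pairs of blocks as ordered proper unshuffles. The Euler recursion
  weights a pair by \<open>length l\<close> in one order and by \<open>length r\<close> in the
  other; after commuting the unshuffle these add up to \<open>length vs\<close>, which cancels the
  division.\<close>

lemma Fw_pair:
  assumes "vs \<noteq> []"
  shows "Fw s d (\<lambda>P. case P of [l, r] \<Rightarrow> g l r + ksign (wt d l * wt d r) (g r l) | _ \<Rightarrow> 0) vs =
     unshuffle_sum d (\<lambda>l r. if l = [] \<or> r = [] then 0 else g l r) vs"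
    (is "Fw s d ?H vs = unshuffle_sum d ?g vs")
proof -
  have 1: "Fw s d (\<lambda>P. ?H (l # P)) r =
     (if r = [] then 0 else g l r + ksign (wt d l * wt d r) (g r l))" for l r
  proof (cases "r = []")
    case False
    have "Fw s d (\<lambda>P. ?H (l # P)) r =
      Fw s d (\<lambda>P. case P of [r] \<Rightarrow> g l r + ksign (wt d l * wt d r) (g r l) | _ \<Rightarrow> 0) r"
      by (rule Fw_cong) (simp split: list.splits)
    then show ?thesis using Fw_single[OF False] False by simp
  qed simp
  have sk: "s c (ksign n x) = ksign n (s c x)" for c n x by (simp add: ksign_def)
  have "s (of_nat (length vs)) (Fw s d ?H vs) =
    unshuffle_sum d (\<lambda>l r. s (of_nat (length l)) (?g l r) +
       ksign (wt d l * wt d r) (s (of_nat (length l)) (?g r l))) vs"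
    unfolding Fw_scaled 1 by (rule unsh_cong) (simp add: scale_right_distrib sk)
  also have "\<dots> = unshuffle_sum d (\<lambda>l r. s (of_nat (length l)) (?g l r)) vs +
     unshuffle_sum d (\<lambda>l r. ksign (wt d l * wt d r) (s (of_nat (length l)) (?g r l))) vs"
    by (rule unsh_add)
  also have "unshuffle_sum d (\<lambda>l r. ksign (wt d l * wt d r) (s (of_nat (length l)) (?g r l))) vs
    = unshuffle_sum d (\<lambda>l r. s (of_nat (length r)) (?g l r)) vs"
    by (rule unsh_comm[symmetric])
  also have "unshuffle_sum d (\<lambda>l r. s (of_nat (length l)) (?g l r)) vs + \<dots> =
     unshuffle_sum d (\<lambda>l r. s (of_nat (length vs)) (?g l r)) vs"
    unfolding unsh_add[symmetric]
    by (rule unsh_cong) (simp add: usplit_def scale_left_distrib[symmetric] of_nat_add[symmetric] add.commute del: of_nat_add)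
  also have "\<dots> = s (of_nat (length vs)) (unshuffle_sum d ?g vs)"
    by (rule unsh_additive[symmetric]) (rule scale_right_distrib)
  finally show ?thesis using assms by simp
qed

end

lemma vector_space_mult: "vector_space ((*) :: 'k::field \<Rightarrow> 'k \<Rightarrow> 'k)"
  by unfold_locales (simp_all add: algebra_simps)

lemma Fw_add: "Fw (*) d (\<lambda>P. H P + K P) vs = Fw (*) d H vs + Fw (*) d K vs"
proof (induction "length vs" arbitrary: vs H K rule: less_induct)
  case less
  let ?f = "\<lambda>H l r. if l = [] then 0 else of_nat (length l) * Fw (*) d (\<lambda>P. H (l # P)) r"
  have "unshuffle_sum d (?f (\<lambda>P. H P + K P)) vs = unshuffle_sum d (\<lambda>l r. ?f H l r + ?f K l r) vs"
  proof (rule unsh_cong)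
    fix l r assume "usplit d vs l r"
    then have "l \<noteq> [] \<Longrightarrow> length r < length vs" by (cases l) (auto simp: usplit_def)
    then show "?f (\<lambda>P. H P + K P) l r = ?f H l r + ?f K l r"
      using less[of r] by (simp add: distrib_left)
  qed
  then show ?case
    by (cases "vs = []") (simp_all add: Fw.simps[of _ _ _ vs] unsh_add add_divide_distrib)
qed

lemma Fw_mult: "Fw (*) d (\<lambda>P. c * H P) vs = c * Fw (*) d H vs"
  by (rule Fw_linear[symmetric]) (simp_all add: algebra_simps)

lemma Fw_ksign: "Fw (*) d (\<lambda>P. ksign n (H P)) vs = ksign n (Fw (*) d H vs)"
  by (rule Fw_linear[symmetric]) (simp_all add: ksign_add ksign_mult_right)

lemma Fw_sum_unsh:
  "Fw (*) d (\<lambda>P. unshuffle_sum d' (\<lambda>l r. H l r P) xs) vs =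
   unshuffle_sum d' (\<lambda>l r. Fw (*) d (H l r) vs) xs"
proof -
  have "Fw (*) d (unshuffle_sum d' H xs) vs = unshuffle_sum d' (\<lambda>l r. Fw (*) d (H l r) vs) xs"
    by (rule unsh_additive[where T = "\<lambda>h. Fw (*) d h vs"]) (simp add: Fw_add[symmetric] plus_fun_def)
  moreover have "unshuffle_sum d' H xs = (\<lambda>P. unshuffle_sum d' (\<lambda>l r. H l r P) xs)"
    by (simp add: unsh_apply fun_eq_iff)
  ultimately show ?thesis by simp
qed

text \<open>The exponential is a morphism of coalgebras.\<close>

lemma Fw_unsh:
  fixes G :: "'e list list \<Rightarrow> 'e list list \<Rightarrow> 'k::field_char_0"
  shows "Fw (*) d (unshuffle_sum (wt d) G) vs =
   unshuffle_sum d (\<lambda>l r. Fw (*) d (\<lambda>L. Fw (*) d (G L) r) l) vs"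
proof (induction "length vs" arbitrary: vs G rule: less_induct)
  case less
  let ?n = "\<lambda>l. of_nat (length l) :: 'k"
  note scaled = Fw_scaled[OF vector_space_mult]
  show ?case
  proof (cases "vs = []")
    case False
    \<comment> \<open>The block \<open>l\<close> singled out by the recursion goes to the left or to
      the right word of blocks. In the second case it passes all blocks on the left, whose total
      weight is \<open>wt d s\<close>.\<close>
    have IH: "?n l * Fw (*) d (\<lambda>P. unshuffle_sum (wt d) G (l # P)) r =
       ?n l * unshuffle_sum d (\<lambda>s t. Fw (*) d (\<lambda>L. Fw (*) d (G (l # L)) t) s) r +
       ?n l * unshuffle_sum d (\<lambda>s t. ksign (wt d l * wt d s) (Fw (*) d (\<lambda>L. Fw (*) d (\<lambda>R. G L (l # R)) t) s)) r"
      if lr: "usplit d vs l r" for l r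
    proof (cases "l = []")
      case False
      then have len: "length r < length vs" using lr by (cases l) (auto simp: usplit_def)
      have 1: "Fw (*) d (\<lambda>L. Fw (*) d (\<lambda>R. ksign (wt d l * wt (wt d) L) (G L (l # R))) t) s =
         ksign (wt d l * wt d s) (Fw (*) d (\<lambda>L. Fw (*) d (\<lambda>R. G L (l # R)) t) s)" for s t
      proof -
        have "Fw (*) d (\<lambda>L. ksign (wt d l * wt (wt d) L) (Fw (*) d (\<lambda>R. G L (l # R)) t)) s =
          Fw (*) d (\<lambda>L. ksign (wt d l * wt d s) (Fw (*) d (\<lambda>R. G L (l # R)) t)) s"
          by (rule Fw_cong) (simp add: bpart_def)
        then show ?thesis by (simp only: Fw_ksign)
      qed
      show ?thesis
        using less[OF len, of "\<lambda>L R. G (l # L) R"]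
          less[OF len, of "\<lambda>L R. ksign (wt d l * wt (wt d) L) (G L (l # R))"]
        by (simp add: Fw_add 1 distrib_left)
    qed simp
    have "?n vs * Fw (*) d (unshuffle_sum (wt d) G) vs =
      unshuffle_sum d (\<lambda>l r. ?n l * unshuffle_sum d (\<lambda>s t. Fw (*) d (\<lambda>L. Fw (*) d (G (l # L)) t) s) r) vs +
      unshuffle_sum d (\<lambda>l r. ?n l * unshuffle_sum d (\<lambda>s t. ksign (wt d l * wt d s) (Fw (*) d (\<lambda>L. Fw (*) d (\<lambda>R. G L (l # R)) t) s)) r) vs"
      (is "_ = ?A + ?B")
      unfolding scaled unsh_add[symmetric] by (rule unsh_cong) (rule IH)
    also have "?A = unshuffle_sum d (\<lambda>a t. unshuffle_sum d (\<lambda>l s. ?n l * Fw (*) d (\<lambda>L. Fw (*) d (G (l # L)) t) s) a) vs"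
      unfolding unsh_mult[symmetric] by (rule unsh_assoc[symmetric])
    also have "\<dots> = unshuffle_sum d (\<lambda>a t. ?n a * Fw (*) d (\<lambda>L. Fw (*) d (G L) t) a) vs"
      by (simp add: scaled)
    also have "?B = unshuffle_sum d (\<lambda>a t. unshuffle_sum d (\<lambda>l s. ?n l * ksign (wt d l * wt d s)
        (Fw (*) d (\<lambda>L. Fw (*) d (\<lambda>R. G L (l # R)) t) s)) a) vs"
      unfolding unsh_mult[symmetric] by (rule unsh_assoc[symmetric])
    also have "\<dots> = unshuffle_sum d (\<lambda>a t. unshuffle_sum d (\<lambda>s l. ?n l *
        Fw (*) d (\<lambda>L. Fw (*) d (\<lambda>R. G L (l # R)) t) s) a) vs"
      by (subst unsh_comm) (simp add: ksign_mult_right, simp add: ksign_def mult.commute)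
    also have "\<dots> = unshuffle_sum d (\<lambda>s b. unshuffle_sum d (\<lambda>l t. ?n l *
        Fw (*) d (\<lambda>L. Fw (*) d (\<lambda>R. G L (l # R)) t) s) b) vs"
      by (rule unsh_assoc)
    also have "\<dots> = unshuffle_sum d (\<lambda>s b. ?n b * Fw (*) d (\<lambda>L. Fw (*) d (G L) b) s) vs"
    proof (rule unsh_cong)
      fix s b
      have "unshuffle_sum d (\<lambda>l t. ?n l * Fw (*) d (\<lambda>L. Fw (*) d (\<lambda>R. G L (l # R)) t) s) b =
        Fw (*) d (\<lambda>L. unshuffle_sum d (\<lambda>l t. ?n l * Fw (*) d (\<lambda>R. G L (l # R)) t) b) s"
        by (simp only: Fw_sum_unsh Fw_mult)
      also have "\<dots> = ?n b * Fw (*) d (\<lambda>L. Fw (*) d (G L) b) s"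
        by (simp only: scaled[symmetric] Fw_mult)
      finally show "unshuffle_sum d (\<lambda>l t. ?n l * Fw (*) d (\<lambda>L. Fw (*) d (\<lambda>R. G L (l # R)) t) s) b =
        ?n b * Fw (*) d (\<lambda>L. Fw (*) d (G L) b) s" .
    qed
    \<comment> \<open>Each of the two factors contributes its own length, as under a derivation, and
      the lengths add up to that of \<open>vs\<close>.\<close>
    finally have "?n vs * Fw (*) d (unshuffle_sum (wt d) G) vs =
      unshuffle_sum d (\<lambda>a t. ?n a * Fw (*) d (\<lambda>L. Fw (*) d (G L) t) a +
        ?n t * Fw (*) d (\<lambda>L. Fw (*) d (G L) t) a) vs"
      by (simp add: unsh_add)
    also have "\<dots> = unshuffle_sum d (\<lambda>a t. ?n vs * Fw (*) d (\<lambda>L. Fw (*) d (G L) t) a) vs"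
      by (rule unsh_cong) (simp add: usplit_def distrib_right[symmetric] of_nat_add[symmetric] del: of_nat_add)
    finally show ?thesis using False by (simp add: unsh_mult)
  qed simp
qed

section \<open>Graded spaces\<close>

lemma graded_vs: "graded_space V \<Longrightarrow> vector_space (scl V)"
  and graded_subspace: "graded_space V \<Longrightarrow> module.subspace (scl V) (cmp V n)"
  by (auto simp: graded_space_def)

lemma cmp_closed:
  assumes "graded_space V"
  shows cmp_0: "0 \<in> cmp V n"
    and cmp_add: "x \<in> cmp V n \<Longrightarrow> y \<in> cmp V n \<Longrightarrow> x + y \<in> cmp V n"
    and cmp_scale: "x \<in> cmp V n \<Longrightarrow> scl V c x \<in> cmp V n"
    and cmp_uminus: "x \<in> cmp V n \<Longrightarrow> - x \<in> cmp V n"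
proof -
  interpret vector_space "scl V" by (rule graded_vs[OF assms])
  note s = graded_subspace[OF assms, of n]
  show "0 \<in> cmp V n" "x \<in> cmp V n \<Longrightarrow> y \<in> cmp V n \<Longrightarrow> x + y \<in> cmp V n"
    "x \<in> cmp V n \<Longrightarrow> scl V c x \<in> cmp V n" "x \<in> cmp V n \<Longrightarrow> - x \<in> cmp V n"
    using subspace_0[OF s] subspace_add[OF s] subspace_scale[OF s] subspace_neg[OF s] by auto
qed

lemma cmp_diff: "graded_space V \<Longrightarrow> x \<in> cmp V n \<Longrightarrow> y \<in> cmp V n \<Longrightarrow> x - y \<in> cmp V n"
  using cmp_add[of V x n "- y"] cmp_uminus[of V y n] by simp

lemma cmp_ksign: "graded_space V \<Longrightarrow> x \<in> cmp V n \<Longrightarrow> ksign m x \<in> cmp V n"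
  by (simp add: ksign_def cmp_uminus)

lemma cmp_additive_on: "graded_space V \<Longrightarrow> additive_on (cmp V n) id"
  by (simp add: additive_on_def cmp_0 cmp_add cmp_uminus)

lemma cmp_hmg: "x \<in> cmp V n \<Longrightarrow> x \<in> hmg V"
  by (auto simp: hmg_def)

lemma deg_eq:
  assumes "graded_space V" and x: "x \<in> cmp V n" and "x \<noteq> 0"
  shows "deg V x = n"
  unfolding deg_def
proof (rule the_equality)
  fix m assume m: "x \<in> cmp V m"
  show "m = n"
  proof (rule ccontr)
    assume "m \<noteq> n"
    \<comment> \<open>If \<open>x\<close> lay in two components, the family consisting of
      \<open>x\<close> and \<open>- x\<close> would have sum 0, which directness forbids for
      \<open>x\<close> other than 0.\<close>
    let ?x = "\<lambda>k. if k = m then x else - x"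
    have "\<forall>k\<in>{m, n}. ?x k = 0"
      using assms(1) unfolding graded_space_def
      by (elim conjE allE[of _ "{m, n}"] allE[of _ ?x])
        (use m x \<open>m \<noteq> n\<close> cmp_uminus[OF assms(1)] in auto)
    then show False using \<open>x \<noteq> 0\<close> by auto
  qed
qed (rule x)

lemma hmg_cmp:
  assumes "graded_space V" "x \<in> hmg V"
  shows "x \<in> cmp V (deg V x)"
proof (cases "x = 0")
  case False
  obtain n where "x \<in> cmp V n" using assms(2) by (auto simp: hmg_def)
  then show ?thesis using deg_eq[OF assms(1) _ False] by simp
qed (simp add: cmp_0[OF assms(1)])

lemma hmg_0: "graded_space V \<Longrightarrow> 0 \<in> hmg V"
  by (rule cmp_hmg[OF cmp_0])

lemma scale_ksign: "vector_space s \<Longrightarrow> s c (ksign n x) = ksign n (s c x)"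
  using module.scale_minus_right[of s c x] by (simp add: ksign_def vector_space_def module_def)

lemma vector_space_scale:
  assumes "vector_space s"
  shows "s c (x + y) = s c x + s c y" "s c 0 = 0" "s 1 x = x" "s a (s b x) = s (a * b) x" "s c (- x) = - s c x"
    "s 0 x = 0" "s (a + b) x = s a x + s b x" "s (- 1) x = - x"
proof -
  interpret vector_space s by fact
  show "s c (x + y) = s c x + s c y" "s c 0 = 0" "s 1 x = x" "s a (s b x) = s (a * b) x" "s c (- x) = - s c x"
    "s 0 x = 0" "s (a + b) x = s a x + s b x" "s (- 1) x = - x"
    by (simp_all add: scale_right_distrib scale_left_distrib)
qed

lemma tot_closed:
  assumes "vector_space (scl X)"
  shows hmg_tot: "x \<in> hmg X \<Longrightarrow> x \<in> tot X"
    and tot_0: "0 \<in> tot X"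
    and tot_add: "x \<in> tot X \<Longrightarrow> y \<in> tot X \<Longrightarrow> x + y \<in> tot X"
    and tot_scale: "x \<in> tot X \<Longrightarrow> scl X c x \<in> tot X"
    and tot_uminus: "x \<in> tot X \<Longrightarrow> - x \<in> tot X"
proof -
  interpret vector_space "scl X" by fact
  show "x \<in> hmg X \<Longrightarrow> x \<in> tot X" "0 \<in> tot X" "x \<in> tot X \<Longrightarrow> y \<in> tot X \<Longrightarrow> x + y \<in> tot X"
    "x \<in> tot X \<Longrightarrow> scl X c x \<in> tot X" "x \<in> tot X \<Longrightarrow> - x \<in> tot X"
    unfolding tot_def by (auto intro: span_base span_zero span_add span_scale span_neg)
qed

lemma linear_map_add:
  assumes "vector_space (scl X)" "vector_space s" "linear_map X s F" "x \<in> tot X" "y \<in> tot X"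
  shows "F (x + y) = F x + F y"
  using assms(3-5) vector_space_scale(3)[OF assms(1)] vector_space_scale(3)[OF assms(2)]
  unfolding linear_map_def by metis

lemma linear_map_0:
  assumes "vector_space (scl X)" "vector_space s" "linear_map X s F"
  shows "F 0 = 0"
  using linear_map_add[OF assms tot_0[OF assms(1)] tot_0[OF assms(1)]] by simp

lemma linear_map_scale:
  assumes "vector_space (scl X)" "vector_space s" "linear_map X s F" "x \<in> tot X"
  shows "F (scl X c x) = s c (F x)"
  using linear_map_0[OF assms(1-3)] assms(3,4) tot_0[OF assms(1)]
  unfolding linear_map_def by (metis add_0)

lemma linear_map_additive_on:
  assumes "vector_space (scl X)" "vector_space s" "linear_map X s F"
  shows "additive_on (tot X) F"
  using linear_map_add[OF assms] tot_0[OF assms(1)] tot_add[OF assms(1)] tot_uminus[OF assms(1)]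
  by (simp add: additive_on_def)

lemma linear_map_uminus:
  assumes "vector_space (scl X)" "vector_space s" "linear_map X s F" "x \<in> tot X"
  shows "F (- x) = - F x"
  using additive_on_uminus[OF linear_map_additive_on[OF assms(1-3)] assms(4)] by simp

lemma linear_map_diff:
  assumes "vector_space (scl X)" "vector_space s" "linear_map X s F" "x \<in> tot X" "y \<in> tot X"
  shows "F (x - y) = F x - F y"
  using additive_on_diff[OF linear_map_additive_on[OF assms(1-3)] assms(4,5)] by simp

lemma linear_map_outside: "linear_map X s F \<Longrightarrow> x \<notin> tot X \<Longrightarrow> F x = 0"
  by (simp add: linear_map_def)

lemma HomD:
  "F \<in> Hom X Y n \<Longrightarrow> linear_map X (scl Y) F"
  "F \<in> Hom X Y n \<Longrightarrow> x \<in> cmp X k \<Longrightarrow> F x \<in> cmp Y (k + n)"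
  by (auto simp: Hom_def)

lemma Hom_hmg: "F \<in> Hom X Y n \<Longrightarrow> x \<in> hmg X \<Longrightarrow> F x \<in> hmg Y"
  using HomD(2) by (fastforce simp: hmg_def)

lemma Hom_tot:
  assumes "F \<in> Hom X Y n" "vector_space (scl X)" "vector_space (scl Y)" "x \<in> tot X"
  shows "F x \<in> tot Y"
proof -
  interpret X: vector_space "scl X" by fact
  have "x \<in> tot X \<and> F x \<in> tot Y" using assms(4) unfolding tot_def
  proof (induction rule: X.span_induct_alt)
    case base
    show ?case using linear_map_0[OF assms(2,3) HomD(1)[OF assms(1)]] tot_0[OF assms(3)] tot_0[OF assms(2)]
      by (simp add: tot_def)
  next
    case (step c x y)
    then have "x \<in> tot X" "y \<in> tot X" "F x \<in> tot Y" "F y \<in> tot Y"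
      using hmg_tot assms(2,3) Hom_hmg[OF assms(1)] by (auto simp: tot_def)
    then show ?case
      using linear_map_add[OF assms(2,3) HomD(1)[OF assms(1)]] linear_map_scale[OF assms(2,3) HomD(1)[OF assms(1)]]
        tot_add tot_scale assms(2,3) unfolding tot_def[symmetric] by metis
  qed
  then show ?thesis by simp
qed

subsection \<open>Slotwise linear functions\<close>

lemma slot_linear_0:
  assumes "graded_space V" "vector_space s" "slot_linear V s f"
  shows "f 0 = 0"
proof -
  have "f (0 + scl V 1 0) = f 0 + s 1 (f 0)"
    using assms(3) cmp_0[OF assms(1)] unfolding slot_linear_def by blast
  then show ?thesis
    using vector_space_scale[OF assms(2)] vector_space_scale[OF graded_vs[OF assms(1)]] by simp
qed

lemma slot_linear_additive_on:
  assumes "graded_space V" "vector_space s" "slot_linear V s f"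
  shows "additive_on (cmp V n) f"
  using assms(3) vector_space_scale(3)[OF assms(2)] vector_space_scale(3)[OF graded_vs[OF assms(1)]]
    cmp_closed[OF assms(1)]
  unfolding additive_on_def slot_linear_def by metis

lemma slot_linear_ksign:
  assumes "graded_space V" "vector_space s" "slot_linear V s f" "u \<in> cmp V n"
  shows "f (ksign m u) = ksign m (f u)"
  using additive_on_ksign[OF slot_linear_additive_on[OF assms(1-3)] assms(4)] by simp

text \<open>A scalar depending on the degree of the argument is constant on each component except at
  0, where \<open>deg V 0\<close> is arbitrary but \<open>f\<close> vanishes.\<close>

lemma slot_linear_weight:
  assumes "graded_space V" "vector_space s" "slot_linear V s f"
  shows "slot_linear V s (\<lambda>u. s (w (deg V u)) (f u))"
  unfolding slot_linear_def
proof (intro allI ballI)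
  fix n u v c assume uv: "u \<in> cmp V n" "v \<in> cmp V n"
  then have *: "u + scl V c v \<in> cmp V n" using cmp_add cmp_scale assms(1) by blast
  have w: "s (w (deg V x)) (f x) = s (w n) (f x)" if "x \<in> cmp V n" for x
    using that deg_eq[OF assms(1) that] slot_linear_0[OF assms] vector_space_scale(2)[OF assms(2)]
    by (cases "x = 0") auto
  show "s (w (deg V (u + scl V c v))) (f (u + scl V c v)) =
      s (w (deg V u)) (f u) + s c (s (w (deg V v)) (f v))"
    using uv assms(3)
    by (simp only: w[OF uv(1)] w[OF uv(2)] w[OF *])
      (simp add: slot_linear_def vector_space_scale[OF assms(2)] mult.commute)
qed

lemma ksign_scale: "vector_space s \<Longrightarrow> ksign n x = s (if even n then 1 else - 1) x"
  using vector_space_scale[of s] by (simp add: ksign_def)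

lemma slot_linear_sign:
  assumes "graded_space V" "vector_space s" "slot_linear V s f"
  shows "slot_linear V s (\<lambda>u. ksign (N (deg V u)) (f u))"
  using slot_linear_weight[OF assms, of "\<lambda>n. if even (N n) then 1 else - 1"]
  by (simp add: ksign_scale[OF assms(2), of _ "f _"])

lemma slot_linear_additive:
  assumes "vector_space s"
  shows "additive_on {f. slot_linear V s f} id"
  using vector_space_scale[OF assms] by (simp add: additive_on_def slot_linear_def)

lemma slot_linear_add:
  "vector_space s \<Longrightarrow> slot_linear V s f \<Longrightarrow> slot_linear V s g \<Longrightarrow> slot_linear V s (\<lambda>x. f x + g x)"
  using additive_on_add[OF slot_linear_additive, of s f V g] by (simp add: plus_fun_def)

lemma slot_linear_zero: "vector_space s \<Longrightarrow> slot_linear V s (\<lambda>x. 0)"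
  using vector_space_scale[of s] by (simp add: slot_linear_def)

lemma slot_linear_uminus: "vector_space s \<Longrightarrow> slot_linear V s f \<Longrightarrow> slot_linear V s (\<lambda>x. - f x)"
  using additive_on_uminus[OF slot_linear_additive, of s f V] by (simp add: fun_Compl_def)

lemma slot_linear_ksign_const:
  "vector_space s \<Longrightarrow> slot_linear V s f \<Longrightarrow> slot_linear V s (\<lambda>x. ksign n (f x))"
  by (cases "even n") (simp_all add: ksign_def slot_linear_uminus)

lemma slot_linear_scale_const:
  "vector_space s \<Longrightarrow> slot_linear V s f \<Longrightarrow> slot_linear V s (\<lambda>x. s c (f x))"
  using vector_space_scale[of s] by (simp add: slot_linear_def mult.commute)

lemma slot_linear_unsh:
  assumes "vector_space s" "\<And>l r. usplit d xs l r \<Longrightarrow> slot_linear V s (\<lambda>u. h u l r)"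
  shows "slot_linear V s (\<lambda>u. unshuffle_sum d (h u) xs)"
proof -
  have "unshuffle_sum d (\<lambda>l r u. h u l r) xs \<in> {f. slot_linear V s f}"
    using unsh_additive_on[OF slot_linear_additive[OF assms(1)], of d xs "\<lambda>l r u. h u l r" V] assms(2) by blast
  moreover have "unshuffle_sum d (\<lambda>l r u. h u l r) xs = (\<lambda>u. unshuffle_sum d (h u) xs)"
    by (simp add: unsh_apply fun_eq_iff)
  ultimately show ?thesis by simp
qed

lemma slot_linear_dec:
  assumes "vector_space s" "\<And>x y. as = x @ y \<Longrightarrow> slot_linear V s (\<lambda>u. h u x y)"
  shows "slot_linear V s (\<lambda>u. dec (h u) as)"
proof -
  have "dec (\<lambda>l r u. h u l r) as \<in> {f. slot_linear V s f}"
    using dec_additive_on[OF slot_linear_additive[OF assms(1)], of as "\<lambda>l r u. h u l r" V] assms(2) by blast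
  moreover have "dec (\<lambda>l r u. h u l r) as = (\<lambda>u. dec (h u) as)"
    by (simp add: dec_apply fun_eq_iff)
  ultimately show ?thesis by simp
qed

lemma slot_linear_Ins:
  assumes "vector_space s" "\<And>x y z. as = x @ y @ z \<Longrightarrow> slot_linear V s (\<lambda>u. K u (x @ g y # z))"
  shows "slot_linear V s (\<lambda>u. Ins d p g (K u) as)"
proof -
  have "Ins d p g (\<lambda>w u. K u w) as \<in> {f. slot_linear V s f}"
    using Ins_additive_on[OF slot_linear_additive[OF assms(1)], of as "\<lambda>w u. K u w" g V] assms(2) by blast
  moreover have "Ins d p g (\<lambda>w u. K u w) as = (\<lambda>u. Ins d p g (K u) as)"
    by (simp add: Ins_apply fun_eq_iff)
  ultimately show ?thesis by simp
qed

lemma slot_linear_cong: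
  assumes "slot_linear V s f" "\<And>u. u \<in> hmg V \<Longrightarrow> f u = g u" "graded_space V"
  shows "slot_linear V s g"
  unfolding slot_linear_def
proof (intro allI ballI)
  fix n u v c assume uv: "u \<in> cmp V n" "v \<in> cmp V n"
  then have *: "u + scl V c v \<in> cmp V n" using cmp_add cmp_scale assms(3) by blast
  have "f (u + scl V c v) = f u + s c (f v)" using assms(1) uv unfolding slot_linear_def by blast
  then show "g (u + scl V c v) = g u + s c (g v)"
    using assms(2)[OF cmp_hmg[OF uv(1)]] assms(2)[OF cmp_hmg[OF uv(2)]] assms(2)[OF cmp_hmg[OF *]] by simp
qed

section \<open>Presented spaces\<close>

lemma vector_space_fscl: "vector_space fscl"
  by unfold_locales (auto simp: fscl_def fun_eq_iff algebra_simps)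

interpretation fs: vector_space fscl
  by (rule vector_space_fscl)

lemma scl_presented [simp]: "scl (presented \<Phi> G d) = fscl"
  by (simp add: presented_def)

lemma vs_presented: "vector_space (scl (presented \<Phi> G d))"
  by (simp add: vector_space_fscl)

lemma tot_presented: "tot (presented \<Phi> G d) = fs.span (pure \<Phi> ` G)"
proof -
  have hm: "hmg (presented \<Phi> G d) = (\<Union>n. fs.span (pure \<Phi> ` {g \<in> G. d g = n}))"
    by (simp add: hmg_def presented_def)
  show ?thesis
  proof (rule antisym)
    show "tot (presented \<Phi> G d) \<subseteq> fs.span (pure \<Phi> ` G)"
      unfolding tot_def hm scl_presented
      by (intro fs.span_minimal UN_least fs.span_mono fs.subspace_span) auto
    show "fs.span (pure \<Phi> ` G) \<subseteq> tot (presented \<Phi> G d)"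
      unfolding tot_def hm scl_presented
      by (intro fs.span_mono subsetI) (auto intro!: fs.span_base)
  qed
qed

lemma cmp_presented: "cmp (presented \<Phi> G d) n = tot (presented \<Phi> {g \<in> G. d g = n} d)"
  by (simp add: tot_presented) (simp add: presented_def)

lemma pure_tot: "g \<in> G \<Longrightarrow> pure \<Phi> g \<in> tot (presented \<Phi> G d)"
  by (simp add: tot_presented fs.span_base)

lemma pure_cmp: "g \<in> G \<Longrightarrow> pure \<Phi> g \<in> cmp (presented \<Phi> G d) (d g)"
  by (simp add: cmp_presented pure_tot)

lemma tot_induct [consumes 1, case_names zero step]:
  assumes "t \<in> tot (presented \<Phi> G d)" and "P 0"
    and "\<And>g c t. g \<in> G \<Longrightarrow> t \<in> tot (presented \<Phi> G d) \<Longrightarrow> P t \<Longrightarrow> P (fscl c (pure \<Phi> g) + t)"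
  shows "P t"
proof -
  have "t \<in> tot (presented \<Phi> G d) \<and> P t"
    using assms(1) unfolding tot_presented
  proof (induction rule: fs.span_induct_alt)
    case base then show ?case using assms(2) fs.span_zero by blast
  next
    case (step c x y)
    then obtain g where g: "g \<in> G" "x = pure \<Phi> g" by blast
    have "fscl c x + y \<in> fs.span (pure \<Phi> ` G)"
      using step by (intro fs.span_add fs.span_scale[OF fs.span_base]) auto
    then have "fscl c x + y \<in> fs.span (pure \<Phi> ` G) \<and> P (fscl c x + y)"
      using step g assms(3)[of g y c] by (simp add: tot_presented)
    then show ?case .
  qed
  then show ?thesis by simp
qed

lemma ev_outside: "t \<in> tot (presented \<Phi> G d) \<Longrightarrow> \<phi> \<notin> \<Phi> \<Longrightarrow> t \<phi> = 0"
  by (induction rule: tot_induct) (simp_all add: fscl_def pure_def)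

text \<open>Elements of a presented space are functionals on forms. A form is a function on all
  monomials, but an element only sees its values on \<open>G\<close>, so the relation between
  \<open>\<chi>\<close>, \<open>\<phi>\<close> and \<open>\<psi>\<close> is required on generators
  alone.\<close>

lemma ev_linear:
  assumes "t \<in> tot (presented \<Phi> G d)" "\<phi> \<in> \<Phi>" "\<psi> \<in> \<Phi>" "\<chi> \<in> \<Phi>"
    and "\<And>g. g \<in> G \<Longrightarrow> \<chi> g = \<phi> g + c * \<psi> g"
  shows "t \<chi> = t \<phi> + c * t \<psi>"
  using assms(1) by (induction rule: tot_induct) (simp_all add: fscl_def pure_def assms algebra_simps)

lemma ev_zero:
  assumes "t \<in> tot (presented \<Phi> G d)" "\<And>g. g \<in> G \<Longrightarrow> \<phi> g = 0"
  shows "t \<phi> = 0"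
  using assms(1) by (induction rule: tot_induct) (simp_all add: fscl_def pure_def assms)

lemma ev_cong:
  assumes "t \<in> tot (presented \<Phi> G d)" "\<phi> \<in> \<Phi>" "\<psi> \<in> \<Phi>" "\<And>g. g \<in> G \<Longrightarrow> \<phi> g = \<psi> g"
  shows "t \<phi> = t \<psi>"
  using ev_linear[of t \<Phi> G d \<phi> \<phi> \<psi> 0] assms by simp

text \<open>Both elements are 0 off \<open>\<Phi>\<close>, so equality can be tested on forms. This
  reduces identities in the space to identities of scalars.\<close>

lemma presented_eqI:
  assumes "t \<in> tot (presented \<Phi> G d)" "t' \<in> tot (presented \<Phi> G d)" "\<And>\<phi>. \<phi> \<in> \<Phi> \<Longrightarrow> t \<phi> = t' \<phi>"
  shows "t = t'"
proof
  fix \<phi> show "t \<phi> = t' \<phi>"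
    using assms ev_outside[of t \<Phi> G d \<phi>] ev_outside[of t' \<Phi> G d \<phi>] by (cases "\<phi> \<in> \<Phi>") simp_all
qed

lemma linear_map_eq_on:
  assumes "vector_space s" "linear_map (presented \<Phi> G d) s F" "linear_map (presented \<Phi> G d) s F'"
    "\<And>g. g \<in> G \<Longrightarrow> F (pure \<Phi> g) = F' (pure \<Phi> g)"
  shows "F = F'"
proof
  fix t
  let ?X = "presented \<Phi> G d"
  show "F t = F' t"
  proof (cases "t \<in> tot ?X")
    case True
    note v = vs_presented[of \<Phi> G d]
    from True show ?thesis
    proof (induction rule: tot_induct)
      case zero then show ?case using linear_map_0[OF v assms(1)] assms(2,3) by metis
    next
      case (step g c t)
      have "F (t + scl ?X c (pure \<Phi> g)) = F' (t + scl ?X c (pure \<Phi> g))"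
        using assms(2,3) pure_tot[OF step(1), of \<Phi> d] step assms(4)[OF step(1)] unfolding linear_map_def by metis
      then have "F (fscl c (pure \<Phi> g) + t) = F' (fscl c (pure \<Phi> g) + t)" by (simp add: add.commute)
      then show ?case .
    qed
  qed (use assms(2,3) linear_map_outside in metis)
qed

lemma lin_extension_eqI:
  assumes "vector_space s" "linear_map (presented \<Phi> G d) s F" "\<And>g. g \<in> G \<Longrightarrow> F (pure \<Phi> g) = f g"
  shows "lin_extension (presented \<Phi> G d) (pure \<Phi>) G s f = F"
  unfolding lin_extension_def
proof (rule the_equality)
  fix F' assume "linear_map (presented \<Phi> G d) s F' \<and> (\<forall>g\<in>G. F' (pure \<Phi> g) = f g)"
  then show "F' = F" using linear_map_eq_on[OF assms(1) _ assms(2)] assms(3) by simp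
qed (use assms in blast)

text \<open>Maps between presented spaces are dual to the pullback of forms.\<close>

lemma lin_ext_fun:
  assumes 1: "\<forall>\<phi>\<in>\<Phi>'. (\<lambda>g. f g \<phi>) \<in> \<Phi>"
    and 2: "\<forall>g\<in>G. \<forall>\<phi>. \<phi> \<notin> \<Phi>' \<longrightarrow> f g \<phi> = 0"
    and F: "F = lin_extension (presented \<Phi> G d) (pure \<Phi>) G fscl f"
  shows "linear_map (presented \<Phi> G d) fscl F"
    and "\<And>g. g \<in> G \<Longrightarrow> F (pure \<Phi> g) = f g"
    and "\<And>t \<phi>. t \<in> tot (presented \<Phi> G d) \<Longrightarrow> \<phi> \<in> \<Phi>' \<Longrightarrow> F t \<phi> = t (\<lambda>g. f g \<phi>)"
proof -
  let ?X = "presented \<Phi> G d"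
  \<comment> \<open>The candidate sends \<open>t\<close> to the functional evaluating
    \<open>t\<close> on the pulled back form; hypothesis 1 says that the pullback respects the
    relations.\<close>
  let ?F = "\<lambda>t. if t \<in> tot ?X then (\<lambda>\<phi>. if \<phi> \<in> \<Phi>' then t (\<lambda>g. f g \<phi>) else 0) else 0"
  note v = vs_presented[of \<Phi> G d]
  have lin: "linear_map ?X fscl ?F"
    unfolding linear_map_def using tot_add[OF v] tot_scale[OF v]
    by (auto simp: fscl_def fun_eq_iff)
  have ev: "?F (pure \<Phi> g) = f g" if "g \<in> G" for g
    using that 1 2 pure_tot[OF that, of \<Phi> d] by (auto simp: fun_eq_iff pure_def)
  have eq: "F = ?F" unfolding F
    by (rule lin_extension_eqI[OF vector_space_fscl lin ev])
  show "linear_map ?X fscl F" "\<And>g. g \<in> G \<Longrightarrow> F (pure \<Phi> g) = f g"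
    "\<And>t \<phi>. t \<in> tot ?X \<Longrightarrow> \<phi> \<in> \<Phi>' \<Longrightarrow> F t \<phi> = t (\<lambda>g. f g \<phi>)"
    unfolding eq using lin ev by auto
qed

section \<open>Linear maps from a presented space to an arbitrary vector space\<close>

lemma separating_functional:
  fixes s :: "'k::field \<Rightarrow> 'w::ab_group_add \<Rightarrow> 'w"
  assumes "vector_space s" "x \<noteq> 0"
  shows "\<exists>\<mu>. Vector_Spaces.linear s (*) \<mu> \<and> \<mu> x \<noteq> 0"
proof -
  interpret p: vector_space_pair s "(*) :: 'k \<Rightarrow> 'k \<Rightarrow> 'k"
    using assms(1) vector_space_mult by (simp add: vector_space_pair_def)
  have "\<not> p.vs1.dependent {x}" using assms(2) by (simp add: p.vs1.dependent_single)
  from p.linear_independent_extend[OF this, of "\<lambda>_. 1"] show ?thesis by auto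
qed

text \<open>Elements of an arbitrary target cannot be evaluated on forms, so linear functionals
  \<open>\<mu>\<close> on the target take their place. Each composite with \<open>f\<close> respects
  the relations, and functionals separate points, so the value of the map is pinned down by its
  images under all \<open>\<mu>\<close>.\<close>

lemma lin_ext_vec:
  fixes s :: "'k::field_char_0 \<Rightarrow> 'w::ab_group_add \<Rightarrow> 'w"
  assumes s: "vector_space s"
    and 1: "\<forall>\<mu>. Vector_Spaces.linear s (*) \<mu> \<longrightarrow> (\<lambda>g. \<mu> (f g)) \<in> \<Phi>"
    and F: "F = lin_extension (presented \<Phi> G d) (pure \<Phi>) G s f"
  shows "linear_map (presented \<Phi> G d) s F"
    and "\<And>g. g \<in> G \<Longrightarrow> F (pure \<Phi> g) = f g"
proof -
  let ?X = "presented \<Phi> G d"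
  let ?L = "\<lambda>\<mu>. Vector_Spaces.linear s ((*) :: 'k \<Rightarrow> 'k \<Rightarrow> 'k) \<mu>"
  note v = vs_presented[of \<Phi> G d]
  have L: "\<mu> (x + y) = \<mu> x + \<mu> y \<and> \<mu> (s c x) = c * \<mu> x" if "?L \<mu>" for \<mu> x y c
  proof -
    interpret Vector_Spaces.linear s "(*)" \<mu> by fact
    show ?thesis by (simp add: add scale)
  qed
  have uniq: "y = y'" if "\<And>\<mu>. ?L \<mu> \<Longrightarrow> \<mu> y = \<mu> y'" for y y'
  proof (rule ccontr)
    assume "y \<noteq> y'"
    then obtain \<mu> where l: "?L \<mu>" "\<mu> (y - y') \<noteq> 0" using separating_functional[OF s, of "y - y'"] by auto
    have "\<mu> (y - y') + \<mu> y' = 0 + \<mu> y'"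
      using L[OF l(1), of "y - y'" y'] that[OF l(1)] by (metis add_0 diff_add_cancel)
    then show False using l(2) by simp
  qed
  have ex: "\<exists>y. \<forall>\<mu>. ?L \<mu> \<longrightarrow> \<mu> y = t (\<lambda>g. \<mu> (f g))" if "t \<in> tot ?X" for t
    using that
  proof (induction rule: tot_induct)
    case zero
    show ?case using L[of _ "0 :: 'w" "0 :: 'w"] by (intro exI[of _ 0]) force
  next
    case (step g c t)
    then obtain y where "\<forall>\<mu>. ?L \<mu> \<longrightarrow> \<mu> y = t (\<lambda>g. \<mu> (f g))" by blast
    then show ?case
      using L 1 by (intro exI[of _ "s c (f g) + y"]) (simp add: fscl_def pure_def)
  qed
  define E where "E = (\<lambda>t. if t \<in> tot ?X then (THE y. \<forall>\<mu>. ?L \<mu> \<longrightarrow> \<mu> y = t (\<lambda>g. \<mu> (f g))) else 0)"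
  have E: "\<mu> (E t) = t (\<lambda>g. \<mu> (f g))" if "?L \<mu>" "t \<in> tot ?X" for \<mu> t
  proof -
    have "\<exists>!y. \<forall>\<mu>. ?L \<mu> \<longrightarrow> \<mu> y = t (\<lambda>g. \<mu> (f g))"
      using ex[OF that(2)] uniq by metis
    from theI'[OF this] show ?thesis using that by (simp add: E_def)
  qed
  have lin: "linear_map ?X s E"
    unfolding linear_map_def
  proof (intro conjI ballI allI impI)
    fix x y c assume xy: "x \<in> tot ?X" "y \<in> tot ?X"
    then have xy': "x + scl ?X c y \<in> tot ?X" using tot_add[OF v] tot_scale[OF v] by blast
    show "E (x + scl ?X c y) = E x + s c (E y)"
    proof (rule uniq)
      fix \<mu> assume l: "?L \<mu>"
      show "\<mu> (E (x + scl ?X c y)) = \<mu> (E x + s c (E y))"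
        using L[OF l] by (simp only: E[OF l xy'] E[OF l xy(1)] E[OF l xy(2)]) (simp add: fscl_def)
    qed
  qed (simp add: E_def)
  have ev: "E (pure \<Phi> g) = f g" if "g \<in> G" for g
    by (rule uniq) (simp add: E pure_tot that, simp add: pure_def 1)
  have "F = E" unfolding F by (rule lin_extension_eqI[OF s lin ev])
  then show "linear_map ?X s F" "\<And>g. g \<in> G \<Longrightarrow> F (pure \<Phi> g) = f g" using lin ev by auto
qed

lemma HomI:
  assumes "vector_space (scl Y)" "\<And>k. module.subspace (scl Y) (cmp Y k)"
    "linear_map (presented \<Phi> G d) (scl Y) F"
    "\<And>g. g \<in> G \<Longrightarrow> F (pure \<Phi> g) \<in> cmp Y (d g + n)"
  shows "F \<in> Hom (presented \<Phi> G d) Y n"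
proof -
  interpret Y: vector_space "scl Y" by fact
  let ?X = "presented \<Phi> G d"
  note v = vs_presented[of \<Phi> G d]
  have "F t \<in> cmp Y (k + n)" if "t \<in> cmp ?X k" for t k
  proof -
    have "t \<in> tot ?X \<and> F t \<in> cmp Y (k + n)" using that unfolding cmp_presented
    proof (induction rule: tot_induct)
      case zero
      have "0 \<in> tot ?X \<and> F 0 \<in> cmp Y (k + n)"
        using linear_map_0[OF v assms(1,3)] tot_0[OF v] Y.subspace_0[OF assms(2)] by simp
      then show ?case .
    next
      case (step g c t)
      then have g: "g \<in> G" "d g = k" by auto
      have "F (t + scl ?X c (pure \<Phi> g)) = F t + scl Y c (F (pure \<Phi> g))"
        using assms(3) step pure_tot[OF g(1), of \<Phi> d] unfolding linear_map_def by blast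
      moreover have "t + scl ?X c (pure \<Phi> g) \<in> tot ?X"
        using step pure_tot[OF g(1), of \<Phi> d] tot_add[OF v] tot_scale[OF v] by blast
      ultimately have "fscl c (pure \<Phi> g) + t \<in> tot ?X \<and> F (fscl c (pure \<Phi> g) + t) \<in> cmp Y (k + n)"
        using step assms(4)[OF g(1)] g Y.subspace_add[OF assms(2)] Y.subspace_scale[OF assms(2)]
        by (simp add: add.commute)
      then show ?case .
    qed
    then show ?thesis by simp
  qed
  then show ?thesis using assms(3) by (auto simp: Hom_def)
qed

lemma presented_subspace: "module.subspace (scl (presented \<Phi> G d)) (cmp (presented \<Phi> G d) k)"
  by (simp add: cmp_presented tot_presented)

lemma sum_fun_apply: "(\<Sum>n\<in>N. x n) \<phi> = (\<Sum>n\<in>N. x n \<phi>)"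
  by (induction N rule: infinite_finite_induct) auto

text \<open>Two properties of a system of relations: a form can be cut down to a single degree,
  which makes the grading direct, and a degreewise linear functional restricts along
  \<open>pure\<close> to a form, which is the universal property of the generators.\<close>

locale presentation =
  fixes \<Phi> :: "('g \<Rightarrow> 'k::field_char_0) set" and G :: "'g set" and dg :: "'g \<Rightarrow> int"
  assumes restrict: "\<phi> \<in> \<Phi> \<Longrightarrow> (\<lambda>g. if dg g = n then \<phi> g else 0) \<in> \<Phi>"
    and univ: "slot_linear (presented \<Phi> G dg) (*) ll \<Longrightarrow> (\<lambda>g. ll (pure \<Phi> g)) \<in> \<Phi>"
begin

abbreviation X where "X \<equiv> presented \<Phi> G dg"

lemma graded_X: "graded_space X"
  unfolding graded_space_def
proof (intro conjI allI impI ballI)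
  fix N x m assume N: "finite N" "\<forall>n\<in>N. x n \<in> cmp X n" "(\<Sum>n\<in>N. x n) = 0" "m \<in> N"
  show "x m = 0"
  proof
    fix \<phi> show "x m \<phi> = 0 \<phi>"
    proof (cases "\<phi> \<in> \<Phi>")
      case True
      \<comment> \<open>Cutting the form down to degree \<open>m\<close> does not change its value
        on \<open>x m\<close> and kills the other summands.\<close>
      let ?\<phi> = "\<lambda>g. if dg g = m then \<phi> g else 0"
      have z: "x n ?\<phi> = 0" if "n \<in> N" "n \<noteq> m" for n
        by (rule ev_zero[of _ _ "{g \<in> G. dg g = n}" dg]) (use that N in \<open>auto simp: cmp_presented\<close>)
      have "x m ?\<phi> = x m \<phi>"
        by (rule ev_cong[of _ \<Phi> "{g \<in> G. dg g = m}" dg]) (use True N restrict in \<open>auto simp: cmp_presented\<close>)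
      moreover have "(\<Sum>n\<in>N. x n ?\<phi>) = 0" using N(3) by (simp add: sum_fun_apply[symmetric])
      ultimately show ?thesis using z N by (simp add: sum.remove[of N m])
    next
      case False
      then show ?thesis
        using ev_outside[of "x m" \<Phi> "{g \<in> G. dg g = m}" dg] N by (simp add: cmp_presented)
    qed
  qed
qed (simp_all add: vector_space_fscl presented_subspace[of \<Phi> G dg, simplified])

text \<open>A functional that is linear only within each component is computed by evaluating
  \<open>x\<close> on the form that the functional induces. This turns statements about abstract
  functionals into statements about generators.\<close>

lemma slot_expand:
  assumes "slot_linear X (*) ll" "x \<in> cmp X n"
  shows "ll x = x (\<lambda>g. ll (pure \<Phi> g))"
proof -
  have "x \<in> cmp X n \<and> ll x = x (\<lambda>g. ll (pure \<Phi> g))"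
    using assms(2) unfolding cmp_presented
  proof (induction rule: tot_induct)
    case zero
    have "0 \<in> cmp X n \<and> ll 0 = (0 :: ('g \<Rightarrow> 'k) \<Rightarrow> 'k) (\<lambda>g. ll (pure \<Phi> g))"
      using slot_linear_0[OF graded_X vector_space_mult assms(1)] cmp_0[OF graded_X, of n] by simp
    then show ?case unfolding cmp_presented .
  next
    case (step g c t)
    then have g: "pure \<Phi> g \<in> cmp X n" and t: "t \<in> cmp X n" using pure_cmp[of g G \<Phi> dg] by (auto simp: cmp_presented)
    have "ll (t + scl X c (pure \<Phi> g)) = ll t + c * ll (pure \<Phi> g)"
      using assms(1) g t unfolding slot_linear_def by blast
    moreover have "t + scl X c (pure \<Phi> g) \<in> cmp X n" using g t cmp_add cmp_scale graded_X by blast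
    moreover have "pure \<Phi> g (\<lambda>g. ll (pure \<Phi> g)) = ll (pure \<Phi> g)" using univ[OF assms(1)] by (simp add: pure_def)
    ultimately have "fscl c (pure \<Phi> g) + t \<in> cmp X n \<and>
        ll (fscl c (pure \<Phi> g) + t) = (fscl c (pure \<Phi> g) + t) (\<lambda>g. ll (pure \<Phi> g))"
      using step by (simp add: add.commute) (simp add: fscl_def)
    then show ?case unfolding cmp_presented .
  qed
  then show ?thesis by simp
qed

end

section \<open>Tensor products\<close>

lemma bilinear_left: "\<beta> \<in> bilinear_forms X Y \<Longrightarrow> y \<in> hmg Y \<Longrightarrow> slot_linear X (*) (\<lambda>x. \<beta> (x, y))"
  and bilinear_right: "\<beta> \<in> bilinear_forms X Y \<Longrightarrow> x \<in> hmg X \<Longrightarrow> slot_linear Y (*) (\<lambda>y. \<beta> (x, y))"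
  by (auto simp: bilinear_forms_def)

lemma tens_pure: "(\<lambda>(x, y). tens X x y) = pure (bilinear_forms X X)"
  by (simp add: tens_def fun_eq_iff)

lemma tens_eval: "\<beta> \<in> bilinear_forms X X \<Longrightarrow> tens X x y \<beta> = \<beta> (x, y)"
  by (simp add: tens_def pure_def)

lemma tens_outside: "\<beta> \<notin> bilinear_forms X X \<Longrightarrow> tens X x y \<beta> = 0"
  by (simp add: tens_def pure_def)

lemma tens_tot: "x \<in> hmg X \<Longrightarrow> y \<in> hmg X \<Longrightarrow> tens X x y \<in> tot (tensor X X)"
  by (simp add: tens_def tensor_def pure_tot)

lemma slot_linear_comp_Hom:
  assumes "F \<in> Hom X Y n" "slot_linear Y s ll" "vector_space (scl X)" "vector_space (scl Y)"
  shows "slot_linear X s (\<lambda>x. ll (F x))"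
  unfolding slot_linear_def
proof (intro allI ballI)
  fix k u v c assume uv: "u \<in> cmp X k" "v \<in> cmp X k"
  then have "F (u + scl X c v) = F u + scl Y c (F v)"
    using HomD(1)[OF assms(1)] hmg_tot[OF assms(3)] cmp_hmg unfolding linear_map_def by metis
  then show "ll (F (u + scl X c v)) = ll (F u) + s c (ll (F v))"
    using assms(2) uv HomD(2)[OF assms(1)] unfolding slot_linear_def by metis
qed

lemma leibniz_form:
  assumes "graded_space X" "Q \<in> Hom X X 1" "\<beta> \<in> bilinear_forms X X"
  shows "(\<lambda>(x, y). \<beta> (Q x, y) + ksign (deg X x) (\<beta> (x, Q y))) \<in> bilinear_forms X X"
proof -
  note v = graded_vs[OF assms(1)]
  have "slot_linear X (*) (\<lambda>y. \<beta> (Q x, y) + ksign (deg X x) (\<beta> (x, Q y)))" if "x \<in> hmg X" for x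
    using that Hom_hmg[OF assms(2)]
    by (intro slot_linear_add slot_linear_ksign_const vector_space_mult bilinear_right[OF assms(3)]
        slot_linear_comp_Hom[OF assms(2) _ v v]) auto
  moreover have "slot_linear X (*) (\<lambda>x. \<beta> (Q x, y) + ksign (deg X x) (\<beta> (x, Q y)))" if "y \<in> hmg X" for y
    using that Hom_hmg[OF assms(2)]
    by (intro slot_linear_add slot_linear_sign[where N = "\<lambda>n. n"] vector_space_mult
        bilinear_left[OF assms(3)] assms(1)
        slot_linear_comp_Hom[OF assms(2) _ v v, of "(*)" "\<lambda>x. \<beta> (x, y)"]) auto
  ultimately show ?thesis by (simp add: bilinear_forms_def)
qed

lemma tensor_leibniz:
  assumes "graded_space X" "Q \<in> Hom X X 1"
  shows "linear_map (tensor X X) fscl (tensor_leibniz X Q)"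
    and "\<And>x y. x \<in> hmg X \<Longrightarrow> y \<in> hmg X \<Longrightarrow>
      tensor_leibniz X Q (tens X x y) = tens X (Q x) y + ksign (deg X x) (tens X x (Q y))"
    and "\<And>t \<beta>. t \<in> tot (tensor X X) \<Longrightarrow> \<beta> \<in> bilinear_forms X X \<Longrightarrow>
      tensor_leibniz X Q t \<beta> = t (\<lambda>(x, y). \<beta> (Q x, y) + ksign (deg X x) (\<beta> (x, Q y)))"
proof -
  let ?f = "\<lambda>(x, y). tens X (Q x) y + ksign (deg X x) (tens X x (Q y))"
  have form: "(\<lambda>g. ?f g \<beta>) = (\<lambda>(x, y). \<beta> (Q x, y) + ksign (deg X x) (\<beta> (x, Q y)))"
    if "\<beta> \<in> bilinear_forms X X" for \<beta>
    using that by (auto simp: fun_eq_iff ksign_apply tens_eval)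
  have 1: "\<forall>\<beta>\<in>bilinear_forms X X. (\<lambda>g. ?f g \<beta>) \<in> bilinear_forms X X"
  proof
    fix \<beta> assume b: "\<beta> \<in> bilinear_forms X X"
    show "(\<lambda>g. ?f g \<beta>) \<in> bilinear_forms X X" unfolding form[OF b] by (rule leibniz_form[OF assms b])
  qed
  have 2: "\<forall>g\<in>hmg X \<times> hmg X. \<forall>\<beta>. \<beta> \<notin> bilinear_forms X X \<longrightarrow> ?f g \<beta> = 0"
    by (auto simp: ksign_apply tens_outside)
  have F: "tensor_leibniz X Q =
    lin_extension (tensor X X) (pure (bilinear_forms X X)) (hmg X \<times> hmg X) fscl ?f"
    unfolding tensor_leibniz_def tens_pure ..
  note l = lin_ext_fun[where f = ?f and \<Phi> = "bilinear_forms X X" and \<Phi>' = "bilinear_forms X X"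
      and F = "tensor_leibniz X Q" and d = "\<lambda>(x, y). deg X x + deg X y" and G = "hmg X \<times> hmg X",
      folded tensor_def, OF 1 2 F]
  show "linear_map (tensor X X) fscl (tensor_leibniz X Q)" by (rule l(1))
  show "tensor_leibniz X Q (tens X x y) = tens X (Q x) y + ksign (deg X x) (tens X x (Q y))"
    if "x \<in> hmg X" "y \<in> hmg X" for x y
    using l(2)[of "(x, y)"] that by (simp add: tens_def)
  show "tensor_leibniz X Q t \<beta> = t (\<lambda>(x, y). \<beta> (Q x, y) + ksign (deg X x) (\<beta> (x, Q y)))"
    if "t \<in> tot (tensor X X)" "\<beta> \<in> bilinear_forms X X" for t \<beta>
    using l(3)[OF that] form[OF that(2)] by simp
qed

lemma tensor_square:
  assumes "graded_space X" "graded_space Y" "F \<in> Hom X Y 0"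
  shows "linear_map (tensor X X) fscl (tensor_square X Y F)"
    and "\<And>x y. x \<in> hmg X \<Longrightarrow> y \<in> hmg X \<Longrightarrow> tensor_square X Y F (tens X x y) = tens Y (F x) (F y)"
    and "\<And>t \<beta>. t \<in> tot (tensor X X) \<Longrightarrow> \<beta> \<in> bilinear_forms Y Y \<Longrightarrow>
      tensor_square X Y F t \<beta> = t (\<lambda>(x, y). \<beta> (F x, F y))"
proof -
  let ?f = "\<lambda>(x, y). tens Y (F x) (F y)"
  note v = graded_vs[OF assms(1)] graded_vs[OF assms(2)]
  have form: "(\<lambda>g. ?f g \<beta>) = (\<lambda>(x, y). \<beta> (F x, F y))" if "\<beta> \<in> bilinear_forms Y Y" for \<beta>
    using that by (auto simp: fun_eq_iff tens_eval)
  have 1: "\<forall>\<beta>\<in>bilinear_forms Y Y. (\<lambda>g. ?f g \<beta>) \<in> bilinear_forms X X"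
  proof
    fix \<beta> assume that: "\<beta> \<in> bilinear_forms Y Y"
    have "slot_linear X (*) (\<lambda>y. \<beta> (F x, F y)) \<and> slot_linear X (*) (\<lambda>y. \<beta> (F y, F x))" if "x \<in> hmg X" for x
      using that Hom_hmg[OF assms(3)] bilinear_left[OF \<open>\<beta> \<in> _\<close>] bilinear_right[OF \<open>\<beta> \<in> _\<close>]
        slot_linear_comp_Hom[OF assms(3) _ v, of "(*)" "\<lambda>y. \<beta> (y, F x)"]
        slot_linear_comp_Hom[OF assms(3) _ v, of "(*)" "\<lambda>y. \<beta> (F x, y)"] by auto
    then show "(\<lambda>g. ?f g \<beta>) \<in> bilinear_forms X X" unfolding form[OF that] by (simp add: bilinear_forms_def)
  qed
  have 2: "\<forall>g\<in>hmg X \<times> hmg X. \<forall>\<beta>. \<beta> \<notin> bilinear_forms Y Y \<longrightarrow> ?f g \<beta> = 0"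
    by (auto simp: tens_outside)
  have FF: "tensor_square X Y F =
    lin_extension (tensor X X) (pure (bilinear_forms X X)) (hmg X \<times> hmg X) fscl ?f"
    unfolding tensor_square_def tens_pure ..
  note l = lin_ext_fun[where f = ?f and \<Phi> = "bilinear_forms X X" and \<Phi>' = "bilinear_forms Y Y"
      and F = "tensor_square X Y F" and d = "\<lambda>(x, y). deg X x + deg X y" and G = "hmg X \<times> hmg X",
      folded tensor_def, OF 1 2 FF]
  show "linear_map (tensor X X) fscl (tensor_square X Y F)" by (rule l(1))
  show "tensor_square X Y F (tens X x y) = tens Y (F x) (F y)" if "x \<in> hmg X" "y \<in> hmg X" for x y
    using l(2)[of "(x, y)"] that by (simp add: tens_def)
  show "tensor_square X Y F t \<beta> = t (\<lambda>(x, y). \<beta> (F x, F y))"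
    if "t \<in> tot (tensor X X)" "\<beta> \<in> bilinear_forms Y Y" for t \<beta>
    using l(3)[OF that] form[OF that(2)] by simp
qed

section \<open>Symmetric and multilinear functions of words\<close>

declare in_listsD [rule del] in_listsI [rule del]

text \<open>The conditions of \<open>sym_forms\<close>, for values in an arbitrary space:
  corestrictions and families of cochains have to satisfy them as well as scalar forms.\<close>

definition vsym ::
  "('k::field_char_0, 'v::ab_group_add) gvs \<Rightarrow> ('k \<Rightarrow> 'w \<Rightarrow> 'w) \<Rightarrow> ('v list \<Rightarrow> 'w::ab_group_add) \<Rightarrow> bool"
where
  "vsym V s f \<longleftrightarrow>
     (\<forall>xs\<in>words V. \<forall>ys\<in>words V. slot_linear V s (\<lambda>u. f (xs @ u # ys))) \<and>
     (\<forall>xs\<in>words V. \<forall>ys\<in>words V. \<forall>u\<in>hmg V. \<forall>v\<in>hmg V.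
        f (xs @ u # v # ys) = ksign (sdeg2 V u * sdeg2 V v) (f (xs @ v # u # ys)))"

lemma sym_forms_iff: "\<phi> \<in> sym_forms V \<longleftrightarrow> vsym V (*) \<phi>"
  by (simp add: sym_forms_def vsym_def)

lemma vsymI:
  assumes "\<And>xs ys. xs \<in> words V \<Longrightarrow> ys \<in> words V \<Longrightarrow> slot_linear V s (\<lambda>u. f (xs @ u # ys))"
    and "\<And>xs ys u v. xs \<in> words V \<Longrightarrow> ys \<in> words V \<Longrightarrow> u \<in> hmg V \<Longrightarrow> v \<in> hmg V \<Longrightarrow>
        f (xs @ u # v # ys) = ksign (sdeg2 V u * sdeg2 V v) (f (xs @ v # u # ys))"
  shows "vsym V s f"
  unfolding vsym_def by (intro conjI ballI assms)

lemma vsym_slot: "vsym V s f \<Longrightarrow> xs \<in> words V \<Longrightarrow> ys \<in> words V \<Longrightarrow> slot_linear V s (\<lambda>u. f (xs @ u # ys))"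
  by (simp add: vsym_def)

lemma vsym_swap: "vsym V s f \<Longrightarrow> xs \<in> words V \<Longrightarrow> ys \<in> words V \<Longrightarrow> u \<in> hmg V \<Longrightarrow> v \<in> hmg V \<Longrightarrow>
        f (xs @ u # v # ys) = ksign (sdeg2 V u * sdeg2 V v) (f (xs @ v # u # ys))"
  unfolding vsym_def by (drule conjunct2) ((drule (1) bspec)+, assumption)

definition vmult ::
  "('k::field_char_0, 'v::ab_group_add) gvs \<Rightarrow> ('k \<Rightarrow> 'w \<Rightarrow> 'w) \<Rightarrow> ('v list \<Rightarrow> 'w::ab_group_add) \<Rightarrow> bool"
where
  "vmult V s f \<longleftrightarrow> (\<forall>xs\<in>words V. \<forall>ys\<in>words V. slot_linear V s (\<lambda>u. f (xs @ u # ys)))"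

lemma vmultI:
  assumes "\<And>xs ys. xs \<in> words V \<Longrightarrow> ys \<in> words V \<Longrightarrow> slot_linear V s (\<lambda>u. f (xs @ u # ys))"
  shows "vmult V s f"
  unfolding vmult_def by (intro ballI assms)

lemma vmult_slot: "vmult V s f \<Longrightarrow> xs \<in> words V \<Longrightarrow> ys \<in> words V \<Longrightarrow> slot_linear V s (\<lambda>u. f (xs @ u # ys))"
  by (simp add: vmult_def)

lemma vsym_vmult: "vsym V s f \<Longrightarrow> vmult V s f"
  by (simp add: vsym_def vmult_def)

lemma vsym_additive:
  assumes "vector_space s"
  shows "additive_on {f. vsym V s f} id"
  unfolding additive_on_def
proof (intro conjI ballI)
  show "0 \<in> {f. vsym V s f}"
    using slot_linear_zero[OF assms] by (auto intro!: vsymI)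
  fix f assume "f \<in> {f. vsym V s f}"
  then have f: "vsym V s f" by simp
  have "vsym V s (- f)"
  proof (rule vsymI)
    fix xs ys assume xy: "xs \<in> words V" "ys \<in> words V"
    show "slot_linear V s (\<lambda>u. (- f) (xs @ u # ys))"
      using slot_linear_uminus[OF assms vsym_slot[OF f xy]] by simp
    fix u v assume "u \<in> hmg V" "v \<in> hmg V"
    from vsym_swap[OF f xy this]
    show "(- f) (xs @ u # v # ys) = ksign (sdeg2 V u * sdeg2 V v) ((- f) (xs @ v # u # ys))"
      by (simp only: uminus_apply ksign_uminus)
  qed
  then show "- f \<in> {f. vsym V s f}" by simp
  fix g assume "g \<in> {f. vsym V s f}"
  then have g: "vsym V s g" by simp
  have "vsym V s (f + g)"
  proof (rule vsymI)
    fix xs ys assume xy: "xs \<in> words V" "ys \<in> words V"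
    show "slot_linear V s (\<lambda>u. (f + g) (xs @ u # ys))"
      using slot_linear_add[OF assms vsym_slot[OF f xy] vsym_slot[OF g xy]] by simp
    fix u v assume uv: "u \<in> hmg V" "v \<in> hmg V"
    show "(f + g) (xs @ u # v # ys) = ksign (sdeg2 V u * sdeg2 V v) ((f + g) (xs @ v # u # ys))"
      by (simp only: plus_fun_apply ksign_add vsym_swap[OF f xy uv] vsym_swap[OF g xy uv])
  qed
  then show "f + g \<in> {f. vsym V s f}" by simp
qed simp

lemma vmult_additive:
  assumes "vector_space s"
  shows "additive_on {f. vmult V s f} id"
  unfolding additive_on_def
proof (intro conjI ballI)
  show "0 \<in> {f. vmult V s f}"
    using slot_linear_zero[OF assms] by (auto intro!: vmultI)
  fix f assume f: "f \<in> {f. vmult V s f}"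
  show "- f \<in> {f. vmult V s f}"
    using f vmult_slot[of V s f] by (auto intro!: vmultI slot_linear_uminus[OF assms])
  fix g assume g: "g \<in> {f. vmult V s f}"
  show "f + g \<in> {f. vmult V s f}"
    using f g vmult_slot[of V s f] vmult_slot[of V s g] by (auto intro!: vmultI slot_linear_add[OF assms])
qed simp

text \<open>A class of functions closed under addition and negation is closed under pointwise signed
  sums. It is instantiated by symmetric and by multilinear functions.\<close>

lemma sum_closure:
  assumes "additive_on {f. P f} (id :: ('a \<Rightarrow> 'b::ab_group_add) \<Rightarrow> _)"
  shows closure_unsh: "(\<And>l r. usplit d xs l r \<Longrightarrow> P (\<lambda>v. h v l r)) \<Longrightarrow> P (\<lambda>v. unshuffle_sum d (h v) xs)"
    and closure_dec: "(\<And>x y. xs = x @ y \<Longrightarrow> P (\<lambda>v. h v x y)) \<Longrightarrow> P (\<lambda>v. dec (h v) xs)"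
    and closure_ksign: "P f \<Longrightarrow> P (\<lambda>v. ksign n (f v))"
    and closure_uminus: "P f \<Longrightarrow> P (\<lambda>v. - f v)"
    and closure_add: "P f \<Longrightarrow> P g \<Longrightarrow> P (\<lambda>v. f v + g v)"
    and closure_zero: "P (\<lambda>v. 0)"
proof -
  show "P (\<lambda>v. unshuffle_sum d (h v) xs)" if "\<And>l r. usplit d xs l r \<Longrightarrow> P (\<lambda>v. h v l r)"
  proof -
    have "unshuffle_sum d (\<lambda>l r v. h v l r) xs \<in> {f. P f}"
      using unsh_additive_on[OF assms, of d xs "\<lambda>l r v. h v l r"] that by blast
    moreover have "unshuffle_sum d (\<lambda>l r v. h v l r) xs = (\<lambda>v. unshuffle_sum d (h v) xs)"
      by (simp add: unsh_apply fun_eq_iff)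
    ultimately show ?thesis by simp
  qed
  show "P (\<lambda>v. dec (h v) xs)" if "\<And>x y. xs = x @ y \<Longrightarrow> P (\<lambda>v. h v x y)"
  proof -
    have "dec (\<lambda>l r v. h v l r) xs \<in> {f. P f}"
      using dec_additive_on[OF assms, of xs "\<lambda>l r v. h v l r"] that by blast
    moreover have "dec (\<lambda>l r v. h v l r) xs = (\<lambda>v. dec (h v) xs)"
      by (simp add: dec_apply fun_eq_iff)
    ultimately show ?thesis by simp
  qed
  show m: "P (\<lambda>v. - f v)" if "P f" for f
    using additive_on_uminus[OF assms, of f] that by (simp add: fun_Compl_def)
  show "P (\<lambda>v. ksign n (f v))" if "P f"
    using m[OF that] that by (cases "even n") (simp_all add: ksign_def)
  show "P (\<lambda>v. f v + g v)" if "P f" "P g"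
    using additive_on_add[OF assms, of f g] that by (simp add: plus_fun_def)
  show "P (\<lambda>v. 0)" using additive_on_0[OF assms] by (simp add: zero_fun_def)
qed

lemmas vsym_sums = sum_closure[OF vsym_additive]
lemmas vmult_sums = sum_closure[OF vmult_additive]

lemma vsym_Ins_sum:
  assumes "vector_space s" "\<And>x y z. as = x @ y @ z \<Longrightarrow> vsym V s (\<lambda>v. K v (x @ g y # z))"
  shows "vsym V s (\<lambda>v. Ins d p g (K v) as)"
  unfolding Ins_eq_dec
  by (intro vsym_sums[OF assms(1)]) (simp add: assms(2))

lemma vsym_Cons:
  assumes "vsym V s f" "x \<in> hmg V"
  shows "vsym V s (\<lambda>l. f (x # l))"
proof (rule vsymI)
  fix xs ys assume "xs \<in> words V" "ys \<in> words V"
  then show "slot_linear V s (\<lambda>u. f (x # xs @ u # ys))"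
    using vsym_slot[OF assms(1), of "x # xs" ys] assms(2) by simp
  fix u v assume "u \<in> hmg V" "v \<in> hmg V"
  then show "f (x # xs @ u # v # ys) = ksign (sdeg2 V u * sdeg2 V v) (f (x # xs @ v # u # ys))"
    using vsym_swap[OF assms(1), of "x # xs" ys u v] assms(2) \<open>xs \<in> _\<close> \<open>ys \<in> _\<close> by simp
qed

lemma vmult_append:
  assumes "vmult V s f" "w \<in> words V" "w' \<in> words V"
  shows "vmult V s (\<lambda>l. f (w @ l @ w'))"
proof (rule vmultI)
  fix xs ys assume "xs \<in> words V" "ys \<in> words V"
  then show "slot_linear V s (\<lambda>u. f (w @ (xs @ u # ys) @ w'))"
    using vmult_slot[OF assms(1), of "w @ xs" "ys @ w'"] assms by simp
qed

lemma vmult_Cons: "vmult V s f \<Longrightarrow> x \<in> hmg V \<Longrightarrow> vmult V s (\<lambda>l. f (x # l))"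
  using vmult_append[of V s f "[x]" "[]"] by simp

lemma vsym_cong:
  assumes "graded_space V" "vsym V s f" "\<And>l. l \<in> words V \<Longrightarrow> l \<noteq> [] \<Longrightarrow> f l = g l"
  shows "vsym V s g"
proof (rule vsymI)
  fix xs ys assume xy: "xs \<in> words V" "ys \<in> words V"
  show "slot_linear V s (\<lambda>u. g (xs @ u # ys))"
    by (rule slot_linear_cong[OF vsym_slot[OF assms(2) xy] assms(3) assms(1)]) (use xy in auto)
  fix u v assume uv: "u \<in> hmg V" "v \<in> hmg V"
  then have "xs @ u # v # ys \<in> words V" "xs @ v # u # ys \<in> words V" using xy by auto
  from assms(3)[OF this(1)] assms(3)[OF this(2)]
  show "g (xs @ u # v # ys) = ksign (sdeg2 V u * sdeg2 V v) (g (xs @ v # u # ys))"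
    using vsym_swap[OF assms(2) xy uv] by simp
qed

lemma vmult_cong:
  assumes "graded_space V" "vmult V s f" "\<And>l. l \<in> words V \<Longrightarrow> l \<noteq> [] \<Longrightarrow> f l = g l"
  shows "vmult V s g"
proof (rule vmultI)
  fix xs ys assume xy: "xs \<in> words V" "ys \<in> words V"
  show "slot_linear V s (\<lambda>u. g (xs @ u # ys))"
    by (rule slot_linear_cong[OF vmult_slot[OF assms(2) xy] assms(3) assms(1)]) (use xy in auto)
qed

lemma vmult_weight:
  assumes "graded_space V" "vector_space s" "vmult V s f"
  shows "vmult V s (\<lambda>l. s (w (length l) (wt (\<lambda>x. deg V x - c) l)) (f l))"
proof (rule vmultI)
  fix xs ys assume xy: "xs \<in> words V" "ys \<in> words V"
  show "slot_linear V s (\<lambda>u. s (w (length (xs @ u # ys)) (wt (\<lambda>x. deg V x - c) (xs @ u # ys))) (f (xs @ u # ys)))"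
    using slot_linear_weight[OF assms(1,2) vmult_slot[OF assms(3) xy],
        of "\<lambda>n. w (length xs + Suc (length ys)) (wt (\<lambda>x. deg V x - c) xs + (n - c + wt (\<lambda>x. deg V x - c) ys))"]
    by simp
qed

lemma sdeg1_eq: "sdeg1 V = (\<lambda>x. deg V x - 1)"
  and sdeg2_eq: "sdeg2 V = (\<lambda>x. deg V x - 2)"
  by (auto simp: sdeg1_def sdeg2_def)

text \<open>Length and weight of a word are invariant under transpositions, and within a component
  the weight varies only at a zero letter, where the value vanishes. This covers signs depending on
  the weight as well as the restriction of forms to one degree or one length.\<close>

lemma vsym_weight:
  assumes "graded_space V" "vector_space s" "vsym V s f"
  shows "vsym V s (\<lambda>l. s (w (length l) (wt (sdeg2 V) l)) (f l))"
proof (rule vsymI)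
  fix xs ys assume xy: "xs \<in> words V" "ys \<in> words V"
  show "slot_linear V s (\<lambda>u. s (w (length (xs @ u # ys)) (wt (sdeg2 V) (xs @ u # ys))) (f (xs @ u # ys)))"
    using vmult_slot[OF vmult_weight[OF assms(1,2) vsym_vmult[OF assms(3)]] xy, of w 2] by (simp add: sdeg2_eq)
  fix u v assume uv: "u \<in> hmg V" "v \<in> hmg V"
  show "s (w (length (xs @ u # v # ys)) (wt (sdeg2 V) (xs @ u # v # ys))) (f (xs @ u # v # ys)) =
    ksign (sdeg2 V u * sdeg2 V v) (s (w (length (xs @ v # u # ys)) (wt (sdeg2 V) (xs @ v # u # ys))) (f (xs @ v # u # ys)))"
    using vsym_swap[OF assms(3) xy uv] scale_ksign[OF assms(2)] by (simp add: add.left_commute)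
qed

lemma vsym_sign:
  assumes "graded_space V" "vector_space s" "vsym V s f"
  shows "vsym V s (\<lambda>l. ksign (N (wt (sdeg2 V) l)) (f l))"
  using vsym_weight[OF assms, of "\<lambda>_ n. if even (N n) then 1 else - 1"]
  by (simp add: ksign_scale[OF assms(2), of _ "f _"])

lemma vmult_sign:
  assumes "graded_space V" "vector_space s" "vmult V s f"
  shows "vmult V s (\<lambda>l. ksign (N (wt (sdeg1 V) l)) (f l))"
  using vmult_weight[OF assms, of "\<lambda>_ n. if even (N n) then 1 else - 1" 1]
  by (simp add: ksign_scale[OF assms(2), of _ "f _"] sdeg1_eq)

lemma vmult_zero_letter:
  assumes "graded_space V" "vector_space s" "vmult V s f" "xs \<in> words V" "0 \<in> set xs"
  shows "f xs = 0"
proof -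
  obtain ys zs where xs: "xs = ys @ 0 # zs" using assms(5) split_list by fast
  then show ?thesis
    using slot_linear_0[OF assms(1,2) vmult_slot[OF assms(3), of ys zs]] assms(4) by simp
qed

lemma vmult_letter_zero:
  assumes "graded_space V" "vector_space s" "vmult V s f" "xs \<in> words V" "ys \<in> words V"
  shows "f (xs @ 0 # ys) = 0"
  using slot_linear_0[OF assms(1,2) vmult_slot[OF assms(3-5)]] .

lemma vsym_move:
  assumes "xs \<in> words V" "ys \<in> words V" "u \<in> hmg V" "vsym V s f"
  shows "f (xs @ u # ys) = ksign (sdeg2 V u * wt (sdeg2 V) xs) (f (u # xs @ ys))"
  using assms(1,4)
proof (induction xs arbitrary: f rule: list.induct)
  case (Cons x xs)
  then have "f (x # xs @ u # ys) = ksign (sdeg2 V u * wt (sdeg2 V) xs) (f (x # u # xs @ ys))"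
    using vsym_Cons[of V s f x] by simp
  also have "f (x # u # xs @ ys) = ksign (sdeg2 V x * sdeg2 V u) (f (u # x # xs @ ys))"
    using vsym_swap[OF Cons.prems(2), of "[]" "xs @ ys" x u] Cons.prems(1) assms by simp
  finally show ?case by (simp add: algebra_simps)
qed simp

text \<open>A zero letter has no well-defined degree, but then the value vanishes.\<close>

lemma vmult_slot_cmp:
  assumes V: "graded_space V" and W: "vector_space (scl W)" "\<And>n. module.subspace (scl W) (cmp W n)"
    and f: "vmult V (scl W) f" "\<And>l. l \<in> words V \<Longrightarrow> l \<noteq> [] \<Longrightarrow> f l \<in> cmp W (wt (\<lambda>x. deg V x - e) l + c)"
    and "xs \<in> words V" "ys \<in> words V" "u \<in> cmp V n"
  shows "f (xs @ u # ys) \<in> cmp W (wt (\<lambda>x. deg V x - e) xs + (n - e) + wt (\<lambda>x. deg V x - e) ys + c)"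
proof (cases "u = 0")
  case True
  interpret vector_space "scl W" by fact
  show ?thesis using vmult_letter_zero[OF V W(1) f(1) assms(6,7)] True subspace_0[OF W(2)] by simp
next
  case False
  then show ?thesis
    using f(2)[of "xs @ u # ys"] deg_eq[OF V assms(8)] cmp_hmg[OF assms(8)] assms(6,7) by (simp add: add.assoc)
qed

text \<open>\<open>ll\<close> is linear only within components, so \<open>f\<close> has to map a
  slot of fixed degree into one component; \<open>vmult_slot_cmp\<close> provides this even at zero
  letters.\<close>

lemma vmult_comp:
  assumes V: "graded_space V" and W: "vector_space (scl W)" "\<And>n. module.subspace (scl W) (cmp W n)"
    and f: "vmult V (scl W) f" "\<And>l. l \<in> words V \<Longrightarrow> l \<noteq> [] \<Longrightarrow> f l \<in> cmp W (wt (\<lambda>x. deg V x - e) l + c)"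
    and ll: "slot_linear W s ll"
  shows "vmult V s (\<lambda>l. ll (f l))"
proof (rule vmultI)
  fix xs ys assume xy: "xs \<in> words V" "ys \<in> words V"
  show "slot_linear V s (\<lambda>u. ll (f (xs @ u # ys)))"
    unfolding slot_linear_def
  proof (intro allI ballI)
    fix n u v a assume uv: "u \<in> cmp V n" "v \<in> cmp V n"
    have "f (xs @ (u + scl V a v) # ys) = f (xs @ u # ys) + scl W a (f (xs @ v # ys))"
      using vmult_slot[OF f(1) xy] uv unfolding slot_linear_def by blast
    then show "ll (f (xs @ (u + scl V a v) # ys)) = ll (f (xs @ u # ys)) + s a (ll (f (xs @ v # ys)))"
      using ll vmult_slot_cmp[OF V W f xy uv(1)] vmult_slot_cmp[OF V W f xy uv(2)]
      unfolding slot_linear_def by simp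
  qed
qed

lemma vsym_comp:
  assumes V: "graded_space V" and W: "vector_space (scl W)" "\<And>n. module.subspace (scl W) (cmp W n)"
    and s: "vector_space s"
    and f: "vsym V (scl W) f" "\<And>l. l \<in> words V \<Longrightarrow> l \<noteq> [] \<Longrightarrow> f l \<in> cmp W (wt (sdeg2 V) l + c)"
    and ll: "slot_linear W s ll"
  shows "vsym V s (\<lambda>l. ll (f l))"
proof (rule vsymI)
  fix xs ys assume xy: "xs \<in> words V" "ys \<in> words V"
  show "slot_linear V s (\<lambda>u. ll (f (xs @ u # ys)))"
    using vmult_slot[OF vmult_comp[OF V W vsym_vmult[OF f(1)] f(2)[unfolded sdeg2_eq] ll] xy] .
  fix u v assume uv: "u \<in> hmg V" "v \<in> hmg V"
  interpret W: vector_space "scl W" by fact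
  have neg: "ll (- x) = - ll x" if "x \<in> cmp W n" for x n
  proof -
    have "ll (0 + scl W 1 0) = ll 0 + s 1 (ll 0)" "ll (0 + scl W (- 1) x) = ll 0 + s (- 1) (ll x)"
      using ll that W.subspace_0[OF W(2)] unfolding slot_linear_def by blast+
    then show ?thesis using vector_space_scale[OF s] by simp
  qed
  show "ll (f (xs @ u # v # ys)) = ksign (sdeg2 V u * sdeg2 V v) (ll (f (xs @ v # u # ys)))"
    using vsym_swap[OF f(1) xy uv] f(2)[of "xs @ v # u # ys"] xy uv neg by (auto simp: ksign_def)
qed

text \<open>Symmetric in each word separately, that is, a form on the tensor square of the symmetric
  coalgebra.\<close>

definition bisym where
  "bisym V s h \<longleftrightarrow> (\<forall>r\<in>words V. vsym V s (\<lambda>l. h l r)) \<and> (\<forall>l\<in>words V. vsym V s (h l))"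

lemma bisymD: "bisym V s h \<Longrightarrow> r \<in> words V \<Longrightarrow> vsym V s (\<lambda>l. h l r)"
  "bisym V s h \<Longrightarrow> l \<in> words V \<Longrightarrow> vsym V s (h l)"
  by (simp_all add: bisym_def)

lemma bisymI:
  "(\<And>r. r \<in> words V \<Longrightarrow> vsym V s (\<lambda>l. h l r)) \<Longrightarrow> (\<And>l. l \<in> words V \<Longrightarrow> vsym V s (h l)) \<Longrightarrow>
   bisym V s h"
  by (simp add: bisym_def)

lemma bisym_left:
  assumes "bisym V s h" "x \<in> hmg V"
  shows "bisym V s (\<lambda>l. h (x # l))"
proof (rule bisymI)
  fix l assume "l \<in> words V"
  then show "vsym V s (h (x # l))" using bisymD(2)[OF assms(1), of "x # l"] assms(2) by simp
  show "vsym V s (\<lambda>w. h (x # w) l)"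
    by (rule vsym_Cons[OF bisymD(1)[OF assms(1) \<open>l \<in> _\<close>] assms(2)])
qed

lemma bisym_right:
  assumes "graded_space V" "vector_space s" "bisym V s h" "x \<in> hmg V"
  shows "bisym V s (\<lambda>l r. ksign (sdeg2 V x * wt (sdeg2 V) l) (h l (x # r)))"
proof (rule bisymI)
  fix l assume l: "l \<in> words V"
  show "vsym V s (\<lambda>r. ksign (sdeg2 V x * wt (sdeg2 V) l) (h l (x # r)))"
    by (rule vsym_sums(3)[OF assms(2) vsym_Cons[OF bisymD(2)[OF assms(3) l] assms(4)]])
  have "x # l \<in> words V" using l assms(4) by simp
  from vsym_sign[OF assms(1,2) bisymD(1)[OF assms(3) this], of "\<lambda>n. sdeg2 V x * n"]
  show "vsym V s (\<lambda>w. ksign (sdeg2 V x * wt (sdeg2 V) w) (h w (x # l)))" .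
qed

text \<open>The unshuffle coproduct is well defined on Koszul-symmetric monomials. The class of
  bisymmetric \<open>h\<close> is stable under peeling off a first letter to either side, so
  induction reduces both conditions to slots at the front of the word.\<close>

lemma vsym_unshuffle:
  assumes V: "graded_space V" and s: "vector_space s" and h: "bisym V s h"
  shows "vsym V s (unshuffle_sum (sdeg2 V) h)"
proof (rule vsymI)
  let ?d = "sdeg2 V"
  fix xs ys assume xy: "xs \<in> words V" "ys \<in> words V"
  have xs: "\<forall>x\<in>set xs. x \<in> hmg V" using xy(1) by (simp add: in_lists_conv_set)
  show "slot_linear V s (\<lambda>u. unshuffle_sum ?d h (xs @ u # ys))"
    using h xs
  proof (induction xs arbitrary: h)
    case Nil
    have "slot_linear V s (\<lambda>u. h (u # l) r)" "slot_linear V s (\<lambda>u. ksign (?d u * wt ?d l) (h l (u # r)))"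
      if "usplit ?d ys l r" for l r
    proof -
      have lr: "l \<in> words V" "r \<in> words V" using usplit_lists[OF that xy(2)] by auto
      show "slot_linear V s (\<lambda>u. h (u # l) r)"
        using vsym_slot[OF bisymD(1)[OF Nil(1) lr(2)], of "[]" l] lr by simp
      show "slot_linear V s (\<lambda>u. ksign (?d u * wt ?d l) (h l (u # r)))"
        using slot_linear_sign[OF V s vsym_slot[OF bisymD(2)[OF Nil(1) lr(1)], of "[]" r], of "\<lambda>n. (n - 2) * wt ?d l"] lr
        by (simp add: sdeg2_def)
    qed
    note 1 = this
    have "slot_linear V s (\<lambda>u. unshuffle_sum ?d (\<lambda>l r. h (u # l) r) ys)"
      by (rule slot_linear_unsh[OF s]) (rule 1(1))
    moreover have "slot_linear V s (\<lambda>u. unshuffle_sum ?d (\<lambda>l r. ksign (?d u * wt ?d l) (h l (u # r))) ys)"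
      by (rule slot_linear_unsh[OF s]) (rule 1(2))
    ultimately have "slot_linear V s (\<lambda>u. unshuffle_sum ?d (\<lambda>l r. h (u # l) r) ys)"
      "slot_linear V s (\<lambda>u. unshuffle_sum ?d (\<lambda>l r. ksign (?d u * wt ?d l) (h l (u # r))) ys)"
      by this+
    from slot_linear_add[OF s this] show ?case by simp
  next
    case (Cons x xs)
    then have x: "x \<in> hmg V" by simp
    from slot_linear_add[OF s Cons.IH[OF bisym_left[OF Cons.prems(1) x]] Cons.IH[OF bisym_right[OF V s Cons.prems(1) x]]]
    show ?case using Cons.prems(2) by simp
  qed
  fix u v assume uv: "u \<in> hmg V" "v \<in> hmg V"
  show "unshuffle_sum ?d h (xs @ u # v # ys) = ksign (?d u * ?d v) (unshuffle_sum ?d h (xs @ v # u # ys))"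
    using h xs
  proof (induction xs arbitrary: h)
    case Nil
    \<comment> \<open>The letters \<open>u\<close>, \<open>v\<close> go both left, both right, or to
      different sides. Symmetry of \<open>h\<close> handles the first two cases; the two mixed terms
      are interchanged.\<close>
    let ?k = "?d u * ?d v"
    have expand: "unshuffle_sum ?d h (a # b # ys) =
        unshuffle_sum ?d (\<lambda>l r. h (a # b # l) r) ys +
        unshuffle_sum ?d (\<lambda>l r. ksign (?d b * wt ?d l) (h (a # l) (b # r))) ys +
        (unshuffle_sum ?d (\<lambda>l r. ksign (?d a * (?d b + wt ?d l)) (h (b # l) (a # r))) ys +
        unshuffle_sum ?d (\<lambda>l r. ksign (?d b * wt ?d l + ?d a * wt ?d l) (h l (a # b # r))) ys)" for a b
      by simp
    have 1: "unshuffle_sum ?d (\<lambda>l r. h (u # v # l) r) ys = unshuffle_sum ?d (\<lambda>l r. ksign ?k (h (v # u # l) r)) ys"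
    proof (rule unsh_cong)
      fix l r assume "usplit ?d ys l r"
      then have "l \<in> words V" "r \<in> words V" using usplit_lists xy(2) by blast+
      then show "h (u # v # l) r = ksign ?k (h (v # u # l) r)"
        using vsym_swap[OF bisymD(1)[OF Nil(1)], of r "[]" l u v] uv by simp
    qed
    have 2: "unshuffle_sum ?d (\<lambda>l r. ksign (?d v * wt ?d l + ?d u * wt ?d l) (h l (u # v # r))) ys =
       unshuffle_sum ?d (\<lambda>l r. ksign (?k + (?d u * wt ?d l + ?d v * wt ?d l)) (h l (v # u # r))) ys"
    proof (rule unsh_cong)
      fix l r assume "usplit ?d ys l r"
      then have "l \<in> words V" "r \<in> words V" using usplit_lists xy(2) by blast+
      then show "ksign (?d v * wt ?d l + ?d u * wt ?d l) (h l (u # v # r)) =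
          ksign (?k + (?d u * wt ?d l + ?d v * wt ?d l)) (h l (v # u # r))"
        using vsym_swap[OF bisymD(2)[OF Nil(1)], of l "[]" r u v] uv by (simp add: algebra_simps)
    qed
    \<comment> \<open>The exponents differ by the even number \<open>2 * ?k\<close>.\<close>
    have 3: "unshuffle_sum ?d (\<lambda>l r. ksign (?d v * wt ?d l) (h (u # l) (v # r))) ys =
      unshuffle_sum ?d (\<lambda>l r. ksign (?k + ?d v * (?d u + wt ?d l)) (h (u # l) (v # r))) ys"
      by (intro unsh_cong ksign_parity) auto
    have 4: "unshuffle_sum ?d (\<lambda>l r. ksign (?d u * (?d v + wt ?d l)) (h (v # l) (u # r))) ys =
      unshuffle_sum ?d (\<lambda>l r. ksign (?k + ?d u * wt ?d l) (h (v # l) (u # r))) ys"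
      by (intro unsh_cong ksign_parity) auto
    show ?case
      unfolding append_Nil expand[of u v] expand[of v u] ksign_add unsh_ksign[symmetric] ksign_ksign 1 2 3 4
      by (simp add: add_ac)
  next
    case (Cons x xs)
    then have x: "x \<in> hmg V" by simp
    show ?case
      using Cons.IH[OF bisym_left[OF Cons.prems(1) x]] Cons.IH[OF bisym_right[OF V s Cons.prems(1) x]] Cons.prems(2)
      by (simp add: ksign_add)
  qed
qed

section \<open>The two cofree coalgebras as presented spaces\<close>

lemma cocomm_mon_vsym: "vsym L fscl (cocomm_mon L)"
  unfolding cocomm_mon_def
proof (rule vsymI)
  fix xs ys assume xy: "xs \<in> words L" "ys \<in> words L"
  show "slot_linear L fscl (\<lambda>u. pure (sym_forms L) (xs @ u # ys))"
    unfolding slot_linear_def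
  proof (intro allI ballI ext)
    fix n u v c \<phi> assume "u \<in> cmp L n" "v \<in> cmp L n"
    then show "pure (sym_forms L) (xs @ (u + scl L c v) # ys) \<phi> =
        (pure (sym_forms L) (xs @ u # ys) + fscl c (pure (sym_forms L) (xs @ v # ys))) \<phi>"
      using vsym_slot[of L "(*)" \<phi> xs ys] xy
      by (auto simp: pure_def fscl_def slot_linear_def sym_forms_iff)
  qed
  fix u v assume "u \<in> hmg L" "v \<in> hmg L"
  then show "pure (sym_forms L) (xs @ u # v # ys) =
      ksign (sdeg2 L u * sdeg2 L v) (pure (sym_forms L) (xs @ v # u # ys))"
    using vsym_swap[of L "(*)" _ xs ys u v] xy
    by (auto simp: fun_eq_iff pure_def ksign_apply sym_forms_iff)
qed

lemma cocomm_mon_eval: "\<phi> \<in> sym_forms L \<Longrightarrow> cocomm_mon L vs \<phi> = \<phi> vs"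
  and cocomm_mon_outside: "\<phi> \<notin> sym_forms L \<Longrightarrow> cocomm_mon L vs \<phi> = 0"
  by (simp_all add: cocomm_mon_def pure_def)

lemma cocomm_gens_iff: "vs \<in> cocomm_gens L \<longleftrightarrow> vs \<in> words L \<and> vs \<noteq> []"
  by (simp add: cocomm_gens_def)

lemma vs_cocomm: "vector_space (scl (cocomm L))"
  and subspace_cocomm: "module.subspace (scl (cocomm L)) (cmp (cocomm L) n)"
  and scl_cocomm [simp]: "scl (cocomm L) = fscl"
  unfolding cocomm_def by (simp_all add: vs_presented presented_subspace vector_space_fscl presented_subspace[simplified])

lemma cocomm_mon_cmp: "vs \<in> words L \<Longrightarrow> vs \<noteq> [] \<Longrightarrow> cocomm_mon L vs \<in> cmp (cocomm L) (wt (sdeg2 L) vs + 2)"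
  unfolding cocomm_def cocomm_mon_def by (rule pure_cmp) (simp add: cocomm_gens_iff)

lemma cocomm_univ:
  assumes "graded_space L" "vector_space s" "slot_linear (cocomm L) s ll"
  shows "vsym L s (\<lambda>vs. ll (cocomm_mon L vs))"
  by (rule vsym_comp[OF assms(1) vs_cocomm subspace_cocomm assms(2) _ _ assms(3), where c = 2])
    (simp_all add: cocomm_mon_vsym cocomm_mon_cmp)

lemma presentation_cocomm:
  assumes "graded_space L"
  shows "presentation (sym_forms L) (cocomm_gens L) (\<lambda>vs. wt (sdeg2 L) vs + 2)"
proof
  fix \<phi> n assume "\<phi> \<in> sym_forms L"
  then have "vsym L (*) (\<lambda>l. (if wt (sdeg2 L) l + 2 = n then 1 else 0) * \<phi> l)"
    unfolding sym_forms_iff by (rule vsym_weight[OF assms vector_space_mult, of \<phi> "\<lambda>_ m. if m + 2 = n then 1 else 0"])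
  then show "(\<lambda>g. if wt (sdeg2 L) g + 2 = n then \<phi> g else 0) \<in> sym_forms L"
    unfolding sym_forms_iff by (rule vsym_cong[OF assms]) simp
next
  fix ll assume "slot_linear (presented (sym_forms L) (cocomm_gens L) (\<lambda>vs. wt (sdeg2 L) vs + 2)) (*) ll"
  then show "(\<lambda>g. ll (pure (sym_forms L) g)) \<in> sym_forms L"
    using cocomm_univ[OF assms vector_space_mult] by (simp add: cocomm_def cocomm_mon_def sym_forms_iff)
qed

section \<open>Functions on the monomials of colour o\<close>

definition vso ::
  "('k::field_char_0, 'v::ab_group_add) gvs \<Rightarrow> ('k, 'a::ab_group_add) gvs \<Rightarrow> ('k \<Rightarrow> 'w \<Rightarrow> 'w) \<Rightarrow>
   ('v list \<Rightarrow> 'a list \<Rightarrow> 'w::ab_group_add) \<Rightarrow> bool" where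
  "vso V A s f \<longleftrightarrow> (\<forall>as\<in>words A. vsym V s (\<lambda>vs. f vs as)) \<and> (\<forall>vs\<in>words V. vmult A s (f vs))"

lemma so_forms_iff: "\<phi> \<in> so_forms V A \<longleftrightarrow> vso V A (*) (\<lambda>vs as. \<phi> (vs, as))"
  by (simp add: so_forms_def vso_def vmult_def sym_forms_iff)

lemma so_mon_vso: "vso V A fscl (\<lambda>vs as. so_mon V A (vs, as))"
  unfolding vso_def so_mon_def
proof (intro conjI ballI vsymI vmultI)
  fix as xs ys assume as: "as \<in> words A" and xy: "xs \<in> words V" "ys \<in> words V"
  have f: "vsym V (*) (\<lambda>vs. \<phi> (vs, as))" if "\<phi> \<in> so_forms V A" for \<phi>
    using that as by (simp add: so_forms_iff vso_def)
  show "slot_linear V fscl (\<lambda>u. pure (so_forms V A) (xs @ u # ys, as))"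
    unfolding slot_linear_def
  proof (intro allI ballI ext)
    fix n u v c \<phi> assume "u \<in> cmp V n" "v \<in> cmp V n"
    then show "pure (so_forms V A) (xs @ (u + scl V c v) # ys, as) \<phi> =
        (pure (so_forms V A) (xs @ u # ys, as) + fscl c (pure (so_forms V A) (xs @ v # ys, as))) \<phi>"
      using vsym_slot[OF f, of \<phi> xs ys] xy by (auto simp: pure_def fscl_def slot_linear_def)
  qed
  fix u v assume "u \<in> hmg V" "v \<in> hmg V"
  then show "pure (so_forms V A) (xs @ u # v # ys, as) =
      ksign (sdeg2 V u * sdeg2 V v) (pure (so_forms V A) (xs @ v # u # ys, as))"
    using vsym_swap[OF f, of _ xs ys u v] xy by (auto simp: fun_eq_iff pure_def ksign_apply)
next
  fix vs xs ys assume vs: "vs \<in> words V" and xy: "xs \<in> words A" "ys \<in> words A"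
  have f: "vmult A (*) (\<lambda>as. \<phi> (vs, as))" if "\<phi> \<in> so_forms V A" for \<phi>
    using that vs by (simp add: so_forms_iff vso_def)
  show "slot_linear A fscl (\<lambda>u. pure (so_forms V A) (vs, xs @ u # ys))"
    unfolding slot_linear_def
  proof (intro allI ballI ext)
    fix n u v c \<phi> assume "u \<in> cmp A n" "v \<in> cmp A n"
    then show "pure (so_forms V A) (vs, xs @ (u + scl A c v) # ys) \<phi> =
        (pure (so_forms V A) (vs, xs @ u # ys) + fscl c (pure (so_forms V A) (vs, xs @ v # ys))) \<phi>"
      using vmult_slot[OF f, of \<phi> xs ys] xy by (auto simp: pure_def fscl_def slot_linear_def)
  qed
qed

lemma so_mon_eval: "\<phi> \<in> so_forms V A \<Longrightarrow> so_mon V A g \<phi> = \<phi> g"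
  and so_mon_outside: "\<phi> \<notin> so_forms V A \<Longrightarrow> so_mon V A g \<phi> = 0"
  by (simp_all add: so_mon_def pure_def)

lemma so_gens_iff: "(vs, as) \<in> so_gens V A \<longleftrightarrow> vs \<in> words V \<and> as \<in> words A \<and> (vs \<noteq> [] \<or> as \<noteq> [])"
  by (auto simp: so_gens_def)

lemma vs_So: "vector_space (scl (So V A))"
  and subspace_So: "module.subspace (scl (So V A)) (cmp (So V A) n)"
  and scl_So [simp]: "scl (So V A) = fscl"
  unfolding So_def by (simp_all add: vs_presented presented_subspace vector_space_fscl presented_subspace[simplified])

lemma so_mon_cmp: "(vs, as) \<in> so_gens V A \<Longrightarrow>
    so_mon V A (vs, as) \<in> cmp (So V A) (wt (sdeg2 V) vs + wt (sdeg1 A) as + 1)"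
  unfolding So_def so_mon_def
  using pure_cmp[of "(vs, as)" "so_gens V A" "so_forms V A" "\<lambda>(vs, as). wt (sdeg2 V) vs + wt (sdeg1 A) as + 1"]
  by simp

lemma so_univ:
  assumes "graded_space V" "graded_space A" "vector_space s" "slot_linear (So V A) s ll"
  shows "vso V A s (\<lambda>vs as. ll (so_mon V A (vs, as)))"
  unfolding vso_def
proof (intro conjI ballI)
  fix as assume as: "as \<in> words A"
  show "vsym V s (\<lambda>vs. ll (so_mon V A (vs, as)))"
  proof (rule vsym_comp[OF assms(1) vs_So subspace_So assms(3) _ _ assms(4)])
    show "vsym V (scl (So V A)) (\<lambda>vs. so_mon V A (vs, as))"
      using so_mon_vso[of V A] as by (simp add: vso_def)
    show "so_mon V A (l, as) \<in> cmp (So V A) (wt (sdeg2 V) l + (wt (sdeg1 A) as + 1))" if "l \<in> words V" "l \<noteq> []" for l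
      using so_mon_cmp[of l as V A] that as by (simp add: so_gens_iff add.assoc)
  qed
next
  fix vs assume vs: "vs \<in> words V"
  show "vmult A s (\<lambda>as. ll (so_mon V A (vs, as)))"
  proof (rule vmult_comp[OF assms(2) vs_So subspace_So _ _ assms(4)])
    show "vmult A (scl (So V A)) (\<lambda>as. so_mon V A (vs, as))"
      using so_mon_vso[of V A] vs by (simp add: vso_def)
    show "so_mon V A (vs, l) \<in> cmp (So V A) (wt (\<lambda>x. deg A x - 1) l + (wt (sdeg2 V) vs + 1))" if "l \<in> words A" "l \<noteq> []" for l
      using so_mon_cmp[of vs l V A] that vs by (simp add: so_gens_iff sdeg1_eq algebra_simps)
  qed
qed

lemma vso_weight:
  assumes "graded_space V" "graded_space A" "vector_space s" "vso V A s f"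
  shows "vso V A s (\<lambda>vs as. s (w (length vs) (wt (sdeg2 V) vs) (length as) (wt (sdeg1 A) as)) (f vs as))"
  unfolding vso_def
proof (intro conjI ballI)
  fix as assume "as \<in> words A"
  then show "vsym V s (\<lambda>vs. s (w (length vs) (wt (sdeg2 V) vs) (length as) (wt (sdeg1 A) as)) (f vs as))"
    using assms(4) by (intro vsym_weight[OF assms(1,3), of _ "\<lambda>l m. w l m (length as) (wt (sdeg1 A) as)"]) (simp add: vso_def)
next
  fix vs assume "vs \<in> words V"
  then show "vmult A s (\<lambda>as. s (w (length vs) (wt (sdeg2 V) vs) (length as) (wt (sdeg1 A) as)) (f vs as))"
    using assms(4) unfolding sdeg1_eq[of A]
    by (intro vmult_weight[OF assms(2,3), of _ "w (length vs) (wt (sdeg2 V) vs)"]) (simp add: vso_def)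
qed

lemma vso_cong:
  assumes "graded_space V" "graded_space A" "vso V A s f"
    "\<And>vs as. (vs, as) \<in> so_gens V A \<Longrightarrow> f vs as = g vs as"
  shows "vso V A s g"
  unfolding vso_def
proof (intro conjI ballI)
  fix as assume as: "as \<in> words A"
  have f: "vsym V s (\<lambda>vs. f vs as)" using assms(3) as by (simp add: vso_def)
  show "vsym V s (\<lambda>vs. g vs as)"
  proof (rule vsym_cong[OF assms(1) f])
    fix l assume "l \<in> words V" "l \<noteq> []"
    then show "f l as = g l as" using as by (intro assms(4)) (simp add: so_gens_iff)
  qed
next
  fix vs assume vs: "vs \<in> words V"
  have f: "vmult A s (f vs)" using assms(3) vs by (simp add: vso_def)
  show "vmult A s (g vs)"
  proof (rule vmult_cong[OF assms(2) f])
    fix l assume "l \<in> words A" "l \<noteq> []"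
    then show "f vs l = g vs l" using vs by (intro assms(4)) (simp add: so_gens_iff)
  qed
qed

lemma presentation_So:
  assumes "graded_space V" "graded_space A"
  shows "presentation (so_forms V A) (so_gens V A) (\<lambda>(vs, as). wt (sdeg2 V) vs + wt (sdeg1 A) as + 1)"
proof
  fix \<phi> n assume "\<phi> \<in> so_forms V A"
  then have "vso V A (*) (\<lambda>vs as. (if wt (sdeg2 V) vs + wt (sdeg1 A) as + 1 = n then 1 else 0) * \<phi> (vs, as))"
    unfolding so_forms_iff
    by (rule vso_weight[OF assms vector_space_mult, of _ "\<lambda>_ k _ m. if k + m + 1 = n then 1 else 0"])
  then show "(\<lambda>g. if (case g of (vs, as) \<Rightarrow> wt (sdeg2 V) vs + wt (sdeg1 A) as + 1) = n then \<phi> g else 0) \<in> so_forms V A"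
    unfolding so_forms_iff by (rule vso_cong[OF assms]) simp
next
  fix ll assume "slot_linear (presented (so_forms V A) (so_gens V A)
    (\<lambda>(vs, as). wt (sdeg2 V) vs + wt (sdeg1 A) as + 1)) (*) ll"
  then show "(\<lambda>g. ll (pure (so_forms V A) g)) \<in> so_forms V A"
    using so_univ[OF assms vector_space_mult] by (simp add: So_def so_mon_def so_forms_iff)
qed

lemma graded_cocomm: "graded_space L \<Longrightarrow> graded_space (cocomm L)"
  unfolding cocomm_def by (rule presentation.graded_X[OF presentation_cocomm])

lemma graded_So: "graded_space V \<Longrightarrow> graded_space A \<Longrightarrow> graded_space (So V A)"
  unfolding So_def by (rule presentation.graded_X[OF presentation_So])

lemma cocomm_expand:
  "graded_space L \<Longrightarrow> slot_linear (cocomm L) (*) ll \<Longrightarrow> x \<in> cmp (cocomm L) n \<Longrightarrow> ll x = x (\<lambda>g. ll (cocomm_mon L g))"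
  unfolding cocomm_def cocomm_mon_def by (rule presentation.slot_expand[OF presentation_cocomm])

lemma so_expand:
  "graded_space V \<Longrightarrow> graded_space A \<Longrightarrow> slot_linear (So V A) (*) ll \<Longrightarrow> x \<in> cmp (So V A) n \<Longrightarrow>
   ll x = x (\<lambda>g. ll (so_mon V A g))"
  unfolding So_def so_mon_def by (rule presentation.slot_expand[OF presentation_So])

text \<open>A word with a zero letter has a meaningless weight, but then the monomial is 0 and lies
  in every component. So the degree has to be computed only for words without zero letters.\<close>

lemma cocomm_mon_cmp_deg:
  assumes "graded_space L" "vs \<in> words L" "vs \<noteq> []" "0 \<notin> set vs \<Longrightarrow> wt (sdeg2 L) vs + 2 = n"
  shows "cocomm_mon L vs \<in> cmp (cocomm L) n"
proof (cases "0 \<in> set vs")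
  case True
  then show ?thesis
    using vmult_zero_letter[OF assms(1) vector_space_fscl vsym_vmult[OF cocomm_mon_vsym] assms(2)]
      cmp_0[OF graded_cocomm[OF assms(1)]] by simp
qed (use cocomm_mon_cmp[OF assms(2,3)] assms(4) in auto)

lemma so_mon_zero_letter:
  assumes "graded_space V" "graded_space A" "(vs, as) \<in> so_gens V A" "0 \<in> set vs \<or> 0 \<in> set as"
  shows "so_mon V A (vs, as) = 0"
  using vmult_zero_letter[OF assms(1) vector_space_fscl vsym_vmult, of "\<lambda>vs. so_mon V A (vs, as)" vs]
    vmult_zero_letter[OF assms(2) vector_space_fscl, of "\<lambda>as. so_mon V A (vs, as)" as]
    so_mon_vso[of V A] assms(3,4) by (auto simp: vso_def so_gens_iff)

lemma so_mon_cmp_deg: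
  assumes "graded_space V" "graded_space A" "(vs, as) \<in> so_gens V A"
    "0 \<notin> set vs \<Longrightarrow> 0 \<notin> set as \<Longrightarrow> wt (sdeg2 V) vs + wt (sdeg1 A) as + 1 = n"
  shows "so_mon V A (vs, as) \<in> cmp (So V A) n"
proof (cases "0 \<in> set vs \<or> 0 \<in> set as")
  case True
  then show ?thesis
    using so_mon_zero_letter[OF assms(1-3)] cmp_0[OF graded_So[OF assms(1,2)]] by simp
qed (use so_mon_cmp[OF assms(3)] assms(4) in auto)

section \<open>Evaluation on families of forms\<close>

lemma vsym_append:
  assumes "vsym V s f" "w \<in> words V" "w' \<in> words V"
  shows "vsym V s (\<lambda>l. f (w @ l @ w'))"
proof (rule vsymI)
  fix xs ys assume xy: "xs \<in> words V" "ys \<in> words V"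
  then have wxy: "w @ xs \<in> words V" "ys @ w' \<in> words V" using assms by auto
  show "slot_linear V s (\<lambda>u. f (w @ (xs @ u # ys) @ w'))"
    using vsym_slot[OF assms(1) wxy] by simp
  fix u v assume "u \<in> hmg V" "v \<in> hmg V"
  from vsym_swap[OF assms(1) wxy this]
  show "f (w @ (xs @ u # v # ys) @ w') = ksign (sdeg2 V u * sdeg2 V v) (f (w @ (xs @ v # u # ys) @ w'))"
    by (simp only: append_assoc append_Cons)
qed

text \<open>A fixed element evaluated on a family of forms depends on the parameter in the way the
  forms do on generators. With \<open>ev_vmult\<close> and \<open>ev_vsym\<close> this makes
  iterated evaluation \<open>x (\<lambda>l. y ...)\<close> meaningful: the inner value is again a
  form in \<open>l\<close>.\<close>

lemma ev_slot:
  assumes y: "y \<in> tot (presented \<Phi> G d)"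
    and f: "\<And>u. u \<in> hmg V \<Longrightarrow> f u \<in> \<Phi>" "\<And>g. g \<in> G \<Longrightarrow> slot_linear V (*) (\<lambda>u. f u g)"
    and V: "graded_space V"
  shows "slot_linear V (*) (\<lambda>u. y (f u))"
  unfolding slot_linear_def
proof (intro allI ballI)
  fix n u v c assume uv: "u \<in> cmp V n" "v \<in> cmp V n"
  then have *: "u + scl V c v \<in> cmp V n" using cmp_add[OF V] cmp_scale[OF V] by blast
  show "y (f (u + scl V c v)) = y (f u) + c * y (f v)"
  proof (rule ev_linear[OF y])
    show "f u \<in> \<Phi>" "f v \<in> \<Phi>" "f (u + scl V c v) \<in> \<Phi>" by (rule f(1)[OF cmp_hmg[OF uv(1)]] f(1)[OF cmp_hmg[OF uv(2)]] f(1)[OF cmp_hmg[OF *]])+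
    show "f (u + scl V c v) g = f u g + c * f v g" if "g \<in> G" for g
      using f(2)[OF that] uv unfolding slot_linear_def by blast
  qed
qed

lemma ev_vmult:
  assumes y: "y \<in> tot (presented \<Phi> G d)"
    and f: "\<And>l. l \<in> words V \<Longrightarrow> f l \<in> \<Phi>" "\<And>g. g \<in> G \<Longrightarrow> vmult V (*) (\<lambda>l. f l g)"
    and V: "graded_space V"
  shows "vmult V (*) (\<lambda>l. y (f l))"
proof (rule vmultI)
  fix xs ys assume xy: "xs \<in> words V" "ys \<in> words V"
  show "slot_linear V (*) (\<lambda>u. y (f (xs @ u # ys)))"
  proof (rule ev_slot[OF y _ _ V])
    show "f (xs @ u # ys) \<in> \<Phi>" if "u \<in> hmg V" for u using that xy by (intro f(1)) simp
    show "slot_linear V (*) (\<lambda>u. f (xs @ u # ys) g)" if "g \<in> G" for g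
      by (rule vmult_slot[OF f(2)[OF that] xy])
  qed
qed

lemma ev_vsym:
  assumes y: "y \<in> tot (presented \<Phi> G d)"
    and f: "\<And>l. l \<in> words V \<Longrightarrow> f l \<in> \<Phi>" "\<And>g. g \<in> G \<Longrightarrow> vsym V (*) (\<lambda>l. f l g)"
    and V: "graded_space V"
  shows "vsym V (*) (\<lambda>l. y (f l))"
proof (rule vsymI)
  fix xs ys assume xy: "xs \<in> words V" "ys \<in> words V"
  show "slot_linear V (*) (\<lambda>u. y (f (xs @ u # ys)))"
    by (rule vmult_slot[OF ev_vmult[OF y f(1) vsym_vmult[OF f(2)] V] xy])
  fix u v assume uv: "u \<in> hmg V" "v \<in> hmg V"
  let ?c = "if even (sdeg2 V u * sdeg2 V v) then 1 else - 1 :: 'b"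
  have w: "xs @ u # v # ys \<in> words V" "xs @ v # u # ys \<in> words V" using xy uv by auto
  \<comment> \<open>The sign \<open>?c\<close> is written as \<open>1 + (?c - 1)\<close> to fit the
    shape \<open>\<phi> + c * \<psi>\<close> in \<open>ev_linear\<close>.\<close>
  have "y (f (xs @ u # v # ys)) = y (f (xs @ v # u # ys)) + (?c - 1) * y (f (xs @ v # u # ys))"
  proof (rule ev_linear[OF y])
    show "f (xs @ v # u # ys) \<in> \<Phi>" "f (xs @ v # u # ys) \<in> \<Phi>" "f (xs @ u # v # ys) \<in> \<Phi>"
      by (rule f(1)[OF w(1)] f(1)[OF w(2)])+
    show "f (xs @ u # v # ys) g = f (xs @ v # u # ys) g + (?c - 1) * f (xs @ v # u # ys) g" if "g \<in> G" for g
      using vsym_swap[OF f(2)[OF that] xy uv] by (simp add: ksign_def)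
  qed
  then show "y (f (xs @ u # v # ys)) = ksign (sdeg2 V u * sdeg2 V v) (y (f (xs @ v # u # ys)))"
    by (simp add: ksign_def)
qed

lemma linear_map_tot:
  assumes "vector_space (scl Y)" "linear_map (presented \<Phi> G d) (scl Y) F"
    "\<And>g. g \<in> G \<Longrightarrow> F (pure \<Phi> g) \<in> tot Y" "t \<in> tot (presented \<Phi> G d)"
  shows "F t \<in> tot Y"
proof -
  let ?X = "presented \<Phi> G d"
  note v = vs_presented[of \<Phi> G d]
  have "t \<in> tot ?X \<and> F t \<in> tot Y" using assms(4)
  proof (induction rule: tot_induct)
    case zero
    have "0 \<in> tot ?X \<and> F 0 \<in> tot Y"
      using linear_map_0[OF v assms(1,2)] tot_0[OF assms(1)] tot_0[OF v] by simp
    then show ?case .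
  next
    case (step g c t)
    note g = pure_tot[OF step(1), of \<Phi> d]
    have "F (t + scl ?X c (pure \<Phi> g)) = F t + scl Y c (F (pure \<Phi> g))"
      using assms(2) step g unfolding linear_map_def by blast
    moreover have "t + scl ?X c (pure \<Phi> g) \<in> tot ?X" using step g tot_add[OF v] tot_scale[OF v] by blast
    ultimately have "fscl c (pure \<Phi> g) + t \<in> tot ?X \<and> F (fscl c (pure \<Phi> g) + t) \<in> tot Y"
      using step assms(3)[OF step(1)] tot_add[OF assms(1)] tot_scale[OF assms(1)] by (simp add: add.commute)
    then show ?case .
  qed
  then show ?thesis ..
qed

lemma bilinear_0:
  assumes "graded_space X" "\<beta> \<in> bilinear_forms X X" "y \<in> hmg X"
  shows "\<beta> (0, y) = 0" "\<beta> (y, 0) = 0"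
  using slot_linear_0[OF assms(1) vector_space_mult bilinear_left[OF assms(2,3)]]
    slot_linear_0[OF assms(1) vector_space_mult bilinear_right[OF assms(2,3)]] by auto

section \<open>Structure maps of the cofree cocommutative coalgebra\<close>

lemma vs_tensor: "vector_space (scl (tensor X Y))" and scl_tensor [simp]: "scl (tensor X Y) = fscl"
  by (simp_all add: tensor_def vector_space_fscl)

lemma tens_closed:
  shows tens_tot_0: "0 \<in> tot (tensor X X)"
    and tens_tot_ksign: "t \<in> tot (tensor X X) \<Longrightarrow> ksign n t \<in> tot (tensor X X)"
    and tens_additive_on: "additive_on (tot (tensor X X)) id"
  using tot_0[OF vs_tensor] tot_uminus[OF vs_tensor] tot_add[OF vs_tensor]
  by (auto simp: ksign_def additive_on_def)

text \<open>The empty monomial is not an element of the (non-counital) coalgebra; it is replaced by 0.\<close>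

definition mon0 :: "('k::field_char_0, 'v::ab_group_add) gvs \<Rightarrow> 'v list \<Rightarrow> ('v list, 'k) functional" where
  "mon0 L l = (if l = [] then 0 else cocomm_mon L l)"

lemma mon0_hmg: "graded_space L \<Longrightarrow> l \<in> words L \<Longrightarrow> mon0 L l \<in> hmg (cocomm L)"
  using cocomm_mon_cmp[of l L] hmg_0[OF graded_cocomm] cmp_hmg by (auto simp: mon0_def)

lemma mon0_univ:
  assumes "graded_space L" "slot_linear (cocomm L) (*) ll"
  shows "vsym L (*) (\<lambda>l. ll (mon0 L l))"
  by (rule vsym_cong[OF assms(1) cocomm_univ[OF assms(1) vector_space_mult assms(2)]]) (simp add: mon0_def)

lemma mon0_bisym:
  assumes "graded_space L" "\<beta> \<in> bilinear_forms (cocomm L) (cocomm L)"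
  shows "bisym L (*) (\<lambda>l r. \<beta> (mon0 L l, mon0 L r))"
proof (rule bisymI)
  fix r assume "r \<in> words L"
  then have r: "mon0 L r \<in> hmg (cocomm L)" by (rule mon0_hmg[OF assms(1)])
  show "vsym L (*) (\<lambda>l. \<beta> (mon0 L l, mon0 L r))"
    by (rule mon0_univ[OF assms(1) bilinear_left[OF assms(2) r]])
  show "vsym L (*) (\<lambda>l. \<beta> (mon0 L r, mon0 L l))"
    by (rule mon0_univ[OF assms(1) bilinear_right[OF assms(2) r]])
qed

text \<open>The transpose of the comultiplication on bilinear forms. Owing to \<open>mon0\<close>,
  unshuffles with an empty part contribute 0.\<close>

definition cocomm_pull ::
  "('k::field_char_0, 'v::ab_group_add) gvs \<Rightarrow> (('v list, 'k) functional \<times> ('v list, 'k) functional \<Rightarrow> 'k) \<Rightarrow>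
   'v list \<Rightarrow> 'k" where
  "cocomm_pull L \<beta> = unshuffle_sum (sdeg2 L) (\<lambda>l r. \<beta> (mon0 L l, mon0 L r))"

lemma cocomm_pull_form:
  "graded_space L \<Longrightarrow> \<beta> \<in> bilinear_forms (cocomm L) (cocomm L) \<Longrightarrow> cocomm_pull L \<beta> \<in> sym_forms L"
  unfolding cocomm_pull_def sym_forms_iff
  by (rule vsym_unshuffle[OF _ vector_space_mult mon0_bisym])

lemma cocomm_Delta:
  assumes L: "graded_space L"
  shows "linear_map (cocomm L) fscl (cocomm_Delta L)"
    and "\<And>t. t \<in> tot (cocomm L) \<Longrightarrow> cocomm_Delta L t \<in> tot (tensor (cocomm L) (cocomm L))"
    and "\<And>t \<beta>. t \<in> tot (cocomm L) \<Longrightarrow> \<beta> \<in> bilinear_forms (cocomm L) (cocomm L) \<Longrightarrow>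
      cocomm_Delta L t \<beta> = t (cocomm_pull L \<beta>)"
proof -
  let ?B = "bilinear_forms (cocomm L) (cocomm L)"
  let ?h = "\<lambda>l r. if l = [] \<or> r = [] then 0 else tens (cocomm L) (cocomm_mon L l) (cocomm_mon L r)"
  let ?f = "unshuffle_sum (sdeg2 L) ?h"
  have ev: "?f vs \<beta> = cocomm_pull L \<beta> vs" if "\<beta> \<in> ?B" "vs \<in> words L" for vs \<beta>
    unfolding unsh_apply cocomm_pull_def
  proof (rule unsh_cong)
    fix l r assume "usplit (sdeg2 L) vs l r"
    then have "l \<in> words L" "r \<in> words L" using usplit_lists that(2) by blast+
    then show "?h l r \<beta> = \<beta> (mon0 L l, mon0 L r)"
      using bilinear_0[OF graded_cocomm[OF L] that(1)] mon0_hmg[OF L] hmg_0[OF graded_cocomm[OF L]]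
        tens_eval[OF that(1)] by (auto simp: mon0_def)
  qed
  have 1: "\<forall>\<beta>\<in>?B. (\<lambda>vs. ?f vs \<beta>) \<in> sym_forms L"
  proof
    fix \<beta> assume b: "\<beta> \<in> ?B"
    show "(\<lambda>vs. ?f vs \<beta>) \<in> sym_forms L"
      unfolding sym_forms_iff
      by (rule vsym_cong[OF L cocomm_pull_form[OF L b, unfolded sym_forms_iff]]) (simp add: ev[OF b])
  qed
  have 2: "\<forall>vs\<in>cocomm_gens L. \<forall>\<beta>. \<beta> \<notin> ?B \<longrightarrow> ?f vs \<beta> = 0"
    by (auto simp: unsh_apply tens_outside intro!: unsh_zeroI)
  note l = lin_ext_fun[where f = ?f and \<Phi> = "sym_forms L" and \<Phi>' = ?B and F = "cocomm_Delta L"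
      and d = "\<lambda>vs. wt (sdeg2 L) vs + 2" and G = "cocomm_gens L", folded cocomm_def cocomm_mon_def, OF 1 2 cocomm_Delta_def]
  show "linear_map (cocomm L) fscl (cocomm_Delta L)" by (rule l(1))
  show "cocomm_Delta L t \<in> tot (tensor (cocomm L) (cocomm L))" if "t \<in> tot (cocomm L)" for t
  proof (rule linear_map_tot[OF vs_tensor, where \<Phi> = "sym_forms L" and G = "cocomm_gens L" and
        d = "\<lambda>vs. wt (sdeg2 L) vs + 2", folded cocomm_def cocomm_mon_def, unfolded scl_tensor, OF l(1) _ that])
    fix vs assume vs: "vs \<in> cocomm_gens L"
    have "?f vs \<in> tot (tensor (cocomm L) (cocomm L))"
    proof (rule unsh_additive_on[OF tens_additive_on, THEN conjunct1])
      fix l r assume "usplit (sdeg2 L) vs l r"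
      then have "l \<in> words L" "r \<in> words L" using usplit_lists[of "sdeg2 L" vs l r "hmg L"] vs
        by (simp_all add: cocomm_gens_iff)
      then show "?h l r \<in> tot (tensor (cocomm L) (cocomm L))"
        using tens_tot[OF cmp_hmg[OF cocomm_mon_cmp] cmp_hmg[OF cocomm_mon_cmp], of l L r] by (simp add: tens_tot_0)
    qed
    then show "cocomm_Delta L (cocomm_mon L vs) \<in> tot (tensor (cocomm L) (cocomm L))"
      using l(2)[OF vs] by simp
  qed
  show "cocomm_Delta L t \<beta> = t (cocomm_pull L \<beta>)" if "t \<in> tot (cocomm L)" "\<beta> \<in> ?B" for t \<beta>
  proof -
    have "cocomm_Delta L t \<beta> = t (\<lambda>vs. ?f vs \<beta>)" by (rule l(3)[OF that])
    also have "\<dots> = t (cocomm_pull L \<beta>)"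
      by (rule ev_cong[OF that(1)[unfolded cocomm_def]])
        (use that 1 cocomm_pull_form[OF L that(2)] ev[OF that(2)] in \<open>auto simp: cocomm_gens_iff\<close>)
    finally show ?thesis .
  qed
qed

lemma cocomm_proj:
  assumes L: "graded_space L"
  shows "cocomm_proj L \<in> Hom (cocomm L) L 0"
    and "\<And>vs. vs \<in> cocomm_gens L \<Longrightarrow> cocomm_proj L (cocomm_mon L vs) = (case vs of [v] \<Rightarrow> v | _ \<Rightarrow> 0)"
proof -
  let ?f = "\<lambda>vs :: 'b list. case vs of [v] \<Rightarrow> v | _ \<Rightarrow> 0"
  have 1: "\<forall>\<mu>. Vector_Spaces.linear (scl L) (*) \<mu> \<longrightarrow> (\<lambda>g. \<mu> (?f g)) \<in> sym_forms L"
  proof (intro allI impI)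
    fix \<mu> :: "'b \<Rightarrow> 'a" assume "Vector_Spaces.linear (scl L) (*) \<mu>"
    then interpret Vector_Spaces.linear "scl L" "(*)" \<mu> .
    have e: "?f (xs @ u # ys) = (if xs = [] \<and> ys = [] then u else 0)" for xs u ys
      by (auto split: list.splits simp: Cons_eq_append_conv append_eq_Cons_conv)
    show "(\<lambda>g. \<mu> (?f g)) \<in> sym_forms L"
      unfolding sym_forms_iff
    proof (rule vsymI)
      fix xs ys show "slot_linear L (*) (\<lambda>u. \<mu> (?f (xs @ u # ys)))"
        unfolding e by (cases "xs = [] \<and> ys = []") (simp_all only: if_True if_False, simp_all add: slot_linear_def add scale)
      fix u v show "\<mu> (?f (xs @ u # v # ys)) = ksign (sdeg2 L u * sdeg2 L v) (\<mu> (?f (xs @ v # u # ys)))"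
        unfolding e by simp
    qed
  qed
  note l = lin_ext_vec[OF graded_vs[OF L] 1, where F = "cocomm_proj L" and
      d = "\<lambda>vs. wt (sdeg2 L) vs + 2" and G = "cocomm_gens L", folded cocomm_def cocomm_mon_def, OF cocomm_proj_def]
  show 2: "\<And>vs. vs \<in> cocomm_gens L \<Longrightarrow> cocomm_proj L (cocomm_mon L vs) = ?f vs"
    by (rule l(2))
  show "cocomm_proj L \<in> Hom (cocomm L) L 0"
    unfolding cocomm_def
  proof (rule HomI[OF graded_vs[OF L] graded_subspace[OF L]])
    show "linear_map (presented (sym_forms L) (cocomm_gens L) (\<lambda>vs. wt (sdeg2 L) vs + 2)) (scl L) (cocomm_proj L)"
      using l(1) by (simp add: cocomm_def)
    fix vs assume vs: "vs \<in> cocomm_gens L"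
    have "?f vs \<in> cmp L (wt (sdeg2 L) vs + 2 + 0)"
      using vs cmp_0[OF L] hmg_cmp[OF L] by (auto simp: cocomm_gens_iff sdeg2_def split: list.splits)
    then show "cocomm_proj L (pure (sym_forms L) vs) \<in> cmp L (wt (sdeg2 L) vs + 2 + 0)"
      using 2[OF vs] by (simp add: cocomm_mon_def)
  qed
qed

text \<open>Every letter is free to go left or right, which gives the power of 2; reassembling the
  word undoes the Koszul sign of the unshuffle.\<close>

lemma unsh_concat:
  assumes "vsym L (*) f" "xs \<in> words L"
  shows "unshuffle_sum (sdeg2 L) (\<lambda>l r. f (l @ r)) xs = 2 ^ length xs * f xs"
proof -
  have "\<forall>x\<in>set xs. x \<in> hmg L" using assms(2) by (simp add: in_lists_conv_set)
  then show ?thesis using assms(1)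
  proof (induction xs arbitrary: f)
    case (Cons x xs)
    then have xs: "xs \<in> words L" "x \<in> hmg L" by (simp_all add: in_lists_conv_set)
    have "unshuffle_sum (sdeg2 L) (\<lambda>l r. ksign (sdeg2 L x * wt (sdeg2 L) l) (f (l @ x # r))) xs =
       unshuffle_sum (sdeg2 L) (\<lambda>l r. f (x # l @ r)) xs"
    proof (rule unsh_cong)
      fix l r assume "usplit (sdeg2 L) xs l r"
      then have "l \<in> words L" "r \<in> words L" using usplit_lists xs by blast+
      then show "ksign (sdeg2 L x * wt (sdeg2 L) l) (f (l @ x # r)) = f (x # l @ r)"
        using vsym_move[OF _ _ xs(2) Cons.prems(2), of l r] by (simp add: ksign_def)
    qed
    then show ?case
      using Cons.IH[OF _ vsym_Cons[OF Cons.prems(2) xs(2)]] Cons.prems(1) by simp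
  qed simp
qed

text \<open>The product of the symmetric algebra: composed with the coproduct it multiplies monomials of
  length \<open>n\<close> by \<open>2^n - 2\<close>, which only vanishes for \<open>n = 1\<close>.\<close>

lemma cocomm_product_form:
  assumes L: "graded_space L" and f: "\<phi> \<in> sym_forms L"
  shows "(\<lambda>(x, y). x (\<lambda>l. y (\<lambda>r. \<phi> (l @ r)))) \<in> bilinear_forms (cocomm L) (cocomm L)"
proof -
  have f': "vsym L (*) \<phi>" using f by (simp add: sym_forms_iff)
  have 1: "(\<lambda>r. \<phi> (l @ r)) \<in> sym_forms L" "(\<lambda>r. \<phi> (r @ l)) \<in> sym_forms L" if "l \<in> words L" for l
    using vsym_append[OF f' that, of "[]"] vsym_append[OF f' _ that, of "[]"] by (simp_all add: sym_forms_iff)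
  have 2: "(\<lambda>l. y (\<lambda>r. \<phi> (l @ r))) \<in> sym_forms L" if "y \<in> tot (cocomm L)" for y
    unfolding sym_forms_iff
  proof (rule ev_vsym[OF that[unfolded cocomm_def] _ _ L, where f = "\<lambda>l r. \<phi> (l @ r)"])
    show "(\<lambda>r. \<phi> (l @ r)) \<in> sym_forms L" if "l \<in> words L" for l by (rule 1(1)[OF that])
    show "vsym L (*) (\<lambda>l. \<phi> (l @ g))" if "g \<in> cocomm_gens L" for g
      using 1(2)[of g] that by (simp add: sym_forms_iff cocomm_gens_iff)
  qed
  note tot = hmg_tot[OF vs_cocomm] tot_add[OF vs_cocomm] tot_scale[OF vs_cocomm]
  have 3: "slot_linear (cocomm L) (*) (\<lambda>y. x (\<lambda>l. y (\<lambda>r. \<phi> (l @ r))))" if x: "x \<in> tot (cocomm L)" for x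
    unfolding slot_linear_def
  proof (intro allI ballI)
    fix n u v c assume "u \<in> cmp (cocomm L) n" "v \<in> cmp (cocomm L) n"
    then have uv: "u \<in> tot (cocomm L)" "v \<in> tot (cocomm L)" by (auto intro: tot(1)[OF cmp_hmg])
    have w: "u + scl (cocomm L) c v \<in> tot (cocomm L)" by (rule tot(2)[OF uv(1) tot(3)[OF uv(2)]])
    show "x (\<lambda>l. (u + scl (cocomm L) c v) (\<lambda>r. \<phi> (l @ r))) = x (\<lambda>l. u (\<lambda>r. \<phi> (l @ r))) + c * x (\<lambda>l. v (\<lambda>r. \<phi> (l @ r)))"
      by (rule ev_linear[OF x[unfolded cocomm_def] 2[OF uv(1)] 2[OF uv(2)] 2[OF w]]) (simp add: fscl_def)
  qed
  have 4: "slot_linear (cocomm L) (*) (\<lambda>x. x (\<lambda>l. y (\<lambda>r. \<phi> (l @ r))))" for y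
    by (simp add: slot_linear_def fscl_def)
  show ?thesis unfolding bilinear_forms_def
    by (simp only: mem_Collect_eq prod.case) (intro conjI ballI 3 4 tot(1))
qed

text \<open>A form splits into its restriction to words of length one, which is seen by the
  projection to cogenerators, and the rest. The rest is the pullback along the comultiplication of a
  rescaled product form, hence vanishes on a primitive element.\<close>

lemma cocomm_primitive:
  assumes L: "graded_space L" and t: "t \<in> cmp (cocomm L) n" "cocomm_Delta L t = 0" "cocomm_proj L t = 0"
  shows "t = 0"
proof
  fix \<phi>
  have tt: "t \<in> tot (cocomm L)" by (rule hmg_tot[OF vs_cocomm cmp_hmg[OF t(1)]])
  note tt' = tt[unfolded cocomm_def]
  show "t \<phi> = 0 \<phi>"
  proof (cases "\<phi> \<in> sym_forms L")
    case False
    then show ?thesis using ev_outside[OF tt'] by simp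
  next
    case True
    then have f: "vsym L (*) \<phi>" by (simp add: sym_forms_iff)
    have w: "(\<lambda>l. c (length l) * \<phi> l) \<in> sym_forms L" for c :: "nat \<Rightarrow> 'a"
      using vsym_weight[OF L vector_space_mult f, of "\<lambda>k _. c k"] by (simp add: sym_forms_iff)
    let ?one = "\<lambda>l. (if length l = 1 then 1 else 0) * \<phi> l"
    let ?rest = "\<lambda>l. (if length l = 1 then 0 else 1) * \<phi> l"
    \<comment> \<open>The divisor \<open>2 ^ n - 2\<close> compensates the factor produced by
      unshuffling and multiplying again. Words of length one are left out because the factor is 0
      there.\<close>
    define \<chi> where "\<chi> = (\<lambda>l. (if length l = 1 then 0 else 1 / (2 ^ length l - 2)) * \<phi> l)"
    have \<chi>: "\<chi> \<in> sym_forms L" "vsym L (*) \<chi>"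
      using w[of "\<lambda>n. if n = 1 then 0 else 1 / (2 ^ n - 2)"] by (simp_all add: \<chi>_def sym_forms_iff)
    let ?\<beta> = "\<lambda>(x :: ('b list, 'a) functional, y). x (\<lambda>l. y (\<lambda>r. \<chi> (l @ r)))"
    have b: "?\<beta> \<in> bilinear_forms (cocomm L) (cocomm L)" by (rule cocomm_product_form[OF L \<chi>(1)])
    have "t (cocomm_pull L ?\<beta>) = 0" using cocomm_Delta(3)[OF L tt b] t(2) by simp
    moreover have "t (cocomm_pull L ?\<beta>) = t ?rest"
    proof (rule ev_cong[OF tt' cocomm_pull_form[OF L b] w])
      fix vs assume "vs \<in> cocomm_gens L"
      then have vs: "vs \<in> words L" "vs \<noteq> []" by (auto simp: cocomm_gens_iff)
      have m: "?\<beta> (mon0 L l, mon0 L r) = (if l = [] \<or> r = [] then 0 else \<chi> (l @ r))" if "l \<in> words L" "r \<in> words L" for l r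
      proof -
        have c: "vsym L (*) (\<lambda>r. \<chi> (l @ r))" "vsym L (*) (\<lambda>l. \<chi> (l @ r))"
          using vsym_append[OF \<chi>(2) that(1), of "[]"] vsym_append[OF \<chi>(2) _ that(2), of "[]"] by simp_all
        have "vsym L (*) (\<lambda>l. mon0 L r (\<lambda>r. \<chi> (l @ r)))"
        proof (rule ev_vsym[OF _ _ _ L, where f = "\<lambda>l r. \<chi> (l @ r)"])
          show "mon0 L r \<in> tot (presented (sym_forms L) (cocomm_gens L) (\<lambda>vs. wt (sdeg2 L) vs + 2))"
            using hmg_tot[OF vs_cocomm mon0_hmg[OF L that(2)]] by (simp add: cocomm_def)
          show "(\<lambda>r. \<chi> (l @ r)) \<in> sym_forms L" if "l \<in> words L" for l
            using vsym_append[OF \<chi>(2) that, of "[]"] by (simp add: sym_forms_iff)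
          show "vsym L (*) (\<lambda>l. \<chi> (l @ g))" if "g \<in> cocomm_gens L" for g
            using vsym_append[OF \<chi>(2) _ , of "[]" g] that by (simp add: cocomm_gens_iff)
        qed
        then show ?thesis using c by (simp add: mon0_def cocomm_mon_eval sym_forms_iff split: if_splits)
      qed
      have "cocomm_pull L ?\<beta> vs = unshuffle_sum (sdeg2 L) (\<lambda>l r. if l = [] \<or> r = [] then 0 else \<chi> (l @ r)) vs"
        unfolding cocomm_pull_def
      proof (rule unsh_cong)
        fix l r assume "usplit (sdeg2 L) vs l r"
        from usplit_lists[OF this vs(1)]
        show "?\<beta> (mon0 L l, mon0 L r) = (if l = [] \<or> r = [] then 0 else \<chi> (l @ r))" by (intro m) auto
      qed
      also have "\<dots> = unshuffle_sum (sdeg2 L) (\<lambda>l r. \<chi> (l @ r)) vs - 2 * \<chi> vs"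
        using unsh_proper[OF vs(2), of "sdeg2 L" "\<lambda>l r. \<chi> (l @ r)"] by simp
      also have "\<dots> = (2 ^ length vs - 2) * \<chi> vs"
        using unsh_concat[OF \<chi>(2) vs(1)] by (simp add: algebra_simps)
      also have "\<dots> = ?rest vs"
      proof (cases "length vs = 1")
        case False
        then have "length vs \<ge> 2" using vs(2) by (cases vs) (auto simp: numeral_2_eq_2 Suc_le_eq)
        then have "(2 :: nat) ^ 2 \<le> 2 ^ length vs" by (intro power_increasing) auto
        then have "(2 :: nat) ^ length vs \<noteq> 2" by auto
        \<comment> \<open>Here characteristic zero enters: the inequality of naturals is transferred
          by injectivity of \<open>of_nat\<close>.\<close>
        then have "(2 :: 'a) ^ length vs \<noteq> 2" by (metis of_nat_eq_iff of_nat_numeral of_nat_power)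
        then show ?thesis using False by (simp add: \<chi>_def)
      qed simp
      finally show "cocomm_pull L ?\<beta> vs = ?rest vs" .
    qed
    moreover have "t ?one = 0"
    proof -
      let ?ll = "\<lambda>v. \<phi> [v]"
      have ll: "slot_linear L (*) ?ll" using vsym_slot[OF f, of "[]" "[]"] by simp
      note p = cocomm_proj[OF L]
      have "?ll (cocomm_proj L t) = t (\<lambda>g. ?ll (cocomm_proj L (cocomm_mon L g)))"
        by (rule cocomm_expand[OF L slot_linear_comp_Hom[OF p(1) ll vs_cocomm graded_vs[OF L]] t(1)])
      also have "\<dots> = t ?one"
      proof (rule ev_cong[OF tt' _ w])
        show "(\<lambda>g. ?ll (cocomm_proj L (cocomm_mon L g))) \<in> sym_forms L"
          unfolding sym_forms_iff
          by (rule cocomm_univ[OF L vector_space_mult slot_linear_comp_Hom[OF p(1) ll vs_cocomm graded_vs[OF L]]])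
        show "?ll (cocomm_proj L (cocomm_mon L g)) = ?one g" if "g \<in> cocomm_gens L" for g
          using p(2)[OF that] slot_linear_0[OF L vector_space_mult ll] that
          by (auto simp: cocomm_gens_iff split: list.splits)
      qed
      finally show ?thesis using t(3) slot_linear_0[OF L vector_space_mult ll] by simp
    qed
    moreover have "t \<phi> = t ?one + 1 * t ?rest"
      by (rule ev_linear[OF tt' w w True]) simp
    ultimately show ?thesis by simp
  qed
qed

section \<open>Structure maps of the cofree S-coalgebra\<close>

lemma slot_linear_if:
  "vector_space s \<Longrightarrow> slot_linear V s f \<Longrightarrow> slot_linear V s (\<lambda>u. if P then f u else 0)"
  by (cases P) (simp_all add: slot_linear_zero)

section \<open>Cogenerators of colour c and the maps relating the three coalgebras\<close>

lemma vs_Ger: "vector_space (scl (Ger_dual V))"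
  and subspace_Ger: "module.subspace (scl (Ger_dual V)) (cmp (Ger_dual V) n)"
  and scl_Ger [simp]: "scl (Ger_dual V) = fscl"
  unfolding Ger_dual_def by (simp_all add: vs_presented presented_subspace vector_space_fscl presented_subspace[simplified])

lemma singletons_blocks: "vs \<in> words V \<Longrightarrow> map (\<lambda>v. [v]) vs \<in> lists (blocks V)"
  by (induction vs) (auto simp: blocks_def)

lemma singletons_deg: "wt (block_deg (sdeg1 V)) (map (\<lambda>v. [v]) vs) = wt (sdeg2 V) vs"
  by (induction vs) (auto simp: block_deg_def sdeg1_def sdeg2_def)

text \<open>Dual to the inclusion of \<open>cocomm V\<close>: on blocks of length one the block
  symmetry becomes the Koszul symmetry for letters of degree \<open>sdeg2\<close>.\<close>

lemma ger_forms_singletons: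
  assumes "\<phi> \<in> ger_forms V"
  shows "vsym V (*) (\<lambda>vs. \<phi> (map (\<lambda>v. [v]) vs))"
proof (rule vsymI)
  fix xs ys assume xy: "xs \<in> words V" "ys \<in> words V"
  note b = singletons_blocks[OF xy(1)] singletons_blocks[OF xy(2)]
  note ger = assms[unfolded ger_forms_def mem_Collect_eq]
  have n: "[] \<in> words V" by simp
  have "\<forall>bs\<in>lists (blocks V). \<forall>cs\<in>lists (blocks V). \<forall>xs\<in>words V. \<forall>ys\<in>words V.
        slot_linear V (*) (\<lambda>u. \<phi> (bs @ (xs @ u # ys) # cs))"
    using ger by (rule conjunct1)
  from bspec[OF bspec[OF bspec[OF bspec[OF this b(1)] b(2)] n] n]
  have "slot_linear V (*) (\<lambda>u. \<phi> (map (\<lambda>v. [v]) xs @ ([] @ u # []) # map (\<lambda>v. [v]) ys))" .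
  then show "slot_linear V (*) (\<lambda>u. \<phi> (map (\<lambda>v. [v]) (xs @ u # ys)))" by simp
  fix u v assume uv: "u \<in> hmg V" "v \<in> hmg V"
  have uv': "[u] \<in> blocks V" "[v] \<in> blocks V" using uv by (auto simp: blocks_def)
  have "\<forall>bs\<in>lists (blocks V). \<forall>cs\<in>lists (blocks V). \<forall>B\<in>blocks V. \<forall>C\<in>blocks V.
        \<phi> (bs @ B # C # cs) =
        ksign (block_deg (sdeg1 V) B * block_deg (sdeg1 V) C) (\<phi> (bs @ C # B # cs))"
    using ger[THEN conjunct2] by (rule conjunct1)
  from bspec[OF bspec[OF bspec[OF bspec[OF this b(1)] b(2)] uv'(1)] uv'(2)]
  show "\<phi> (map (\<lambda>v. [v]) (xs @ u # v # ys)) =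
      ksign (sdeg2 V u * sdeg2 V v) (\<phi> (map (\<lambda>v. [v]) (xs @ v # u # ys)))"
    by (simp add: block_deg_def sdeg1_def sdeg2_def)
qed

lemma shuffle_sum_zeroI:
  "(\<And>w. length w = length xs + length ys \<Longrightarrow> h w = 0) \<Longrightarrow> shuffle_sum d h xs ys = 0"
  by (induction d h xs ys rule: shuffle_sum.induct) auto

text \<open>A form supported on monomials \<open>[[v]]\<close> satisfies the other relations because
  all terms are 0: the symmetry relation involves two blocks, and a shuffle of two nonempty words is
  a block of length at least two.\<close>

lemma ger_forms_cogenerators:
  assumes V: "graded_space V" and ll: "slot_linear V (*) ll"
  shows "(\<lambda>Bs. case Bs of [[v]] \<Rightarrow> ll v | _ \<Rightarrow> 0) \<in> ger_forms V" (is "?f \<in> _")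
proof -
  have e: "?f (bs @ (xs @ u # ys) # cs) = (if bs = [] \<and> xs = [] \<and> ys = [] \<and> cs = [] then ll u else 0)" for bs xs u ys cs
    by (cases bs; cases xs) (auto split: list.splits)
  have 1: "slot_linear V (*) (\<lambda>u. ?f (bs @ (xs @ u # ys) # cs))" for bs xs ys cs
    unfolding e by (rule slot_linear_if[OF vector_space_mult ll])
  have 2: "?f (bs @ B # C # cs) = 0" for bs B C cs
    by (cases bs) (auto split: list.splits)
  have 3: "?f (bs @ w # cs) = 0" if "length w \<ge> 2" for bs w cs
    using that by (cases bs) (auto split: list.splits)
  have 4: "shuffle_sum (sdeg1 V) (\<lambda>w. ?f (bs @ w # cs)) xs ys = 0" if "xs \<in> blocks V" "ys \<in> blocks V" for bs cs xs ys
  proof (rule shuffle_sum_zeroI)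
    fix w :: "'b list" assume "length w = length xs + length ys"
    moreover have "length xs \<ge> 1" "length ys \<ge> 1" using that by (auto simp: blocks_def Suc_le_eq)
    ultimately show "?f (bs @ w # cs) = 0" by (intro 3) simp
  qed
  show ?thesis unfolding ger_forms_def mem_Collect_eq
    by (intro conjI ballI 1 4) (simp_all only: 2 ksign_zero)
qed

lemma ger_gens_singletons: "vs \<in> words V \<Longrightarrow> vs \<noteq> [] \<Longrightarrow> map (\<lambda>v. [v]) vs \<in> ger_gens V"
  using singletons_blocks by (simp add: ger_gens_def)

lemma ger_mon_cmp:
  "vs \<in> words V \<Longrightarrow> vs \<noteq> [] \<Longrightarrow> ger_mon V (map (\<lambda>v. [v]) vs) \<in> cmp (Ger_dual V) (wt (sdeg2 V) vs + 2)"
  using pure_cmp[OF ger_gens_singletons, of vs V "ger_forms V" "\<lambda>Bs. wt (block_deg (sdeg1 V)) Bs + 2"]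
  by (simp add: Ger_dual_def ger_mon_def singletons_deg)

lemma ger_mon_outside: "\<phi> \<notin> ger_forms V \<Longrightarrow> ger_mon V Bs \<phi> = 0"
  and ger_mon_eval: "\<phi> \<in> ger_forms V \<Longrightarrow> ger_mon V Bs \<phi> = \<phi> Bs"
  by (simp_all add: ger_mon_def pure_def)

lemma ger_proj:
  assumes V: "graded_space V"
  shows "ger_proj V \<in> Hom (Ger_dual V) V 0"
    and "\<And>Bs. Bs \<in> ger_gens V \<Longrightarrow> ger_proj V (ger_mon V Bs) = (case Bs of [[v]] \<Rightarrow> v | _ \<Rightarrow> 0)"
proof -
  let ?f = "\<lambda>Bs :: 'b list list. case Bs of [[v]] \<Rightarrow> v | _ \<Rightarrow> 0"
  have 1: "\<forall>\<mu>. Vector_Spaces.linear (scl V) (*) \<mu> \<longrightarrow> (\<lambda>g. \<mu> (?f g)) \<in> ger_forms V"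
  proof (intro allI impI)
    fix \<mu> :: "'b \<Rightarrow> 'a" assume "Vector_Spaces.linear (scl V) (*) \<mu>"
    then interpret Vector_Spaces.linear "scl V" "(*)" \<mu> .
    have "(\<lambda>g. \<mu> (?f g)) = (\<lambda>Bs. case Bs of [[v]] \<Rightarrow> \<mu> v | _ \<Rightarrow> 0)"
      by (auto simp: fun_eq_iff split: list.splits)
    then show "(\<lambda>g. \<mu> (?f g)) \<in> ger_forms V"
      using ger_forms_cogenerators[OF V, of \<mu>] by (simp add: slot_linear_def add scale)
  qed
  note l = lin_ext_vec[OF graded_vs[OF V] 1, where F = "ger_proj V" and
      d = "\<lambda>Bs. wt (block_deg (sdeg1 V)) Bs + 2" and G = "ger_gens V", folded Ger_dual_def ger_mon_def, OF ger_proj_def]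
  show 2: "\<And>Bs. Bs \<in> ger_gens V \<Longrightarrow> ger_proj V (ger_mon V Bs) = ?f Bs" by (rule l(2))
  show "ger_proj V \<in> Hom (Ger_dual V) V 0"
    unfolding Ger_dual_def
  proof (rule HomI[OF graded_vs[OF V] graded_subspace[OF V]])
    show "linear_map (presented (ger_forms V) (ger_gens V) (\<lambda>Bs. wt (block_deg (sdeg1 V)) Bs + 2)) (scl V) (ger_proj V)"
      using l(1) by (simp add: Ger_dual_def)
    fix Bs assume Bs: "Bs \<in> ger_gens V"
    have "?f Bs \<in> cmp V (wt (block_deg (sdeg1 V)) Bs + 2 + 0)"
      using Bs cmp_0[OF V] hmg_cmp[OF V]
      by (auto simp: ger_gens_def blocks_def block_deg_def sdeg1_def split: list.splits)
    then show "ger_proj V (pure (ger_forms V) Bs) \<in> cmp V (wt (block_deg (sdeg1 V)) Bs + 2 + 0)"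
      using 2[OF Bs] by (simp add: ger_mon_def)
  qed
qed

lemma cocomm_incl:
  assumes V: "graded_space V"
  shows "cocomm_incl V \<in> Hom (cocomm V) (Ger_dual V) 0"
    and "\<And>vs. vs \<in> cocomm_gens V \<Longrightarrow> cocomm_incl V (cocomm_mon V vs) = ger_mon V (map (\<lambda>v. [v]) vs)"
proof -
  let ?f = "\<lambda>vs. ger_mon V (map (\<lambda>v. [v]) vs)"
  have 1: "\<forall>\<phi>\<in>ger_forms V. (\<lambda>g. ?f g \<phi>) \<in> sym_forms V"
  proof
    fix \<phi> assume p: "\<phi> \<in> ger_forms V"
    show "(\<lambda>g. ?f g \<phi>) \<in> sym_forms V"
      using ger_forms_singletons[OF p] by (simp add: ger_mon_eval[OF p] sym_forms_iff)
  qed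
  have 2: "\<forall>vs\<in>cocomm_gens V. \<forall>\<phi>. \<phi> \<notin> ger_forms V \<longrightarrow> ?f vs \<phi> = 0"
    by (simp add: ger_mon_outside)
  note l = lin_ext_fun[OF 1 2, where F = "cocomm_incl V" and d = "\<lambda>vs. wt (sdeg2 V) vs + 2",
      folded cocomm_def cocomm_mon_def, OF cocomm_incl_def]
  show 3: "\<And>vs. vs \<in> cocomm_gens V \<Longrightarrow> cocomm_incl V (cocomm_mon V vs) = ?f vs" by (rule l(2))
  show "cocomm_incl V \<in> Hom (cocomm V) (Ger_dual V) 0"
    unfolding cocomm_def
  proof (rule HomI[OF vs_Ger subspace_Ger])
    show "linear_map (presented (sym_forms V) (cocomm_gens V) (\<lambda>vs. wt (sdeg2 V) vs + 2)) (scl (Ger_dual V)) (cocomm_incl V)"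
      using l(1) by (simp add: cocomm_def)
    fix vs assume vs: "vs \<in> cocomm_gens V"
    show "cocomm_incl V (pure (sym_forms V) vs) \<in> cmp (Ger_dual V) (wt (sdeg2 V) vs + 2 + 0)"
      using 3[OF vs] ger_mon_cmp[of vs V] vs by (simp add: cocomm_mon_def cocomm_gens_iff)
  qed
qed

lemma so_rho:
  assumes V: "graded_space V"
  shows "so_rho V A \<in> Hom (So V A) (Ger_dual V) 1"
    and "\<And>vs as. (vs, as) \<in> so_gens V A \<Longrightarrow>
      so_rho V A (so_mon V A (vs, as)) = (if as = [] then ger_mon V (map (\<lambda>v. [v]) vs) else 0)"
proof -
  let ?f = "\<lambda>(vs, as :: 'c list). if as = [] then ger_mon V (map (\<lambda>v. [v]) vs) else 0"
  have 1: "\<forall>\<phi>\<in>ger_forms V. (\<lambda>g. ?f g \<phi>) \<in> so_forms V A"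
  proof
    fix \<phi> assume p: "\<phi> \<in> ger_forms V"
    have "vso V A (*) (\<lambda>vs as. if as = [] then \<phi> (map (\<lambda>v. [v]) vs) else 0)"
      unfolding vso_def
    proof (intro conjI ballI)
      fix as :: "'c list"
      show "vsym V (*) (\<lambda>vs. if as = [] then \<phi> (map (\<lambda>v. [v]) vs) else 0)"
        using ger_forms_singletons[OF p] vsym_sums(6)[OF vector_space_mult] by (cases "as = []") simp_all
    qed (auto intro!: vmultI slot_linear_zero[OF vector_space_mult])
    moreover have "(\<lambda>vs as. ?f (vs, as) \<phi>) = (\<lambda>vs as. if as = [] then \<phi> (map (\<lambda>v. [v]) vs) else 0)"
      by (auto simp: fun_eq_iff ger_mon_eval[OF p])
    ultimately show "(\<lambda>g. ?f g \<phi>) \<in> so_forms V A"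
      unfolding so_forms_iff by simp
  qed
  have 2: "\<forall>g\<in>so_gens V A. \<forall>\<phi>. \<phi> \<notin> ger_forms V \<longrightarrow> ?f g \<phi> = 0"
    by (auto simp: ger_mon_outside)
  note l = lin_ext_fun[OF 1 2, where F = "so_rho V A" and
      d = "\<lambda>(vs, as). wt (sdeg2 V) vs + wt (sdeg1 A) as + 1",
      folded So_def so_mon_def, OF so_rho_def]
  show 3: "so_rho V A (so_mon V A (vs, as)) = (if as = [] then ger_mon V (map (\<lambda>v. [v]) vs) else 0)"
    if "(vs, as) \<in> so_gens V A" for vs as using l(2)[OF that] by simp
  show "so_rho V A \<in> Hom (So V A) (Ger_dual V) 1"
    unfolding So_def
  proof (rule HomI[OF vs_Ger subspace_Ger])
    show "linear_map (presented (so_forms V A) (so_gens V A) (\<lambda>(vs, as). wt (sdeg2 V) vs + wt (sdeg1 A) as + 1))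
        (scl (Ger_dual V)) (so_rho V A)"
      using l(1) by (simp add: So_def)
    fix g assume g: "g \<in> so_gens V A"
    obtain vs as where vs: "g = (vs, as)" by (cases g)
    interpret module "scl (Ger_dual V)" using vs_Ger by (simp add: module_def vector_space_def)
    show "so_rho V A (pure (so_forms V A) g) \<in> cmp (Ger_dual V) ((case g of (vs, as) \<Rightarrow> wt (sdeg2 V) vs + wt (sdeg1 A) as + 1) + 1)"
      using 3[OF g[unfolded vs]] ger_mon_cmp[of vs V] g subspace_0[OF subspace_Ger]
      by (auto simp: so_mon_def vs so_gens_iff add.commute)
  qed
qed

lemma so_proj:
  assumes V: "graded_space V" and A: "graded_space A"
  shows "so_proj V A \<in> Hom (So V A) A 0"
    and "\<And>g. g \<in> so_gens V A \<Longrightarrow> so_proj V A (so_mon V A g) = (case g of ([], [a]) \<Rightarrow> a | _ \<Rightarrow> 0)"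
proof -
  let ?f = "\<lambda>g :: 'b list \<times> 'c list. case g of ([], [a]) \<Rightarrow> a | _ \<Rightarrow> 0"
  have 1: "\<forall>\<mu>. Vector_Spaces.linear (scl A) (*) \<mu> \<longrightarrow> (\<lambda>g. \<mu> (?f g)) \<in> so_forms V A"
  proof (intro allI impI)
    fix \<mu> :: "'c \<Rightarrow> 'a" assume "Vector_Spaces.linear (scl A) (*) \<mu>"
    then interpret Vector_Spaces.linear "scl A" "(*)" \<mu> .
    have e: "?f (vs, xs @ u # ys) = (if vs = [] \<and> xs = [] \<and> ys = [] then u else 0)" for vs xs u ys
      by (cases vs; cases xs) (auto split: list.splits)
    have e': "?f (xs @ u # ys, as) = 0" for xs u ys as by (cases xs) simp_all
    show "(\<lambda>g. \<mu> (?f g)) \<in> so_forms V A"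
      unfolding so_forms_iff vso_def
    proof (intro conjI ballI vsymI vmultI)
      fix vs xs ys
      show "slot_linear A (*) (\<lambda>u. \<mu> (?f (vs, xs @ u # ys)))"
        unfolding e by (cases "vs = [] \<and> xs = [] \<and> ys = []")
          (simp_all only: if_True if_False, simp_all add: slot_linear_def add scale)
    next
      fix as xs ys
      show "slot_linear V (*) (\<lambda>u. \<mu> (?f (xs @ u # ys, as)))"
        unfolding e' by (simp add: slot_linear_def)
      fix u v
      show "\<mu> (?f (xs @ u # v # ys, as)) = ksign (sdeg2 V u * sdeg2 V v) (\<mu> (?f (xs @ v # u # ys, as)))"
        unfolding e' by simp
    qed
  qed
  note l = lin_ext_vec[OF graded_vs[OF A] 1, where F = "so_proj V A" and
      d = "\<lambda>(vs, as). wt (sdeg2 V) vs + wt (sdeg1 A) as + 1" and G = "so_gens V A",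
      folded So_def so_mon_def, OF so_proj_def]
  show 2: "\<And>g. g \<in> so_gens V A \<Longrightarrow> so_proj V A (so_mon V A g) = ?f g" by (rule l(2))
  show "so_proj V A \<in> Hom (So V A) A 0"
    unfolding So_def
  proof (rule HomI[OF graded_vs[OF A] graded_subspace[OF A]])
    show "linear_map (presented (so_forms V A) (so_gens V A) (\<lambda>(vs, as). wt (sdeg2 V) vs + wt (sdeg1 A) as + 1))
        (scl A) (so_proj V A)"
      using l(1) by (simp add: So_def)
    fix g assume g: "g \<in> so_gens V A"
    have "?f g \<in> cmp A ((case g of (vs, as) \<Rightarrow> wt (sdeg2 V) vs + wt (sdeg1 A) as + 1) + 0)"
      using g cmp_0[OF A] hmg_cmp[OF A] by (cases g) (auto simp: so_gens_iff sdeg1_def split: list.splits)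
    then show "so_proj V A (pure (so_forms V A) g) \<in> cmp A ((case g of (vs, as) \<Rightarrow> wt (sdeg2 V) vs + wt (sdeg1 A) as + 1) + 0)"
      using 2[OF g] by (simp add: so_mon_def)
  qed
qed

subsection \<open>The comultiplication\<close>

lemma dec_left_all: "dec (\<lambda>x y. if x = [] then K x y else 0) as = K [] as"
  by (cases as) simp_all

lemma dec_right_all: "dec (\<lambda>x y. if y = [] then K x y else 0) as = K as []"
  by (induction as arbitrary: K) simp_all

lemma dec_concat: "dec (\<lambda>x y. K (x @ y)) as = (of_nat (length as) + 1) * (K as :: 'k::field_char_0)"
proof (induction as arbitrary: K)
  case (Cons a as)
  show ?case using Cons.IH[of "\<lambda>w. K (a # w)"] by (simp add: algebra_simps)
qed simp

lemma vmult_dec: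
  assumes s: "vector_space s" and K: "\<And>y. y \<in> words A \<Longrightarrow> vmult A s (\<lambda>x. K x y)" "\<And>x. x \<in> words A \<Longrightarrow> vmult A s (K x)"
  shows "vmult A s (dec K)"
proof (rule vmultI)
  fix xs ys assume xy: "xs \<in> words A" "ys \<in> words A"
  have 1: "slot_linear A s (\<lambda>u. dec (\<lambda>x y. K x (y @ u # ys)) xs)"
  proof (rule slot_linear_dec[OF s])
    fix x y assume "xs = x @ y"
    then have "x \<in> words A" "y \<in> words A" using xy by auto
    then show "slot_linear A s (\<lambda>u. K x (y @ u # ys))" using vmult_slot[OF K(2) _ xy(2)] by blast
  qed
  have 2: "slot_linear A s (\<lambda>u. dec (\<lambda>x y. K (xs @ u # x) y) ys)"
  proof (rule slot_linear_dec[OF s])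
    fix x y assume "ys = x @ y"
    then have "x \<in> words A" "y \<in> words A" using xy by auto
    then show "slot_linear A s (\<lambda>u. K (xs @ u # x) y)" using vmult_slot[OF K(1) xy(1)] by blast
  qed
  show "slot_linear A s (\<lambda>u. dec K (xs @ u # ys))"
    unfolding dec_snoc_mid by (rule slot_linear_add[OF s 1 2])
qed

text \<open>The monomial without letters does not belong to the coalgebra and is replaced by 0, as
  in \<open>mon0\<close>.\<close>

definition mon1 ::
  "('k::field_char_0, 'v::ab_group_add) gvs \<Rightarrow> ('k, 'a::ab_group_add) gvs \<Rightarrow> 'v list \<Rightarrow> 'a list \<Rightarrow>
   ('v list \<times> 'a list, 'k) functional" where
  "mon1 V A l x = (if l = [] \<and> x = [] then 0 else so_mon V A (l, x))"

context
  fixes V :: "('k::field_char_0, 'v::ab_group_add) gvs" and A :: "('k, 'a::ab_group_add) gvs"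
  assumes V: "graded_space V" and A: "graded_space A"
begin

lemma mon1_hmg: "l \<in> words V \<Longrightarrow> x \<in> words A \<Longrightarrow> mon1 V A l x \<in> hmg (So V A)"
  using so_mon_cmp[of l x V A] hmg_0[OF graded_So[OF V A]] cmp_hmg by (auto simp: mon1_def so_gens_iff)

lemma mon1_univ:
  assumes "slot_linear (So V A) (*) ll"
  shows "vso V A (*) (\<lambda>l x. ll (mon1 V A l x))"
proof (rule vso_cong[OF V A so_univ[OF V A vector_space_mult assms]])
  fix vs as assume "(vs, as) \<in> so_gens V A"
  then show "ll (so_mon V A (vs, as)) = ll (mon1 V A vs as)" by (auto simp: mon1_def so_gens_iff)
qed

text \<open>The comultiplication of colour o in dual form. The product in the exponent is the Koszul
  sign of moving \<open>x\<close> past \<open>r\<close>; the remaining summand, the degree of the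
  left factor before suspension, comes from \<open>s \<otimes> s\<close>.\<close>

definition so_split ::
  "('v list \<Rightarrow> 'a list \<Rightarrow> 'v list \<Rightarrow> 'a list \<Rightarrow> 'm::ab_group_add) \<Rightarrow> 'v list \<Rightarrow> 'a list \<Rightarrow> 'm" where
  "so_split H vs as = unshuffle_sum (sdeg2 V) (\<lambda>l r. dec (\<lambda>x y.
     ksign (wt (sdeg2 V) r * wt (sdeg1 A) x + (wt (sdeg2 V) l + wt (sdeg1 A) x)) (H l x r y)) as) vs"

definition so_pull ::
  "(('v list \<times> 'a list, 'k) functional \<times> ('v list \<times> 'a list, 'k) functional \<Rightarrow> 'k) \<Rightarrow> 'v list \<times> 'a list \<Rightarrow> 'k" where
  "so_pull \<beta> = (\<lambda>(vs, as). so_split (\<lambda>l x r y. \<beta> (mon1 V A l x, mon1 V A r y)) vs as)"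

lemma so_split_form:
  assumes 1: "\<And>r y. r \<in> words V \<Longrightarrow> y \<in> words A \<Longrightarrow> vso V A (*) (\<lambda>l x. H l x r y)"
    and 2: "\<And>l x. l \<in> words V \<Longrightarrow> x \<in> words A \<Longrightarrow> vso V A (*) (H l x)"
  shows "vso V A (*) (so_split H)"
  unfolding vso_def
proof (intro conjI ballI)
  fix as assume as: "as \<in> words A"
  have "bisym V (*) (\<lambda>l r. dec (\<lambda>x y.
     ksign (wt (sdeg2 V) r * wt (sdeg1 A) x + (wt (sdeg2 V) l + wt (sdeg1 A) x)) (H l x r y)) as)"
  proof (rule bisymI; rule vsym_sums(2)[OF vector_space_mult])
    fix r x y assume r: "r \<in> words V" and "as = x @ y"
    then have xy: "x \<in> words A" "y \<in> words A" using as by auto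
    have "vsym V (*) (\<lambda>l. H l x r y)" using 1[OF r xy(2)] xy by (simp add: vso_def)
    from vsym_sign[OF V vector_space_mult this, of "\<lambda>n. wt (sdeg2 V) r * wt (sdeg1 A) x + (n + wt (sdeg1 A) x)"]
    show "vsym V (*) (\<lambda>l. ksign (wt (sdeg2 V) r * wt (sdeg1 A) x + (wt (sdeg2 V) l + wt (sdeg1 A) x)) (H l x r y))" .
    have "vsym V (*) (\<lambda>l. H r x l y)" using 2[OF r xy(1)] xy by (simp add: vso_def)
    from vsym_sign[OF V vector_space_mult this, of "\<lambda>n. n * wt (sdeg1 A) x + (wt (sdeg2 V) r + wt (sdeg1 A) x)"]
    show "vsym V (*) (\<lambda>l. ksign (wt (sdeg2 V) l * wt (sdeg1 A) x + (wt (sdeg2 V) r + wt (sdeg1 A) x)) (H r x l y))" .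
  qed
  from vsym_unshuffle[OF V vector_space_mult this]
  show "vsym V (*) (\<lambda>vs. so_split H vs as)" by (simp add: so_split_def)
next
  fix vs assume vs: "vs \<in> words V"
  show "vmult A (*) (so_split H vs)"
    unfolding so_split_def
  proof (rule vmult_sums(1)[OF vector_space_mult], rule vmult_dec[OF vector_space_mult])
    fix l r y assume "usplit (sdeg2 V) vs l r" and y: "y \<in> words A"
    then have lr: "l \<in> words V" "r \<in> words V" using usplit_lists vs by blast+
    have "vmult A (*) (\<lambda>x. H l x r y)" using 1[OF lr(2) y] lr by (simp add: vso_def)
    from vmult_sign[OF A vector_space_mult this, of "\<lambda>n. wt (sdeg2 V) r * n + (wt (sdeg2 V) l + n)"]
    show "vmult A (*) (\<lambda>x. ksign (wt (sdeg2 V) r * wt (sdeg1 A) x + (wt (sdeg2 V) l + wt (sdeg1 A) x)) (H l x r y))" .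
    have "vmult A (*) (H l y r)" using 2[OF lr(1) y] lr by (simp add: vso_def)
    then show "vmult A (*) (\<lambda>x. ksign (wt (sdeg2 V) r * wt (sdeg1 A) y + (wt (sdeg2 V) l + wt (sdeg1 A) y)) (H l y r x))"
      by (rule vmult_sums(3)[OF vector_space_mult])
  qed
qed

lemma so_pull_form:
  assumes "\<beta> \<in> bilinear_forms (So V A) (So V A)"
  shows "so_pull \<beta> \<in> so_forms V A"
proof -
  have "vso V A (*) (so_split (\<lambda>l x r y. \<beta> (mon1 V A l x, mon1 V A r y)))"
  proof (rule so_split_form)
    fix r y assume "r \<in> words V" "y \<in> words A"
    then have *: "mon1 V A r y \<in> hmg (So V A)" by (rule mon1_hmg)
    show "vso V A (*) (\<lambda>l x. \<beta> (mon1 V A l x, mon1 V A r y))"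
      by (rule mon1_univ[OF bilinear_left[OF assms *]])
    show "vso V A (*) (\<lambda>l x. \<beta> (mon1 V A r y, mon1 V A l x))"
      by (rule mon1_univ[OF bilinear_right[OF assms *]])
  qed
  then show ?thesis by (simp add: so_forms_iff so_pull_def)
qed

lemma so_Delta:
  shows "linear_map (So V A) fscl (so_Delta V A)"
    and "\<And>t. t \<in> tot (So V A) \<Longrightarrow> so_Delta V A t \<in> tot (tensor (So V A) (So V A))"
    and "\<And>t \<beta>. t \<in> tot (So V A) \<Longrightarrow> \<beta> \<in> bilinear_forms (So V A) (So V A) \<Longrightarrow>
      so_Delta V A t \<beta> = t (so_pull \<beta>)"
proof -
  let ?B = "bilinear_forms (So V A) (So V A)"
  let ?h = "\<lambda>l r x y. if (l, x) = ([], []) \<or> (r, y) = ([], []) then 0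
        else ksign (wt (sdeg2 V) r * wt (sdeg1 A) x + (wt (sdeg2 V) l + wt (sdeg1 A) x))
               (tens (So V A) (so_mon V A (l, x)) (so_mon V A (r, y)))"
  let ?f = "\<lambda>(vs, as). unshuffle_sum (sdeg2 V) (\<lambda>l r. \<Sum>i\<le>length as.
        let x = take i as; y = drop i as in ?h l r x y) vs"
  have f: "?f (vs, as) = unshuffle_sum (sdeg2 V) (\<lambda>l r. dec (?h l r) as) vs" for vs as
    unfolding Let_def prod.case
  proof (rule unsh_cong)
    fix l r
    show "(\<Sum>i\<le>length as. ?h l r (take i as) (drop i as)) = dec (?h l r) as"
      by (rule dec_eq_sum)
  qed
  have split: "l \<in> words V \<and> r \<in> words V \<and> x \<in> words A \<and> y \<in> words A"
    if "(vs, as) \<in> so_gens V A" "usplit (sdeg2 V) vs l r" "as = x @ y" for vs as l r x y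
    using usplit_lists[OF that(2), of "hmg V"] that(1,3) by (auto simp: so_gens_iff)
  have ev: "?f g \<beta> = so_pull \<beta> g" if b: "\<beta> \<in> ?B" and g: "g \<in> so_gens V A" for g \<beta>
  proof -
    obtain vs as where g': "g = (vs, as)" by (cases g)
    have "?h l r x y \<beta> = ksign (wt (sdeg2 V) r * wt (sdeg1 A) x + (wt (sdeg2 V) l + wt (sdeg1 A) x))
        (\<beta> (mon1 V A l x, mon1 V A r y))" if "usplit (sdeg2 V) vs l r" "as = x @ y" for l r x y
      using split[OF g[unfolded g'] that] bilinear_0[OF graded_So[OF V A] b] mon1_hmg
      by (auto simp: mon1_def ksign_apply tens_eval[OF b] hmg_0[OF graded_So[OF V A]])
    then have "unshuffle_sum (sdeg2 V) (\<lambda>l r. dec (\<lambda>x y. ?h l r x y \<beta>) as) vs = so_pull \<beta> (vs, as)"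
      unfolding so_pull_def so_split_def prod.case by (intro unsh_cong dec_cong)
    then show ?thesis unfolding g' f unsh_apply dec_apply .
  qed
  have 1: "\<forall>\<beta>\<in>?B. (\<lambda>g. ?f g \<beta>) \<in> so_forms V A"
  proof
    fix \<beta> assume b: "\<beta> \<in> ?B"
    have "vso V A (*) (\<lambda>vs as. so_pull \<beta> (vs, as))" using so_pull_form[OF b] by (simp add: so_forms_iff)
    then show "(\<lambda>g. ?f g \<beta>) \<in> so_forms V A"
      unfolding so_forms_iff
    proof (rule vso_cong[OF V A])
      fix vs as assume g: "(vs, as) \<in> so_gens V A"
      show "so_pull \<beta> (vs, as) = ?f (vs, as) \<beta>" by (rule ev[OF b g, symmetric])
    qed
  qed
  have 2: "\<forall>g\<in>so_gens V A. \<forall>\<beta>. \<beta> \<notin> ?B \<longrightarrow> ?f g \<beta> = 0"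
  proof (intro ballI allI impI)
    fix g :: "'v list \<times> 'a list" and \<beta> assume b: "\<beta> \<notin> ?B"
    obtain vs as where g': "g = (vs, as)" by (cases g)
    have "?h l r x y \<beta> = 0" for l r x y using tens_outside[OF b] by (simp add: ksign_apply)
    then show "?f g \<beta> = 0" unfolding g' f unsh_apply dec_apply by simp
  qed
  note l = lin_ext_fun[where f = ?f and \<Phi> = "so_forms V A" and \<Phi>' = ?B and F = "so_Delta V A"
      and d = "\<lambda>(vs, as). wt (sdeg2 V) vs + wt (sdeg1 A) as + 1" and G = "so_gens V A",
      folded So_def so_mon_def, OF 1 2 so_Delta_def]
  show "linear_map (So V A) fscl (so_Delta V A)" by (rule l(1))
  show "so_Delta V A t \<in> tot (tensor (So V A) (So V A))" if "t \<in> tot (So V A)" for t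
  proof (rule linear_map_tot[OF vs_tensor, where \<Phi> = "so_forms V A" and G = "so_gens V A" and
        d = "\<lambda>(vs, as). wt (sdeg2 V) vs + wt (sdeg1 A) as + 1", folded So_def so_mon_def, unfolded scl_tensor, OF l(1) _ that])
    fix g assume g: "g \<in> so_gens V A"
    obtain vs as where g': "g = (vs, as)" by (cases g)
    have "unshuffle_sum (sdeg2 V) (\<lambda>l r. dec (?h l r) as) vs \<in> tot (tensor (So V A) (So V A))"
    proof (rule unsh_additive_on[OF tens_additive_on, THEN conjunct1], rule dec_additive_on[OF tens_additive_on, THEN conjunct1])
      fix l r x y assume "usplit (sdeg2 V) vs l r" "as = x @ y"
      from split[OF g[unfolded g'] this]
      show "?h l r x y \<in> tot (tensor (So V A) (So V A))"
        using tens_tot[OF cmp_hmg[OF so_mon_cmp] cmp_hmg[OF so_mon_cmp], of l x V A r y]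
        by (auto simp: tens_tot_0 so_gens_iff intro: tens_tot_ksign)
    qed
    then show "so_Delta V A (so_mon V A g) \<in> tot (tensor (So V A) (So V A))"
      unfolding l(2)[OF g] unfolding g' f .
  qed
  show "so_Delta V A t \<beta> = t (so_pull \<beta>)" if "t \<in> tot (So V A)" "\<beta> \<in> ?B" for t \<beta>
  proof -
    have "so_Delta V A t \<beta> = t (\<lambda>g. ?f g \<beta>)" by (rule l(3)[OF that])
    also have "\<dots> = t (so_pull \<beta>)"
      by (rule ev_cong[OF that(1)[unfolded So_def] bspec[OF 1 that(2)] so_pull_form[OF that(2)] ev[OF that(2)]])
    finally show ?thesis .
  qed
qed

end

section \<open>Primitive elements of the component of colour o\<close>

context
  fixes V :: "('k::field_char_0, 'v::ab_group_add) gvs" and A :: "('k, 'a::ab_group_add) gvs"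
  assumes V: "graded_space V" and A: "graded_space A"
begin

abbreviation (input) so_sign :: "'v list \<Rightarrow> 'a list \<Rightarrow> 'v list \<Rightarrow> int" where
  "so_sign l x r \<equiv> wt (sdeg2 V) r * wt (sdeg1 A) x + (wt (sdeg2 V) l + wt (sdeg1 A) x)"

text \<open>Concatenation in both words, with the sign of \<open>so_split\<close> built in so that
  the two signs cancel in \<open>so_product_pull\<close>.\<close>

definition so_conc :: "('v list \<times> 'a list \<Rightarrow> 'k) \<Rightarrow> 'v list \<Rightarrow> 'a list \<Rightarrow> 'v list \<times> 'a list \<Rightarrow> 'k" where
  "so_conc \<phi> l x = (\<lambda>(r, y). ksign (so_sign l x r) (\<phi> (l @ r, x @ y)))"

lemma so_conc_right:
  assumes f: "\<phi> \<in> so_forms V A" and lx: "l \<in> words V" "x \<in> words A"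
  shows "so_conc \<phi> l x \<in> so_forms V A"
  unfolding so_forms_iff vso_def so_conc_def prod.case
proof (intro conjI ballI)
  fix y assume y: "y \<in> words A"
  have "vsym V (*) (\<lambda>vs. \<phi> (vs, x @ y))" using f lx y by (simp add: so_forms_iff vso_def)
  from vsym_append[OF this lx(1), of "[]"]
  have "vsym V (*) (\<lambda>r. \<phi> (l @ r, x @ y))" by simp
  from vsym_sign[OF V vector_space_mult this, of "\<lambda>n. n * wt (sdeg1 A) x + (wt (sdeg2 V) l + wt (sdeg1 A) x)"]
  show "vsym V (*) (\<lambda>r. ksign (so_sign l x r) (\<phi> (l @ r, x @ y)))" .
next
  fix r assume r: "r \<in> words V"
  have "vmult A (*) (\<lambda>as. \<phi> (l @ r, as))" using f lx r by (simp add: so_forms_iff vso_def)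
  from vmult_append[OF this lx(2), of "[]"]
  have "vmult A (*) (\<lambda>y. \<phi> (l @ r, x @ y))" by simp
  then show "vmult A (*) (\<lambda>y. ksign (so_sign l x r) (\<phi> (l @ r, x @ y)))"
    by (rule vmult_sums(3)[OF vector_space_mult])
qed

lemma so_conc_left:
  assumes f: "\<phi> \<in> so_forms V A" and g: "g \<in> so_gens V A"
  shows "vso V A (*) (\<lambda>l x. so_conc \<phi> l x g)"
proof -
  obtain r y where g': "g = (r, y)" by (cases g)
  have ry: "r \<in> words V" "y \<in> words A" using g by (simp_all add: g' so_gens_iff)
  show ?thesis unfolding vso_def so_conc_def prod.case g'
  proof (intro conjI ballI)
    fix x assume x: "x \<in> words A"
    have "vsym V (*) (\<lambda>vs. \<phi> (vs, x @ y))" using f ry x by (simp add: so_forms_iff vso_def)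
    from vsym_append[OF this _ ry(1), of "[]"]
    have "vsym V (*) (\<lambda>l. \<phi> (l @ r, x @ y))" by simp
    from vsym_sign[OF V vector_space_mult this, of "\<lambda>n. wt (sdeg2 V) r * wt (sdeg1 A) x + (n + wt (sdeg1 A) x)"]
    show "vsym V (*) (\<lambda>l. ksign (so_sign l x r) (\<phi> (l @ r, x @ y)))" .
  next
    fix l assume l: "l \<in> words V"
    have "vmult A (*) (\<lambda>as. \<phi> (l @ r, as))" using f ry l by (simp add: so_forms_iff vso_def)
    from vmult_append[OF this _ ry(2), of "[]"]
    have "vmult A (*) (\<lambda>x. \<phi> (l @ r, x @ y))" by simp
    from vmult_sign[OF A vector_space_mult this, of "\<lambda>n. wt (sdeg2 V) r * n + (wt (sdeg2 V) l + n)"]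
    show "vmult A (*) (\<lambda>x. ksign (so_sign l x r) (\<phi> (l @ r, x @ y)))" .
  qed
qed

lemma so_conc_ev:
  assumes f: "\<phi> \<in> so_forms V A" and y: "y \<in> tot (So V A)"
  shows "(\<lambda>(l, x). y (so_conc \<phi> l x)) \<in> so_forms V A"
  unfolding so_forms_iff vso_def prod.case
proof (intro conjI ballI)
  fix x assume x: "x \<in> words A"
  show "vsym V (*) (\<lambda>l. y (so_conc \<phi> l x))"
  proof (rule ev_vsym[OF y[unfolded So_def] _ _ V, where f = "\<lambda>l. so_conc \<phi> l x"])
    show "so_conc \<phi> l x \<in> so_forms V A" if "l \<in> words V" for l by (rule so_conc_right[OF f that x])
    show "vsym V (*) (\<lambda>l. so_conc \<phi> l x g)" if "g \<in> so_gens V A" for g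
      using so_conc_left[OF f that] x by (simp add: vso_def)
  qed
next
  fix l assume l: "l \<in> words V"
  show "vmult A (*) (\<lambda>x. y (so_conc \<phi> l x))"
  proof (rule ev_vmult[OF y[unfolded So_def] _ _ A, where f = "\<lambda>x. so_conc \<phi> l x"])
    show "so_conc \<phi> l x \<in> so_forms V A" if "x \<in> words A" for x by (rule so_conc_right[OF f l that])
    show "vmult A (*) (\<lambda>x. so_conc \<phi> l x g)" if "g \<in> so_gens V A" for g
      using so_conc_left[OF f that] l by (simp add: vso_def)
  qed
qed

text \<open>The product of \<open>S \<otimes> T\<close> (symmetric product and concatenation):
  the composition with the comultiplication is multiplication by \<open>2^k (n + 1) - 2\<close>.\<close>

lemma so_product_form:
  assumes f: "\<phi> \<in> so_forms V A"
  shows "(\<lambda>(x, y). x (\<lambda>(l, a). y (so_conc \<phi> l a))) \<in> bilinear_forms (So V A) (So V A)"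
proof -
  note tot = hmg_tot[OF vs_So] tot_add[OF vs_So] tot_scale[OF vs_So]
  have 3: "slot_linear (So V A) (*) (\<lambda>y. x (\<lambda>(l, a). y (so_conc \<phi> l a)))" if x: "x \<in> tot (So V A)" for x
    unfolding slot_linear_def
  proof (intro allI ballI)
    fix n u v c assume "u \<in> cmp (So V A) n" "v \<in> cmp (So V A) n"
    then have uv: "u \<in> tot (So V A)" "v \<in> tot (So V A)" by (auto intro: tot(1)[OF cmp_hmg])
    have w: "u + scl (So V A) c v \<in> tot (So V A)" by (rule tot(2)[OF uv(1) tot(3)[OF uv(2)]])
    show "x (\<lambda>(l, a). (u + scl (So V A) c v) (so_conc \<phi> l a)) =
        x (\<lambda>(l, a). u (so_conc \<phi> l a)) + c * x (\<lambda>(l, a). v (so_conc \<phi> l a))"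
      by (rule ev_linear[OF x[unfolded So_def] so_conc_ev[OF f uv(1)] so_conc_ev[OF f uv(2)] so_conc_ev[OF f w]])
        (simp add: fscl_def split: prod.split)
  qed
  have 4: "slot_linear (So V A) (*) (\<lambda>x. x (\<lambda>(l, a). y (so_conc \<phi> l a)))" for y
    by (simp add: slot_linear_def fscl_def)
  show ?thesis unfolding bilinear_forms_def
    by (simp only: mem_Collect_eq prod.case) (intro conjI ballI 3 4 tot(1))
qed

text \<open>The factor counts \<open>2 ^ k\<close> unshuffles times \<open>n + 1\<close>
  deconcatenations, less the two splittings with an empty tensor factor.\<close>

lemma so_product_pull:
  assumes f: "\<phi> \<in> so_forms V A" and g: "(vs, as) \<in> so_gens V A"
  shows "so_pull V A (\<lambda>(x, y). x (\<lambda>(l, a). y (so_conc \<phi> l a))) (vs, as) =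
     (2 ^ length vs * (of_nat (length as) + 1) - 2) * \<phi> (vs, as)"
proof -
  let ?K = "\<lambda>l r x y. \<phi> (l @ r, x @ y)"
  let ?E = "\<lambda>l r x y. if (l = [] \<and> x = []) \<or> (r = [] \<and> y = []) then 0 else ?K l r x y"
  have vs: "vs \<in> words V" "as \<in> words A" "vs \<noteq> [] \<or> as \<noteq> []" using g by (simp_all add: so_gens_iff)
  have m: "mon1 V A l x (\<lambda>(l, a). mon1 V A r y (so_conc \<phi> l a)) =
      (if (l = [] \<and> x = []) \<or> (r = [] \<and> y = []) then 0 else so_conc \<phi> l x (r, y))"
    if w: "l \<in> words V" "r \<in> words V" "x \<in> words A" "y \<in> words A" for l r x y
  proof -
    have ev: "mon1 V A l x \<psi> = (if l = [] \<and> x = [] then 0 else \<psi> (l, x))" if "\<psi> \<in> so_forms V A" for l x \<psi>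
      using that by (simp add: mon1_def so_mon_eval)
    show ?thesis
      unfolding ev[OF so_conc_ev[OF f hmg_tot[OF vs_So mon1_hmg[OF V A w(2,4)]]]] prod.case
        ev[OF so_conc_right[OF f w(1,3)]] by simp
  qed
  have pull: "so_pull V A (\<lambda>(x, y). x (\<lambda>(l, a). y (so_conc \<phi> l a))) (vs, as) =
      unshuffle_sum (sdeg2 V) (\<lambda>l r. dec (?E l r) as) vs"
    unfolding so_pull_def[OF V A] so_split_def[OF V A] prod.case
  proof (intro unsh_cong dec_cong)
    fix l r x y assume "usplit (sdeg2 V) vs l r" "as = x @ y"
    with usplit_lists[OF this(1) vs(1)] vs(2)
    have w: "l \<in> words V" "r \<in> words V" "x \<in> words A" "y \<in> words A" by simp_all
    show "ksign (so_sign l x r) (mon1 V A l x (\<lambda>(l, a). mon1 V A r y (so_conc \<phi> l a))) = ?E l r x y"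
      unfolding m[OF w] by (simp add: so_conc_def ksign_def)
  qed
  have "unshuffle_sum (sdeg2 V) (\<lambda>l r. dec (?K l r) as) vs = unshuffle_sum (sdeg2 V) (\<lambda>l r. dec (?E l r) as) vs +
     (unshuffle_sum (sdeg2 V) (\<lambda>l r. dec (\<lambda>x y. if l = [] \<and> x = [] then ?K l r x y else 0) as) vs +
      unshuffle_sum (sdeg2 V) (\<lambda>l r. dec (\<lambda>x y. if r = [] \<and> y = [] then ?K l r x y else 0) as) vs)"
    unfolding unsh_add[symmetric] dec_add[symmetric]
  proof (intro unsh_cong dec_cong)
    fix l r x y assume "usplit (sdeg2 V) vs l r" "as = x @ y"
    then have "\<not> (l = [] \<and> x = [] \<and> r = [] \<and> y = [])" using vs(3) by (auto simp: usplit_def)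
    then show "?K l r x y = ?E l r x y + ((if l = [] \<and> x = [] then ?K l r x y else 0) +
        (if r = [] \<and> y = [] then ?K l r x y else 0))" by auto
  qed
  moreover have "unshuffle_sum (sdeg2 V) (\<lambda>l r. dec (\<lambda>x y. if l = [] \<and> x = [] then ?K l r x y else 0) as) vs = \<phi> (vs, as)"
  proof -
    have "dec (\<lambda>x y. if l = [] \<and> x = [] then ?K l r x y else 0) as = (if l = [] then \<phi> (l @ r, as) else 0)" for l r
      using dec_left_all[of "?K l r" as] by simp
    then show ?thesis by (simp add: unsh_right_all)
  qed
  moreover have "unshuffle_sum (sdeg2 V) (\<lambda>l r. dec (\<lambda>x y. if r = [] \<and> y = [] then ?K l r x y else 0) as) vs = \<phi> (vs, as)"
  proof -
    have "dec (\<lambda>x y. if r = [] \<and> y = [] then ?K l r x y else 0) as = (if r = [] then \<phi> (l @ r, as) else 0)" for l r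
      using dec_right_all[of "?K l r" as] by simp
    then show ?thesis by (simp add: unsh_left_all)
  qed
  moreover have "unshuffle_sum (sdeg2 V) (\<lambda>l r. dec (?K l r) as) vs = 2 ^ length vs * (of_nat (length as) + 1) * \<phi> (vs, as)"
  proof -
    have "vsym V (*) (\<lambda>vs. \<phi> (vs, as))" using f vs by (simp add: so_forms_iff vso_def)
    from unsh_concat[OF this vs(1)] show ?thesis
      by (simp add: dec_concat[of "\<lambda>w. \<phi> (_, w)"] unsh_mult)
  qed
  ultimately show ?thesis unfolding pull by (simp add: algebra_simps)
qed

lemma slot_linear_cogen:
  assumes "slot_linear V (*) ll"
  shows "slot_linear (So V A) (*) (\<lambda>t. ll (ger_proj V (so_rho V A t)))"
  by (rule slot_linear_comp_Hom[OF so_rho(1)[OF V] slot_linear_comp_Hom[OF ger_proj(1)[OF V] assms vs_Ger graded_vs[OF V]]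
        vs_So vs_Ger])

lemma cogen_mon:
  assumes "(vs, as) \<in> so_gens V A"
  shows "ger_proj V (so_rho V A (so_mon V A (vs, as))) = (if as = [] then case vs of [v] \<Rightarrow> v | _ \<Rightarrow> 0 else 0)"
proof (cases "as = []")
  case True
  then have "map (\<lambda>v. [v]) vs \<in> ger_gens V" using assms ger_gens_singletons[of vs V] by (simp add: so_gens_iff)
  from ger_proj(2)[OF V this] show ?thesis
    using so_rho(2)[OF V assms] True by (simp split: list.splits)
next
  case False
  then show ?thesis
    using so_rho(2)[OF V assms] linear_map_0[OF vs_Ger graded_vs[OF V] HomD(1)[OF ger_proj(1)[OF V]]] by simp
qed

text \<open>Only single letters, from \<open>V\<close> or from \<open>A\<close>, escape detection by
  the comultiplication; these two cases account for the two projections in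
  \<open>so_primitive\<close>.\<close>

lemma weight_nonzero:
  assumes "(2 :: 'k) ^ k * (of_nat m + 1) = 2"
  shows "k = 1 \<and> m = 0 \<or> k = 0 \<and> m = 1"
proof -
  have "of_nat (2 ^ k * (m + 1)) = (of_nat 2 :: 'k)" using assms by (simp add: distrib_left add.commute)
  then have e: "2 ^ k * (m + 1) = (2 :: nat)" unfolding of_nat_eq_iff .
  show ?thesis
  proof (cases k)
    case (Suc j)
    then have "2 ^ j * (m + 1) = (1 :: nat)" using e by simp
    then have "2 ^ j = (1 :: nat) \<and> m + 1 = 1" by (simp only: nat_mult_eq_1_iff)
    then show ?thesis using Suc by auto
  qed (use e in simp)
qed

text \<open>As in \<open>cocomm_primitive\<close>, but with three parts of a form. A single letter
  from \<open>V\<close> is primitive in colour o without being a cogenerator of that colour; it is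
  detected through \<open>so_rho\<close>.\<close>

lemma so_primitive:
  assumes t: "t \<in> cmp (So V A) n" "so_Delta V A t = 0" "so_proj V A t = 0" "ger_proj V (so_rho V A t) = 0"
  shows "t = 0"
proof
  fix \<phi>
  have tt: "t \<in> tot (So V A)" by (rule hmg_tot[OF vs_So cmp_hmg[OF t(1)]])
  note tt' = tt[unfolded So_def]
  show "t \<phi> = 0 \<phi>"
  proof (cases "\<phi> \<in> so_forms V A")
    case False
    then show ?thesis using ev_outside[OF tt'] by simp
  next
    case True
    then have f: "vso V A (*) (\<lambda>vs as. \<phi> (vs, as))" by (simp add: so_forms_iff)
    have w: "(\<lambda>(vs, as). c (length vs) (length as) * \<phi> (vs, as)) \<in> so_forms V A" for c :: "nat \<Rightarrow> nat \<Rightarrow> 'k"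
      using vso_weight[OF V A vector_space_mult f, of "\<lambda>k _ m _. c k m"] by (simp add: so_forms_iff)
    \<comment> \<open>Indicator weights on pairs of lengths: \<open>cV\<close> for a single letter
      from \<open>V\<close>, \<open>cA\<close> for a single letter from \<open>A\<close>,
      \<open>c0\<close> for all other pairs; \<open>cc\<close> is \<open>c0\<close> divided by the
      factor from \<open>so_product_pull\<close>.\<close>
    define cV :: "nat \<Rightarrow> nat \<Rightarrow> 'k" where "cV k m = (if k = 1 \<and> m = 0 then 1 else 0)" for k m
    define cA :: "nat \<Rightarrow> nat \<Rightarrow> 'k" where "cA k m = (if k = 0 \<and> m = 1 then 1 else 0)" for k m
    define c0 :: "nat \<Rightarrow> nat \<Rightarrow> 'k" where "c0 k m = (if cV k m = 1 \<or> cA k m = 1 then 0 else 1)" for k m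
    define cc :: "nat \<Rightarrow> nat \<Rightarrow> 'k" where "cc k m = c0 k m / (2 ^ k * (of_nat m + 1) - 2)" for k m
    define \<chi> where "\<chi> c = (\<lambda>(vs, as). c (length vs) (length as) * \<phi> (vs, as))" for c
    note \<chi> = w[folded \<chi>_def]
    have 1: "t (\<chi> c0) = 0"
    proof -
      let ?\<beta> = "\<lambda>(x :: ('v list \<times> 'a list, 'k) functional, y). x (\<lambda>(l, a). y (so_conc (\<chi> cc) l a))"
      have b: "?\<beta> \<in> bilinear_forms (So V A) (So V A)" by (rule so_product_form[OF \<chi>])
      have "t (so_pull V A ?\<beta>) = 0" using so_Delta(3)[OF V A tt b] t(2) by simp
      moreover have "t (so_pull V A ?\<beta>) = t (\<chi> c0)"
      proof (rule ev_cong[OF tt' so_pull_form[OF V A b] \<chi>])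
        fix g assume g: "g \<in> so_gens V A"
        obtain vs as where g': "g = (vs, as)" by (cases g)
        have "(2 ^ length vs * (of_nat (length as) + 1) - 2) * cc (length vs) (length as) = c0 (length vs) (length as)"
          using weight_nonzero[of "length vs" "length as"] by (auto simp: cc_def c0_def cV_def cA_def)
        then show "so_pull V A ?\<beta> g = \<chi> c0 g"
          using so_product_pull[OF \<chi>, of vs as cc] g by (simp add: g' \<chi>_def mult.assoc[symmetric])
      qed
      ultimately show ?thesis by simp
    qed
    have 2: "t (\<chi> cV) = 0"
    proof -
      let ?ll = "\<lambda>v. \<phi> ([v], [])"
      have "vsym V (*) (\<lambda>vs. \<phi> (vs, []))" using f by (simp add: vso_def)
      from vsym_slot[OF this, of "[]" "[]"] have ll: "slot_linear V (*) ?ll" by simp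
      note ll0 = slot_linear_0[OF V vector_space_mult ll]
      have "?ll (ger_proj V (so_rho V A t)) = t (\<lambda>g. ?ll (ger_proj V (so_rho V A (so_mon V A g))))"
        by (rule so_expand[OF V A slot_linear_cogen[OF ll] t(1)])
      also have "\<dots> = t (\<chi> cV)"
      proof (rule ev_cong[OF tt' _ \<chi>])
        show "(\<lambda>g. ?ll (ger_proj V (so_rho V A (so_mon V A g)))) \<in> so_forms V A"
          unfolding so_forms_iff by (rule so_univ[OF V A vector_space_mult slot_linear_cogen[OF ll]])
        fix g assume g: "g \<in> so_gens V A"
        obtain vs as where g': "g = (vs, as)" by (cases g)
        show "?ll (ger_proj V (so_rho V A (so_mon V A g))) = \<chi> cV g"
          unfolding g' cogen_mon[OF g[unfolded g']]
          using ll0 by (auto simp: \<chi>_def cV_def split: list.splits)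
      qed
      finally show ?thesis using t(4) ll0 by simp
    qed
    have 3: "t (\<chi> cA) = 0"
    proof -
      let ?ll = "\<lambda>a. \<phi> ([], [a])"
      have "vmult A (*) (\<lambda>as. \<phi> ([], as))" using f by (simp add: vso_def)
      from vmult_slot[OF this, of "[]" "[]"] have ll: "slot_linear A (*) ?ll" by simp
      note ll0 = slot_linear_0[OF A vector_space_mult ll]
      note sl = slot_linear_comp_Hom[OF so_proj(1)[OF V A] ll vs_So graded_vs[OF A]]
      have "?ll (so_proj V A t) = t (\<lambda>g. ?ll (so_proj V A (so_mon V A g)))"
        by (rule so_expand[OF V A sl t(1)])
      also have "\<dots> = t (\<chi> cA)"
      proof (rule ev_cong[OF tt' _ \<chi>])
        show "(\<lambda>g. ?ll (so_proj V A (so_mon V A g))) \<in> so_forms V A"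
          unfolding so_forms_iff by (rule so_univ[OF V A vector_space_mult sl])
        fix g assume g: "g \<in> so_gens V A"
        show "?ll (so_proj V A (so_mon V A g)) = \<chi> cA g"
          unfolding so_proj(2)[OF V A g]
          using ll0 by (auto simp: \<chi>_def cA_def split: list.splits prod.splits)
      qed
      finally show ?thesis using t(3) ll0 by simp
    qed
    define cVA where "cVA k m = cV k m + cA k m" for k m
    have "t \<phi> = t (\<chi> c0) + 1 * t (\<chi> cVA)"
      by (rule ev_linear[OF tt' \<chi> \<chi> True])
        (auto simp: \<chi>_def cVA_def c0_def cV_def cA_def split: prod.splits)
    moreover have "t (\<chi> cVA) = t (\<chi> cV) + 1 * t (\<chi> cA)"
      by (rule ev_linear[OF tt' \<chi> \<chi> \<chi>]) (auto simp: \<chi>_def cVA_def algebra_simps split: prod.splits)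
    ultimately show ?thesis using 1 2 3 by simp
  qed
qed

end

section \<open>Hochschild cochains\<close>

lemma scl_hoch [simp]: "scl (hoch A) = (\<lambda>c f as. scl A c (f as))"
  by (simp add: hoch_def)

lemma vs_hoch: "vector_space (scl A) \<Longrightarrow> vector_space (scl (hoch A))"
  using vector_space_scale[of "scl A"]
  by (unfold_locales) (simp_all add: fun_eq_iff mult.commute)

context
  fixes A :: "('k::field_char_0, 'a::ab_group_add) gvs"
  assumes A: "graded_space A"
begin

text \<open>The definition quantifies over all degrees in which the letters lie, here each letter is
  taken at its own degree. The two differ only at zero letters, which lie in every component, and
  there a multilinear map vanishes.\<close>

lemma hoch_cmp:
  "f \<in> cmp (hoch A) n \<longleftrightarrow> (\<forall>as. as \<notin> words A \<longrightarrow> f as = 0) \<and> vmult A (scl A) f \<and>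
     (\<forall>as\<in>words A. f as \<in> cmp A (wt (sdeg1 A) as + n))"
proof -
  have wt: "wt (sdeg1 A) as + n = sum_list (map (deg A) as) + n - int (length as)" for as
    by (induction as) (simp_all add: sdeg1_def)
  have "(\<forall>as\<in>words A. f as \<in> cmp A (wt (sdeg1 A) as + n)) \<longleftrightarrow>
    (\<forall>ks as. list_all2 (\<lambda>k a. a \<in> cmp A k) ks as \<longrightarrow> f as \<in> cmp A (sum_list ks + n - int (length as)))"
    if f: "vmult A (scl A) f"
  proof (intro iffI ballI allI impI)
    fix ks as assume h: "\<forall>as\<in>words A. f as \<in> cmp A (wt (sdeg1 A) as + n)" "list_all2 (\<lambda>k a. a \<in> cmp A k) ks as"
    have as: "as \<in> words A" using h(2) cmp_hmg by (induction rule: list_all2_induct) auto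
    show "f as \<in> cmp A (sum_list ks + n - int (length as))"
    proof (cases "0 \<in> set as")
      case True
      then show ?thesis using vmult_zero_letter[OF A graded_vs[OF A] f as] cmp_0[OF A] by simp
    next
      case False
      have "map (deg A) as = ks" using h(2) False
        by (induction rule: list_all2_induct) (auto simp: deg_eq[OF A])
      then show ?thesis using h(1) as wt[of as] by (auto simp: wt[symmetric])
    qed
  next
    fix as assume h: "\<forall>ks as. list_all2 (\<lambda>k a. a \<in> cmp A k) ks as \<longrightarrow> f as \<in> cmp A (sum_list ks + n - int (length as))"
      and as: "as \<in> words A"
    have "list_all2 (\<lambda>k a. a \<in> cmp A k) (map (deg A) as) as"
      using as hmg_cmp[OF A] by (simp add: list_all2_conv_all_nth in_lists_conv_set)
    then show "f as \<in> cmp A (wt (sdeg1 A) as + n)" using h by (simp add: wt)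
  qed
  then show ?thesis by (auto simp: hoch_def vmult_def)
qed

lemma hochD:
  assumes "f \<in> cmp (hoch A) n"
  shows "as \<notin> words A \<Longrightarrow> f as = 0" "vmult A (scl A) f" "as \<in> words A \<Longrightarrow> f as \<in> cmp A (wt (sdeg1 A) as + n)"
  using assms by (simp_all add: hoch_cmp)

lemma hoch_hmg: "f \<in> cmp (hoch A) n \<Longrightarrow> as \<in> words A \<Longrightarrow> f as \<in> hmg A"
  by (rule cmp_hmg[OF hochD(3)])

lemma graded_hoch: "graded_space (hoch A)"
  unfolding graded_space_def
proof (intro conjI allI impI ballI)
  show vs: "vector_space (scl (hoch A))" by (rule vs_hoch[OF graded_vs[OF A]])
  interpret H: vector_space "scl (hoch A)" by (rule vs)
  note vm = vmult_additive[OF graded_vs[OF A]]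
  show "module.subspace (scl (hoch A)) (cmp (hoch A) n)" for n
  proof (rule H.subspaceI)
    show "0 \<in> cmp (hoch A) n"
      using additive_on_0[OF vm] by (simp add: hoch_cmp cmp_0[OF A])
    fix f g assume fg: "f \<in> cmp (hoch A) n" "g \<in> cmp (hoch A) n"
    then show "f + g \<in> cmp (hoch A) n"
      using additive_on_add[OF vm, of f _ g] by (simp add: hoch_cmp cmp_add[OF A])
  next
    fix c f assume f: "f \<in> cmp (hoch A) n"
    have "vmult A (scl A) (\<lambda>as. scl A c (f as))"
      by (rule vmultI) (rule slot_linear_scale_const[OF graded_vs[OF A] vmult_slot[OF hochD(2)[OF f]]])
    then show "scl (hoch A) c f \<in> cmp (hoch A) n"
      using f by (simp add: hoch_cmp cmp_scale[OF A] vector_space_scale[OF graded_vs[OF A]])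
  qed
next
  fix N x n assume N: "finite N" "\<forall>n\<in>N. x n \<in> cmp (hoch A) n" "(\<Sum>n\<in>N. x n) = 0" "n \<in> N"
  show "x n = 0"
  proof
    fix as show "x n as = 0 as"
    proof (cases "as \<in> words A")
      case False then show ?thesis using N hochD(1) by fastforce
    next
      case True
      \<comment> \<open>At a fixed word the values \<open>x n as\<close> lie in distinct components
        of \<open>A\<close>, shifted by the weight of the word, so directness in \<open>A\<close>
        applies.\<close>
      let ?N = "(\<lambda>n. wt (sdeg1 A) as + n) ` N" and ?x = "\<lambda>m. x (m - wt (sdeg1 A) as) as"
      have "(\<Sum>m\<in>?N. ?x m) = (\<Sum>n\<in>N. x n as)" by (subst sum.reindex) (auto simp: inj_on_def)
      also have "\<dots> = 0" using N(3) by (simp add: sum_fun_apply[symmetric])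
      finally have 1: "(\<Sum>m\<in>?N. ?x m) = 0" .
      have 2: "\<forall>m\<in>?N. ?x m \<in> cmp A m" using N(2) hochD(3)[OF _ True] by auto
      have 3: "finite ?N" using N(1) by simp
      have "\<forall>N x. finite N \<longrightarrow> (\<forall>n\<in>N. x n \<in> cmp A n) \<longrightarrow> (\<Sum>n\<in>N. x n) = 0 \<longrightarrow> (\<forall>n\<in>N. x n = 0)"
        using A unfolding graded_space_def by (elim conjE)
      from this[THEN spec[of _ ?N], THEN spec[of _ ?x], THEN mp, OF 3, THEN mp, OF 2, THEN mp, OF 1]
      have "\<forall>m\<in>?N. ?x m = 0" .
      then show ?thesis using N(4) by simp
    qed
  qed
qed

lemma hoch_zero_letter:
  assumes "f \<in> cmp (hoch A) n"
  shows "f (x @ 0 # z) = 0"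
proof (cases "x @ 0 # z \<in> words A")
  case True
  then show ?thesis using vmult_zero_letter[OF A graded_vs[OF A] hochD(2)[OF assms]] by simp
qed (use hochD(1)[OF assms] in simp)

lemma hoch_ins_outside:
  assumes f: "f \<in> cmp (hoch A) a" and g: "g \<in> cmp (hoch A) b" and "x @ y @ z \<notin> words A"
  shows "f (x @ g y # z) = 0"
proof (cases "y \<in> words A")
  case True
  then show ?thesis using assms(3) by (intro hochD(1)[OF f]) auto
next
  case False
  then show ?thesis using hochD(1)[OF g False] hoch_zero_letter[OF f] by simp
qed

lemma hoch_ins_cmp:
  assumes f: "f \<in> cmp (hoch A) a" and g: "g \<in> cmp (hoch A) b" and w: "x \<in> words A" "y \<in> words A" "z \<in> words A"
  shows "f (x @ g y # z) \<in> cmp A (wt (sdeg1 A) (x @ y @ z) + (a + b - 1))"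
proof (cases "g y = 0")
  case True
  then show ?thesis using hoch_zero_letter[OF f] cmp_0[OF A] by simp
next
  case False
  have "deg A (g y) = wt (sdeg1 A) y + b" by (rule deg_eq[OF A hochD(3)[OF g w(2)] False])
  moreover have "x @ g y # z \<in> words A" using w hoch_hmg[OF g] by simp
  ultimately show ?thesis using hochD(3)[OF f, of "x @ g y # z"] by (simp add: sdeg1_def algebra_simps)
qed

text \<open>The inserted letter \<open>g y\<close> has the expected degree unless it is 0, and the
  premise covers that case.\<close>

lemma sign_letter:
  assumes g: "g \<in> cmp (hoch A) b" and y: "y \<in> words A" and "g y = 0 \<Longrightarrow> v = 0"
  shows "ksign (sdeg1 A (g y) * p) v = ksign ((wt (sdeg1 A) y + b - 1) * p) v"
proof (cases "g y = 0")
  case False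
  then show ?thesis using deg_eq[OF A hochD(3)[OF g y]] by (simp add: sdeg1_def)
qed (use assms(3) in simp)

text \<open>Follows the recursion of \<open>Ins\<close>: the inserted \<open>g\<close> consumes a
  beginning of the word or leaves the first letter in place, and the sign for passing that letter is
  constant on its component.\<close>

lemma vmult_Ins:
  assumes s: "vector_space s" and K: "vmult A s K" and g: "g \<in> cmp (hoch A) b"
  shows "vmult A s (Ins (sdeg1 A) p g K)"
proof (rule vmultI)
  fix xs ys assume xy: "xs \<in> words A" and ys: "ys \<in> words A"
  note sub = graded_subspace[OF A]
  have "\<forall>x\<in>set xs. x \<in> hmg A" using xy by (simp add: in_lists_conv_set)
  then show "slot_linear A s (\<lambda>u. Ins (sdeg1 A) p g K (xs @ u # ys))" using K
  proof (induction xs arbitrary: K)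
    case Nil
    have "slot_linear A s (\<lambda>u. dec (\<lambda>y z. K (g y # z)) (u # ys))"
    proof -
      have "vmult A s (dec (\<lambda>y z. K (g y # z)))"
      proof (rule vmult_dec[OF s])
        fix y assume y: "y \<in> words A"
        show "vmult A s (\<lambda>z. K (g y # z))" by (rule vmult_Cons[OF Nil.prems(2) hoch_hmg[OF g y]])
        show "vmult A s (\<lambda>x. K (g x # y))"
        proof (rule vmult_comp[OF A graded_vs[OF A] sub hochD(2)[OF g]])
          show "g l \<in> cmp A (wt (\<lambda>x. deg A x - 1) l + b)" if "l \<in> words A" for l
            using hochD(3)[OF g that] by (simp add: sdeg1_eq)
          show "slot_linear A s (\<lambda>a. K (a # y))"
            using vmult_slot[OF Nil.prems(2), of "[]" y] y by simp
        qed
      qed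
      from vmult_slot[OF this, of "[]" ys] ys show ?thesis by simp
    qed
    moreover have "slot_linear A s (\<lambda>u. ksign (p * sdeg1 A u) (Ins (sdeg1 A) p g (\<lambda>w. K (u # w)) ys))"
    proof -
      have "slot_linear A s (\<lambda>u. Ins (sdeg1 A) p g (\<lambda>w. K (u # w)) ys)"
      proof (rule slot_linear_Ins[OF s])
        fix x y z assume "ys = x @ y @ z"
        then have "x \<in> words A" "y \<in> words A" "z \<in> words A" using ys by auto
        then have "x @ g y # z \<in> words A" using hoch_hmg[OF g] by simp
        then show "slot_linear A s (\<lambda>u. K (u # x @ g y # z))"
          using vmult_slot[OF Nil.prems(2), of "[]" "x @ g y # z"] by simp
      qed
      from slot_linear_sign[OF A s this, of "\<lambda>n. p * (n - 1)"] show ?thesis by (simp add: sdeg1_def)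
    qed
    ultimately show ?case using slot_linear_add[OF s] by simp
  next
    case (Cons x xs)
    have x: "x \<in> hmg A" and xs: "x # xs \<in> words A" using Cons.prems(1) by (simp_all add: in_lists_conv_set)
    have "vmult A s (dec (\<lambda>y z. K (g y # z)))"
    proof (rule vmult_dec[OF s])
      fix y assume y: "y \<in> words A"
      show "vmult A s (\<lambda>z. K (g y # z))" by (rule vmult_Cons[OF Cons.prems(2) hoch_hmg[OF g y]])
      show "vmult A s (\<lambda>x. K (g x # y))"
      proof (rule vmult_comp[OF A graded_vs[OF A] sub hochD(2)[OF g]])
        show "g l \<in> cmp A (wt (\<lambda>x. deg A x - 1) l + b)" if "l \<in> words A" for l
          using hochD(3)[OF g that] by (simp add: sdeg1_eq)
        show "slot_linear A s (\<lambda>a. K (a # y))"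
          using vmult_slot[OF Cons.prems(2), of "[]" y] y by simp
      qed
    qed
    from vmult_slot[OF this xs ys]
    have 1: "slot_linear A s (\<lambda>u. dec (\<lambda>y z. K (g y # z)) (x # xs @ u # ys))" by simp
    have 2: "slot_linear A s (\<lambda>u. ksign (p * sdeg1 A x) (Ins (sdeg1 A) p g (\<lambda>w. K (x # w)) (xs @ u # ys)))"
      using Cons.prems by (intro slot_linear_ksign_const[OF s] Cons.IH vmult_Cons x) simp_all
    show ?case using slot_linear_add[OF s 1 2] by simp
  qed
qed

lemma Ins_hoch:
  assumes f: "f \<in> cmp (hoch A) a" and g: "g \<in> cmp (hoch A) b"
  shows "Ins (sdeg1 A) p g f \<in> cmp (hoch A) (a + b - 1)"
  unfolding hoch_cmp
proof (intro conjI allI impI ballI)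
  show "vmult A (scl A) (Ins (sdeg1 A) p g f)" by (rule vmult_Ins[OF graded_vs[OF A] hochD(2)[OF f] g])
  show "Ins (sdeg1 A) p g f as = 0" if "as \<notin> words A" for as
    by (rule Ins_zeroI) (use hoch_ins_outside[OF f g] that in auto)
  fix as assume as: "as \<in> words A"
  show "Ins (sdeg1 A) p g f as \<in> cmp A (wt (sdeg1 A) as + (a + b - 1))"
  proof (rule Ins_additive_on[OF cmp_additive_on[OF A], THEN conjunct1])
    fix x y z assume e: "as = x @ y @ z"
    then have "x \<in> words A" "y \<in> words A" "z \<in> words A" using as by auto
    from hoch_ins_cmp[OF f g this] show "f (x @ g y # z) \<in> cmp A (wt (sdeg1 A) as + (a + b - 1))"
      unfolding e .
  qed
qed

section \<open>The Gerstenhaber bracket and its Jacobi identity\<close>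

lemma insertion_Ins:
  assumes f: "f \<in> cmp (hoch A) a" and g: "g \<in> cmp (hoch A) b"
  shows "insertion A f g = Ins (sdeg1 A) (b - 1) g f"
proof
  fix as
  have "insertion A f g as = Ins (sdeg1 A) (deg (hoch A) g - 1) g f as"
  proof -
    have "(\<Sum>j\<le>length as - i. ksign n (f (take i as @ g (take j (drop i as)) # drop (i + j) as))) =
        ksign n (dec (\<lambda>y z. f (take i as @ g y # z)) (drop i as))" for i n
      using dec_eq_sum[of "\<lambda>y z. ksign n (f (take i as @ g y # z))" "drop i as"]
      by (simp add: dec_ksign add.commute)
    then show ?thesis unfolding insertion_def Ins_eq_dec dec_eq_sum[symmetric] by simp
  qed
  also have "\<dots> = Ins (sdeg1 A) (b - 1) g f as"
  \<comment> \<open>The zero cochain has no degree, but all of its insertions vanish.\<close>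
  proof (cases "g = 0")
    case True
    have "Ins (sdeg1 A) p g f as = 0" for p by (rule Ins_zeroI) (simp add: True hoch_zero_letter[OF f])
    then show ?thesis by simp
  qed (simp add: deg_eq[OF graded_hoch g])
  finally show "insertion A f g as = Ins (sdeg1 A) (b - 1) g f as" .
qed

lemma gerst_eq:
  assumes f: "f \<in> cmp (hoch A) a" and g: "g \<in> cmp (hoch A) b"
  shows "gerst_bracket A f g = Ins (sdeg1 A) (b - 1) g f - ksign ((a - 1) * (b - 1)) (Ins (sdeg1 A) (a - 1) f g)"
proof -
  have "ksign ((deg (hoch A) f - 1) * (deg (hoch A) g - 1)) (Ins (sdeg1 A) (a - 1) f g) = ksign ((a - 1) * (b - 1)) (Ins (sdeg1 A) (a - 1) f g)"
  proof (cases "f = 0 \<or> g = 0")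
    case True
    then have "Ins (sdeg1 A) (a - 1) f g as = 0" for as
      by (intro Ins_zeroI) (auto simp: hoch_zero_letter[OF g])
    then have "Ins (sdeg1 A) (a - 1) f g = 0" by auto
    then show ?thesis by simp
  qed (simp add: deg_eq[OF graded_hoch f] deg_eq[OF graded_hoch g])
  then show ?thesis unfolding gerst_bracket_def insertion_Ins[OF f g] insertion_Ins[OF g f] by simp
qed

lemma gerst_cmp:
  assumes f: "f \<in> cmp (hoch A) a" and g: "g \<in> cmp (hoch A) b"
  shows "gerst_bracket A f g \<in> cmp (hoch A) (a + b - 1)"
  unfolding gerst_eq[OF assms]
  using Ins_hoch[OF f g] Ins_hoch[OF g f]
  by (intro cmp_diff[OF graded_hoch] cmp_ksign[OF graded_hoch]) (simp_all add: add.commute)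

lemma gerst_antisym:
  assumes f: "f \<in> cmp (hoch A) a" and g: "g \<in> cmp (hoch A) b"
  shows "gerst_bracket A g f = - ksign ((a - 1) * (b - 1)) (gerst_bracket A f g)"
  unfolding gerst_eq[OF f g] gerst_eq[OF g f]
  by (simp add: ksign_def mult.commute)

lemma ksign_diff: "ksign n (x - y) = ksign n x - ksign n y"
  by (simp add: ksign_def)

lemma Ins_diff: "Ins (sdeg1 A) p g (\<lambda>w. K w - L w) as = Ins (sdeg1 A) p g K as - Ins (sdeg1 A) p g L as"
  using Ins_add[of "sdeg1 A" p g K "\<lambda>w. - L w" as] by (simp add: Ins_uminus)

text \<open>One step of the recursion for both insertions. The four summands: \<open>g\<close>
  stands at the front and contains \<open>h\<close>; \<open>g\<close> stands at the front with
  \<open>h\<close> to its right; \<open>h\<close> stands at the front with \<open>g\<close> to its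
  right; both leave the first letter alone. In the third, \<open>g\<close> passes the letter made by
  \<open>h\<close>, which produces \<open>ksign (p * r)\<close>.\<close>

lemma Ins_Ins_expand:
  assumes s: "vector_space s" and g: "g \<in> cmp (hoch A) b" and h: "h \<in> cmp (hoch A) c"
    and p: "p = b - 1" and r: "r = c - 1" and as: "as \<in> words A" and K: "vmult A s K"
  shows "Ins (sdeg1 A) r h (Ins (sdeg1 A) p g K) as =
    dec (\<lambda>x y. K (Ins (sdeg1 A) r h g x # y)) as +
    (dec (\<lambda>x y. ksign (r * wt (sdeg1 A) x) (Ins (sdeg1 A) r h (\<lambda>z. K (g x # z)) y)) as +
     (ksign (p * r) (dec (\<lambda>x y. ksign (p * wt (sdeg1 A) x) (Ins (sdeg1 A) p g (\<lambda>z. K (h x # z)) y)) as) +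
      (case as of [] \<Rightarrow> 0 | a # w \<Rightarrow> ksign (r * sdeg1 A a + p * sdeg1 A a) (Ins (sdeg1 A) r h (Ins (sdeg1 A) p g (\<lambda>w. K (a # w))) w))))"
proof -
  define N where "N p g K as = (case as of [] \<Rightarrow> 0 | a # w \<Rightarrow> ksign (p * sdeg1 A a) (Ins (sdeg1 A) p g (\<lambda>w. K (a # w)) w))"
    for p g and K :: "'a list \<Rightarrow> 'b" and as
  have split: "Ins (sdeg1 A) p g K as = dec (\<lambda>y z. K (g y # z)) as + N p g K as" for p g K as
    by (cases as) (simp_all add: N_def)
  have words: "x \<in> words A" "y \<in> words A" if "as = x @ y" for x y using that as by auto
  have 1: "Ins (sdeg1 A) r h (dec (\<lambda>y z. K (g y # z))) as =
    dec (\<lambda>x y. K (Ins (sdeg1 A) r h g x # y)) as +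
    dec (\<lambda>x y. ksign (r * wt (sdeg1 A) x) (Ins (sdeg1 A) r h (\<lambda>z. K (g x # z)) y)) as"
    unfolding Ins_dec dec_add[symmetric]
  proof (rule dec_cong)
    fix x y assume e: "as = x @ y"
    have "Ins (sdeg1 A) r h g x \<in> cmp A (wt (sdeg1 A) x + (b + c - 1)) \<and>
      K (Ins (sdeg1 A) r h g x # y) = Ins (sdeg1 A) r h (\<lambda>w. K (g w # y)) x"
    proof (rule Ins_additive_on[where T = "\<lambda>v. K (v # y)"])
      show "additive_on (cmp A (wt (sdeg1 A) x + (b + c - 1))) (\<lambda>v. K (v # y))"
        using slot_linear_additive_on[OF A s vmult_slot[OF K, of "[]" y]] words[OF e] by simp
      fix x1 y1 z1 assume x: "x = x1 @ y1 @ z1"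
      then have "x1 \<in> words A" "y1 \<in> words A" "z1 \<in> words A" using words[OF e] by auto
      from hoch_ins_cmp[OF g h this] show "g (x1 @ h y1 # z1) \<in> cmp A (wt (sdeg1 A) x + (b + c - 1))" unfolding x .
    qed
    then show "Ins (sdeg1 A) r h (\<lambda>w. K (g w # y)) x + ksign (r * wt (sdeg1 A) x) (Ins (sdeg1 A) r h (\<lambda>z. K (g x # z)) y) =
        K (Ins (sdeg1 A) r h g x # y) + ksign (r * wt (sdeg1 A) x) (Ins (sdeg1 A) r h (\<lambda>z. K (g x # z)) y)" by simp
  qed
  have 2: "dec (\<lambda>y z. N p g K (h y # z)) as =
    ksign (p * r) (dec (\<lambda>x y. ksign (p * wt (sdeg1 A) x) (Ins (sdeg1 A) p g (\<lambda>z. K (h x # z)) y)) as)"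
    unfolding dec_ksign[symmetric]
  proof (rule dec_cong)
    fix x y assume e: "as = x @ y"
    note xy = words[OF e]
    have z: "Ins (sdeg1 A) p g (\<lambda>z. K (h x # z)) y = 0" if "h x = 0"
    proof (rule Ins_zeroI)
      fix x1 y1 z1 assume "y = x1 @ y1 @ z1"
      then have "x1 @ g y1 # z1 \<in> words A" using xy hoch_hmg[OF g, of y1] by auto
      then show "K (h x # x1 @ g y1 # z1) = 0"
        using vmult_letter_zero[OF A s K, of "[]"] that by simp
    qed
    have "N p g K (h x # y) = ksign (sdeg1 A (h x) * p) (Ins (sdeg1 A) p g (\<lambda>z. K (h x # z)) y)"
      by (simp add: N_def mult.commute)
    also have "\<dots> = ksign ((wt (sdeg1 A) x + c - 1) * p) (Ins (sdeg1 A) p g (\<lambda>z. K (h x # z)) y)"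
      by (rule sign_letter[OF h xy(1) z])
    finally show "N p g K (h x # y) = ksign (p * r) (ksign (p * wt (sdeg1 A) x) (Ins (sdeg1 A) p g (\<lambda>z. K (h x # z)) y))"
      by (simp add: r algebra_simps)
  qed
  have 3: "N r h (N p g K) as =
    (case as of [] \<Rightarrow> 0 | a # w \<Rightarrow> ksign (r * sdeg1 A a + p * sdeg1 A a) (Ins (sdeg1 A) r h (Ins (sdeg1 A) p g (\<lambda>w. K (a # w))) w))"
  proof (cases as)
    case (Cons a w)
    have "N r h (N p g K) as = ksign (r * sdeg1 A a) (Ins (sdeg1 A) r h (\<lambda>w. ksign (p * sdeg1 A a) (Ins (sdeg1 A) p g (\<lambda>w. K (a # w)) w)) w)"
      unfolding Cons by (simp add: N_def)
    then show ?thesis unfolding Ins_ksign by (simp add: Cons)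
  qed (simp add: N_def)
  have "Ins (sdeg1 A) r h (Ins (sdeg1 A) p g K) as = Ins (sdeg1 A) r h (\<lambda>w. dec (\<lambda>y z. K (g y # z)) w + N p g K w) as"
    by (rule Ins_cong) (rule split)
  also have "\<dots> = Ins (sdeg1 A) r h (dec (\<lambda>y z. K (g y # z))) as + (dec (\<lambda>y z. N p g K (h y # z)) as + N r h (N p g K) as)"
    unfolding Ins_add by (simp only: split[of r h "N p g K"])
  finally show ?thesis unfolding 1 2 3 by (simp only: add.assoc)
qed

text \<open>The right pre-Lie identity: in \<open>(K \<circ> g) \<circ> h\<close>, the terms in which \<open>h\<close> is not inserted into \<open>g\<close>
  are symmetric in \<open>g\<close> and \<open>h\<close>.\<close>

lemma Ins_Ins:
  assumes s: "vector_space s" and g: "g \<in> cmp (hoch A) b" and h: "h \<in> cmp (hoch A) c"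
    and p: "p = b - 1" and r: "r = c - 1" and as: "as \<in> words A" and K: "vmult A s K"
  shows "Ins (sdeg1 A) r h (Ins (sdeg1 A) p g K) as - ksign (p * r) (Ins (sdeg1 A) p g (Ins (sdeg1 A) r h K) as) =
     Ins (sdeg1 A) (p + r) (Ins (sdeg1 A) r h g) K as - ksign (p * r) (Ins (sdeg1 A) (p + r) (Ins (sdeg1 A) p g h) K as)"
proof -
  have "\<forall>x\<in>set as. x \<in> hmg A" using as by (simp add: in_lists_conv_set)
  then show ?thesis using K
  proof (induction as arbitrary: K)
    case Nil
    have n: "[] \<in> words A" by simp
    show ?case
      unfolding Ins_Ins_expand[OF s g h p r n Nil(2)] Ins_Ins_expand[OF s h g r p n Nil(2)]
      by (simp add: ksign_def mult.commute)
  next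
    case (Cons a as)
    have w: "a # as \<in> words A" using Cons.prems(1) by (simp add: in_lists_conv_set)
    have IH: "Ins (sdeg1 A) r h (Ins (sdeg1 A) p g (\<lambda>w. K (a # w))) as - ksign (p * r) (Ins (sdeg1 A) p g (Ins (sdeg1 A) r h (\<lambda>w. K (a # w))) as) =
     Ins (sdeg1 A) (p + r) (Ins (sdeg1 A) r h g) (\<lambda>w. K (a # w)) as - ksign (p * r) (Ins (sdeg1 A) (p + r) (Ins (sdeg1 A) p g h) (\<lambda>w. K (a # w)) as)"
      by (rule Cons.IH) (use Cons.prems in \<open>auto intro: vmult_Cons\<close>)
    let ?e = "r * sdeg1 A a + p * sdeg1 A a"
    have e: "(p + r) * sdeg1 A a = ?e" "p * sdeg1 A a + r * sdeg1 A a = ?e" "r * p = p * r" by (simp_all add: algebra_simps)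
    have IH': "ksign ?e (Ins (sdeg1 A) r h (Ins (sdeg1 A) p g (\<lambda>w. K (a # w))) as) -
        ksign (p * r) (ksign ?e (Ins (sdeg1 A) p g (Ins (sdeg1 A) r h (\<lambda>w. K (a # w))) as)) =
      ksign ?e (Ins (sdeg1 A) (p + r) (Ins (sdeg1 A) r h g) (\<lambda>w. K (a # w)) as) -
        ksign (p * r) (ksign ?e (Ins (sdeg1 A) (p + r) (Ins (sdeg1 A) p g h) (\<lambda>w. K (a # w)) as))"
      using arg_cong[OF IH, of "ksign ?e"] by (simp only: ksign_diff ksign_ksign add.commute[of "p * r"])
    \<comment> \<open>\<open>X\<close> and \<open>Y\<close> are the terms with two disjoint
      insertions, one of them at the front. They trade places when \<open>g\<close> and
      \<open>h\<close> are exchanged and cancel because of the sign \<open>p * r\<close>.\<close>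
    have cancel: "P + (X + (ksign (p * r) Y + T)) - ksign (p * r) (P' + (Y + (ksign (p * r) X + T'))) =
        P + R - ksign (p * r) (P' + R')" if "T - ksign (p * r) T' = R - ksign (p * r) R'" for P X Y T P' T' R R' :: 'b
    proof -
      have "P + (X + (ksign (p * r) Y + T)) - ksign (p * r) (P' + (Y + (ksign (p * r) X + T'))) =
          P - ksign (p * r) P' + (T - ksign (p * r) T')"
        by (simp add: ksign_def)
      then show ?thesis unfolding that by (simp add: ksign_add algebra_simps)
    qed
    have R: "Ins (sdeg1 A) (p + r) F K (a # as) =
        dec (\<lambda>x y. K (F x # y)) (a # as) + ksign ?e (Ins (sdeg1 A) (p + r) F (\<lambda>w. K (a # w)) as)" for F
      by (simp only: Ins.simps(2) e)
    show ?case
      unfolding Ins_Ins_expand[OF s g h p r w Cons.prems(2)] Ins_Ins_expand[OF s h g r p w Cons.prems(2)] list.case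
        R e
      by (rule cancel) (rule IH')
  qed
qed

lemma Ins_inner_diff:
  assumes f: "f \<in> cmp (hoch A) a" and F: "F \<in> cmp (hoch A) e" and G: "G \<in> cmp (hoch A) e" and as: "as \<in> words A"
  shows "Ins (sdeg1 A) p (\<lambda>y. F y - G y) f as = Ins (sdeg1 A) p F f as - Ins (sdeg1 A) p G f as"
proof -
  have "Ins (sdeg1 A) p (\<lambda>y. F y - G y) f as + Ins (sdeg1 A) p G f as = Ins (sdeg1 A) p F f as"
    unfolding Ins_eq_dec dec_add[symmetric] ksign_add[symmetric]
  proof (intro dec_cong arg_cong[where f = "ksign _"])
    fix x v y z assume "as = x @ v" "v = y @ z"
    then have w: "x \<in> words A" "y \<in> words A" "z \<in> words A" using as by auto
    note ad = slot_linear_additive_on[OF A graded_vs[OF A] vmult_slot[OF hochD(2)[OF f] w(1,3)]]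
    from additive_on_diff[OF ad hochD(3)[OF F w(2)] hochD(3)[OF G w(2)]]
    show "f (x @ (F y - G y) # z) + f (x @ G y # z) = f (x @ F y # z)" by simp
  qed
  then show ?thesis by (simp add: algebra_simps)
qed

lemma Ins_inner_ksign:
  assumes f: "f \<in> cmp (hoch A) a" and F: "F \<in> cmp (hoch A) e" and as: "as \<in> words A"
  shows "Ins (sdeg1 A) p (\<lambda>y. ksign n (F y)) f as = ksign n (Ins (sdeg1 A) p F f as)"
proof -
  have "Ins (sdeg1 A) p (\<lambda>y. ksign n (F y)) f as = Ins (sdeg1 A) p F (\<lambda>w. ksign n (f w)) as"
  proof (rule Ins_cong)
    fix x y z assume "as = x @ y @ z"
    then have w: "x \<in> words A" "y \<in> words A" "z \<in> words A" using as by auto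
    from slot_linear_ksign[OF A graded_vs[OF A] vmult_slot[OF hochD(2)[OF f] w(1,3)] hochD(3)[OF F w(2)]]
    show "f (x @ ksign n (F y) # z) = ksign n (f (x @ F y # z))" .
  qed
  then show ?thesis by (simp add: Ins_ksign)
qed

lemma gerst_gerst:
  assumes f: "f \<in> cmp (hoch A) (i + 1)" and g: "g \<in> cmp (hoch A) (j + 1)" and h: "h \<in> cmp (hoch A) (k + 1)"
    and as: "as \<in> words A"
  shows "gerst_bracket A (gerst_bracket A f g) h as =
     Ins (sdeg1 A) k h (Ins (sdeg1 A) j g f) as - ksign (i * j) (Ins (sdeg1 A) k h (Ins (sdeg1 A) i f g) as) -
     ksign ((i + j) * k) (Ins (sdeg1 A) (i + j) (Ins (sdeg1 A) j g f) h as - ksign (i * j) (Ins (sdeg1 A) (i + j) (Ins (sdeg1 A) i f g) h as))"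
proof -
  have fg: "gerst_bracket A f g = (\<lambda>w. Ins (sdeg1 A) j g f w - ksign (i * j) (Ins (sdeg1 A) i f g w))"
    using gerst_eq[OF f g] by (simp add: fun_eq_iff ksign_apply)
  have c: "gerst_bracket A f g \<in> cmp (hoch A) (i + j + 1)"
    using gerst_cmp[OF f g] by (simp add: algebra_simps)
  have 1: "Ins (sdeg1 A) j g f \<in> cmp (hoch A) (i + j + 1)" "Ins (sdeg1 A) i f g \<in> cmp (hoch A) (i + j + 1)"
    using Ins_hoch[OF f g, of j] Ins_hoch[OF g f, of i] by (simp_all add: algebra_simps)
  have 2: "(\<lambda>w. ksign (i * j) (Ins (sdeg1 A) i f g w)) \<in> cmp (hoch A) (i + j + 1)"
  proof -
    have "(\<lambda>w. ksign (i * j) (Ins (sdeg1 A) i f g w)) = ksign (i * j) (Ins (sdeg1 A) i f g)"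
      by (simp add: fun_eq_iff ksign_apply)
    then show ?thesis using cmp_ksign[OF graded_hoch 1(2), of "i * j"] by simp
  qed
  have "gerst_bracket A (gerst_bracket A f g) h as =
    Ins (sdeg1 A) k h (gerst_bracket A f g) as - ksign ((i + j) * k) (Ins (sdeg1 A) (i + j) (gerst_bracket A f g) h as)"
    using gerst_eq[OF c h] by (simp add: ksign_apply)
  then show ?thesis
    unfolding fg Ins_diff Ins_ksign Ins_inner_diff[OF h 1(1) 2 as] Ins_inner_ksign[OF h 1(2) as] .
qed

text \<open>As for any pre-Lie product, the Jacobi identity is a signed cyclic sum of three
  instances of the pre-Lie identity \<open>Ins_Ins\<close>. The terms named \<open>T\<close> are of
  type \<open>(f o g) o h\<close>, those named \<open>U\<close> of type \<open>f o (g o h)\<close>;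
  the identities eliminate the latter.\<close>

lemma gerst_jacobi:
  assumes f: "f \<in> cmp (hoch A) (i + 1)" and g: "g \<in> cmp (hoch A) (j + 1)" and h: "h \<in> cmp (hoch A) (k + 1)"
  shows "ksign (i * k) (gerst_bracket A (gerst_bracket A f g) h) +
     ksign (j * i) (gerst_bracket A (gerst_bracket A g h) f) +
     ksign (k * j) (gerst_bracket A (gerst_bracket A h f) g) = 0"
proof
  fix as
  show "(ksign (i * k) (gerst_bracket A (gerst_bracket A f g) h) +
     ksign (j * i) (gerst_bracket A (gerst_bracket A g h) f) +
     ksign (k * j) (gerst_bracket A (gerst_bracket A h f) g)) as = 0 as"
  proof (cases "as \<in> words A")
    case False
    then show ?thesis
      using hochD(1)[OF gerst_cmp[OF gerst_cmp[OF f g] h]] hochD(1)[OF gerst_cmp[OF gerst_cmp[OF g h] f]]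
        hochD(1)[OF gerst_cmp[OF gerst_cmp[OF h f] g]] by (simp add: ksign_apply)
  next
    case as: True
    note vs = graded_vs[OF A]
    define T1 T1' T2 T2' T3 T3' where
      "T1 = Ins (sdeg1 A) k h (Ins (sdeg1 A) j g f) as" "T1' = Ins (sdeg1 A) j g (Ins (sdeg1 A) k h f) as"
      "T2 = Ins (sdeg1 A) i f (Ins (sdeg1 A) k h g) as" "T2' = Ins (sdeg1 A) k h (Ins (sdeg1 A) i f g) as"
      "T3 = Ins (sdeg1 A) j g (Ins (sdeg1 A) i f h) as" "T3' = Ins (sdeg1 A) i f (Ins (sdeg1 A) j g h) as"
    define U1 U1' U2 U2' U3 U3' where
      "U1 = Ins (sdeg1 A) (j + k) (Ins (sdeg1 A) k h g) f as" "U1' = Ins (sdeg1 A) (j + k) (Ins (sdeg1 A) j g h) f as"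
      "U2 = Ins (sdeg1 A) (k + i) (Ins (sdeg1 A) i f h) g as" "U2' = Ins (sdeg1 A) (k + i) (Ins (sdeg1 A) k h f) g as"
      "U3 = Ins (sdeg1 A) (i + j) (Ins (sdeg1 A) j g f) h as" "U3' = Ins (sdeg1 A) (i + j) (Ins (sdeg1 A) i f g) h as"
    note defs = T1_T1'_T2_T2'_T3_T3'_def U1_U1'_U2_U2'_U3_U3'_def
    have 1: "T1 - ksign (j * k) T1' = U1 - ksign (j * k) U1'"
      unfolding defs using Ins_Ins[OF vs g h _ _ as hochD(2)[OF f], of j k] by simp
    have 2: "T2 - ksign (k * i) T2' = U2 - ksign (k * i) U2'"
      unfolding defs using Ins_Ins[OF vs h f _ _ as hochD(2)[OF g], of k i] by simp
    have 3: "T3 - ksign (i * j) T3' = U3 - ksign (i * j) U3'"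
      unfolding defs using Ins_Ins[OF vs f g _ _ as hochD(2)[OF h], of i j] by simp
    have e: "gerst_bracket A (gerst_bracket A f g) h as = T1 - ksign (i * j) T2' - ksign ((i + j) * k) (U3 - ksign (i * j) U3')"
      "gerst_bracket A (gerst_bracket A g h) f as = T2 - ksign (j * k) T3' - ksign ((j + k) * i) (U1 - ksign (j * k) U1')"
      "gerst_bracket A (gerst_bracket A h f) g as = T3 - ksign (k * i) T1' - ksign ((k + i) * j) (U2 - ksign (k * i) U2')"
      using gerst_gerst[OF f g h as] gerst_gerst[OF g h f as] gerst_gerst[OF h f g as] unfolding defs by simp_all
    have "ksign (i * k) (T1 - ksign (i * j) T2' - ksign ((i + j) * k) (U3 - ksign (i * j) U3')) +
      ksign (j * i) (T2 - ksign (j * k) T3' - ksign ((j + k) * i) (U1 - ksign (j * k) U1')) +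
      ksign (k * j) (T3 - ksign (k * i) T1' - ksign ((k + i) * j) (U2 - ksign (k * i) U2')) = 0"
      unfolding 1[symmetric] 2[symmetric] 3[symmetric]
      by (cases "even i"; cases "even j"; cases "even k") (simp_all add: ksign_def)
    then show ?thesis by (simp add: e ksign_apply)
  qed
qed

end

section \<open>Coderivations and morphisms of the cofree cocommutative coalgebra\<close>

text \<open>The transpose of \<open>tensor_leibniz\<close> on bilinear forms.\<close>

definition leib where
  "leib X Q \<beta> = (\<lambda>(x, y). \<beta> (Q x, y) + ksign (deg X x) (\<beta> (x, Q y)))"

lemma tensor_eqI:
  "t \<in> tot (tensor X X) \<Longrightarrow> t' \<in> tot (tensor X X) \<Longrightarrow>
   (\<And>\<beta>. \<beta> \<in> bilinear_forms X X \<Longrightarrow> t \<beta> = t' \<beta>) \<Longrightarrow> t = t'"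
  unfolding tensor_def by (rule presented_eqI)

lemma leib_form: "graded_space X \<Longrightarrow> Q \<in> Hom X X 1 \<Longrightarrow> \<beta> \<in> bilinear_forms X X \<Longrightarrow> leib X Q \<beta> \<in> bilinear_forms X X"
  unfolding leib_def by (rule leibniz_form)

lemma tensor_leibniz_leib:
  "graded_space X \<Longrightarrow> Q \<in> Hom X X 1 \<Longrightarrow> t \<in> tot (tensor X X) \<Longrightarrow> \<beta> \<in> bilinear_forms X X \<Longrightarrow>
      tensor_leibniz X Q t \<beta> = t (leib X Q \<beta>)"
  unfolding leib_def by (rule tensor_leibniz(3))

lemma tensor_map_tot:
  assumes "linear_map (tensor X X) fscl F" "\<And>x y. x \<in> hmg X \<Longrightarrow> y \<in> hmg X \<Longrightarrow> F (tens X x y) \<in> tot (tensor Y Y)"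
    "t \<in> tot (tensor X X)"
  shows "F t \<in> tot (tensor Y Y)"
proof (rule linear_map_tot[OF vs_tensor, where \<Phi> = "bilinear_forms X X" and G = "hmg X \<times> hmg X" and
      d = "\<lambda>(x, y). deg X x + deg X y", folded tensor_def, unfolded scl_tensor, OF assms(1) _ assms(3)])
  fix g assume "g \<in> hmg X \<times> hmg X"
  then show "F (pure (bilinear_forms X X) g) \<in> tot (tensor Y Y)"
    using assms(2) by (auto simp: tens_def)
qed

lemma tensor_leibniz_tot:
  assumes "graded_space X" "Q \<in> Hom X X 1" "t \<in> tot (tensor X X)"
  shows "tensor_leibniz X Q t \<in> tot (tensor X X)"
proof (rule tensor_map_tot[OF tensor_leibniz(1)[OF assms(1,2)] _ assms(3)])
  fix x y assume xy: "x \<in> hmg X" "y \<in> hmg X"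
  show "tensor_leibniz X Q (tens X x y) \<in> tot (tensor X X)"
    unfolding tensor_leibniz(2)[OF assms(1,2) xy]
    by (intro tot_add[OF vs_tensor] tens_tot_ksign tens_tot xy Hom_hmg[OF assms(2)])
qed

lemma tensor_square_tot:
  assumes "graded_space X" "graded_space Y" "F \<in> Hom X Y 0" "t \<in> tot (tensor X X)"
  shows "tensor_square X Y F t \<in> tot (tensor Y Y)"
proof (rule tensor_map_tot[OF tensor_square(1)[OF assms(1-3)] _ assms(4)])
  fix x y assume xy: "x \<in> hmg X" "y \<in> hmg X"
  show "tensor_square X Y F (tens X x y) \<in> tot (tensor Y Y)"
    unfolding tensor_square(2)[OF assms(1-3) xy] by (intro tens_tot xy Hom_hmg[OF assms(3)])
qed

lemma square_form:
  assumes "vector_space (scl X)" "vector_space (scl Y)" "F \<in> Hom X Y 0" "\<beta> \<in> bilinear_forms Y Y"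
  shows "(\<lambda>(x, y). \<beta> (F x, F y)) \<in> bilinear_forms X X"
proof -
  have "slot_linear X (*) (\<lambda>y. \<beta> (F x, F y)) \<and> slot_linear X (*) (\<lambda>y. \<beta> (F y, F x))" if "x \<in> hmg X" for x
    using slot_linear_comp_Hom[OF assms(3) bilinear_left[OF assms(4) Hom_hmg[OF assms(3) that]] assms(1,2)]
      slot_linear_comp_Hom[OF assms(3) bilinear_right[OF assms(4) Hom_hmg[OF assms(3) that]] assms(1,2)] by simp
  then show ?thesis by (simp add: bilinear_forms_def)
qed

lemma deg_sign:
  assumes "graded_space X" "x \<in> cmp X n" "x = 0 \<Longrightarrow> v = 0"
  shows "ksign (deg X x) v = ksign n v"
  using deg_eq[OF assms(1,2)] assms(3) by (cases "x = 0") auto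

text \<open>The mixed terms carry the signs of \<open>x\<close> and of \<open>Q x\<close>, which are
  opposite, and cancel. So the square of \<open>Q \<otimes> 1 + 1 \<otimes> Q\<close> is
  \<open>Q^2 \<otimes> 1 + 1 \<otimes> Q^2\<close>.\<close>

lemma leib_leib:
  assumes X: "graded_space X" and Q: "Q \<in> Hom X X 1" and b: "\<beta> \<in> bilinear_forms X X" and x: "x \<in> hmg X" and y: "y \<in> hmg X"
  shows "leib X Q (leib X Q \<beta>) (x, y) = \<beta> (Q (Q x), y) + \<beta> (x, Q (Q y))"
proof -
  obtain n where n: "x \<in> cmp X n" using hmg_cmp[OF X x] by blast
  note z = bilinear_0[OF X b]
  have 1: "ksign (deg X (Q x)) (\<beta> (Q x, Q y)) = ksign (n + 1) (\<beta> (Q x, Q y))"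
    by (rule deg_sign[OF X HomD(2)[OF Q n]]) (simp add: z Hom_hmg[OF Q y])
  have 2: "ksign (deg X x) (\<beta> (Q x, Q y)) = ksign n (\<beta> (Q x, Q y))"
    by (rule deg_sign[OF X n])
      (simp add: z Hom_hmg[OF Q y] linear_map_0[OF graded_vs[OF X] graded_vs[OF X] HomD(1)[OF Q]])
  show ?thesis unfolding leib_def prod.case ksign_add 1 2 by (simp add: ksign_def)
qed

lemma Hom_0: "graded_space X \<Longrightarrow> graded_space Y \<Longrightarrow> F \<in> Hom X Y n \<Longrightarrow> F 0 = 0"
  by (rule linear_map_0[OF graded_vs graded_vs HomD(1)])

lemma lin_extension_cong:
  "(\<And>g. g \<in> G \<Longrightarrow> f g = f' g) \<Longrightarrow> lin_extension X e G s f = lin_extension X e G s f'"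
  unfolding lin_extension_def by (simp cong: ball_cong)

lemma linear_map_comp:
  assumes "F \<in> Hom X Y n" "linear_map Y s F'" "vector_space (scl X)" "vector_space (scl Y)" "vector_space s"
  shows "linear_map X s (\<lambda>t. F' (F t))"
  unfolding linear_map_def
proof (intro conjI ballI allI impI)
  fix x y c assume xy: "x \<in> tot X" "y \<in> tot X"
  note t = Hom_tot[OF assms(1,3,4)]
  have "F (x + scl X c y) = F x + scl Y c (F y)"
    using HomD(1)[OF assms(1)] xy unfolding linear_map_def by blast
  then show "F' (F (x + scl X c y)) = F' (F x) + s c (F' (F y))"
    using assms(2) t[OF xy(1)] t[OF xy(2)] unfolding linear_map_def by simp
next
  fix x assume "x \<notin> tot X"
  then show "F' (F x) = 0"
    using linear_map_outside[OF HomD(1)[OF assms(1)]] linear_map_0[OF assms(4,5,2)] by simp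
qed

lemma cocomm_linear_eq:
  assumes "vector_space s" "linear_map (cocomm L) s F" "linear_map (cocomm L) s F'"
    "\<And>vs. vs \<in> cocomm_gens L \<Longrightarrow> F (cocomm_mon L vs) = F' (cocomm_mon L vs)"
  shows "F = F'"
  using assms unfolding cocomm_def cocomm_mon_def by (rule linear_map_eq_on)

lemma cocomm_mon_tot: "vs \<in> cocomm_gens L \<Longrightarrow> cocomm_mon L vs \<in> tot (cocomm L)"
  unfolding cocomm_def cocomm_mon_def by (rule pure_tot)

lemma cocomm_mon_deg: "vs \<in> cocomm_gens L \<Longrightarrow> cocomm_mon L vs \<in> cmp (cocomm L) (wt (sdeg2 L) vs + 2)"
  by (rule cocomm_mon_cmp) (simp_all add: cocomm_gens_iff)

context
  fixes L :: "('k::field_char_0, 'v::ab_group_add) gvs"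
  assumes L: "graded_space L"
begin

text \<open>The difference is homogeneous and primitive with projection 0, so
  \<open>cocomm_primitive\<close> applies.\<close>

lemma cocomm_eqI:
  assumes t: "t \<in> cmp (cocomm L) n" "t' \<in> cmp (cocomm L) n" "cocomm_proj L t = cocomm_proj L t'"
    and b: "\<And>\<beta>. \<beta> \<in> bilinear_forms (cocomm L) (cocomm L) \<Longrightarrow> cocomm_Delta L t \<beta> = cocomm_Delta L t' \<beta>"
  shows "t = t'"
proof -
  have tt: "t \<in> tot (cocomm L)" "t' \<in> tot (cocomm L)" using t(1,2) by (auto intro: hmg_tot[OF vs_cocomm cmp_hmg])
  have "cocomm_Delta L t = cocomm_Delta L t'"
    by (rule tensor_eqI[OF cocomm_Delta(2)[OF L tt(1)] cocomm_Delta(2)[OF L tt(2)] b])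
  then have "cocomm_Delta L (t - t') = 0"
    using linear_map_diff[OF vs_cocomm vector_space_fscl cocomm_Delta(1)[OF L] tt] by simp
  moreover have "cocomm_proj L (t - t') = 0"
    using linear_map_diff[OF vs_cocomm graded_vs[OF L] HomD(1)[OF cocomm_proj(1)[OF L]] tt] t(3) by simp
  ultimately have "t - t' = 0"
    by (rule cocomm_primitive[OF L cmp_diff[OF graded_cocomm[OF L] t(1,2)]])
  then show ?thesis by simp
qed

lemma cocomm_Delta_mon:
  assumes "vs \<in> cocomm_gens L" "\<beta> \<in> bilinear_forms (cocomm L) (cocomm L)"
  shows "cocomm_Delta L (cocomm_mon L vs) \<beta> = cocomm_pull L \<beta> vs"
  using cocomm_Delta(3)[OF L cocomm_mon_tot[OF assms(1)] assms(2)] cocomm_mon_eval[OF cocomm_pull_form[OF L assms(2)]] by simp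

text \<open>The coproduct is reduced, so both parts are strictly shorter than \<open>vs\<close>.
  This is what drives the inductions on the length of the word.\<close>

lemma cocomm_pull_cong:
  assumes vs: "vs \<in> cocomm_gens L"
    and b: "\<beta> \<in> bilinear_forms (cocomm L) (cocomm L)" "\<beta>' \<in> bilinear_forms (cocomm L) (cocomm L)"
    and e: "\<And>l r. l \<in> cocomm_gens L \<Longrightarrow> r \<in> cocomm_gens L \<Longrightarrow> length l < length vs \<Longrightarrow> length r < length vs \<Longrightarrow>
      \<beta> (cocomm_mon L l, cocomm_mon L r) = \<beta>' (cocomm_mon L l, cocomm_mon L r)"
  shows "cocomm_pull L \<beta> vs = cocomm_pull L \<beta>' vs"
  unfolding cocomm_pull_def
proof (rule unsh_cong)
  fix l r assume u: "usplit (sdeg2 L) vs l r"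
  have lr: "l \<in> words L" "r \<in> words L" using usplit_lists[OF u, of "hmg L"] vs by (simp_all add: cocomm_gens_iff)
  note z = bilinear_0[OF graded_cocomm[OF L] b(1)] bilinear_0[OF graded_cocomm[OF L] b(2)]
  show "\<beta> (mon0 L l, mon0 L r) = \<beta>' (mon0 L l, mon0 L r)"
  proof (cases "l = [] \<or> r = []")
    case True
    note h = mon0_hmg[OF L lr(1)] mon0_hmg[OF L lr(2)]
    have "mon0 L l = 0 \<or> mon0 L r = 0" using True by (auto simp: mon0_def)
    then show ?thesis using z(1)[OF h(2)] z(2)[OF h(1)] z(3)[OF h(2)] z(4)[OF h(1)] by auto
  next
    case False
    then have "length l < length vs" "length r < length vs"
      using u by (cases l; cases r; simp add: usplit_def)+
    then show ?thesis using e[of l r] False lr by (simp add: mon0_def cocomm_gens_iff)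
  qed
qed

lemma cocomm_induct [consumes 1, case_names step]:
  assumes "vs \<in> cocomm_gens L" and "\<And>vs. vs \<in> cocomm_gens L \<Longrightarrow> (\<And>ws. ws \<in> cocomm_gens L \<Longrightarrow> length ws < length vs \<Longrightarrow> P ws) \<Longrightarrow> P vs"
  shows "P vs"
  using assms(1) by (induction "length vs" arbitrary: vs rule: less_induct) (use assms(2) in blast)

lemma coderivation_mon:
  assumes Q: "Q \<in> Hom (cocomm L) (cocomm L) 1" "coderivation (cocomm L) 2 (cocomm_Delta L) Q"
    and t: "t \<in> tot (cocomm L)" and b: "\<beta> \<in> bilinear_forms (cocomm L) (cocomm L)"
  shows "cocomm_Delta L (Q t) \<beta> = cocomm_Delta L t (leib (cocomm L) Q \<beta>)"
  using Q(2) t tensor_leibniz_leib[OF graded_cocomm[OF L] Q(1) cocomm_Delta(2)[OF L t] b]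
  by (simp add: coderivation_def ksign_def)

text \<open>The coproduct of \<open>Q\<close> on a monomial involves \<open>Q\<close> only on
  strictly shorter monomials. By induction the two values have the same coproduct, and by hypothesis
  the same projection.\<close>

lemma cocomm_coder_unique:
  assumes Q: "Q \<in> Hom (cocomm L) (cocomm L) 1" "coderivation (cocomm L) 2 (cocomm_Delta L) Q"
    and Q': "Q' \<in> Hom (cocomm L) (cocomm L) 1" "coderivation (cocomm L) 2 (cocomm_Delta L) Q'"
    and p: "\<And>vs. vs \<in> cocomm_gens L \<Longrightarrow> cocomm_proj L (Q (cocomm_mon L vs)) = cocomm_proj L (Q' (cocomm_mon L vs))"
  shows "Q = Q'"
proof (rule cocomm_linear_eq[OF vector_space_fscl HomD(1)[OF Q(1), unfolded scl_cocomm] HomD(1)[OF Q'(1), unfolded scl_cocomm]])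
  fix vs assume "vs \<in> cocomm_gens L"
  then show "Q (cocomm_mon L vs) = Q' (cocomm_mon L vs)"
  proof (induction rule: cocomm_induct)
    case (step vs)
    show ?case
    proof (rule cocomm_eqI[OF HomD(2)[OF Q(1) cocomm_mon_deg[OF step(1)]] HomD(2)[OF Q'(1) cocomm_mon_deg[OF step(1)]] p[OF step(1)]])
      fix \<beta> assume b: "\<beta> \<in> bilinear_forms (cocomm L) (cocomm L)"
      note lb = leib_form[OF graded_cocomm[OF L] Q(1) b] leib_form[OF graded_cocomm[OF L] Q'(1) b]
      show "cocomm_Delta L (Q (cocomm_mon L vs)) \<beta> = cocomm_Delta L (Q' (cocomm_mon L vs)) \<beta>"
        unfolding coderivation_mon[OF Q cocomm_mon_tot[OF step(1)] b] coderivation_mon[OF Q' cocomm_mon_tot[OF step(1)] b]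
          cocomm_Delta_mon[OF step(1) lb(1)] cocomm_Delta_mon[OF step(1) lb(2)]
        by (rule cocomm_pull_cong[OF step(1) lb]) (simp add: leib_def step(2))
    qed
  qed
qed

text \<open>The square of an odd coderivation is again a coderivation, hence determined by its
  corestriction. The induction is that of \<open>cocomm_coder_unique\<close>, with
  \<open>leib_leib\<close> showing that the coproduct of the square only involves the square on
  shorter monomials.\<close>

lemma cocomm_square_zero:
  assumes Q: "Q \<in> Hom (cocomm L) (cocomm L) 1" "coderivation (cocomm L) 2 (cocomm_Delta L) Q"
    and p: "\<And>vs. vs \<in> cocomm_gens L \<Longrightarrow> cocomm_proj L (Q (Q (cocomm_mon L vs))) = 0"
  shows "Q (Q t) = 0"
proof -
  note G = graded_cocomm[OF L]
  have m: "Q (Q (cocomm_mon L vs)) = 0" if "vs \<in> cocomm_gens L" for vs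
    using that
  proof (induction rule: cocomm_induct)
    case (step vs)
    note c = HomD(2)[OF Q(1) HomD(2)[OF Q(1) cocomm_mon_deg[OF step(1)]]]
    note t = cocomm_mon_tot[OF step(1)] Hom_tot[OF Q(1) vs_cocomm vs_cocomm cocomm_mon_tot[OF step(1)]]
    show ?case
    proof (rule cocomm_eqI[OF c cmp_0[OF G]])
      show "cocomm_proj L (Q (Q (cocomm_mon L vs))) = cocomm_proj L 0"
        using p[OF step(1)] Hom_0[OF G L cocomm_proj(1)[OF L]] by simp
      fix \<beta> assume b: "\<beta> \<in> bilinear_forms (cocomm L) (cocomm L)"
      note lb = leib_form[OF G Q(1) b]
      note llb = leib_form[OF G Q(1) lb]
      have z: "(\<lambda>_. 0) \<in> bilinear_forms (cocomm L) (cocomm L)"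
        by (simp add: bilinear_forms_def slot_linear_def)
      have "cocomm_Delta L (Q (Q (cocomm_mon L vs))) \<beta> = cocomm_pull L (leib (cocomm L) Q (leib (cocomm L) Q \<beta>)) vs"
        unfolding coderivation_mon[OF Q t(2) b] coderivation_mon[OF Q t(1) lb] cocomm_Delta_mon[OF step(1) llb] ..
      also have "\<dots> = cocomm_pull L (\<lambda>_. 0) vs"
      proof (rule cocomm_pull_cong[OF step(1) llb z])
        fix l r assume lr: "l \<in> cocomm_gens L" "r \<in> cocomm_gens L" "length l < length vs" "length r < length vs"
        note h = cmp_hmg[OF cocomm_mon_deg[OF lr(1)]] cmp_hmg[OF cocomm_mon_deg[OF lr(2)]]
        show "leib (cocomm L) Q (leib (cocomm L) Q \<beta>) (cocomm_mon L l, cocomm_mon L r) = 0"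
          unfolding leib_leib[OF G Q(1) b h] step(2)[OF lr(1,3)] step(2)[OF lr(2,4)] using bilinear_0[OF G b] h by simp
      qed
      also have "\<dots> = 0" by (simp add: cocomm_pull_def)
      finally show "cocomm_Delta L (Q (Q (cocomm_mon L vs))) \<beta> = cocomm_Delta L 0 \<beta>"
        using linear_map_0[OF vs_cocomm vector_space_fscl cocomm_Delta(1)[OF L]] by simp
    qed
  qed
  have "(\<lambda>t. Q (Q t)) = (\<lambda>t. 0)"
  proof (rule cocomm_linear_eq[OF vector_space_fscl, of L])
    show "linear_map (cocomm L) fscl (\<lambda>t. Q (Q t))"
      by (rule linear_map_comp[OF Q(1) HomD(1)[OF Q(1), unfolded scl_cocomm] vs_cocomm vs_cocomm vector_space_fscl])
    show "linear_map (cocomm L) fscl (\<lambda>t. 0)" by (simp add: linear_map_def)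
  qed (rule m)
  then show ?thesis by (rule fun_cong)
qed

subsection \<open>The coderivation with given corestriction\<close>

text \<open>The shift 3 consists of the two suspensions in \<open>cocomm L\<close> and the degree 1
  of the codifferential. The value at the empty word is fixed as 0 because \<open>coder\<close> also
  runs over unshuffles with an empty left part.\<close>

definition corestriction :: "('v list \<Rightarrow> 'v) \<Rightarrow> bool" where
  "corestriction q \<longleftrightarrow> vsym L (scl L) q \<and> (\<forall>l\<in>words L. q l \<in> cmp L (wt (sdeg2 L) l + 3)) \<and> q [] = 0"

definition cocomm_coder :: "('v list \<Rightarrow> 'v) \<Rightarrow> ('v list, 'k) functional \<Rightarrow> ('v list, 'k) functional" where
  "cocomm_coder q = lin_extension (cocomm L) (cocomm_mon L) (cocomm_gens L) fscl
     (coder (sdeg2 L) q (cocomm_mon L))"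

lemma corestriction_bisym:
  assumes q: "corestriction q" and f: "vsym L (*) \<phi>"
  shows "bisym L (*) (\<lambda>l r. \<phi> (q l # r))"
proof (rule bisymI)
  fix l assume l: "l \<in> words L"
  show "vsym L (*) (\<lambda>r. \<phi> (q l # r))"
    by (rule vsym_Cons[OF f]) (use q l in \<open>auto simp: corestriction_def intro: cmp_hmg\<close>)
  show "vsym L (*) (\<lambda>r. \<phi> (q r # l))"
  proof (rule vsym_comp[OF L graded_vs[OF L] graded_subspace[OF L] vector_space_mult, where f = q and c = 3 and ll = "\<lambda>x. \<phi> (x # l)"])
    show "slot_linear L (*) (\<lambda>x. \<phi> (x # l))" using vsym_slot[OF f, of "[]" l] l by simp
  qed (use q in \<open>auto simp: corestriction_def\<close>)
qed

lemma coder_form: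
  assumes q: "corestriction q" and f: "\<phi> \<in> sym_forms L"
  shows "coder (sdeg2 L) q \<phi> \<in> sym_forms L"
proof -
  have "coder (sdeg2 L) q \<phi> = unshuffle_sum (sdeg2 L) (\<lambda>l r. \<phi> (q l # r))"
    by (simp add: coder_def fun_eq_iff)
  then show ?thesis
    using vsym_unshuffle[OF L vector_space_mult corestriction_bisym[OF q]] f by (simp add: sym_forms_iff)
qed

lemma mon_corestriction_cmp:
  assumes q: "corestriction q" and "l \<in> words L" "r \<in> words L"
  shows "cocomm_mon L (q l # r) \<in> cmp (cocomm L) (wt (sdeg2 L) l + wt (sdeg2 L) r + 3)"
proof (rule cocomm_mon_cmp_deg[OF L])
  have c: "q l \<in> cmp L (wt (sdeg2 L) l + 3)" using q assms(2) by (simp add: corestriction_def)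
  then show "q l # r \<in> words L" using assms(3) cmp_hmg by auto
  assume "0 \<notin> set (q l # r)"
  then show "wt (sdeg2 L) (q l # r) + 2 = wt (sdeg2 L) l + wt (sdeg2 L) r + 3"
    using deg_eq[OF L c] by (auto simp: sdeg2_def)
qed simp

text \<open>Well-definedness and the coderivation property are checked on forms, where
  \<open>cocomm_coder q\<close> acts by \<open>coder\<close> and \<open>coder_unsh\<close> is
  available. The last clause says that every \<open>q\<close> occurs as a corestriction.\<close>

lemma cocomm_coder:
  assumes q: "corestriction q"
  shows "cocomm_coder q \<in> Hom (cocomm L) (cocomm L) 1"
    and "\<And>vs. vs \<in> cocomm_gens L \<Longrightarrow> cocomm_coder q (cocomm_mon L vs) = coder (sdeg2 L) q (cocomm_mon L) vs"
    and "\<And>t \<phi>. t \<in> tot (cocomm L) \<Longrightarrow> \<phi> \<in> sym_forms L \<Longrightarrow> cocomm_coder q t \<phi> = t (coder (sdeg2 L) q \<phi>)"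
    and "coderivation (cocomm L) 2 (cocomm_Delta L) (cocomm_coder q)"
    and "\<And>vs. vs \<in> cocomm_gens L \<Longrightarrow> cocomm_proj L (cocomm_coder q (cocomm_mon L vs)) = q vs"
proof -
  let ?d = "sdeg2 L" and ?f = "coder (sdeg2 L) q (cocomm_mon L)"
  note G = graded_cocomm[OF L]
  have ev: "(\<lambda>g. ?f g \<phi>) = coder ?d q \<phi>" if "\<phi> \<in> sym_forms L" for \<phi>
    by (simp add: coder_def fun_eq_iff unsh_apply cocomm_mon_eval[OF that])
  have 1: "\<forall>\<phi>\<in>sym_forms L. (\<lambda>g. ?f g \<phi>) \<in> sym_forms L"
    using ev coder_form[OF q] by simp
  have 2: "\<forall>g\<in>cocomm_gens L. \<forall>\<phi>. \<phi> \<notin> sym_forms L \<longrightarrow> ?f g \<phi> = 0"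
    by (simp add: coder_def unsh_apply cocomm_mon_outside)
  note l = lin_ext_fun[OF 1 2, where F = "cocomm_coder q" and d = "\<lambda>vs. wt (sdeg2 L) vs + 2",
      folded cocomm_def cocomm_mon_def, OF cocomm_coder_def]
  show val: "\<And>vs. vs \<in> cocomm_gens L \<Longrightarrow> cocomm_coder q (cocomm_mon L vs) = ?f vs" by (rule l(2))
  show eval: "cocomm_coder q t \<phi> = t (coder ?d q \<phi>)" if "t \<in> tot (cocomm L)" "\<phi> \<in> sym_forms L" for t \<phi>
    using l(3)[OF that] ev[OF that(2)] by simp
  have fcmp: "?f vs \<in> cmp (cocomm L) (wt ?d vs + 3)" if "vs \<in> words L" for vs
    unfolding coder_def
  proof (rule unsh_additive_on[OF cmp_additive_on[OF G], THEN conjunct1])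
    fix l r assume u: "usplit ?d vs l r"
    with usplit_lists[OF u that] mon_corestriction_cmp[OF q, of l r]
    show "cocomm_mon L (q l # r) \<in> cmp (cocomm L) (wt ?d vs + 3)" by (simp add: usplit_wt)
  qed
  show Hom: "cocomm_coder q \<in> Hom (cocomm L) (cocomm L) 1"
  proof -
    have "cocomm_coder q \<in> Hom (presented (sym_forms L) (cocomm_gens L) (\<lambda>vs. wt (sdeg2 L) vs + 2)) (cocomm L) 1"
    proof (rule HomI[OF vs_cocomm subspace_cocomm])
      show "linear_map (presented (sym_forms L) (cocomm_gens L) (\<lambda>vs. wt (sdeg2 L) vs + 2)) (scl (cocomm L)) (cocomm_coder q)"
        using l(1) by (simp add: cocomm_def)
      show "cocomm_coder q (pure (sym_forms L) vs) \<in> cmp (cocomm L) (wt (sdeg2 L) vs + 2 + 1)" if "vs \<in> cocomm_gens L" for vs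
        using val[OF that] fcmp[of vs] that by (simp add: cocomm_mon_def cocomm_gens_iff add.commute)
    qed
    then show ?thesis by (simp add: cocomm_def)
  qed
  show "cocomm_proj L (cocomm_coder q (cocomm_mon L vs)) = q vs" if vs: "vs \<in> cocomm_gens L" for vs
  proof -
    have w: "vs \<in> words L" using vs by (simp add: cocomm_gens_iff)
    note ad = linear_map_additive_on[OF vs_cocomm graded_vs[OF L] HomD(1)[OF cocomm_proj(1)[OF L]]]
    have gen: "q l # r \<in> cocomm_gens L" if "usplit ?d vs l r" for l r
      using q usplit_lists[OF that w] by (auto simp: corestriction_def cocomm_gens_iff intro: cmp_hmg)
    have "cocomm_proj L (cocomm_coder q (cocomm_mon L vs)) =
        unshuffle_sum ?d (\<lambda>l r. cocomm_proj L (cocomm_mon L (q l # r))) vs"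
      unfolding val[OF vs] coder_def
      by (rule unsh_additive_on[OF ad, THEN conjunct2]) (rule cocomm_mon_tot[OF gen])
    also have "\<dots> = unshuffle_sum ?d (\<lambda>l r. if r = [] then q l else 0) vs"
    proof (rule unsh_cong)
      fix l r assume "usplit ?d vs l r"
      from cocomm_proj(2)[OF L gen[OF this]]
      show "cocomm_proj L (cocomm_mon L (q l # r)) = (if r = [] then q l else 0)"
        by (simp split: list.splits)
    qed
    finally show ?thesis by (simp add: unsh_left_all)
  qed
  show "coderivation (cocomm L) 2 (cocomm_Delta L) (cocomm_coder q)"
    unfolding coderivation_def
  proof
    fix t assume t: "t \<in> tot (cocomm L)"
    note Qt = Hom_tot[OF Hom vs_cocomm vs_cocomm t]
    have "cocomm_Delta L (cocomm_coder q t) = tensor_leibniz (cocomm L) (cocomm_coder q) (cocomm_Delta L t)"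
    proof (rule tensor_eqI[OF cocomm_Delta(2)[OF L Qt] tensor_leibniz_tot[OF G Hom cocomm_Delta(2)[OF L t]]])
      fix \<beta> assume b: "\<beta> \<in> bilinear_forms (cocomm L) (cocomm L)"
      note lb = leib_form[OF G Hom b]
      let ?G = "\<lambda>l r. \<beta> (mon0 L l, mon0 L r)"
      have c1: "\<beta> (cocomm_coder q (mon0 L l), y) = coder ?d q (\<lambda>l. \<beta> (mon0 L l, y)) l"
        and c2: "\<beta> (y, cocomm_coder q (mon0 L l)) = coder ?d q (\<lambda>l. \<beta> (y, mon0 L l)) l"
        if "l \<in> words L" "y \<in> hmg (cocomm L)" for l y
      proof -
        have c: "ll (cocomm_coder q (mon0 L l)) = coder ?d q (\<lambda>l. ll (mon0 L l)) l"
          if sl: "slot_linear (cocomm L) (*) ll" for ll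
        proof (cases "l = []")
          \<comment> \<open>On the empty word \<open>coder\<close> produces the monomial with the
            single letter \<open>q [] = 0\<close>, so both sides are 0.\<close>
          case True
          have "cocomm_mon L [0] = 0"
            using vmult_zero_letter[OF L vector_space_fscl vsym_vmult[OF cocomm_mon_vsym], of "[0]"] hmg_0[OF L] by simp
          then show ?thesis using True q Hom_0[OF G G Hom]
            by (simp add: coder_def mon0_def corestriction_def)
        next
          case False
          then have g: "l \<in> cocomm_gens L" using \<open>l \<in> words L\<close> by (simp add: cocomm_gens_iff)
          have s: "(\<lambda>g. ll (cocomm_mon L g)) \<in> sym_forms L"
            using cocomm_univ[OF L vector_space_mult sl] by (simp add: sym_forms_iff)
          have "ll (cocomm_coder q (cocomm_mon L l)) = cocomm_coder q (cocomm_mon L l) (\<lambda>g. ll (cocomm_mon L g))"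
            by (rule cocomm_expand[OF L sl HomD(2)[OF Hom cocomm_mon_deg[OF g]]])
          also have "\<dots> = coder ?d q (\<lambda>g. ll (cocomm_mon L g)) l"
            using eval[OF cocomm_mon_tot[OF g] s] cocomm_mon_eval[OF coder_form[OF q s]] by simp
          also have "\<dots> = coder ?d q (\<lambda>l. ll (mon0 L l)) l" by (simp add: coder_def mon0_def)
          finally show ?thesis using False by (simp add: mon0_def)
        qed
        show "\<beta> (cocomm_coder q (mon0 L l), y) = coder ?d q (\<lambda>l. \<beta> (mon0 L l, y)) l"
          by (rule c[OF bilinear_left[OF b that(2)]])
        show "\<beta> (y, cocomm_coder q (mon0 L l)) = coder ?d q (\<lambda>l. \<beta> (y, mon0 L l)) l"
          by (rule c[OF bilinear_right[OF b that(2)]])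
      qed
      have key: "coder ?d q (cocomm_pull L \<beta>) vs = cocomm_pull L (leib (cocomm L) (cocomm_coder q) \<beta>) vs"
        if vs: "vs \<in> cocomm_gens L" for vs
      proof -
        have w: "vs \<in> words L" using vs by (simp add: cocomm_gens_iff)
        have sub: "l \<in> words L" if "set l \<subseteq> set vs" for l using that w by (auto simp: in_lists_conv_set)
        have "coder ?d q (cocomm_pull L \<beta>) vs =
           unshuffle_sum ?d (\<lambda>l r. coder ?d q (\<lambda>l. ?G l r) l + ksign (wt ?d l) (coder ?d q (?G l) r)) vs"
          unfolding cocomm_pull_def
        proof (rule coder_unsh)
          fix l L' R assume s: "set l \<subseteq> set vs" "set L' \<subseteq> set vs" "set R \<subseteq> set vs"
          note w = sub[OF s(1)] sub[OF s(2)] sub[OF s(3)]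
          have c: "q l \<in> cmp L (wt ?d l + 3)" using q w by (simp add: corestriction_def)
          show "ksign (?d (q l) * wt ?d L') (?G L' (q l # R)) = ksign ((wt ?d l + 1) * wt ?d L') (?G L' (q l # R))"
          proof (cases "q l = 0")
            case True
            have "cocomm_mon L (0 # R) = 0"
              using vmult_zero_letter[OF L vector_space_fscl vsym_vmult[OF cocomm_mon_vsym], of "0 # R"] hmg_0[OF L] w by simp
            then show ?thesis using True bilinear_0(2)[OF G b mon0_hmg[OF L w(2)]] by (simp add: mon0_def)
          qed (use deg_eq[OF L c] in \<open>simp add: sdeg2_def add.commute\<close>)
        qed
        also have "\<dots> = cocomm_pull L (leib (cocomm L) (cocomm_coder q) \<beta>) vs"
          unfolding cocomm_pull_def
        proof (rule unsh_cong)
          fix l r assume "usplit ?d vs l r"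
          with usplit_lists[OF this w] have lr: "l \<in> words L" "r \<in> words L" by simp_all
          \<comment> \<open>The degree of a monomial differs from its weight by the even number 2; a
            zero monomial, which has no degree, is covered by the premise.\<close>
          have s: "ksign (deg (cocomm L) (mon0 L l)) v = ksign (wt ?d l) v" if "mon0 L l = 0 \<Longrightarrow> v = 0" for v :: 'k
          proof (cases "mon0 L l = 0")
            case False
            then have "deg (cocomm L) (mon0 L l) = wt ?d l + 2"
              using deg_eq[OF G cocomm_mon_cmp[OF lr(1)]] by (auto simp: mon0_def split: if_splits)
            then show ?thesis by (simp add: ksign_def)
          qed (use that in simp)
          have "\<beta> (mon0 L l, cocomm_coder q (mon0 L r)) = 0" if "mon0 L l = 0"
            using bilinear_0(1)[OF G b] Hom_hmg[OF Hom mon0_hmg[OF L lr(2)]] that by simp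
          from s[OF this]
          show "coder ?d q (\<lambda>l. ?G l r) l + ksign (wt ?d l) (coder ?d q (?G l) r) =
              leib (cocomm L) (cocomm_coder q) \<beta> (mon0 L l, mon0 L r)"
            unfolding leib_def prod.case c1[OF lr(1) mon0_hmg[OF L lr(2)]] c2[OF lr(2) mon0_hmg[OF L lr(1)]] by simp
        qed
        finally show ?thesis .
      qed
      show "cocomm_Delta L (cocomm_coder q t) \<beta> = tensor_leibniz (cocomm L) (cocomm_coder q) (cocomm_Delta L t) \<beta>"
        unfolding tensor_leibniz_leib[OF G Hom cocomm_Delta(2)[OF L t] b] cocomm_Delta(3)[OF L t lb]
          cocomm_Delta(3)[OF L Qt b] eval[OF t cocomm_pull_form[OF L b]]
        by (rule ev_cong[OF t[unfolded cocomm_def] coder_form[OF q cocomm_pull_form[OF L b]] cocomm_pull_form[OF L lb] key])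
    qed
    then show "cocomm_Delta L (cocomm_coder q t) =
        ksign 2 (tensor_leibniz (cocomm L) (cocomm_coder q) (cocomm_Delta L t))" by (simp add: ksign_def)
  qed
qed

end

lemma Fw_plus:
  assumes s: "vector_space s"
  shows "Fw s d (\<lambda>P. H P + K P) vs = Fw s d H vs + Fw s d K vs"
proof (induction "length vs" arbitrary: vs H K rule: less_induct)
  case less
  let ?f = "\<lambda>H l r. if l = [] then 0 else s (of_nat (length l)) (Fw s d (\<lambda>P. H (l # P)) r)"
  have "unshuffle_sum d (?f (\<lambda>P. H P + K P)) vs = unshuffle_sum d (\<lambda>l r. ?f H l r + ?f K l r) vs"
  proof (rule unsh_cong)
    fix l r assume "usplit d vs l r"
    then have "l \<noteq> [] \<Longrightarrow> length r < length vs" by (cases l) (auto simp: usplit_def)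
    then show "?f (\<lambda>P. H P + K P) l r = ?f H l r + ?f K l r"
      using less[of r] by (simp add: vector_space_scale[OF s])
  qed
  then show ?case
    by (cases "vs = []") (simp_all add: Fw.simps[of _ _ _ vs] unsh_add vector_space_scale[OF s])
qed

lemma unsh_zero_letter:
  "x \<in> set xs \<Longrightarrow> (\<And>l r. x \<in> set l \<or> x \<in> set r \<Longrightarrow> h l r = 0) \<Longrightarrow> unshuffle_sum d h xs = 0"
proof (induction xs arbitrary: h)
  case (Cons y ys)
  show ?case
  proof (cases "x = y")
    case True
    then have "unshuffle_sum d (\<lambda>l r. h (y # l) r) ys = 0"
        "unshuffle_sum d (\<lambda>l r. ksign (d y * wt d l) (h l (y # r))) ys = 0"
      by (auto intro!: unsh_zeroI simp: Cons.prems(2))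
    then show ?thesis by simp
  next
    case False
    then have x: "x \<in> set ys" using Cons.prems(1) by simp
    have "unshuffle_sum d (\<lambda>l r. h (y # l) r) ys = 0"
      by (rule Cons.IH[OF x]) (auto simp: Cons.prems(2))
    moreover have "unshuffle_sum d (\<lambda>l r. ksign (d y * wt d l) (h l (y # r))) ys = 0"
      by (rule Cons.IH[OF x]) (auto simp: Cons.prems(2))
    ultimately show ?thesis by simp
  qed
qed simp

lemma cocomm_mon_zero_letter:
  assumes "graded_space L" "vs \<in> words L" "0 \<in> set vs"
  shows "cocomm_mon L vs = 0"
  by (rule vmult_zero_letter[OF assms(1) vector_space_fscl vsym_vmult[OF cocomm_mon_vsym] assms(2,3)])

subsection \<open>Morphisms\<close>

definition coalgebra_map where
  "coalgebra_map L L' F \<longleftrightarrow> F \<in> Hom (cocomm L) (cocomm L') 0 \<and>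
     (\<forall>t\<in>tot (cocomm L). cocomm_Delta L' (F t) = tensor_square (cocomm L) (cocomm L') F (cocomm_Delta L t))"

context
  fixes L :: "('k::field_char_0, 'v::ab_group_add) gvs" and L' :: "('k, 'w::ab_group_add) gvs"
  assumes L: "graded_space L" and L': "graded_space L'"
begin

lemma coalgebra_map_mon:
  assumes F: "coalgebra_map L L' F" and t: "t \<in> tot (cocomm L)" and b: "\<beta> \<in> bilinear_forms (cocomm L') (cocomm L')"
  shows "cocomm_Delta L' (F t) \<beta> = cocomm_Delta L t (\<lambda>(x, y). \<beta> (F x, F y))"
  using F t tensor_square(3)[OF graded_cocomm[OF L] graded_cocomm[OF L'] _ cocomm_Delta(2)[OF L t] b, of F]
  by (simp add: coalgebra_map_def)

lemma coalgebra_map_unique: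
  assumes F: "coalgebra_map L L' F" and F': "coalgebra_map L L' F'"
    and p: "\<And>vs. vs \<in> cocomm_gens L \<Longrightarrow> cocomm_proj L' (F (cocomm_mon L vs)) = cocomm_proj L' (F' (cocomm_mon L vs))"
  shows "F = F'"
proof -
  have H: "F \<in> Hom (cocomm L) (cocomm L') 0" "F' \<in> Hom (cocomm L) (cocomm L') 0"
    using F F' by (simp_all add: coalgebra_map_def)
  show ?thesis
  proof (rule cocomm_linear_eq[OF vector_space_fscl HomD(1)[OF H(1), unfolded scl_cocomm] HomD(1)[OF H(2), unfolded scl_cocomm]])
    fix vs assume "vs \<in> cocomm_gens L"
    from this show "F (cocomm_mon L vs) = F' (cocomm_mon L vs)"
    proof (induction rule: cocomm_induct[OF L, consumes 1, case_names step])
      case (step vs)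
      show ?case
      proof (rule cocomm_eqI[OF L' HomD(2)[OF H(1) cocomm_mon_deg[OF step(1)]] HomD(2)[OF H(2) cocomm_mon_deg[OF step(1)]] p[OF step(1)]])
        fix \<beta> assume b: "\<beta> \<in> bilinear_forms (cocomm L') (cocomm L')"
        note fb = square_form[OF vs_cocomm vs_cocomm H(1) b] square_form[OF vs_cocomm vs_cocomm H(2) b]
        show "cocomm_Delta L' (F (cocomm_mon L vs)) \<beta> = cocomm_Delta L' (F' (cocomm_mon L vs)) \<beta>"
          unfolding coalgebra_map_mon[OF F cocomm_mon_tot[OF step(1)] b] coalgebra_map_mon[OF F' cocomm_mon_tot[OF step(1)] b]
            cocomm_Delta_mon[OF L step(1) fb(1)] cocomm_Delta_mon[OF L step(1) fb(2)]
          by (rule cocomm_pull_cong[OF L step(1) fb]) (simp add: step(2))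
      qed
    qed
  qed
qed

text \<open>Both composites are coderivations along \<open>F\<close>, so the induction of
  \<open>cocomm_coder_unique\<close> carries over. Since \<open>F\<close> has degree 0, a monomial
  and its nonzero image produce the same sign.\<close>

lemma coalgebra_map_intertwines:
  assumes F: "coalgebra_map L L' F"
    and Q: "Q \<in> Hom (cocomm L) (cocomm L) 1" "coderivation (cocomm L) 2 (cocomm_Delta L) Q"
    and Q': "Q' \<in> Hom (cocomm L') (cocomm L') 1" "coderivation (cocomm L') 2 (cocomm_Delta L') Q'"
    and p: "\<And>vs. vs \<in> cocomm_gens L \<Longrightarrow>
      cocomm_proj L' (F (Q (cocomm_mon L vs))) = cocomm_proj L' (Q' (F (cocomm_mon L vs)))"
  shows "F (Q t) = Q' (F t)"
proof -
  note G = graded_cocomm[OF L] graded_cocomm[OF L']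
  have H: "F \<in> Hom (cocomm L) (cocomm L') 0" using F by (simp add: coalgebra_map_def)
  have "(\<lambda>t. F (Q t)) = (\<lambda>t. Q' (F t))"
  proof (rule cocomm_linear_eq[OF vector_space_fscl])
    show "linear_map (cocomm L) fscl (\<lambda>t. F (Q t))"
      by (rule linear_map_comp[OF Q(1) HomD(1)[OF H, unfolded scl_cocomm] vs_cocomm vs_cocomm vector_space_fscl])
    show "linear_map (cocomm L) fscl (\<lambda>t. Q' (F t))"
      by (rule linear_map_comp[OF H HomD(1)[OF Q'(1), unfolded scl_cocomm] vs_cocomm vs_cocomm vector_space_fscl])
    fix vs assume "vs \<in> cocomm_gens L"
    from this show "F (Q (cocomm_mon L vs)) = Q' (F (cocomm_mon L vs))"
    proof (induction rule: cocomm_induct[OF L, consumes 1, case_names step])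
      case (step vs)
      note m = cocomm_mon_deg[OF step(1)]
      note t = cocomm_mon_tot[OF step(1)] Hom_tot[OF Q(1) vs_cocomm vs_cocomm cocomm_mon_tot[OF step(1)]]
        Hom_tot[OF H vs_cocomm vs_cocomm cocomm_mon_tot[OF step(1)]]
      have c: "F (Q (cocomm_mon L vs)) \<in> cmp (cocomm L') (wt (sdeg2 L) vs + 3)"
        "Q' (F (cocomm_mon L vs)) \<in> cmp (cocomm L') (wt (sdeg2 L) vs + 3)"
        using HomD(2)[OF H HomD(2)[OF Q(1) m]] HomD(2)[OF Q'(1) HomD(2)[OF H m]] by (simp_all add: add.commute)
      show ?case
      proof (rule cocomm_eqI[OF L' c p[OF step(1)]])
        fix \<beta> assume b: "\<beta> \<in> bilinear_forms (cocomm L') (cocomm L')"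
        let ?F = "\<lambda>\<beta> (x, y). \<beta> (F x, F y)"
        note fb = square_form[OF vs_cocomm vs_cocomm H b]
        note lb = leib_form[OF G(1) Q(1) fb]
        note lb' = leib_form[OF G(2) Q'(1) b]
        note flb = square_form[OF vs_cocomm vs_cocomm H lb']
        have "cocomm_Delta L' (F (Q (cocomm_mon L vs))) \<beta> = cocomm_pull L (leib (cocomm L) Q (?F \<beta>)) vs"
          unfolding coalgebra_map_mon[OF F t(2) b] coderivation_mon[OF L Q t(1) fb] cocomm_Delta_mon[OF L step(1) lb] ..
        also have "\<dots> = cocomm_pull L (?F (leib (cocomm L') Q' \<beta>)) vs"
        proof (rule cocomm_pull_cong[OF L step(1) lb flb])
          fix l r assume lr: "l \<in> cocomm_gens L" "r \<in> cocomm_gens L" "length l < length vs" "length r < length vs"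
          note h = cmp_hmg[OF cocomm_mon_deg[OF lr(2)]]
          have z: "F (cocomm_mon L l) = 0 \<Longrightarrow> \<beta> (F (cocomm_mon L l), Q' (F (cocomm_mon L r))) = 0"
            using bilinear_0(1)[OF G(2) b Hom_hmg[OF Q'(1) Hom_hmg[OF H h]]] by simp
          have 1: "ksign (deg (cocomm L) (cocomm_mon L l)) (\<beta> (F (cocomm_mon L l), Q' (F (cocomm_mon L r)))) =
              ksign (wt (sdeg2 L) l + 2) (\<beta> (F (cocomm_mon L l), Q' (F (cocomm_mon L r))))"
            by (rule deg_sign[OF G(1) cocomm_mon_deg[OF lr(1)] z]) (simp add: Hom_0[OF G H])
          have 2: "ksign (deg (cocomm L') (F (cocomm_mon L l))) (\<beta> (F (cocomm_mon L l), Q' (F (cocomm_mon L r)))) =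
              ksign (wt (sdeg2 L) l + 2 + 0) (\<beta> (F (cocomm_mon L l), Q' (F (cocomm_mon L r))))"
            by (rule deg_sign[OF G(2) HomD(2)[OF H cocomm_mon_deg[OF lr(1)]] z])
          show "leib (cocomm L) Q (?F \<beta>) (cocomm_mon L l, cocomm_mon L r) =
              ?F (leib (cocomm L') Q' \<beta>) (cocomm_mon L l, cocomm_mon L r)"
            unfolding leib_def prod.case step(2)[OF lr(1,3)] step(2)[OF lr(2,4)] 1 2 by simp
        qed
        also have "\<dots> = cocomm_Delta L' (Q' (F (cocomm_mon L vs))) \<beta>"
          unfolding coderivation_mon[OF L' Q' t(3) b] coalgebra_map_mon[OF F t(1) lb'] cocomm_Delta_mon[OF L step(1) flb] ..
        finally show "cocomm_Delta L' (F (Q (cocomm_mon L vs))) \<beta> = cocomm_Delta L' (Q' (F (cocomm_mon L vs))) \<beta>" .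
      qed
    qed
  qed
  then show ?thesis by (rule fun_cong)
qed

text \<open>Corestrictions of coalgebra morphisms. The degree condition concerns nonempty words
  because blocks of a partition are nonempty; the slot \<open>u []\<close> later holds the
  A-infinity structure.\<close>

definition cofamily :: "('v list \<Rightarrow> 'w) \<Rightarrow> bool" where
  "cofamily u \<longleftrightarrow> vsym L (scl L') u \<and> (\<forall>l\<in>words L. l \<noteq> [] \<longrightarrow> u l \<in> cmp L' (wt (sdeg2 L) l + 2))"

definition cocomm_exp :: "('v list \<Rightarrow> 'w) \<Rightarrow> ('v list, 'k) functional \<Rightarrow> ('w list, 'k) functional" where
  "cocomm_exp u = lin_extension (cocomm L) (cocomm_mon L) (cocomm_gens L) fscl
     (Fw fscl (sdeg2 L) (\<lambda>P. cocomm_mon L' (map u P)))"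

lemma vsym_Fw_param:
  assumes "\<And>P. bpart d r P \<Longrightarrow> vsym L (*) (\<lambda>l. K l P)"
  shows "vsym L (*) (\<lambda>l. Fw (*) d (K l) r)"
proof -
  let ?s = "\<lambda>c f l. c * f l :: 'k"
  have "Fw ?s d (\<lambda>P l. K l P) r \<in> {f. vsym L (*) f} \<and>
      id (Fw ?s d (\<lambda>P l. K l P) r) = Fw ?s d (\<lambda>P. id (\<lambda>l. K l P)) r"
  proof (rule Fw_linear_on[OF vsym_additive[OF vector_space_mult]])
    fix c :: 'k and f assume "f \<in> {f. vsym L (*) f}"
    then show "?s c f \<in> {f. vsym L (*) f} \<and> id (?s c f) = ?s c (id f)"
      using vsym_weight[OF L vector_space_mult, of f "\<lambda>_ _. c"] by simp
  qed (use assms in simp)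
  moreover have "Fw ?s d (\<lambda>P l. K l P) r = (\<lambda>l. Fw (*) d (K l) r)"
  proof
    fix l
    show "Fw ?s d (\<lambda>P l. K l P) r l = Fw (*) d (K l) r"
      by (rule Fw_linear[where T = "\<lambda>f. f l"]) simp_all
  qed
  ultimately show ?thesis by simp
qed

text \<open>The recursion presents \<open>Fw\<close>, up to a scalar depending on the length, as an
  unshuffle sum of its own values on shorter words, so its symmetry follows from
  \<open>vsym_unshuffle\<close>.\<close>

lemma vsym_Fw:
  assumes "\<And>P P'. P \<in> lists (blocks L) \<Longrightarrow> P' \<in> lists (blocks L) \<Longrightarrow> vsym L (*) (\<lambda>l. H (P @ l # P'))"
  shows "vsym L (*) (Fw (*) (sdeg2 L) H)"
proof -
  let ?d = "sdeg2 L"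
  \<comment> \<open>Symmetry is a statement about words of all lengths at once, which does not fit
    an induction on length. Truncation to words of length at most \<open>n\<close> makes the
    induction possible.\<close>
  have tr: "vsym L (*) (\<lambda>vs. if length vs \<le> n then Fw (*) ?d H vs else 0)"
    if "\<And>P P'. P \<in> lists (blocks L) \<Longrightarrow> P' \<in> lists (blocks L) \<Longrightarrow> vsym L (*) (\<lambda>l. H (P @ l # P'))" for n H
    using that
  proof (induction n arbitrary: H)
    case 0
    show ?case by (rule vsym_cong[OF L vsym_sums(6)[OF vector_space_mult]]) simp
  next
    case (Suc n)
    let ?h = "\<lambda>l r. of_nat (length l) * (if length r \<le> n then Fw (*) ?d (\<lambda>P. H (l # P)) r else 0)"
    have "bisym L (*) ?h"
    proof (rule bisymI)
      fix l assume l: "l \<in> words L"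
      show "vsym L (*) (?h l)"
      proof (cases "l = []")
        case True
        then show ?thesis using vsym_sums(6)[OF vector_space_mult] by simp
      next
        case False
        then have lb: "l \<in> blocks L" using l by (simp add: blocks_def)
        have "vsym L (*) (\<lambda>r. if length r \<le> n then Fw (*) ?d (\<lambda>P. H (l # P)) r else 0)"
        proof (rule Suc.IH)
          fix P P' assume "P \<in> lists (blocks L)" "P' \<in> lists (blocks L)"
          then show "vsym L (*) (\<lambda>r. H (l # P @ r # P'))" using Suc.prems[of "l # P" P'] lb by simp
        qed
        from vsym_weight[OF L vector_space_mult this, of "\<lambda>_ _. of_nat (length l)"]
        show ?thesis .
      qed
      have "vsym L (*) (\<lambda>r. if length l \<le> n then Fw (*) ?d (\<lambda>P. H (r # P)) l else 0)"
      proof (cases "length l \<le> n")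
        case True
        have "vsym L (*) (\<lambda>r. Fw (*) ?d (\<lambda>P. H (r # P)) l)"
        proof (rule vsym_Fw_param)
          fix P assume "bpart ?d l P"
          then have "P \<in> lists (blocks L)" using l by (auto simp: bpart_def in_lists_conv_set blocks_def)
          then show "vsym L (*) (\<lambda>r. H (r # P))" using Suc.prems[of "[]" P] by simp
        qed
        then show ?thesis using True by simp
      qed (use vsym_sums(6)[OF vector_space_mult] in simp)
      from vsym_weight[OF L vector_space_mult this, of "\<lambda>k _. of_nat k"]
      show "vsym L (*) (\<lambda>r. ?h r l)" .
    qed
    from vsym_weight[OF L vector_space_mult vsym_unshuffle[OF L vector_space_mult this],
        of "\<lambda>k _. if k \<le> Suc n then 1 / of_nat k else 0"]
    show ?case
    proof (rule vsym_cong[OF L])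
      fix vs :: "'v list" assume vs: "vs \<noteq> []"
      show "(if length vs \<le> Suc n then 1 / of_nat (length vs) else 0) * unshuffle_sum ?d ?h vs =
          (if length vs \<le> Suc n then Fw (*) ?d H vs else 0)"
      proof (cases "length vs \<le> Suc n")
        case True
        have "unshuffle_sum ?d ?h vs =
          unshuffle_sum ?d (\<lambda>l r. if l = [] then 0 else of_nat (length l) * Fw (*) ?d (\<lambda>P. H (l # P)) r) vs"
        proof (rule unsh_cong)
          fix l r assume "usplit ?d vs l r"
          then have "l \<noteq> [] \<Longrightarrow> length r \<le> n" using True by (cases l) (auto simp: usplit_def)
          then show "?h l r = (if l = [] then 0 else of_nat (length l) * Fw (*) ?d (\<lambda>P. H (l # P)) r)" by simp
        qed
        then show ?thesis using True vs by (simp add: Fw.simps[of _ _ _ vs])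
      qed simp
    qed
  qed
  show ?thesis
  proof (rule vsymI)
    fix xs ys assume xy: "xs \<in> words L" "ys \<in> words L"
    show "slot_linear L (*) (\<lambda>u. Fw (*) ?d H (xs @ u # ys))"
      using vsym_slot[OF tr[OF assms] xy, of "length xs + Suc (length ys)"] by simp
    fix u v assume uv: "u \<in> hmg L" "v \<in> hmg L"
    from vsym_swap[OF tr[OF assms, of "length xs + Suc (Suc (length ys))"] xy uv]
    show "Fw (*) ?d H (xs @ u # v # ys) = ksign (?d u * ?d v) (Fw (*) ?d H (xs @ v # u # ys))" by simp
  qed
qed

context
  fixes u :: "'v list \<Rightarrow> 'w"
  assumes u: "cofamily u"
begin

lemma bpart_words:
  assumes "bpart (sdeg2 L) vs P" "vs \<in> words L"
  shows "B \<in> set P \<Longrightarrow> B \<in> words L \<and> B \<noteq> [] \<and> u B \<in> cmp L' (wt (sdeg2 L) B + 2)"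
    and "map u P \<in> words L'"
proof -
  show 1: "B \<in> words L \<and> B \<noteq> [] \<and> u B \<in> cmp L' (wt (sdeg2 L) B + 2)" if "B \<in> set P" for B
  proof -
    have "B \<in> words L" "B \<noteq> []" using assms that by (auto simp: bpart_def in_lists_conv_set)
    then show ?thesis using u by (simp add: cofamily_def)
  qed
  show "map u P \<in> words L'" using 1 by (auto simp: in_lists_conv_set intro: cmp_hmg)
qed

lemma bpart_deg:
  assumes "bpart (sdeg2 L) vs P" "vs \<in> words L" "0 \<notin> set (map u P)" "B \<in> set P"
  shows "sdeg2 L' (u B) = wt (sdeg2 L) B"
  using bpart_words(1)[OF assms(1,2,4)] deg_eq[OF L', of "u B"] assms(3,4) by (force simp: sdeg2_def)

lemma bpart_mon_cmp:
  assumes "bpart (sdeg2 L) vs P" "vs \<in> cocomm_gens L"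
  shows "cocomm_mon L' (map u P) \<in> cmp (cocomm L') (wt (sdeg2 L) vs + 2)" "map u P \<in> cocomm_gens L'"
proof -
  have vs: "vs \<in> words L" "vs \<noteq> []" using assms(2) by (simp_all add: cocomm_gens_iff)
  have P: "map u P \<in> words L'" "map u P \<noteq> []" using bpart_words(2)[OF assms(1) vs(1)] assms(1) vs by (auto simp: bpart_def)
  then show "map u P \<in> cocomm_gens L'" by (simp add: cocomm_gens_iff)
  show "cocomm_mon L' (map u P) \<in> cmp (cocomm L') (wt (sdeg2 L) vs + 2)"
  proof (rule cocomm_mon_cmp_deg[OF L' P])
    assume z: "0 \<notin> set (map u P)"
    have "wt (sdeg2 L') (map u P) = wt (\<lambda>B. sdeg2 L' (u B)) P" by (simp add: wt_def comp_def)
    also have "\<dots> = wt (wt (sdeg2 L)) P" by (rule wt_cong) (rule bpart_deg[OF assms(1) vs(1) z])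
    also have "\<dots> = wt (sdeg2 L) vs" using assms(1) by (simp add: bpart_def)
    finally show "wt (sdeg2 L') (map u P) + 2 = wt (sdeg2 L) vs + 2" by simp
  qed
qed

lemma exp_form:
  assumes f: "\<phi> \<in> sym_forms L'"
  shows "Fw (*) (sdeg2 L) (\<lambda>P. \<phi> (map u P)) \<in> sym_forms L"
  unfolding sym_forms_iff
proof (rule vsym_Fw)
  fix P P' assume P: "P \<in> lists (blocks L)" "P' \<in> lists (blocks L)"
  have uB: "u B \<in> hmg L'" if "B \<in> blocks L" for B
  proof -
    have "u B \<in> cmp L' (wt (sdeg2 L) B + 2)" using that u by (simp add: blocks_def cofamily_def)
    then show ?thesis by (rule cmp_hmg)
  qed
  have w: "map u P \<in> words L'" "map u P' \<in> words L'"
    using P uB by (auto simp: in_lists_conv_set)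
  have "vsym L (*) (\<lambda>l. \<phi> (map u P @ u l # map u P'))"
  proof (rule vsym_comp[OF L graded_vs[OF L'] graded_subspace[OF L'] vector_space_mult, where f = u and c = 2
        and ll = "\<lambda>x. \<phi> (map u P @ x # map u P')"])
    show "slot_linear L' (*) (\<lambda>x. \<phi> (map u P @ x # map u P'))"
      using vsym_slot[of L' "(*)" \<phi>] f w by (simp add: sym_forms_iff)
  qed (use u in \<open>auto simp: cofamily_def\<close>)
  then show "vsym L (*) (\<lambda>l. \<phi> (map u (P @ l # P')))" by simp
qed

lemma cocomm_exp:
  shows "cocomm_exp u \<in> Hom (cocomm L) (cocomm L') 0"
    and "\<And>vs. vs \<in> cocomm_gens L \<Longrightarrow> cocomm_exp u (cocomm_mon L vs) = Fw fscl (sdeg2 L) (\<lambda>P. cocomm_mon L' (map u P)) vs"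
    and "\<And>t \<phi>. t \<in> tot (cocomm L) \<Longrightarrow> \<phi> \<in> sym_forms L' \<Longrightarrow>
      cocomm_exp u t \<phi> = t (Fw (*) (sdeg2 L) (\<lambda>P. \<phi> (map u P)))"
proof -
  let ?d = "sdeg2 L" and ?f = "Fw fscl (sdeg2 L) (\<lambda>P. cocomm_mon L' (map u P))"
  have ap: "?f g \<phi> = Fw (*) ?d (\<lambda>P. cocomm_mon L' (map u P) \<phi>) g" for g \<phi>
    by (rule Fw_linear[where T = "\<lambda>f. f \<phi>"]) (simp_all add: fscl_def)
  have ev: "(\<lambda>g. ?f g \<phi>) = Fw (*) ?d (\<lambda>P. \<phi> (map u P))" if "\<phi> \<in> sym_forms L'" for \<phi>
    by (simp add: ap fun_eq_iff cocomm_mon_eval[OF that])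
  have 1: "\<forall>\<phi>\<in>sym_forms L'. (\<lambda>g. ?f g \<phi>) \<in> sym_forms L" using ev exp_form by simp
  have 2: "\<forall>g\<in>cocomm_gens L. \<forall>\<phi>. \<phi> \<notin> sym_forms L' \<longrightarrow> ?f g \<phi> = 0"
    by (simp add: ap cocomm_mon_outside Fw_zero[OF vector_space_mult])
  note l = lin_ext_fun[OF 1 2, where F = "cocomm_exp u" and d = "\<lambda>vs. wt (sdeg2 L) vs + 2",
      folded cocomm_def cocomm_mon_def, OF cocomm_exp_def]
  show val: "\<And>vs. vs \<in> cocomm_gens L \<Longrightarrow> cocomm_exp u (cocomm_mon L vs) = ?f vs" by (rule l(2))
  show "cocomm_exp u t \<phi> = t (Fw (*) ?d (\<lambda>P. \<phi> (map u P)))" if "t \<in> tot (cocomm L)" "\<phi> \<in> sym_forms L'" for t \<phi>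
    using l(3)[OF that] ev[OF that(2)] by simp
  have "cocomm_exp u \<in> Hom (presented (sym_forms L) (cocomm_gens L) (\<lambda>vs. wt (sdeg2 L) vs + 2)) (cocomm L') 0"
  proof (rule HomI[OF vs_cocomm subspace_cocomm])
    show "linear_map (presented (sym_forms L) (cocomm_gens L) (\<lambda>vs. wt (sdeg2 L) vs + 2)) (scl (cocomm L')) (cocomm_exp u)"
      using l(1) by (simp add: cocomm_def)
    fix vs assume vs: "vs \<in> cocomm_gens L"
    have "?f vs \<in> cmp (cocomm L') (wt ?d vs + 2) \<and> id (?f vs) = Fw fscl ?d (\<lambda>P. id (cocomm_mon L' (map u P))) vs"
      by (rule Fw_linear_on[OF cmp_additive_on[OF graded_cocomm[OF L']]])
        (use cmp_scale[OF graded_cocomm[OF L']] bpart_mon_cmp(1)[OF _ vs] in auto)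
    then show "cocomm_exp u (pure (sym_forms L) vs) \<in> cmp (cocomm L') (wt (sdeg2 L) vs + 2 + 0)"
      using val[OF vs] by (simp add: cocomm_mon_def)
  qed
  then show "cocomm_exp u \<in> Hom (cocomm L) (cocomm L') 0" by (simp add: cocomm_def)
qed

lemma cocomm_exp_linear:
  assumes "linear_map (cocomm L') s T" "vector_space s" "vs \<in> cocomm_gens L"
  shows "T (cocomm_exp u (cocomm_mon L vs)) = Fw s (sdeg2 L) (\<lambda>P. T (cocomm_mon L' (map u P))) vs"
  unfolding cocomm_exp(2)[OF assms(3)]
proof (rule Fw_linear_on[OF linear_map_additive_on[OF vs_cocomm assms(2,1)], THEN conjunct2])
  show "fscl c x \<in> tot (cocomm L') \<and> T (fscl c x) = s c (T x)" if "x \<in> tot (cocomm L')" for c x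
    using tot_scale[OF vs_cocomm that, of c] linear_map_scale[OF vs_cocomm assms(2,1) that, of c] by simp
  show "cocomm_mon L' (map u P) \<in> tot (cocomm L')" if "bpart (sdeg2 L) vs P" for P
    by (rule cocomm_mon_tot[OF bpart_mon_cmp(2)[OF that assms(3)]])
qed

lemma cocomm_exp_proj:
  assumes vs: "vs \<in> cocomm_gens L"
  shows "cocomm_proj L' (cocomm_exp u (cocomm_mon L vs)) = u vs"
proof -
  have "cocomm_proj L' (cocomm_exp u (cocomm_mon L vs)) =
      Fw (scl L') (sdeg2 L) (\<lambda>P. cocomm_proj L' (cocomm_mon L' (map u P))) vs"
    by (rule cocomm_exp_linear[OF HomD(1)[OF cocomm_proj(1)[OF L']] graded_vs[OF L'] vs])
  also have "\<dots> = Fw (scl L') (sdeg2 L) (\<lambda>P. case P of [l] \<Rightarrow> u l | _ \<Rightarrow> 0) vs"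
    by (rule Fw_cong) (auto simp: cocomm_proj(2)[OF L' bpart_mon_cmp(2)[OF _ vs]] split: list.splits)
  also have "\<dots> = u vs" using vs by (intro Fw_single graded_vs L') (simp add: cocomm_gens_iff)
  finally show ?thesis .
qed

text \<open>Partitioning a word and distributing the blocks amounts to distributing the letters and
  partitioning both parts; this is \<open>Fw_unsh\<close>, applied to bilinear forms.\<close>

lemma cocomm_exp_coalgebra_map: "coalgebra_map L L' (cocomm_exp u)"
  unfolding coalgebra_map_def
proof (intro conjI ballI)
  let ?d = "sdeg2 L" and ?F = "cocomm_exp u"
  note G = graded_cocomm[OF L] graded_cocomm[OF L']
  show Hom: "?F \<in> Hom (cocomm L) (cocomm L') 0" by (rule cocomm_exp(1))
  fix t assume t: "t \<in> tot (cocomm L)"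
  note Ft = Hom_tot[OF Hom vs_cocomm vs_cocomm t]
  show "cocomm_Delta L' (?F t) = tensor_square (cocomm L) (cocomm L') ?F (cocomm_Delta L t)"
  proof (rule tensor_eqI[OF cocomm_Delta(2)[OF L' Ft] tensor_square_tot[OF G Hom cocomm_Delta(2)[OF L t]]])
    fix \<beta> assume b: "\<beta> \<in> bilinear_forms (cocomm L') (cocomm L')"
    note fb = square_form[OF vs_cocomm vs_cocomm Hom b]
    let ?\<beta> = "\<lambda>(x, y). \<beta> (?F x, ?F y)"
    let ?G = "\<lambda>l r. \<beta> (mon0 L' (map u l), mon0 L' (map u r))"
    have c: "ll (?F (mon0 L l)) = Fw (*) ?d (\<lambda>P. ll (mon0 L' (map u P))) l"
      if sl: "slot_linear (cocomm L') (*) ll" and l: "l \<in> words L" for ll l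
    proof (cases "l = []")
      case True
      then show ?thesis using Hom_0[OF G Hom] by (simp add: mon0_def)
    next
      case False
      then have g: "l \<in> cocomm_gens L" using l by (simp add: cocomm_gens_iff)
      have s: "(\<lambda>g. ll (cocomm_mon L' g)) \<in> sym_forms L'"
        using cocomm_univ[OF L' vector_space_mult sl] by (simp add: sym_forms_iff)
      have "ll (?F (cocomm_mon L l)) = ?F (cocomm_mon L l) (\<lambda>g. ll (cocomm_mon L' g))"
        by (rule cocomm_expand[OF L' sl HomD(2)[OF Hom cocomm_mon_deg[OF g]]])
      also have "\<dots> = Fw (*) ?d (\<lambda>P. ll (cocomm_mon L' (map u P))) l"
        using cocomm_exp(3)[OF cocomm_mon_tot[OF g] s] cocomm_mon_eval[OF exp_form[OF s]] by simp
      also have "\<dots> = Fw (*) ?d (\<lambda>P. ll (mon0 L' (map u P))) l"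
        by (rule Fw_cong) (use False in \<open>auto simp: mon0_def bpart_def\<close>)
      finally show ?thesis using False by (simp add: mon0_def)
    qed
    have key: "Fw (*) ?d (\<lambda>P. cocomm_pull L' \<beta> (map u P)) vs = cocomm_pull L ?\<beta> vs" if vs: "vs \<in> cocomm_gens L" for vs
    proof -
      have w: "vs \<in> words L" using vs by (simp add: cocomm_gens_iff)
      have "Fw (*) ?d (\<lambda>P. cocomm_pull L' \<beta> (map u P)) vs = Fw (*) ?d (unshuffle_sum (wt ?d) ?G) vs"
      proof (rule Fw_cong)
        fix P assume P: "bpart ?d vs P"
        have e: "cocomm_pull L' \<beta> (map u P) = unshuffle_sum (\<lambda>B. sdeg2 L' (u B)) ?G P"
          unfolding cocomm_pull_def by (rule unsh_map)
        \<comment> \<open>One side takes signs from the degrees of the letters \<open>u B\<close>,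
          the other from the weights of the blocks \<open>B\<close>. They agree unless some
          \<open>u B\<close> is 0, and then all summands vanish.\<close>
        show "cocomm_pull L' \<beta> (map u P) = unshuffle_sum (wt ?d) ?G P"
        proof (cases "0 \<in> set (map u P)")
          case False
          show ?thesis unfolding e by (rule unsh_deg_cong) (rule bpart_deg[OF P w False])
        next
          case True
          then obtain B where B: "B \<in> set P" "u B = 0" by auto
          have z: "mon0 L' (map u l) = 0" if "B \<in> set l" "set l \<subseteq> set P" for l
          proof -
            have "map u l \<in> words L'" using that bpart_words(2)[OF P w] by (auto simp: in_lists_conv_set)
            moreover have "0 \<in> set (map u l)" using that B by force
            ultimately show ?thesis using cocomm_mon_zero_letter[OF L'] by (simp add: mon0_def)
          qed
          let ?G' = "\<lambda>l r. if set l \<subseteq> set P \<and> set r \<subseteq> set P then ?G l r else 0"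
          have h: "mon0 L' (map u l) \<in> hmg (cocomm L')" if "set l \<subseteq> set P" for l
            using that bpart_words(2)[OF P w] by (intro mon0_hmg[OF L']) (auto simp: in_lists_conv_set)
          have "unshuffle_sum d ?G P = 0" for d
          proof -
            have "unshuffle_sum d ?G P = unshuffle_sum d ?G' P"
              by (rule unsh_cong) (simp add: usplit_def)
            also have "\<dots> = 0"
              by (rule unsh_zero_letter[OF B(1)]) (auto simp: z bilinear_0[OF G(2) b] h)
            finally show ?thesis .
          qed
          then show ?thesis unfolding e by simp
        qed
      qed
      also have "\<dots> = unshuffle_sum ?d (\<lambda>l r. Fw (*) ?d (\<lambda>P. Fw (*) ?d (?G P) r) l) vs"
        by (rule Fw_unsh)
      also have "\<dots> = cocomm_pull L ?\<beta> vs"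
        unfolding cocomm_pull_def
      proof (rule unsh_cong)
        fix l r assume "usplit ?d vs l r"
        with usplit_lists[OF this w] have lr: "l \<in> words L" "r \<in> words L" by simp_all
        have "\<beta> (?F (mon0 L l), ?F (mon0 L r)) = Fw (*) ?d (\<lambda>P. \<beta> (mon0 L' (map u P), ?F (mon0 L r))) l"
          by (rule c[OF bilinear_left[OF b Hom_hmg[OF Hom mon0_hmg[OF L lr(2)]]] lr(1)])
        also have "\<dots> = Fw (*) ?d (\<lambda>P. Fw (*) ?d (?G P) r) l"
        proof (rule Fw_cong)
          fix P assume "bpart ?d l P"
          from c[OF bilinear_right[OF b mon0_hmg[OF L' bpart_words(2)[OF this lr(1)]]] lr(2)]
          show "\<beta> (mon0 L' (map u P), ?F (mon0 L r)) = Fw (*) ?d (?G P) r" .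
        qed
        finally show "Fw (*) ?d (\<lambda>P. Fw (*) ?d (?G P) r) l = ?\<beta> (mon0 L l, mon0 L r)" by simp
      qed
      finally show ?thesis .
    qed
    show "cocomm_Delta L' (?F t) \<beta> = tensor_square (cocomm L) (cocomm L') ?F (cocomm_Delta L t) \<beta>"
      unfolding tensor_square(3)[OF G Hom cocomm_Delta(2)[OF L t] b] cocomm_Delta(3)[OF L t fb]
        cocomm_Delta(3)[OF L' Ft b] cocomm_exp(3)[OF t cocomm_pull_form[OF L' b]]
      by (rule ev_cong[OF t[unfolded cocomm_def] exp_form[OF cocomm_pull_form[OF L' b]] cocomm_pull_form[OF L fb] key])
  qed
qed

end

text \<open>A morphism is determined by its corestriction, and the exponential of the corestriction
  is a morphism with the same one.\<close>

lemma coalgebra_map_exp: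
  assumes F: "coalgebra_map L L' F"
  defines "u \<equiv> \<lambda>vs. cocomm_proj L' (F (cocomm_mon L vs))"
  shows "cofamily u" "F = cocomm_exp u"
proof -
  have H: "F \<in> Hom (cocomm L) (cocomm L') 0" using F by (simp add: coalgebra_map_def)
  have sl: "slot_linear (cocomm L) (scl L') (\<lambda>t. cocomm_proj L' (F t))"
  proof (rule slot_linear_comp_Hom[OF H _ vs_cocomm vs_cocomm])
    show "slot_linear (cocomm L') (scl L') (cocomm_proj L')"
      using slot_linear_comp_Hom[OF cocomm_proj(1)[OF L'], of "scl L'" "\<lambda>x. x"] vs_cocomm graded_vs[OF L']
      by (simp add: slot_linear_def)
  qed
  show u: "cofamily u"
    unfolding cofamily_def
  proof (intro conjI ballI impI)
    show "vsym L (scl L') u"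
      unfolding u_def by (rule cocomm_univ[OF L graded_vs[OF L'] sl])
    show "u l \<in> cmp L' (wt (sdeg2 L) l + 2)" if "l \<in> words L" "l \<noteq> []" for l
      using HomD(2)[OF cocomm_proj(1)[OF L'] HomD(2)[OF H cocomm_mon_deg[of l L]]] that
      by (simp add: u_def cocomm_gens_iff)
  qed
  show "F = cocomm_exp u"
    by (rule coalgebra_map_unique[OF F cocomm_exp_coalgebra_map[OF u]])
      (simp only: cocomm_exp_proj[OF u], simp add: u_def)
qed

end

section \<open>The codifferential of the Hochschild complex\<close>

lemma cocomm_coder_proj2:
  assumes L: "graded_space L" and q: "corestriction L q" and vs: "vs \<in> cocomm_gens L"
  shows "cocomm_proj L (cocomm_coder L q (cocomm_coder L q (cocomm_mon L vs))) =
     unshuffle_sum (sdeg2 L) (\<lambda>l r. q (q l # r)) vs"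
proof -
  note C = cocomm_coder[OF L q]
  have w: "vs \<in> words L" using vs by (simp add: cocomm_gens_iff)
  have gen: "q l # r \<in> cocomm_gens L" if "usplit (sdeg2 L) vs l r" for l r
    using q usplit_lists[OF that w] by (auto simp: corestriction_def[OF L] cocomm_gens_iff intro: cmp_hmg)
  have lin: "linear_map (cocomm L) (scl L) (\<lambda>t. cocomm_proj L (cocomm_coder L q t))"
    by (rule linear_map_comp[OF C(1) HomD(1)[OF cocomm_proj(1)[OF L]] vs_cocomm vs_cocomm graded_vs[OF L]])
  have "cocomm_proj L (cocomm_coder L q (cocomm_coder L q (cocomm_mon L vs))) =
     unshuffle_sum (sdeg2 L) (\<lambda>l r. cocomm_proj L (cocomm_coder L q (cocomm_mon L (q l # r)))) vs"
    unfolding C(2)[OF vs] coder_def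
    by (rule unsh_additive_on[OF linear_map_additive_on[OF vs_cocomm graded_vs[OF L] lin], THEN conjunct2])
      (rule cocomm_mon_tot[OF gen])
  also have "\<dots> = unshuffle_sum (sdeg2 L) (\<lambda>l r. q (q l # r)) vs"
    by (rule unsh_cong) (rule C(5)[OF gen])
  finally show ?thesis .
qed

text \<open>The corestriction of \<open>hoch_codiff A m\<close>, isolated so that the general
  results on \<open>cocomm_coder\<close> apply, see \<open>hoch_codiff_coder\<close>.\<close>

definition hoch_cores ::
  "('k::field_char_0, 'a::ab_group_add) gvs \<Rightarrow> ('a list \<Rightarrow> 'a) \<Rightarrow> ('a list \<Rightarrow> 'a) list \<Rightarrow> 'a list \<Rightarrow> 'a" where
  "hoch_cores A m l = (case l of [f] \<Rightarrow> gerst_bracket A m f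
     | [f, g] \<Rightarrow> ksign (deg (hoch A) f) (gerst_bracket A f g) | _ \<Rightarrow> 0)"

lemma hoch_cores_simps [simp]:
  "hoch_cores A m [] = 0" "hoch_cores A m [f] = gerst_bracket A m f"
  "hoch_cores A m [f, g] = ksign (deg (hoch A) f) (gerst_bracket A f g)"
  "hoch_cores A m (f # g # h # r) = 0"
  by (simp_all add: hoch_cores_def)

context
  fixes A :: "('k::field_char_0, 'a::ab_group_add) gvs"
  assumes A: "graded_space A"
begin

lemma Ins_inner_linear:
  assumes f: "f \<in> cmp (hoch A) a" and u: "u \<in> cmp (hoch A) n" and v: "v \<in> cmp (hoch A) n"
  shows "Ins (sdeg1 A) p (u + scl (hoch A) c v) f as = Ins (sdeg1 A) p u f as + scl A c (Ins (sdeg1 A) p v f as)"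
proof -
  have w: "u + scl (hoch A) c v \<in> cmp (hoch A) n"
    by (rule cmp_add[OF graded_hoch[OF A] u cmp_scale[OF graded_hoch[OF A] v]])
  have e: "f (x @ (u + scl (hoch A) c v) y # z) = f (x @ u y # z) + scl A c (f (x @ v y # z))" for x y z
  proof (cases "x @ y @ z \<in> words A")
    case True
    then have xyz: "x \<in> words A" "y \<in> words A" "z \<in> words A" by auto
    show ?thesis
      using vmult_slot[OF hochD(2)[OF A f] xyz(1,3)] hochD(3)[OF A u xyz(2)] hochD(3)[OF A v xyz(2)]
      unfolding slot_linear_def by simp
  next
    case False
    then show ?thesis
      using hoch_ins_outside[OF A f w False] hoch_ins_outside[OF A f u False] hoch_ins_outside[OF A f v False]
        vector_space_scale[OF graded_vs[OF A]] by simp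
  qed
  have "scl A c (Ins (sdeg1 A) p v f as) = Ins (sdeg1 A) p v (\<lambda>w. scl A c (f w)) as"
    by (rule Ins_additive) (rule vector_space_scale(1)[OF graded_vs[OF A]])
  then show ?thesis
    unfolding Ins_eq_dec by (simp only: e dec_add ksign_add)
qed

lemma Ins_outer_linear:
  "Ins (sdeg1 A) p f (u + scl (hoch A) c v) as = Ins (sdeg1 A) p f u as + scl A c (Ins (sdeg1 A) p f v as)"
proof -
  have "scl A c (Ins (sdeg1 A) p f v as) = Ins (sdeg1 A) p f (\<lambda>w. scl A c (v w)) as"
    by (rule Ins_additive) (rule vector_space_scale(1)[OF graded_vs[OF A]])
  then show ?thesis by (simp add: Ins_add[symmetric] plus_fun_def)
qed

lemma gerst_slot_right:
  assumes f: "f \<in> cmp (hoch A) a"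
  shows "slot_linear (hoch A) (scl (hoch A)) (gerst_bracket A f)"
  unfolding slot_linear_def
proof (intro allI ballI)
  fix n u v c assume u: "u \<in> cmp (hoch A) n" and v: "v \<in> cmp (hoch A) n"
  have w: "u + scl (hoch A) c v \<in> cmp (hoch A) n"
    by (rule cmp_add[OF graded_hoch[OF A] u cmp_scale[OF graded_hoch[OF A] v]])
  show "gerst_bracket A f (u + scl (hoch A) c v) = gerst_bracket A f u + scl (hoch A) c (gerst_bracket A f v)"
    unfolding gerst_eq[OF A f w] gerst_eq[OF A f u] gerst_eq[OF A f v]
  proof
    fix as
    show "(Ins (sdeg1 A) (n - 1) (u + scl (hoch A) c v) f - ksign ((a - 1) * (n - 1)) (Ins (sdeg1 A) (a - 1) f (u + scl (hoch A) c v))) as =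
      (Ins (sdeg1 A) (n - 1) u f - ksign ((a - 1) * (n - 1)) (Ins (sdeg1 A) (a - 1) f u) +
       scl (hoch A) c (Ins (sdeg1 A) (n - 1) v f - ksign ((a - 1) * (n - 1)) (Ins (sdeg1 A) (a - 1) f v))) as"
      unfolding minus_apply plus_fun_apply ksign_apply Ins_inner_linear[OF f u v] Ins_outer_linear
      using additive_on_diff[OF additive_onI[of "scl A c"]] vector_space_scale(1)[OF graded_vs[OF A]]
      by (simp add: ksign_add ksign_apply scale_ksign[OF graded_vs[OF A]])
  qed
qed

text \<open>Reduced to linearity in the second argument by graded antisymmetry, whose sign depends
  only on the degree of the varying cochain.\<close>

lemma gerst_slot_left:
  assumes g: "g \<in> cmp (hoch A) b"
  shows "slot_linear (hoch A) (scl (hoch A)) (\<lambda>f. gerst_bracket A f g)"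
proof (rule slot_linear_cong[OF _ _ graded_hoch[OF A]])
  note H = graded_hoch[OF A]
  show "slot_linear (hoch A) (scl (hoch A)) (\<lambda>f. - ksign ((b - 1) * (deg (hoch A) f - 1)) (gerst_bracket A g f))"
    by (intro slot_linear_uminus[OF graded_vs[OF H]] slot_linear_sign[OF H graded_vs[OF H] gerst_slot_right[OF g], of "\<lambda>n. (b - 1) * (n - 1)"])
  fix u assume "u \<in> hmg (hoch A)"
  from gerst_antisym[OF A g hmg_cmp[OF H this]]
  show "- ksign ((b - 1) * (deg (hoch A) u - 1)) (gerst_bracket A g u) = gerst_bracket A u g" by simp
qed

lemma gerst_ksign:
  assumes f: "f \<in> cmp (hoch A) a" and g: "g \<in> cmp (hoch A) b"
  shows "gerst_bracket A (ksign n f) g = ksign n (gerst_bracket A f g)"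
    and "gerst_bracket A f (ksign n g) = ksign n (gerst_bracket A f g)"
    and "gerst_bracket A 0 g = 0" "gerst_bracket A f 0 = 0"
proof -
  note H = graded_hoch[OF A]
  note vs = graded_vs[OF H]
  show "gerst_bracket A (ksign n f) g = ksign n (gerst_bracket A f g)"
    by (rule slot_linear_ksign[OF H vs gerst_slot_left[OF g] f])
  show "gerst_bracket A f (ksign n g) = ksign n (gerst_bracket A f g)"
    by (rule slot_linear_ksign[OF H vs gerst_slot_right[OF f] g])
  show "gerst_bracket A 0 g = 0" by (rule slot_linear_0[OF H vs gerst_slot_left[OF g]])
  show "gerst_bracket A f 0 = 0" by (rule slot_linear_0[OF H vs gerst_slot_right[OF f]])
qed

lemma sign_gerst:
  assumes f: "f \<in> cmp (hoch A) a" and g: "g \<in> cmp (hoch A) b"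
  shows "ksign (deg (hoch A) f) (gerst_bracket A f g) = ksign a (gerst_bracket A f g)"
  by (rule deg_sign[OF graded_hoch[OF A] f]) (simp add: gerst_ksign(3)[OF f g])

context
  fixes m :: "'a list \<Rightarrow> 'a"
  assumes m: "m \<in> cmp (hoch A) 2"
begin

text \<open>The factor \<open>ksign (deg (hoch A) f)\<close> turns graded antisymmetry with respect
  to shifted degrees into graded symmetry with respect to \<open>sdeg2\<close>. Linearity is checked
  by the number of letters, since only words of length one and two can have a nonzero value.\<close>

lemma hoch_cores: "corestriction (hoch A) (hoch_cores A m)"
  unfolding corestriction_def[OF graded_hoch[OF A]]
proof (intro conjI ballI)
  note H = graded_hoch[OF A]
  note vs = graded_vs[OF H]
  show "vsym (hoch A) (scl (hoch A)) (hoch_cores A m)"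
  proof (rule vsymI)
    fix xs ys assume xy: "xs \<in> words (hoch A)" "ys \<in> words (hoch A)"
    have "length xs + length ys \<ge> 2 \<or> (xs = [] \<and> ys = []) \<or> (\<exists>x. xs = [x] \<and> ys = []) \<or> (\<exists>y. xs = [] \<and> ys = [y])"
      by (cases xs rule: remdups_adj.cases; cases ys rule: remdups_adj.cases) auto
    then consider "length xs + length ys \<ge> 2" | "xs = []" "ys = []" | x where "xs = [x]" "ys = []" | y where "xs = []" "ys = [y]"
      by blast
    then show "slot_linear (hoch A) (scl (hoch A)) (\<lambda>u. hoch_cores A m (xs @ u # ys))"
    proof cases
      case 1
      then have "hoch_cores A m (xs @ u # ys) = 0" for u
        by (cases "xs @ u # ys" rule: remdups_adj.cases; auto simp: hoch_cores_def split: list.splits)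
          (auto simp: append_eq_Cons_conv)
      then show ?thesis using slot_linear_zero[OF vs] by simp
    next
      case 2
      then show ?thesis using gerst_slot_right[OF m] by simp
    next
      case 3
      then have "x \<in> hmg (hoch A)" using xy by simp
      from slot_linear_ksign_const[OF vs gerst_slot_right[OF hmg_cmp[OF H this]]]
      show ?thesis using 3 by simp
    next
      case 4
      then have "y \<in> hmg (hoch A)" using xy by simp
      from slot_linear_sign[OF H vs gerst_slot_left[OF hmg_cmp[OF H this]], of "\<lambda>n. n"]
      show ?thesis using 4 by simp
    qed
    fix u v assume "u \<in> hmg (hoch A)" "v \<in> hmg (hoch A)"
    note uv = hmg_cmp[OF H this(1)] hmg_cmp[OF H this(2)]
    show "hoch_cores A m (xs @ u # v # ys) =
        ksign (sdeg2 (hoch A) u * sdeg2 (hoch A) v) (hoch_cores A m (xs @ v # u # ys))"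
    proof (cases "xs = [] \<and> ys = []")
      case True
      then show ?thesis
        using gerst_antisym[OF A uv] by (simp add: sdeg2_def) (simp add: ksign_def)
    next
      case False
      then have "hoch_cores A m (xs @ u # v # ys) = 0" for u v
        by (cases xs; cases ys; cases "tl xs") (auto simp: hoch_cores_def split: list.splits)
      then show ?thesis by simp
    qed
  qed
  show "hoch_cores A m l \<in> cmp (hoch A) (wt (sdeg2 (hoch A)) l + 3)" if l: "l \<in> words (hoch A)" for l
  proof -
    have z: "0 \<in> cmp (hoch A) n" for n by (rule cmp_0[OF H])
    consider "l = []" | f where "l = [f]" | f g where "l = [f, g]" | f g h r where "l = f # g # h # r"
      by (metis list.exhaust)
    then show ?thesis
    proof cases
      case 2
      then have "f \<in> hmg (hoch A)" using l by simp
      from gerst_cmp[OF A m hmg_cmp[OF H this]] show ?thesis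
        using 2 by (simp add: sdeg2_def add.commute)
    next
      case 3
      then have "f \<in> hmg (hoch A)" "g \<in> hmg (hoch A)" using l by simp_all
      from cmp_ksign[OF H gerst_cmp[OF A hmg_cmp[OF H this(1)] hmg_cmp[OF H this(2)]], of "deg (hoch A) f"]
      show ?thesis using 3 by (simp add: sdeg2_def)
    qed (simp_all add: z)
  qed
qed simp

lemma hoch_codiff_coder: "hoch_codiff A m = cocomm_coder (hoch A) (hoch_cores A m)"
  unfolding hoch_codiff_def cocomm_coder_def[OF graded_hoch[OF A]]
proof (rule lin_extension_cong)
  note H = graded_hoch[OF A]
  fix vs assume "vs \<in> cocomm_gens (hoch A)"
  then have w: "vs \<in> words (hoch A)" by (simp add: cocomm_gens_iff)
  show "unshuffle_sum (sdeg2 (hoch A)) (\<lambda>l r. case l of [f] \<Rightarrow> cocomm_mon (hoch A) (gerst_bracket A m f # r)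
          | [f, g] \<Rightarrow> ksign (deg (hoch A) f) (cocomm_mon (hoch A) (gerst_bracket A f g # r)) | _ \<Rightarrow> 0) vs =
     coder (sdeg2 (hoch A)) (hoch_cores A m) (cocomm_mon (hoch A)) vs"
    unfolding coder_def
  proof (rule unsh_cong)
    fix l r assume u: "usplit (sdeg2 (hoch A)) vs l r"
    note lr = usplit_lists[OF u w]
    have z: "cocomm_mon (hoch A) (0 # r) = 0"
      by (rule cocomm_mon_zero_letter[OF H]) (use lr hmg_0[OF H] in auto)
    consider "l = []" | f where "l = [f]" | f g where "l = [f, g]" | f g h r where "l = f # g # h # r"
      by (metis list.exhaust)
    then show "(case l of [f] \<Rightarrow> cocomm_mon (hoch A) (gerst_bracket A m f # r)
          | [f, g] \<Rightarrow> ksign (deg (hoch A) f) (cocomm_mon (hoch A) (gerst_bracket A f g # r)) | _ \<Rightarrow> 0) =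
        cocomm_mon (hoch A) (hoch_cores A m l # r)"
    proof cases
      case 3
      then have "f \<in> hmg (hoch A)" "g \<in> hmg (hoch A)" using lr by simp_all
      note c = gerst_cmp[OF A hmg_cmp[OF H this(1)] hmg_cmp[OF H this(2)]]
      have "slot_linear (hoch A) fscl (\<lambda>x. cocomm_mon (hoch A) (x # r))"
        using vsym_slot[OF cocomm_mon_vsym, of "[]" "hoch A" r] lr by simp
      from slot_linear_ksign[OF H vector_space_fscl this c] show ?thesis using 3 by simp
    qed (simp_all add: z)
  qed
qed

end

section \<open>The square of the Hochschild codifferential\<close>

context
  fixes m :: "'a list \<Rightarrow> 'a"
  assumes m: "m \<in> cmp (hoch A) 2" and mm: "gerst_bracket A m m = 0"
begin

text \<open>The Jacobi identity for \<open>m\<close>, \<open>m\<close>, \<open>f\<close> has one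
  term containing \<open>[m, m] = 0\<close> and two equal terms, so division by 2 gives the
  claim.\<close>

lemma gerst_m_m:
  assumes f: "f \<in> cmp (hoch A) (k + 1)"
  shows "gerst_bracket A m (gerst_bracket A m f) = 0"
proof -
  note H = graded_hoch[OF A]
  have m': "m \<in> cmp (hoch A) (1 + 1)" using m by simp
  have mf: "gerst_bracket A m f \<in> cmp (hoch A) (k + 2)" using gerst_cmp[OF A m f] by (simp add: add.commute)
  let ?X = "gerst_bracket A (gerst_bracket A m f) m"
  have "gerst_bracket A (gerst_bracket A f m) m = - ksign k ?X"
    unfolding gerst_antisym[OF A m f] using gerst_ksign(1)[OF mf m, of "k + 1"] by (simp add: ksign_def split: if_splits)
  moreover have "ksign (1 * k) (gerst_bracket A (gerst_bracket A m m) f) +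
     ksign (1 * 1) ?X + ksign (k * 1) (gerst_bracket A (gerst_bracket A f m) m) = 0"
    by (rule gerst_jacobi[OF A m' m' f])
  ultimately have "ksign (1 * 1) ?X + ksign (k * 1) (- ksign k ?X) = 0"
    unfolding mm gerst_ksign(3)[OF m f] by (simp only: ksign_zero add_0_left)
  then have X: "?X + ?X = 0"
    by (cases "even k") (simp_all add: ksign_def eq_neg_iff_add_eq_0[symmetric])
  have "?X = 0"
  proof -
    have "scl (hoch A) (1 / 2) (?X + ?X) = ?X"
      using vector_space_scale[OF graded_vs[OF H]] by (simp del: scl_hoch add: vector_space_scale(7)[OF graded_vs[OF H], symmetric] vector_space_scale(1)[OF graded_vs[OF H]])
    then show ?thesis using X vector_space_scale(2)[OF graded_vs[OF H], of "1 / 2"] by simp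
  qed
  then show ?thesis unfolding gerst_antisym[OF A mf m] by simp
qed

text \<open>The corestriction of the square, sorted by the number of letters: for one letter the
  square of the differential, for two the derivation rule, for three the Jacobi identity; from four
  letters on every term is 0.\<close>

lemma hoch_cores_square:
  assumes w: "vs \<in> words (hoch A)"
  shows "unshuffle_sum (sdeg2 (hoch A)) (\<lambda>l r. hoch_cores A m (hoch_cores A m l # r)) vs = 0"
proof -
  note H = graded_hoch[OF A]
  let ?q = "hoch_cores A m" and ?B = "gerst_bracket A"
  have z: "?q (0 # r) = 0" if "r \<in> words (hoch A)" for r
    using vmult_letter_zero[OF H graded_vs[OF H] vsym_vmult, of "?q" "[]" r] hoch_cores[OF m] that
    by (simp add: corestriction_def[OF H])
  have pair: "?q [F, h] = ksign n (?B F h)" if "F \<in> cmp (hoch A) n" "h \<in> cmp (hoch A) c" for F h n c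
    using sign_gerst[OF that] by simp
  have "vs = [] \<or> (\<exists>f. vs = [f]) \<or> (\<exists>f g. vs = [f, g]) \<or> (\<exists>f g h. vs = [f, g, h]) \<or> length vs \<ge> 4"
  proof (cases "length vs \<ge> 4")
    case False
    then have "length vs = 0 \<or> length vs = 1 \<or> length vs = 2 \<or> length vs = 3" by linarith
    then show ?thesis by (auto simp: numeral_eq_Suc length_Suc_conv)
  qed simp
  then consider "vs = []" | f where "vs = [f]" | f g where "vs = [f, g]" | f g h where "vs = [f, g, h]"
    | "length vs \<ge> 4"
    by blast
  then show ?thesis
  proof cases
    case 1
    then show ?thesis using z[of "[]"] by simp
  next
    case (2 f)
    then have "f \<in> hmg (hoch A)" using w by simp
    with hmg_cmp[OF H this] have "?B m (?B m f) = 0" "?q [0, f] = 0"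
      using gerst_m_m[of f "deg (hoch A) f - 1"] z[of "[f]"] by simp_all
    then show ?thesis using 2 by simp
  next
    case (3 f g)
    \<comment> \<open>Degrees shifted by 1, for which the bracket is a Lie bracket of degree 0; this
      is the form required by \<open>gerst_jacobi\<close>.\<close>
    define j k where "j = deg (hoch A) f - 1" "k = deg (hoch A) g - 1"
    have d: "deg (hoch A) f = j + 1" "deg (hoch A) g = k + 1" by (simp_all add: j_k_def)
    have fg: "f \<in> cmp (hoch A) (j + 1)" "g \<in> cmp (hoch A) (k + 1)"
      using w 3 hmg_cmp[OF H, of f] hmg_cmp[OF H, of g] by (simp_all add: d)
    have m': "m \<in> cmp (hoch A) (1 + 1)" using m by simp
    have c: "?B f g \<in> cmp (hoch A) (j + k + 1)" "?B m f \<in> cmp (hoch A) (j + 2)" "?B m g \<in> cmp (hoch A) (k + 2)"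
      using gerst_cmp[OF A fg] gerst_cmp[OF A m fg(1)] gerst_cmp[OF A m fg(2)] by (simp_all add: algebra_simps)
    have z': "?q [0, f, g] = 0" by simp
    let ?X = "?B (?B m f) g" and ?Y = "?B (?B f g) m" and ?Z = "?B (?B m g) f"
    have e1: "?q [?q [f, g]] = - ksign (k + 1) ?Y"
      unfolding hoch_cores_simps d gerst_ksign(2)[OF m c(1)] gerst_antisym[OF A c(1) m]
      by (simp add: ksign_def)
    have e2: "?q [?q [f], g] = ksign (j + 2) ?X" and e3: "?q [?q [g], f] = ksign (k + 2) ?Z"
      using pair[OF c(2) fg(2)] pair[OF c(3) fg(1)] by simp_all
    have gm: "?B (?B g m) f = - ksign k ?Z"
      unfolding gerst_antisym[OF A m fg(2)] using gerst_ksign(1)[OF c(3) fg(1), of "k + 1"]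
      by (simp add: ksign_def split: if_splits)
    have J: "ksign (1 * k) ?X + ksign (j * 1) ?Y + ksign (k * j) (?B (?B g m) f) = 0"
      by (rule gerst_jacobi[OF A m' fg])
    have "unshuffle_sum (sdeg2 (hoch A)) (\<lambda>l r. ?q (?q l # r)) vs =
      ?q [?q [f, g]] + ?q [?q [f], g] + ksign ((j - 1) * (k - 1)) (?q [?q [g], f])"
      using z' by (simp add: 3 sdeg2_def d del: hoch_cores_simps(2-4))
    also have "\<dots> = ksign (j + k) (ksign (1 * k) ?X + ksign (j * 1) ?Y + ksign (k * j) (?B (?B g m) f))"
      unfolding e1 e2 e3 gm
      by (cases "even j"; cases "even k") (simp_all add: ksign_def algebra_simps)
    finally show ?thesis unfolding J by simp
  next
    case (4 f g h)
    define i j k where "i = deg (hoch A) f - 1" "j = deg (hoch A) g - 1" "k = deg (hoch A) h - 1"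
    have d: "deg (hoch A) f = i + 1" "deg (hoch A) g = j + 1" "deg (hoch A) h = k + 1" by (simp_all add: i_j_k_def)
    have fgh: "f \<in> cmp (hoch A) (i + 1)" "g \<in> cmp (hoch A) (j + 1)" "h \<in> cmp (hoch A) (k + 1)"
      using w 4 hmg_cmp[OF H, of f] hmg_cmp[OF H, of g] hmg_cmp[OF H, of h] by (simp_all add: d)
    have c: "ksign n (?B f g) \<in> cmp (hoch A) (i + j + 1)" "ksign n (?B f h) \<in> cmp (hoch A) (i + k + 1)"
        "ksign n (?B g h) \<in> cmp (hoch A) (j + k + 1)" for n
      using cmp_ksign[OF H gerst_cmp[OF A fgh(1,2)], of n] cmp_ksign[OF H gerst_cmp[OF A fgh(1,3)], of n]
        cmp_ksign[OF H gerst_cmp[OF A fgh(2,3)], of n]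
      by (simp_all add: algebra_simps)
    note c0 = c[of 0, simplified]
    let ?X = "?B (?B f g) h" and ?Y = "?B (?B g h) f" and ?Z = "?B (?B h f) g"
    have e: "?q [?q [f, g], h] = ksign (i + j + 1) (ksign (i + 1) ?X)"
        "?q [?q [f, h], g] = ksign (i + k + 1) (ksign (i + 1) (?B (?B f h) g))"
        "?q [?q [g, h], f] = ksign (j + k + 1) (ksign (j + 1) ?Y)"
      using pair[OF c(1) fgh(3)] pair[OF c(2) fgh(2)] pair[OF c(3) fgh(1)]
        gerst_ksign(1)[OF c0(1) fgh(3)] gerst_ksign(1)[OF c0(2) fgh(2)] gerst_ksign(1)[OF c0(3) fgh(1)]
      by (simp_all add: d)
    have hf: "?B h f \<in> cmp (hoch A) (k + i + 1)" using gerst_cmp[OF A fgh(3,1)] by (simp add: algebra_simps)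
    have fh: "?B (?B f h) g = - ksign (i * k) ?Z"
      unfolding gerst_antisym[OF A fgh(3,1)] using gerst_ksign(1)[OF hf fgh(2), of "i * k + 1"]
      by (simp add: ksign_def split: if_splits)
    have J: "ksign (i * k) ?X + ksign (j * i) ?Y + ksign (k * j) ?Z = 0"
      by (rule gerst_jacobi[OF A fgh])
    have "?q [?q [f, g, h]] = 0" "?q (?q [] # [f, g, h]) = 0" "?q [?q [f], g, h] = 0" "?q [?q [g], f, h] = 0"
        "?q [?q [h], f, g] = 0"
      using z[of "[]"] by simp_all
    then have "unshuffle_sum (sdeg2 (hoch A)) (\<lambda>l r. ?q (?q l # r)) vs =
      ?q [?q [f, g], h] + ksign ((j - 1) * (k - 1)) (?q [?q [f, h], g]) +
      ksign ((i - 1) * ((j - 1) + (k - 1))) (?q [?q [g, h], f])"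
      by (simp add: 4 sdeg2_def d del: hoch_cores_simps)
    also have "\<dots> = ksign (i * k + j) (ksign (i * k) ?X + ksign (j * i) ?Y + ksign (k * j) ?Z)"
      unfolding e fh
      by (cases "even i"; cases "even j"; cases "even k") (simp_all add: ksign_def algebra_simps)
    finally show ?thesis unfolding J by simp
  next
    \<comment> \<open>A nonzero inner value uses at most two of the letters, so the outer
      application has at least three entries.\<close>
    case 5
    show ?thesis
    proof (rule unsh_zeroI)
      fix l r assume u: "usplit (sdeg2 (hoch A)) vs l r"
      note lr = usplit_lists[OF u w]
      have len: "length l + length r = length vs" using u by (simp add: usplit_def)
      show "?q (?q l # r) = 0"
      proof (cases "length l = 1 \<or> length l = 2")
        case True
        then have "length r \<ge> 2" using len 5 by auto
        then show ?thesis by (cases r rule: remdups_adj.cases) auto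
      next
        case False
        then have "?q l = 0" by (cases l rule: remdups_adj.cases) (auto simp: hoch_cores_def split: list.splits)
        then show ?thesis using z lr by simp
      qed
    qed
  qed
qed

lemma hoch_LambdaLie: "LambdaLie_infinity (hoch A) (hoch_codiff A m)"
proof -
  note H = graded_hoch[OF A]
  note q = hoch_cores[OF m]
  note C = cocomm_coder[OF H q]
  have "cocomm_coder (hoch A) (hoch_cores A m) (cocomm_coder (hoch A) (hoch_cores A m) t) = 0" for t
    by (rule cocomm_square_zero[OF H C(1) C(4)])
      (simp add: cocomm_coder_proj2[OF H q] hoch_cores_square cocomm_gens_iff)
  then show ?thesis
    unfolding LambdaLie_infinity_def hoch_codiff_coder[OF m] using C(1) C(4) by simp
qed

end

end

section \<open>Coderivations of the cofree S-coalgebra\<close>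

lemma so_mon_tot: "g \<in> so_gens V A \<Longrightarrow> so_mon V A g \<in> tot (So V A)"
  unfolding So_def so_mon_def by (rule pure_tot)

lemma so_linear_eq:
  assumes "vector_space s" "linear_map (So V A) s F" "linear_map (So V A) s F'"
    "\<And>g. g \<in> so_gens V A \<Longrightarrow> F (so_mon V A g) = F' (so_mon V A g)"
  shows "F = F'"
  using assms unfolding So_def so_mon_def by (rule linear_map_eq_on)

context
  fixes V :: "('k::field_char_0, 'v::ab_group_add) gvs" and A :: "('k, 'a::ab_group_add) gvs"
  assumes V: "graded_space V" and A: "graded_space A"
begin

lemma so_eqI:
  assumes t: "t \<in> cmp (So V A) n" "t' \<in> cmp (So V A) n" "so_proj V A t = so_proj V A t'"
      "ger_proj V (so_rho V A t) = ger_proj V (so_rho V A t')"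
    and b: "\<And>\<beta>. \<beta> \<in> bilinear_forms (So V A) (So V A) \<Longrightarrow> so_Delta V A t \<beta> = so_Delta V A t' \<beta>"
  shows "t = t'"
proof -
  have tt: "t \<in> tot (So V A)" "t' \<in> tot (So V A)" using t(1,2) by (auto intro: hmg_tot[OF vs_So cmp_hmg])
  have "so_Delta V A t = so_Delta V A t'"
    by (rule tensor_eqI[OF so_Delta(2)[OF V A tt(1)] so_Delta(2)[OF V A tt(2)] b])
  then have "so_Delta V A (t - t') = 0"
    using linear_map_diff[OF vs_So vector_space_fscl so_Delta(1)[OF V A] tt] by simp
  moreover have "so_proj V A (t - t') = 0"
    using linear_map_diff[OF vs_So graded_vs[OF A] HomD(1)[OF so_proj(1)[OF V A]] tt] t(3) by simp
  moreover have "ger_proj V (so_rho V A (t - t')) = 0"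
    using linear_map_diff[OF vs_So graded_vs[OF V]
        linear_map_comp[OF so_rho(1)[OF V] HomD(1)[OF ger_proj(1)[OF V]] vs_So vs_Ger graded_vs[OF V]] tt] t(4) by simp
  ultimately have "t - t' = 0"
    by (rule so_primitive[OF V A cmp_diff[OF graded_So[OF V A] t(1,2)]])
  then show ?thesis by simp
qed

lemma so_Delta_mon:
  assumes "g \<in> so_gens V A" "\<beta> \<in> bilinear_forms (So V A) (So V A)"
  shows "so_Delta V A (so_mon V A g) \<beta> = so_pull V A \<beta> g"
  using so_Delta(3)[OF V A so_mon_tot[OF assms(1)] assms(2)] so_mon_eval[OF so_pull_form[OF V A assms(2)]] by simp

abbreviation (input) so_size :: "'v list \<times> 'a list \<Rightarrow> nat" where
  "so_size g \<equiv> length (fst g) + length (snd g)"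

lemma so_pull_cong:
  assumes g: "g \<in> so_gens V A"
    and b: "\<beta> \<in> bilinear_forms (So V A) (So V A)" "\<beta>' \<in> bilinear_forms (So V A) (So V A)"
    and e: "\<And>l r. l \<in> so_gens V A \<Longrightarrow> r \<in> so_gens V A \<Longrightarrow> so_size l < so_size g \<Longrightarrow> so_size r < so_size g \<Longrightarrow>
      \<beta> (so_mon V A l, so_mon V A r) = \<beta>' (so_mon V A l, so_mon V A r)"
  shows "so_pull V A \<beta> g = so_pull V A \<beta>' g"
proof -
  obtain vs as where g': "g = (vs, as)" by (cases g)
  have w: "vs \<in> words V" "as \<in> words A" using g by (simp_all add: g' so_gens_iff)
  show ?thesis
    unfolding g' so_pull_def[OF V A] so_split_def[OF V A] prod.case
  proof (intro unsh_cong dec_cong)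
    fix l r x y assume u: "usplit (sdeg2 V) vs l r" and as: "as = x @ y"
    have lr: "l \<in> words V" "r \<in> words V" "x \<in> words A" "y \<in> words A" using usplit_lists[OF u w(1)] w(2) as by auto
    note h = mon1_hmg[OF V A lr(1,3)] mon1_hmg[OF V A lr(2,4)]
    note z = bilinear_0[OF graded_So[OF V A] b(1)] bilinear_0[OF graded_So[OF V A] b(2)]
    have "\<beta> (mon1 V A l x, mon1 V A r y) = \<beta>' (mon1 V A l x, mon1 V A r y)"
    proof (cases "(l = [] \<and> x = []) \<or> (r = [] \<and> y = [])")
      case True
      have "mon1 V A l x = 0 \<or> mon1 V A r y = 0" using True by (auto simp: mon1_def)
      then show ?thesis using z(1)[OF h(2)] z(2)[OF h(1)] z(3)[OF h(2)] z(4)[OF h(1)] by auto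
    next
      case False
      then have "length l + length x > 0" "length r + length y > 0" by auto
      moreover have "length l + length r = length vs" "length x + length y = length as"
        using u as by (simp_all add: usplit_def)
      ultimately have "so_size (l, x) < so_size g" "so_size (r, y) < so_size g"
        unfolding g' fst_conv snd_conv by linarith+
      moreover have "(l, x) \<in> so_gens V A" "(r, y) \<in> so_gens V A" using False lr by (auto simp: so_gens_iff)
      ultimately show ?thesis using e[of "(l, x)" "(r, y)"] False by (auto simp: mon1_def)
    qed
    then show "ksign (wt (sdeg2 V) r * wt (sdeg1 A) x + (wt (sdeg2 V) l + wt (sdeg1 A) x)) (\<beta> (mon1 V A l x, mon1 V A r y)) =
      ksign (wt (sdeg2 V) r * wt (sdeg1 A) x + (wt (sdeg2 V) l + wt (sdeg1 A) x)) (\<beta>' (mon1 V A l x, mon1 V A r y))"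
      by simp
  qed
qed

lemma so_induct [consumes 1, case_names step]:
  assumes "g \<in> so_gens V A" and "\<And>g. g \<in> so_gens V A \<Longrightarrow>
    (\<And>h. h \<in> so_gens V A \<Longrightarrow> so_size h < so_size g \<Longrightarrow> P h) \<Longrightarrow> P g"
  shows "P g"
  using assms(1) by (induction "so_size g" arbitrary: g rule: less_induct) (use assms(2) in blast)

lemma so_mon_deg: "g \<in> so_gens V A \<Longrightarrow> so_mon V A g \<in> cmp (So V A) (wt (sdeg2 V) (fst g) + wt (sdeg1 A) (snd g) + 1)"
  using so_mon_cmp[of "fst g" "snd g" V A] by simp

lemma so_coderivation_mon:
  assumes Q: "Q \<in> Hom (So V A) (So V A) 1" "coderivation (So V A) 1 (so_Delta V A) Q"
    and t: "t \<in> tot (So V A)" and b: "\<beta> \<in> bilinear_forms (So V A) (So V A)"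
  shows "so_Delta V A (Q t) \<beta> = - so_Delta V A t (leib (So V A) Q \<beta>)"
  using Q(2) t tensor_leibniz_leib[OF graded_So[OF V A] Q(1) so_Delta(2)[OF V A t] b]
  by (simp add: coderivation_def ksign_def)

text \<open>As for \<open>cocomm_coder_unique\<close>, but the corestriction has two parts: the
  projection to \<open>A\<close> and, through \<open>so_rho\<close>, the projection to
  \<open>V\<close>.\<close>

lemma so_coder_unique:
  assumes Q: "Q \<in> Hom (So V A) (So V A) 1" "coderivation (So V A) 1 (so_Delta V A) Q"
    and Q': "Q' \<in> Hom (So V A) (So V A) 1" "coderivation (So V A) 1 (so_Delta V A) Q'"
    and p: "\<And>g. g \<in> so_gens V A \<Longrightarrow> so_proj V A (Q (so_mon V A g)) = so_proj V A (Q' (so_mon V A g))"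
    and r: "\<And>g. g \<in> so_gens V A \<Longrightarrow>
      ger_proj V (so_rho V A (Q (so_mon V A g))) = ger_proj V (so_rho V A (Q' (so_mon V A g)))"
  shows "Q = Q'"
proof (rule so_linear_eq[OF vector_space_fscl HomD(1)[OF Q(1), unfolded scl_So] HomD(1)[OF Q'(1), unfolded scl_So]])
  fix g assume "g \<in> so_gens V A"
  then show "Q (so_mon V A g) = Q' (so_mon V A g)"
  proof (induction rule: so_induct)
    case (step g)
    show ?case
    proof (rule so_eqI[OF HomD(2)[OF Q(1) so_mon_deg[OF step(1)]] HomD(2)[OF Q'(1) so_mon_deg[OF step(1)]] p[OF step(1)] r[OF step(1)]])
      fix \<beta> assume b: "\<beta> \<in> bilinear_forms (So V A) (So V A)"
      note lb = leib_form[OF graded_So[OF V A] Q(1) b] leib_form[OF graded_So[OF V A] Q'(1) b]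
      have "so_pull V A (leib (So V A) Q \<beta>) g = so_pull V A (leib (So V A) Q' \<beta>) g"
        by (rule so_pull_cong[OF step(1) lb]) (simp add: leib_def step(2))
      then show "so_Delta V A (Q (so_mon V A g)) \<beta> = so_Delta V A (Q' (so_mon V A g)) \<beta>"
        unfolding so_coderivation_mon[OF Q so_mon_tot[OF step(1)] b] so_coderivation_mon[OF Q' so_mon_tot[OF step(1)] b]
          so_Delta_mon[OF step(1) lb(1)] so_Delta_mon[OF step(1) lb(2)] by simp
    qed
  qed
qed

lemma so_square_zero:
  assumes Q: "Q \<in> Hom (So V A) (So V A) 1" "coderivation (So V A) 1 (so_Delta V A) Q"
    and p: "\<And>g. g \<in> so_gens V A \<Longrightarrow> so_proj V A (Q (Q (so_mon V A g))) = 0"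
    and r: "\<And>g. g \<in> so_gens V A \<Longrightarrow> ger_proj V (so_rho V A (Q (Q (so_mon V A g)))) = 0"
  shows "Q (Q t) = 0"
proof -
  note G = graded_So[OF V A]
  have m: "Q (Q (so_mon V A g)) = 0" if "g \<in> so_gens V A" for g
    using that
  proof (induction rule: so_induct)
    case (step g)
    note c = HomD(2)[OF Q(1) HomD(2)[OF Q(1) so_mon_deg[OF step(1)]]]
    note t = so_mon_tot[OF step(1)] Hom_tot[OF Q(1) vs_So vs_So so_mon_tot[OF step(1)]]
    show ?case
    proof (rule so_eqI[OF c cmp_0[OF G]])
      show "so_proj V A (Q (Q (so_mon V A g))) = so_proj V A 0"
        using p[OF step(1)] Hom_0[OF G A so_proj(1)[OF V A]] by simp
      show "ger_proj V (so_rho V A (Q (Q (so_mon V A g)))) = ger_proj V (so_rho V A 0)"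
        using r[OF step(1)] linear_map_0[OF vs_So graded_vs[OF V]
          linear_map_comp[OF so_rho(1)[OF V] HomD(1)[OF ger_proj(1)[OF V]] vs_So vs_Ger graded_vs[OF V]]] by simp
      fix \<beta> assume b: "\<beta> \<in> bilinear_forms (So V A) (So V A)"
      note lb = leib_form[OF G Q(1) b]
      note llb = leib_form[OF G Q(1) lb]
      have z: "(\<lambda>_. 0) \<in> bilinear_forms (So V A) (So V A)"
        by (simp add: bilinear_forms_def slot_linear_def)
      have "so_Delta V A (Q (Q (so_mon V A g))) \<beta> = so_pull V A (leib (So V A) Q (leib (So V A) Q \<beta>)) g"
        unfolding so_coderivation_mon[OF Q t(2) b] so_coderivation_mon[OF Q t(1) lb] so_Delta_mon[OF step(1) llb] by simp
      also have "\<dots> = so_pull V A (\<lambda>_. 0) g"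
      proof (rule so_pull_cong[OF step(1) llb z])
        fix l r assume lr: "l \<in> so_gens V A" "r \<in> so_gens V A" "so_size l < so_size g" "so_size r < so_size g"
        note h = cmp_hmg[OF so_mon_deg[OF lr(1)]] cmp_hmg[OF so_mon_deg[OF lr(2)]]
        show "leib (So V A) Q (leib (So V A) Q \<beta>) (so_mon V A l, so_mon V A r) = 0"
          unfolding leib_leib[OF G Q(1) b h] step(2)[OF lr(1,3)] step(2)[OF lr(2,4)] using bilinear_0[OF G b] h by simp
      qed
      also have "\<dots> = 0" by (simp add: so_pull_def[OF V A] so_split_def[OF V A] split: prod.split)
      finally show "so_Delta V A (Q (Q (so_mon V A g))) \<beta> = so_Delta V A 0 \<beta>"
        using linear_map_0[OF vs_So vector_space_fscl so_Delta(1)[OF V A]] by simp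
    qed
  qed
  have "(\<lambda>t. Q (Q t)) = (\<lambda>t. 0)"
  proof (rule so_linear_eq[OF vector_space_fscl, of V A])
    show "linear_map (So V A) fscl (\<lambda>t. Q (Q t))"
      by (rule linear_map_comp[OF Q(1) HomD(1)[OF Q(1), unfolded scl_So] vs_So vs_So vector_space_fscl])
    show "linear_map (So V A) fscl (\<lambda>t. 0)" by (simp add: linear_map_def)
  qed (rule m)
  then show ?thesis by (rule fun_cong)
qed

subsection \<open>The coderivation given by \<open>q\<close> and \<open>u\<close>\<close>

text \<open>All components of the colour-o map at once. The shift 2 is the degree of an A-infinity
  structure at the empty word, and at nonempty words the double suspension in
  \<open>cocomm V\<close> under a morphism of degree 0. \<open>u [] [] = 0\<close> reflects the
  absence of a monomial without letters.\<close>

definition hoch_family :: "('v list \<Rightarrow> 'a list \<Rightarrow> 'a) \<Rightarrow> bool" where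
  "hoch_family u \<longleftrightarrow> vsym V (scl (hoch A)) u \<and> (\<forall>vs\<in>words V. u vs \<in> cmp (hoch A) (wt (sdeg2 V) vs + 2)) \<and> u [] [] = 0"

text \<open>The coderivation of colour o in dual form: \<open>q\<close> contracts part of
  \<open>vs\<close> to a letter of \<open>V\<close>, and \<open>u\<close> turns part of
  \<open>vs\<close> with a segment of \<open>as\<close> into a letter of \<open>A\<close>. The minus
  sign reflects that \<open>so_rho\<close> is odd. In the second sum an operation of degree 1 passes
  \<open>l\<close>, and \<open>u r\<close>, of shifted degree \<open>wt r + 1\<close>, passes the
  letters in front of its slot.\<close>

definition so_lift ::
  "('v list \<Rightarrow> 'v) \<Rightarrow> ('v list \<Rightarrow> 'a list \<Rightarrow> 'a) \<Rightarrow> ('v list \<Rightarrow> 'a list \<Rightarrow> 'm::ab_group_add) \<Rightarrow> 'v list \<Rightarrow> 'a list \<Rightarrow> 'm" where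
  "so_lift q u H vs as = - coder (sdeg2 V) q (\<lambda>vs. H vs as) vs +
     unshuffle_sum (sdeg2 V) (\<lambda>l r. ksign (wt (sdeg2 V) l) (Ins (sdeg1 A) (wt (sdeg2 V) r + 1) (u r) (H l) as)) vs"

definition so_coder ::
  "('v list \<Rightarrow> 'v) \<Rightarrow> ('v list \<Rightarrow> 'a list \<Rightarrow> 'a) \<Rightarrow> ('v list \<times> 'a list, 'k) functional \<Rightarrow> ('v list \<times> 'a list, 'k) functional" where
  "so_coder q u = lin_extension (So V A) (so_mon V A) (so_gens V A) fscl
     (\<lambda>(vs, as). so_lift q u (\<lambda>vs as. so_mon V A (vs, as)) vs as)"

lemma so_lift_additive_on:
  assumes T: "additive_on S T"
    and 1: "\<And>l r. usplit (sdeg2 V) vs l r \<Longrightarrow> H (q l # r) as \<in> S"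
    and 2: "\<And>l r x y z. usplit (sdeg2 V) vs l r \<Longrightarrow> as = x @ y @ z \<Longrightarrow> H l (x @ u r y # z) \<in> S"
  shows "so_lift q u H vs as \<in> S \<and> T (so_lift q u H vs as) = so_lift q u (\<lambda>vs as. T (H vs as)) vs as"
proof -
  have i: "Ins (sdeg1 A) (wt (sdeg2 V) r + 1) (u r) (H l) as \<in> S \<and>
     T (Ins (sdeg1 A) (wt (sdeg2 V) r + 1) (u r) (H l) as) =
     Ins (sdeg1 A) (wt (sdeg2 V) r + 1) (u r) (\<lambda>w. T (H l w)) as" if "usplit (sdeg2 V) vs l r" for l r
    by (rule Ins_additive_on[OF T, where K = "H l" and g = "u r"]) (rule 2[OF that])
  have j: "ksign n (Ins (sdeg1 A) (wt (sdeg2 V) r + 1) (u r) (H l) as) \<in> S \<and>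
     T (ksign n (Ins (sdeg1 A) (wt (sdeg2 V) r + 1) (u r) (H l) as)) =
     ksign n (Ins (sdeg1 A) (wt (sdeg2 V) r + 1) (u r) (\<lambda>w. T (H l w)) as)" if "usplit (sdeg2 V) vs l r" for l r n
    using additive_on_ksign[OF T i[OF that, THEN conjunct1]] i[OF that] by simp
  have a: "coder (sdeg2 V) q (\<lambda>vs. H vs as) vs \<in> S \<and>
     T (coder (sdeg2 V) q (\<lambda>vs. H vs as) vs) = coder (sdeg2 V) q (\<lambda>vs. T (H vs as)) vs"
    unfolding coder_def by (rule unsh_additive_on[OF T 1])
  have b: "unshuffle_sum (sdeg2 V) (\<lambda>l r. ksign (wt (sdeg2 V) l) (Ins (sdeg1 A) (wt (sdeg2 V) r + 1) (u r) (H l) as)) vs \<in> S \<and>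
     T (unshuffle_sum (sdeg2 V) (\<lambda>l r. ksign (wt (sdeg2 V) l) (Ins (sdeg1 A) (wt (sdeg2 V) r + 1) (u r) (H l) as)) vs) =
     unshuffle_sum (sdeg2 V) (\<lambda>l r. ksign (wt (sdeg2 V) l) (Ins (sdeg1 A) (wt (sdeg2 V) r + 1) (u r) (\<lambda>w. T (H l w)) as)) vs"
    (is "?B \<in> S \<and> T ?B = ?B'")
  proof -
    have "?B \<in> S \<and> T ?B = unshuffle_sum (sdeg2 V) (\<lambda>l r. T (ksign (wt (sdeg2 V) l)
        (Ins (sdeg1 A) (wt (sdeg2 V) r + 1) (u r) (H l) as))) vs"
      by (rule unsh_additive_on[OF T]) (rule j[THEN conjunct1])
    moreover have "unshuffle_sum (sdeg2 V) (\<lambda>l r. T (ksign (wt (sdeg2 V) l)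
        (Ins (sdeg1 A) (wt (sdeg2 V) r + 1) (u r) (H l) as))) vs = ?B'"
      by (rule unsh_cong) (rule j[THEN conjunct2])
    ultimately show ?thesis by simp
  qed
  note a' = additive_on_uminus[OF T a[THEN conjunct1]]
  show ?thesis
    unfolding so_lift_def using additive_on_add[OF T a'[THEN conjunct1] b[THEN conjunct1]] a a' b by simp
qed

context
  fixes q :: "'v list \<Rightarrow> 'v" and u :: "'v list \<Rightarrow> 'a list \<Rightarrow> 'a"
  assumes q: "corestriction V q" and u: "hoch_family u"
begin

lemma q_words: "l \<in> words V \<Longrightarrow> q l \<in> cmp V (wt (sdeg2 V) l + 3)" "q [] = 0"
  using q by (simp_all add: corestriction_def[OF V])

lemma u_words: "r \<in> words V \<Longrightarrow> u r \<in> cmp (hoch A) (wt (sdeg2 V) r + 2)" "u [] [] = 0"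
  using u by (simp_all add: hoch_family_def)

lemma u_letter: "r \<in> words V \<Longrightarrow> y \<in> words A \<Longrightarrow> u r y \<in> cmp A (wt (sdeg1 A) y + (wt (sdeg2 V) r + 2))"
  by (rule hochD(3)[OF A u_words(1)])

lemma u_vsym: "vsym V (scl A) (\<lambda>r. u r y)"
proof (rule vsymI)
  have uv: "vsym V (scl (hoch A)) u" using u by (simp add: hoch_family_def)
  fix xs ys assume xy: "xs \<in> words V" "ys \<in> words V"
  from vsym_slot[OF uv xy] show "slot_linear V (scl A) (\<lambda>a. u (xs @ a # ys) y)"
    unfolding slot_linear_def scl_hoch by simp
  fix a b assume "a \<in> hmg V" "b \<in> hmg V"
  from fun_cong[OF vsym_swap[OF uv xy this], of y]
  show "u (xs @ a # b # ys) y = ksign (sdeg2 V a * sdeg2 V b) (u (xs @ b # a # ys) y)"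
    by (simp only: ksign_apply)
qed

text \<open>Symmetry in \<open>vs\<close> comes from \<open>vsym_unshuffle\<close>, multilinearity
  in \<open>as\<close> from \<open>vmult_Ins\<close>. In the \<open>u\<close>-part the sign varies
  with \<open>r\<close>, but only through its weight, so \<open>vsym_sign\<close> absorbs
  it.\<close>

lemma so_lift_form:
  assumes f: "vso V A (*) H"
  shows "vso V A (*) (so_lift q u H)"
  unfolding vso_def
proof (intro conjI ballI)
  fix as assume as: "as \<in> words A"
  have "vsym V (*) (\<lambda>vs. H vs as)" using f as by (simp add: vso_def)
  from vsym_unshuffle[OF V vector_space_mult corestriction_bisym[OF V q this]]
  have 1: "vsym V (*) (\<lambda>vs. coder (sdeg2 V) q (\<lambda>vs. H vs as) vs)" by (simp add: coder_def)
  have "bisym V (*) (\<lambda>l r. ksign (wt (sdeg2 V) l) (Ins (sdeg1 A) (wt (sdeg2 V) r + 1) (u r) (H l) as))"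
  proof (rule bisymI)
    fix r assume r: "r \<in> words V"
    have "vsym V (*) (\<lambda>l. Ins (sdeg1 A) (wt (sdeg2 V) r + 1) (u r) (H l) as)"
    proof (rule vsym_Ins_sum[OF vector_space_mult])
      fix x y z assume xyz: "as = x @ y @ z"
      have "x @ u r y # z \<in> words A" using xyz as cmp_hmg[OF u_letter[OF r, of y]] by auto
      then show "vsym V (*) (\<lambda>l. H l (x @ u r y # z))" using f by (simp add: vso_def)
    qed
    from vsym_sign[OF V vector_space_mult this, of "\<lambda>n. n"]
    show "vsym V (*) (\<lambda>l. ksign (wt (sdeg2 V) l) (Ins (sdeg1 A) (wt (sdeg2 V) r + 1) (u r) (H l) as))" .
  next
    fix l assume l: "l \<in> words V"
    have "vsym V (*) (\<lambda>r. dec (\<lambda>x v. ksign ((wt (sdeg2 V) r + 1) * wt (sdeg1 A) x) (dec (\<lambda>y z. H l (x @ u r y # z)) v)) as)"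
    proof (rule vsym_sums(2)[OF vector_space_mult])
      fix x v assume xv: "as = x @ v"
      have "vsym V (*) (\<lambda>r. dec (\<lambda>y z. H l (x @ u r y # z)) v)"
      proof (rule vsym_sums(2)[OF vector_space_mult])
        fix y z assume yz: "v = y @ z"
        have w: "x \<in> words A" "y \<in> words A" "z \<in> words A" using as xv yz by auto
        have "vmult A (*) (H l)" using f l by (simp add: vso_def)
        from vmult_slot[OF this w(1,3)]
        have sl: "slot_linear A (*) (\<lambda>a. H l (x @ a # z))" .
        show "vsym V (*) (\<lambda>r. H l (x @ u r y # z))"
        proof (rule vsym_comp[OF V graded_vs[OF A] graded_subspace[OF A] vector_space_mult u_vsym _ sl,
              where c = "wt (sdeg1 A) y + 2"])
          fix r assume "r \<in> words V"
          from u_letter[OF this w(2)]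
          show "u r y \<in> cmp A (wt (sdeg2 V) r + (wt (sdeg1 A) y + 2))" by (simp add: algebra_simps)
        qed
      qed
      from vsym_sign[OF V vector_space_mult this, of "\<lambda>n. (n + 1) * wt (sdeg1 A) x"]
      show "vsym V (*) (\<lambda>r. ksign ((wt (sdeg2 V) r + 1) * wt (sdeg1 A) x) (dec (\<lambda>y z. H l (x @ u r y # z)) v))" .
    qed
    then have "vsym V (*) (\<lambda>r. Ins (sdeg1 A) (wt (sdeg2 V) r + 1) (u r) (H l) as)" by (simp add: Ins_eq_dec)
    then show "vsym V (*) (\<lambda>r. ksign (wt (sdeg2 V) l) (Ins (sdeg1 A) (wt (sdeg2 V) r + 1) (u r) (H l) as))"
      by (rule vsym_sums(3)[OF vector_space_mult])
  qed
  from vsym_unshuffle[OF V vector_space_mult this]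
  show "vsym V (*) (\<lambda>vs. so_lift q u H vs as)"
    unfolding so_lift_def by (intro vsym_sums(4,5)[OF vector_space_mult] 1)
next
  fix vs assume vs: "vs \<in> words V"
  have "vmult A (*) (H (q l # r))" if "usplit (sdeg2 V) vs l r" for l r
    using f usplit_lists[OF that vs] q_words(1)[THEN cmp_hmg, of l] by (simp add: vso_def)
  then have 1: "vmult A (*) (\<lambda>as. coder (sdeg2 V) q (\<lambda>vs. H vs as) vs)"
    unfolding coder_def by (rule vmult_sums(1)[OF vector_space_mult])
  have 2: "vmult A (*) (\<lambda>as. unshuffle_sum (sdeg2 V) (\<lambda>l r. ksign (wt (sdeg2 V) l) (Ins (sdeg1 A) (wt (sdeg2 V) r + 1) (u r) (H l) as)) vs)"
  proof (rule vmult_sums(1)[OF vector_space_mult], rule vmult_sums(3)[OF vector_space_mult])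
    fix l r assume "usplit (sdeg2 V) vs l r"
    with usplit_lists[OF this vs] have lr: "l \<in> words V" "r \<in> words V" by simp_all
    show "vmult A (*) (\<lambda>as. Ins (sdeg1 A) (wt (sdeg2 V) r + 1) (u r) (H l) as)"
      by (rule vmult_Ins[OF A vector_space_mult _ u_words(1)[OF lr(2)]]) (use f lr in \<open>simp add: vso_def\<close>)
  qed
  have "vmult A (*) (\<lambda>as. so_lift q u H vs as)"
    unfolding so_lift_def by (intro vmult_sums(4,5)[OF vector_space_mult] 1 2)
  then show "vmult A (*) (so_lift q u H vs)" .
qed

lemma so_lift_gens:
  assumes g: "(vs, as) \<in> so_gens V A"
  shows "usplit (sdeg2 V) vs l r \<Longrightarrow> (q l # r, as) \<in> so_gens V A"
    and "usplit (sdeg2 V) vs l r \<Longrightarrow> as = x @ y @ z \<Longrightarrow> (l, x @ u r y # z) \<in> so_gens V A"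
  using g usplit_lists[of "sdeg2 V" vs l r "hmg V"] q_words(1)[THEN cmp_hmg, of l] u_letter[THEN cmp_hmg, of r y]
  by (auto simp: so_gens_iff)

lemma so_coder:
  shows "so_coder q u \<in> Hom (So V A) (So V A) 1"
    and "\<And>vs as. (vs, as) \<in> so_gens V A \<Longrightarrow>
      so_coder q u (so_mon V A (vs, as)) = so_lift q u (\<lambda>vs as. so_mon V A (vs, as)) vs as"
    and "\<And>t \<phi>. t \<in> tot (So V A) \<Longrightarrow> \<phi> \<in> so_forms V A \<Longrightarrow>
      so_coder q u t \<phi> = t (\<lambda>(vs, as). so_lift q u (\<lambda>vs as. \<phi> (vs, as)) vs as)"
proof -
  let ?f = "\<lambda>(vs, as). so_lift q u (\<lambda>vs as. so_mon V A (vs, as)) vs as"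
  note G = graded_So[OF V A]
  have ap: "so_lift q u H vs as \<phi> = so_lift q u (\<lambda>vs as. H vs as \<phi>) vs as" for H :: "'v list \<Rightarrow> 'a list \<Rightarrow> ('v list \<times> 'a list, 'k) functional" and vs as \<phi>
    unfolding so_lift_def coder_def by (simp add: unsh_apply ksign_apply Ins_apply)
  have ev: "(\<lambda>g. ?f g \<phi>) = (\<lambda>(vs, as). so_lift q u (\<lambda>vs as. \<phi> (vs, as)) vs as)" if "\<phi> \<in> so_forms V A" for \<phi>
    by (auto simp: fun_eq_iff ap so_mon_eval[OF that])
  have form: "(\<lambda>(vs, as). so_lift q u (\<lambda>vs as. \<phi> (vs, as)) vs as) \<in> so_forms V A" if "\<phi> \<in> so_forms V A" for \<phi>
    using so_lift_form that by (simp add: so_forms_iff)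
  have 1: "\<forall>\<phi>\<in>so_forms V A. (\<lambda>g. ?f g \<phi>) \<in> so_forms V A"
    using ev form by simp
  have z: "so_lift q u (\<lambda>vs as. 0) vs as = 0" for vs as
    by (simp add: so_lift_def coder_def)
  have 2: "\<forall>g\<in>so_gens V A. \<forall>\<phi>. \<phi> \<notin> so_forms V A \<longrightarrow> ?f g \<phi> = 0"
    by (auto simp: ap so_mon_outside z)
  note l = lin_ext_fun[OF 1 2, where F = "so_coder q u" and d = "\<lambda>(vs, as). wt (sdeg2 V) vs + wt (sdeg1 A) as + 1",
      folded So_def so_mon_def, OF so_coder_def]
  show val: "so_coder q u (so_mon V A (vs, as)) = so_lift q u (\<lambda>vs as. so_mon V A (vs, as)) vs as"
    if "(vs, as) \<in> so_gens V A" for vs as using l(2)[OF that] by simp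
  show "so_coder q u t \<phi> = t (\<lambda>(vs, as). so_lift q u (\<lambda>vs as. \<phi> (vs, as)) vs as)"
    if "t \<in> tot (So V A)" "\<phi> \<in> so_forms V A" for t \<phi>
    using l(3)[OF that] ev[OF that(2)] by simp
  have c: "so_lift q u (\<lambda>vs as. so_mon V A (vs, as)) vs as \<in> cmp (So V A) (wt (sdeg2 V) vs + wt (sdeg1 A) as + 2)"
    if g: "(vs, as) \<in> so_gens V A" for vs as
  proof (rule so_lift_additive_on[OF cmp_additive_on[OF G], THEN conjunct1])
    have w: "vs \<in> words V" "as \<in> words A" using g by (simp_all add: so_gens_iff)
    fix l r assume s: "usplit (sdeg2 V) vs l r"
    note lr = usplit_lists[OF s w(1)]
    show "so_mon V A (q l # r, as) \<in> cmp (So V A) (wt (sdeg2 V) vs + wt (sdeg1 A) as + 2)"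
    proof (rule so_mon_cmp_deg[OF V A so_lift_gens(1)[OF g s]])
      assume "0 \<notin> set (q l # r)"
      then have "deg V (q l) = wt (sdeg2 V) l + 3" using deg_eq[OF V q_words(1)] lr by auto
      then show "wt (sdeg2 V) (q l # r) + wt (sdeg1 A) as + 1 = wt (sdeg2 V) vs + wt (sdeg1 A) as + 2"
        using usplit_wt[OF s] by (simp add: sdeg2_def)
    qed
    fix x y z assume xyz: "as = x @ y @ z"
    show "so_mon V A (l, x @ u r y # z) \<in> cmp (So V A) (wt (sdeg2 V) vs + wt (sdeg1 A) as + 2)"
    proof (rule so_mon_cmp_deg[OF V A so_lift_gens(2)[OF g s xyz]])
      assume "0 \<notin> set (x @ u r y # z)"
      then have "deg A (u r y) = wt (sdeg1 A) y + (wt (sdeg2 V) r + 2)" using deg_eq[OF A u_letter] lr w xyz by auto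
      then show "wt (sdeg2 V) l + wt (sdeg1 A) (x @ u r y # z) + 1 = wt (sdeg2 V) vs + wt (sdeg1 A) as + 2"
        using usplit_wt[OF s] by (simp add: sdeg1_def xyz)
    qed
  qed
  have "so_coder q u \<in> Hom (presented (so_forms V A) (so_gens V A) (\<lambda>(vs, as). wt (sdeg2 V) vs + wt (sdeg1 A) as + 1)) (So V A) 1"
  proof (rule HomI[OF vs_So subspace_So])
    show "linear_map (presented (so_forms V A) (so_gens V A) (\<lambda>(vs, as). wt (sdeg2 V) vs + wt (sdeg1 A) as + 1))
        (scl (So V A)) (so_coder q u)"
      using l(1) by (simp add: So_def)
    fix g assume g: "g \<in> so_gens V A"
    obtain vs as where g': "g = (vs, as)" by (cases g)
    show "so_coder q u (pure (so_forms V A) g) \<in> cmp (So V A) ((case g of (vs, as) \<Rightarrow> wt (sdeg2 V) vs + wt (sdeg1 A) as + 1) + 1)"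
      using val[of vs as] c[of vs as] g by (simp add: g' so_mon_def add.commute add.left_commute)
  qed
  then show "so_coder q u \<in> Hom (So V A) (So V A) 1" by (simp add: So_def)
qed

end

end

section \<open>The coderivation property in colour o\<close>

context
  fixes V :: "('k::field_char_0, 'v::ab_group_add) gvs" and A :: "('k, 'a::ab_group_add) gvs"
  assumes V: "graded_space V" and A: "graded_space A"
begin

context
  fixes q :: "'v list \<Rightarrow> 'v" and u :: "'v list \<Rightarrow> 'a list \<Rightarrow> 'a"
  assumes q: "corestriction V q" and u: "hoch_family V A u"
begin

text \<open>The central sign computation: \<open>so_lift\<close> is a coderivation for
  \<open>so_split\<close>. The \<open>q\<close>-part rests on \<open>coder_unsh\<close>, the
  \<open>u\<close>-part on \<open>Ins_dec\<close> and a regrouping of threefold unshuffles. The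
  outer minus is the sign between two maps of degree 1, the coderivation and the comultiplication.
  The premise on zero letters covers \<open>q l\<close> and \<open>u r y\<close> when they are
  0.\<close>

lemma so_lift_split:
  fixes G :: "'v list \<Rightarrow> 'a list \<Rightarrow> 'v list \<Rightarrow> 'a list \<Rightarrow> 'm::ab_group_add"
  assumes vs: "vs \<in> words V" and as: "as \<in> words A"
    and z: "\<And>l x r y. l \<in> words V \<Longrightarrow> x \<in> words A \<Longrightarrow> r \<in> words V \<Longrightarrow> y \<in> words A \<Longrightarrow>
      0 \<in> set l \<or> 0 \<in> set x \<or> 0 \<in> set r \<Longrightarrow> G l x r y = 0"
  shows "so_lift V A q u (so_split V A G) vs as = - so_split V A (\<lambda>l x r y.
     so_lift V A q u (\<lambda>l x. G l x r y) l x +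
     ksign (wt (sdeg2 V) l + wt (sdeg1 A) x + 1) (so_lift V A q u (G l x) r y)) vs as"
proof -
  let ?d = "sdeg2 V" and ?e = "sdeg1 A"
  define \<epsilon> where "\<epsilon> L x R = wt ?d R * wt ?e x + (wt ?d L + wt ?e x)" for L x R
  define \<Gamma> where "\<Gamma> L R = dec (\<lambda>x y. ksign (\<epsilon> L x R) (G L x R y))" for L R
  have S: "so_split V A G = (\<lambda>vs as. unshuffle_sum ?d (\<lambda>L R. \<Gamma> L R as) vs)"
    by (simp add: fun_eq_iff so_split_def[OF V A] \<Gamma>_def \<epsilon>_def)
  have sub: "l \<in> words V" if "set l \<subseteq> set vs" for l using that vs by (auto simp: in_lists_conv_set)
  have w: "x \<in> words A" "y \<in> words A" if "as = x @ y" for x y using that as by auto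
  have qd: "wt ?d (q l # r) = wt ?d l + 1 + wt ?d r" if "q l \<noteq> 0" "l \<in> words V" for l r
    using deg_eq[OF V q_words(1)[OF V A q u that(2)] that(1)] by (simp add: sdeg2_def)
  let ?I1 = "\<lambda>L R r x y. Ins ?e (wt ?d r + 1) (u r) (\<lambda>x. G L x R y) x"
  let ?I2 = "\<lambda>L R r x y. Ins ?e (wt ?d r + 1) (u r) (G L x R) y"

  \<comment> \<open>Contraction raises the weight of a word by 1. In the left factor this changes
    the exponent by 1, in the right factor (\<open>G2\<close>) by the weight of \<open>x\<close>,
    which has to be moved past \<open>R\<close>.\<close>
  have G1: "ksign (\<epsilon> (q l # r) x R) (G (q l # r) x R y) = ksign (\<epsilon> L x R + 1) (G (q l # r) x R y)"
    if "usplit ?d L l r" "L \<in> words V" "R \<in> words V" "as = x @ y" for L R x y l r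
  proof (cases "q l = 0")
    case True
    then show ?thesis using z[of "q l # r" x R y] usplit_lists[OF that(1,2)] hmg_0[OF V] w[OF that(4)] that(3) by simp
  next
    case False
    then have "\<epsilon> (q l # r) x R = \<epsilon> L x R + 1"
      using usplit_lists[OF that(1,2)] usplit_wt[OF that(1)] qd[of l r] by (simp only: \<epsilon>_def) simp
    then show ?thesis by simp
  qed
  have G2: "ksign (\<epsilon> L x (q l # r)) (G L x (q l # r) y) = ksign (\<epsilon> L x R + wt ?e x) (G L x (q l # r) y)"
    if "usplit ?d R l r" "L \<in> words V" "R \<in> words V" "as = x @ y" for L R x y l r
  proof (cases "q l = 0")
    case True
    then show ?thesis using z[of L x "q l # r" y] usplit_lists[OF that(1,3)] hmg_0[OF V] w[OF that(4)] that(2) by simp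
  next
    case False
    then have "\<epsilon> L x (q l # r) = \<epsilon> L x R + wt ?e x"
      using usplit_lists[OF that(1,3)] usplit_wt[OF that(1)] qd[of l r] by (simp only: \<epsilon>_def) (simp add: algebra_simps)
    then show ?thesis by simp
  qed
  have A1: "coder ?d q (\<lambda>L. \<Gamma> L R as) L = dec (\<lambda>x y. ksign (\<epsilon> L x R + 1) (coder ?d q (\<lambda>L. G L x R y) L)) as"
    if "L \<in> words V" "R \<in> words V" for L R
    unfolding coder_def \<Gamma>_def unsh_dec
  proof (rule dec_cong)
    fix x y assume xy: "as = x @ y"
    show "unshuffle_sum ?d (\<lambda>l r. ksign (\<epsilon> (q l # r) x R) (G (q l # r) x R y)) L =
        ksign (\<epsilon> L x R + 1) (unshuffle_sum ?d (\<lambda>l r. G (q l # r) x R y) L)"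
      unfolding unsh_ksign[symmetric] by (rule unsh_cong) (rule G1[OF _ that xy])
  qed
  have A2: "ksign (wt ?d L) (coder ?d q (\<lambda>R. \<Gamma> L R as) R) =
      dec (\<lambda>x y. ksign (wt ?d R * wt ?e x) (coder ?d q (\<lambda>R. G L x R y) R)) as"
    if "L \<in> words V" "R \<in> words V" for L R
    unfolding coder_def \<Gamma>_def unsh_dec dec_ksign[symmetric]
  proof (rule dec_cong)
    fix x y assume xy: "as = x @ y"
    have "unshuffle_sum ?d (\<lambda>l r. ksign (\<epsilon> L x (q l # r)) (G L x (q l # r) y)) R =
        ksign (\<epsilon> L x R + wt ?e x) (unshuffle_sum ?d (\<lambda>l r. G L x (q l # r) y) R)"
      unfolding unsh_ksign[symmetric] by (rule unsh_cong) (rule G2[OF _ that xy])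
    then show "ksign (wt ?d L) (unshuffle_sum ?d (\<lambda>l r. ksign (\<epsilon> L x (q l # r)) (G L x (q l # r) y)) R) =
        ksign (wt ?d R * wt ?e x) (unshuffle_sum ?d (\<lambda>l r. G L x (q l # r) y) R)"
      by (simp only: ksign_ksign) (intro ksign_parity, simp add: \<epsilon>_def)
  qed
  have PA: "coder ?d q (\<lambda>vs. unshuffle_sum ?d (\<lambda>L R. \<Gamma> L R as) vs) vs =
     unshuffle_sum ?d (\<lambda>L R. dec (\<lambda>x y. ksign (\<epsilon> L x R + 1) (coder ?d q (\<lambda>L. G L x R y) L) +
        ksign (wt ?d R * wt ?e x) (coder ?d q (\<lambda>R. G L x R y) R)) as) vs"
  proof -
    have "coder ?d q (unshuffle_sum ?d (\<lambda>L R. \<Gamma> L R as)) vs =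
      unshuffle_sum ?d (\<lambda>L R. coder ?d q (\<lambda>L. \<Gamma> L R as) L + ksign (wt ?d L) (coder ?d q (\<lambda>R. \<Gamma> L R as) R)) vs"
    proof (rule coder_unsh)
      fix l L R assume s: "set l \<subseteq> set vs" "set L \<subseteq> set vs" "set R \<subseteq> set vs"
      note sw = sub[OF s(1)] sub[OF s(2)] sub[OF s(3)]
      show "ksign (?d (q l) * wt ?d L) (\<Gamma> L (q l # R) as) = ksign ((wt ?d l + 1) * wt ?d L) (\<Gamma> L (q l # R) as)"
      proof (cases "q l = 0")
        case True
        have "\<Gamma> L (q l # R) as = dec (\<lambda>x y. 0) as"
          unfolding \<Gamma>_def
        proof (rule dec_cong)
          fix x y assume "as = x @ y"
          from z[OF sw(2) w(1)[OF this] _ w(2)[OF this], of "q l # R"]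
          show "ksign (\<epsilon> L x (q l # R)) (G L x (q l # R) y) = 0" using True hmg_0[OF V] sw by simp
        qed
        then show ?thesis by simp
      qed (use qd[of l "[]"] sw in simp)
    qed
    also have "\<dots> = unshuffle_sum ?d (\<lambda>L R. dec (\<lambda>x y. ksign (\<epsilon> L x R + 1) (coder ?d q (\<lambda>L. G L x R y) L) +
        ksign (wt ?d R * wt ?e x) (coder ?d q (\<lambda>R. G L x R y) R)) as) vs"
    proof (rule unsh_cong)
      fix L R assume "usplit ?d vs L R"
      with usplit_lists[OF this vs] have LR: "L \<in> words V" "R \<in> words V" by simp_all
      show "coder ?d q (\<lambda>L. \<Gamma> L R as) L + ksign (wt ?d L) (coder ?d q (\<lambda>R. \<Gamma> L R as) R) =
        dec (\<lambda>x y. ksign (\<epsilon> L x R + 1) (coder ?d q (\<lambda>L. G L x R y) L) +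
          ksign (wt ?d R * wt ?e x) (coder ?d q (\<lambda>R. G L x R y) R)) as"
        unfolding A1[OF LR] A2[OF LR] dec_add ..
    qed
    finally show ?thesis .
  qed

  \<comment> \<open>By \<open>Ins_dec\<close> the insertion falls into \<open>x\<close> or into
    \<open>y\<close>; in the first case the weight of \<open>x\<close> that enters the sign grows by
    \<open>wt r + 1\<close>.\<close>
  have B: "Ins ?e (wt ?d r + 1) (u r) (\<Gamma> L R) as =
      dec (\<lambda>x y. ksign (wt ?d R * (wt ?e x + wt ?d r + 1) + wt ?d L + wt ?e x + wt ?d r + 1) (?I1 L R r x y)) as +
      dec (\<lambda>x y. ksign ((wt ?d r + 1) * wt ?e x + \<epsilon> L x R) (?I2 L R r x y)) as"
    if "L \<in> words V" "R \<in> words V" "r \<in> words V" for L R r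
    unfolding \<Gamma>_def Ins_dec dec_add[symmetric]
  proof (rule dec_cong)
    fix x y assume xy: "as = x @ y"
    let ?n = "wt ?d R * (wt ?e x + wt ?d r + 1) + wt ?d L + wt ?e x + wt ?d r + 1"
    have "Ins ?e (wt ?d r + 1) (u r) (\<lambda>x. ksign (\<epsilon> L x R) (G L x R y)) x =
       Ins ?e (wt ?d r + 1) (u r) (\<lambda>x. ksign ?n (G L x R y)) x"
    proof (rule Ins_cong)
      fix a b c assume abc: "x = a @ b @ c"
      then have ws: "a \<in> words A" "b \<in> words A" "c \<in> words A" using w(1)[OF xy] by auto
      show "ksign (\<epsilon> L (a @ u r b # c) R) (G L (a @ u r b # c) R y) = ksign ?n (G L (a @ u r b # c) R y)"
      proof (cases "u r b = 0")
        case True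
        then show ?thesis using z[of L "a @ u r b # c" R y] that ws hmg_0[OF A] w(2)[OF xy] by simp
      next
        case False
        then have "?e (u r b) = wt ?e b + wt ?d r + 1"
          using deg_eq[OF A u_letter[OF V A q u that(3) ws(2)]] by (simp add: sdeg1_def)
        then have "wt ?e (a @ u r b # c) = wt ?e x + wt ?d r + 1" by (simp add: abc)
        then have "\<epsilon> L (a @ u r b # c) R = ?n" by (simp only: \<epsilon>_def add.assoc)
        then show ?thesis by (simp only:)
      qed
    qed
    then show "Ins ?e (wt ?d r + 1) (u r) (\<lambda>x. ksign (\<epsilon> L x R) (G L x R y)) x +
        ksign ((wt ?d r + 1) * wt ?e x) (Ins ?e (wt ?d r + 1) (u r) (\<lambda>y. ksign (\<epsilon> L x R) (G L x R y)) y) =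
        ksign ?n (?I1 L R r x y) + ksign ((wt ?d r + 1) * wt ?e x + \<epsilon> L x R) (?I2 L R r x y)"
      by (simp only: Ins_ksign ksign_ksign)
  qed
  let ?T1 = "\<lambda>L R r. dec (\<lambda>x y. ksign (wt ?d R * wt ?e x + wt ?d R * wt ?d r + wt ?e x + wt ?d r + 1) (?I1 L R r x y)) as"
  let ?T2 = "\<lambda>L R r. dec (\<lambda>x y. ksign (wt ?d R + wt ?d r * wt ?e x + wt ?d R * wt ?e x) (?I2 L R r x y)) as"
  have PB: "unshuffle_sum ?d (\<lambda>l r. ksign (wt ?d l) (Ins ?e (wt ?d r + 1) (u r) (\<lambda>as. unshuffle_sum ?d (\<lambda>L R. \<Gamma> L R as) l) as)) vs =
     unshuffle_sum ?d (\<lambda>l r. unshuffle_sum ?d (\<lambda>L R. ?T1 L R r) l) vs +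
     unshuffle_sum ?d (\<lambda>l r. unshuffle_sum ?d (\<lambda>L R. ?T2 L R r) l) vs"
    unfolding Ins_unsh unsh_add[symmetric] unsh_ksign[symmetric]
  proof (intro unsh_cong)
    fix l r L R assume s: "usplit ?d vs l r" "usplit ?d l L R"
    with usplit_lists[OF s(1) vs] have lr: "l \<in> words V" "r \<in> words V" by simp_all
    with usplit_lists[OF s(2) lr(1)] have LR: "L \<in> words V" "R \<in> words V" by simp_all
    show "ksign (wt ?d l) (Ins ?e (wt ?d r + 1) (u r) (\<Gamma> L R) as) = ?T1 L R r + ?T2 L R r"
      unfolding B[OF LR lr(2)] ksign_add dec_ksign[symmetric] ksign_ksign
      by (rule arg_cong2[where f = "(+)"]; rule dec_cong; rule ksign_parity)
        (auto simp: usplit_wt[OF s(2)] \<epsilon>_def)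
  qed
  \<comment> \<open>An insertion into \<open>x\<close> groups \<open>r\<close> with
    \<open>L\<close>, so \<open>r\<close> has to be exchanged with \<open>R\<close>. An insertion
    into \<open>y\<close> (\<open>P2\<close>) groups \<open>r\<close> with \<open>R\<close>, which
    is plain coassociativity.\<close>
  have P1: "unshuffle_sum ?d (\<lambda>l r. unshuffle_sum ?d (\<lambda>L R. ?T1 L R r) l) vs =
      unshuffle_sum ?d (\<lambda>L' R. dec (\<lambda>x y. ksign (\<epsilon> L' x R + 1) (unshuffle_sum ?d (\<lambda>L r. ksign (wt ?d L) (?I1 L R r x y)) L')) as) vs"
    unfolding unsh_swap[where K = "?T1"] unsh_ksign[symmetric] unsh_dec[symmetric] dec_ksign[symmetric] ksign_ksign
    by (intro unsh_cong dec_cong ksign_parity) (auto simp: usplit_wt \<epsilon>_def)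
  have P2: "unshuffle_sum ?d (\<lambda>l r. unshuffle_sum ?d (\<lambda>L R. ?T2 L R r) l) vs =
      unshuffle_sum ?d (\<lambda>L R'. dec (\<lambda>x y. ksign (wt ?d R' * wt ?e x) (unshuffle_sum ?d (\<lambda>R r. ksign (wt ?d R) (?I2 L R r x y)) R')) as) vs"
    unfolding unsh_assoc[where K = "?T2"] unsh_ksign[symmetric] unsh_dec[symmetric] ksign_ksign
    by (intro unsh_cong dec_cong ksign_parity) (auto simp: usplit_wt algebra_simps)
  have "so_lift V A q u (so_split V A G) vs as =
     - coder ?d q (\<lambda>vs. unshuffle_sum ?d (\<lambda>L R. \<Gamma> L R as) vs) vs +
     unshuffle_sum ?d (\<lambda>l r. ksign (wt ?d l) (Ins ?e (wt ?d r + 1) (u r) (\<lambda>as. unshuffle_sum ?d (\<lambda>L R. \<Gamma> L R as) l) as)) vs"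
    unfolding so_lift_def[OF V A] S ..
  also have "\<dots> = - so_split V A (\<lambda>l x r y.
     so_lift V A q u (\<lambda>l x. G l x r y) l x +
     ksign (wt ?d l + wt ?e x + 1) (so_lift V A q u (G l x) r y)) vs as"
    unfolding PA PB P1 P2 so_split_def[OF V A] unsh_uminus[symmetric] unsh_add[symmetric] dec_uminus[symmetric] dec_add[symmetric]
  proof (intro unsh_cong dec_cong)
    fix L R x y
    let ?a = "coder ?d q (\<lambda>L. G L x R y) L" and ?b = "coder ?d q (\<lambda>R. G L x R y) R"
      and ?c = "unshuffle_sum ?d (\<lambda>L r. ksign (wt ?d L) (?I1 L R r x y)) L"
      and ?f = "unshuffle_sum ?d (\<lambda>R r. ksign (wt ?d R) (?I2 L R r x y)) R"
    show "- (ksign (\<epsilon> L x R + 1) ?a + ksign (wt ?d R * wt ?e x) ?b) +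
        (ksign (\<epsilon> L x R + 1) ?c + ksign (wt ?d R * wt ?e x) ?f) =
      - ksign (wt ?d R * wt ?e x + (wt ?d L + wt ?e x))
        (so_lift V A q u (\<lambda>l x. G l x R y) L x + ksign (wt ?d L + wt ?e x + 1) (so_lift V A q u (G L x) R y))"
      unfolding so_lift_def[OF V A] \<epsilon>_def ksign_add ksign_uminus ksign_ksign
      by (cases "even (wt ?d L)"; cases "even (wt ?e x)"; cases "even (wt ?d R)") (simp_all add: ksign_def)
  qed
  finally show ?thesis .
qed

lemma so_lift_cong:
  assumes g: "(vs, as) \<in> so_gens V A" and e: "\<And>vs as. (vs, as) \<in> so_gens V A \<Longrightarrow> H vs as = H' vs as"
  shows "so_lift V A q u H vs as = so_lift V A q u H' vs as"
proof -
  have "coder (sdeg2 V) q (\<lambda>vs. H vs as) vs = coder (sdeg2 V) q (\<lambda>vs. H' vs as) vs"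
    unfolding coder_def by (rule unsh_cong) (rule e[OF so_lift_gens(1)[OF V A q u g]])
  moreover have "unshuffle_sum (sdeg2 V) (\<lambda>l r. ksign (wt (sdeg2 V) l) (Ins (sdeg1 A) (wt (sdeg2 V) r + 1) (u r) (H l) as)) vs =
      unshuffle_sum (sdeg2 V) (\<lambda>l r. ksign (wt (sdeg2 V) l) (Ins (sdeg1 A) (wt (sdeg2 V) r + 1) (u r) (H' l) as)) vs"
  proof (rule unsh_cong)
    fix l r assume "usplit (sdeg2 V) vs l r"
    note * = so_lift_gens(2)[OF V A q u g this]
    have "Ins (sdeg1 A) (wt (sdeg2 V) r + 1) (u r) (H l) as = Ins (sdeg1 A) (wt (sdeg2 V) r + 1) (u r) (H' l) as"
      by (rule Ins_cong) (rule e[OF *])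
    then show "ksign (wt (sdeg2 V) l) (Ins (sdeg1 A) (wt (sdeg2 V) r + 1) (u r) (H l) as) =
      ksign (wt (sdeg2 V) l) (Ins (sdeg1 A) (wt (sdeg2 V) r + 1) (u r) (H' l) as)" by simp
  qed
  ultimately show ?thesis by (simp only: so_lift_def[OF V A])
qed

lemma so_coder_linear:
  assumes T: "linear_map (So V A) s T" "vector_space s" and g: "(vs, as) \<in> so_gens V A"
  shows "T (so_coder V A q u (so_mon V A (vs, as))) = so_lift V A q u (\<lambda>vs as. T (so_mon V A (vs, as))) vs as"
  unfolding so_coder(2)[OF V A q u g]
  by (rule so_lift_additive_on[OF V A linear_map_additive_on[OF vs_So T(2,1)], THEN conjunct2])
    (rule so_mon_tot[OF so_lift_gens(1)[OF V A q u g]] so_mon_tot[OF so_lift_gens(2)[OF V A q u g]]; assumption)+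

lemma so_coder_form:
  "\<phi> \<in> so_forms V A \<Longrightarrow> (\<lambda>(vs, as). so_lift V A q u (\<lambda>vs as. \<phi> (vs, as)) vs as) \<in> so_forms V A"
  using so_lift_form[OF V A q u] by (simp add: so_forms_iff)

lemma so_coder_coderivation: "coderivation (So V A) 1 (so_Delta V A) (so_coder V A q u)"
  unfolding coderivation_def
proof
  let ?C = "so_coder V A q u"
  note G = graded_So[OF V A]
  note Hom = so_coder(1)[OF V A q u]
  fix t assume t: "t \<in> tot (So V A)"
  note Qt = Hom_tot[OF Hom vs_So vs_So t]
  note LT = tensor_leibniz_tot[OF G Hom so_Delta(2)[OF V A t]]
  have "so_Delta V A (?C t) = - tensor_leibniz (So V A) ?C (so_Delta V A t)"
  proof (rule tensor_eqI[OF so_Delta(2)[OF V A Qt] tot_uminus[OF vs_tensor LT]])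
    fix \<beta> assume b: "\<beta> \<in> bilinear_forms (So V A) (So V A)"
    note lb = leib_form[OF G Hom b]
    let ?G = "\<lambda>l x r y. \<beta> (mon1 V A l x, mon1 V A r y)"
    have c: "ll (?C (mon1 V A l x)) = so_lift V A q u (\<lambda>l x. ll (mon1 V A l x)) l x"
      if sl: "slot_linear (So V A) (*) ll" and lx: "l \<in> words V" "x \<in> words A" for ll l x
    proof (cases "l = [] \<and> x = []")
      \<comment> \<open>Without letters only the monomials with the single letter
        \<open>q []\<close> or \<open>u [] []\<close> arise, and both letters are 0.\<close>
      case True
      have "mon1 V A [0] [] = 0" "mon1 V A [] [0] = 0"
        using so_mon_zero_letter[OF V A, of "[0]" "[]"] so_mon_zero_letter[OF V A, of "[]" "[0]"] hmg_0[OF V] hmg_0[OF A]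
        by (simp_all add: mon1_def so_gens_iff)
      then show ?thesis using True q_words(2)[OF V A q u] u_words(2)[OF V A q u] Hom_0[OF G G Hom]
          slot_linear_0[OF G vector_space_mult sl]
        by (simp add: so_lift_def[OF V A] coder_def mon1_def[of V A "[]" "[]"])
    next
      case False
      then have g: "(l, x) \<in> so_gens V A" using lx by (simp add: so_gens_iff)
      have s: "(\<lambda>g. ll (so_mon V A g)) \<in> so_forms V A"
        using so_univ[OF V A vector_space_mult sl] by (simp add: so_forms_iff)
      have "ll (?C (so_mon V A (l, x))) = ?C (so_mon V A (l, x)) (\<lambda>g. ll (so_mon V A g))"
        by (rule so_expand[OF V A sl HomD(2)[OF Hom so_mon_cmp[OF g]]])
      also have "\<dots> = so_lift V A q u (\<lambda>l x. ll (so_mon V A (l, x))) l x"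
        using so_coder(3)[OF V A q u so_mon_tot[OF g] s] so_mon_eval[OF so_coder_form[OF s]] by simp
      also have "\<dots> = so_lift V A q u (\<lambda>l x. ll (mon1 V A l x)) l x"
        by (rule so_lift_cong[OF g]) (auto simp: mon1_def so_gens_iff)
      finally have "ll (?C (so_mon V A (l, x))) = so_lift V A q u (\<lambda>l x. ll (mon1 V A l x)) l x" .
      moreover have "mon1 V A l x = so_mon V A (l, x)" using False by (auto simp: mon1_def)
      ultimately show ?thesis by (simp only:)
    qed
    have key: "so_lift V A q u (\<lambda>vs as. so_pull V A \<beta> (vs, as)) vs as = - so_pull V A (leib (So V A) ?C \<beta>) (vs, as)"
      if g: "(vs, as) \<in> so_gens V A" for vs as
    proof -
      have w: "vs \<in> words V" "as \<in> words A" using g by (simp_all add: so_gens_iff)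
      have "so_lift V A q u (so_split V A ?G) vs as = - so_split V A (\<lambda>l x r y.
         so_lift V A q u (\<lambda>l x. ?G l x r y) l x +
         ksign (wt (sdeg2 V) l + wt (sdeg1 A) x + 1) (so_lift V A q u (?G l x) r y)) vs as"
      proof (rule so_lift_split[OF w])
        fix l x r y assume lr: "l \<in> words V" "x \<in> words A" "r \<in> words V" "y \<in> words A"
          and z: "0 \<in> set l \<or> 0 \<in> set x \<or> 0 \<in> set r"
        note h = mon1_hmg[OF V A lr(1,2)] mon1_hmg[OF V A lr(3,4)]
        have "mon1 V A l x = 0 \<or> mon1 V A r y = 0"
          using z so_mon_zero_letter[OF V A, of l x] so_mon_zero_letter[OF V A, of r y] lr
          by (auto simp: mon1_def so_gens_iff)
        then show "?G l x r y = 0" using bilinear_0[OF G b] h by auto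
      qed
      also have "so_split V A (\<lambda>l x r y.
         so_lift V A q u (\<lambda>l x. ?G l x r y) l x +
         ksign (wt (sdeg2 V) l + wt (sdeg1 A) x + 1) (so_lift V A q u (?G l x) r y)) vs as =
         so_pull V A (leib (So V A) ?C \<beta>) (vs, as)"
        unfolding so_split_def[OF V A] so_pull_def[OF V A] prod.case
      proof (intro unsh_cong dec_cong)
        fix l r x y assume "usplit (sdeg2 V) vs l r" "as = x @ y"
        with usplit_lists[OF this(1) w(1)] w(2)
        have lr: "l \<in> words V" "r \<in> words V" "x \<in> words A" "y \<in> words A" by simp_all
        note h = mon1_hmg[OF V A lr(1,3)] mon1_hmg[OF V A lr(2,4)]
        have mc: "mon1 V A l x \<in> cmp (So V A) (wt (sdeg2 V) l + wt (sdeg1 A) x + 1)"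
          using so_mon_cmp[of l x V A] cmp_0[OF G] lr by (auto simp: mon1_def so_gens_iff)
        have "ksign (deg (So V A) (mon1 V A l x)) (\<beta> (mon1 V A l x, ?C (mon1 V A r y))) =
            ksign (wt (sdeg2 V) l + wt (sdeg1 A) x + 1) (\<beta> (mon1 V A l x, ?C (mon1 V A r y)))"
          by (rule deg_sign[OF G mc]) (simp add: bilinear_0(1)[OF G b Hom_hmg[OF Hom h(2)]])
        then have e: "so_lift V A q u (\<lambda>l x. ?G l x r y) l x +
              ksign (wt (sdeg2 V) l + wt (sdeg1 A) x + 1) (so_lift V A q u (?G l x) r y) =
            leib (So V A) ?C \<beta> (mon1 V A l x, mon1 V A r y)"
          unfolding leib_def prod.case c[OF bilinear_left[OF b h(2)] lr(1,3)] c[OF bilinear_right[OF b h(1)] lr(2,4)]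
          by simp
        show "ksign (wt (sdeg2 V) r * wt (sdeg1 A) x + (wt (sdeg2 V) l + wt (sdeg1 A) x))
            (so_lift V A q u (\<lambda>l x. ?G l x r y) l x +
              ksign (wt (sdeg2 V) l + wt (sdeg1 A) x + 1) (so_lift V A q u (?G l x) r y)) =
          ksign (wt (sdeg2 V) r * wt (sdeg1 A) x + (wt (sdeg2 V) l + wt (sdeg1 A) x))
            (leib (So V A) ?C \<beta> (mon1 V A l x, mon1 V A r y))"
          unfolding e ..
      qed
      finally show ?thesis by (simp add: so_pull_def[OF V A])
    qed
    have "?C t (so_pull V A \<beta>) = t (\<lambda>(vs, as). so_lift V A q u (\<lambda>vs as. so_pull V A \<beta> (vs, as)) vs as)"
      by (rule so_coder(3)[OF V A q u t so_pull_form[OF V A b]])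
    \<comment> \<open>The minus sign passes through the evaluation as the scalar \<open>- 1\<close>
      of \<open>ev_linear\<close>.\<close>
    also have "\<dots> = 0 + - 1 * t (so_pull V A (leib (So V A) ?C \<beta>))"
    proof -
      have z: "(\<lambda>_. 0) \<in> so_forms V A"
        by (auto simp: so_forms_iff vso_def intro: vsym_sums(6) vmult_sums(6) vector_space_mult)
      have "t (\<lambda>(vs, as). so_lift V A q u (\<lambda>vs as. so_pull V A \<beta> (vs, as)) vs as) =
          t (\<lambda>_. 0) + - 1 * t (so_pull V A (leib (So V A) ?C \<beta>))"
        by (rule ev_linear[OF t[unfolded So_def] z so_pull_form[OF V A lb] so_coder_form[OF so_pull_form[OF V A b]]])
          (auto simp: key)
      then show ?thesis using ev_zero[OF t[unfolded So_def], of "\<lambda>_. 0"] by simp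
    qed
    finally show "so_Delta V A (?C t) \<beta> = (- tensor_leibniz (So V A) ?C (so_Delta V A t)) \<beta>"
      using tensor_leibniz_leib[OF G Hom so_Delta(2)[OF V A t] b] so_Delta(3)[OF V A t lb] so_Delta(3)[OF V A Qt b]
      by simp
  qed
  then show "so_Delta V A (?C t) = ksign 1 (tensor_leibniz (So V A) ?C (so_Delta V A t))" by (simp add: ksign_def)
qed

end

end

text \<open>A single letter remains only if \<open>g\<close> consumes the whole word.\<close>

lemma Ins_cogenerators: "Ins d p g (\<lambda>w. case w of [a] \<Rightarrow> a | _ \<Rightarrow> 0) as = g as"
proof -
  have 1: "dec (\<lambda>y z. case x @ g y # z of [a] \<Rightarrow> a | _ \<Rightarrow> 0) v = (if x = [] then g v else 0)" for x v
  proof (cases "x = []")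
    case True
    have "dec (\<lambda>y z. if z = [] then g y else 0) v = g v" using dec_right_all[of "\<lambda>y z. g y"] .
    moreover have "(case g y # z of [a] \<Rightarrow> a | _ \<Rightarrow> 0) = (if z = [] then g y else 0)" for y z
      by (simp split: list.splits)
    ultimately show ?thesis using True by simp
  next
    case False
    then have "(case x @ g y # z of [a] \<Rightarrow> a | _ \<Rightarrow> 0) = 0" for y z by (cases x) (auto split: list.splits)
    then show ?thesis using False by simp
  qed
  have "(\<lambda>x v. ksign (p * wt d x) (dec (\<lambda>y z. case x @ g y # z of [a] \<Rightarrow> a | _ \<Rightarrow> 0) v)) =
      (\<lambda>x v. if x = [] then g v else 0)"
    by (auto simp: fun_eq_iff 1)
  then show ?thesis unfolding Ins_eq_dec using dec_left_all[of "\<lambda>x v. g v" as] by simp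
qed

lemma coder_cogenerators: "q [] = 0 \<Longrightarrow> coder d q (\<lambda>vs. case vs of [v] \<Rightarrow> v | _ \<Rightarrow> 0) vs = q vs"
proof -
  have "(case q l # r of [v] \<Rightarrow> v | _ \<Rightarrow> 0) = (if r = [] then q l else 0)" for l r
    by (simp split: list.splits)
  then show ?thesis using unsh_left_all[of d "\<lambda>l r. q l" vs] by (simp add: coder_def)
qed

section \<open>Corestrictions of the coderivation and of its square\<close>

context
  fixes V :: "('k::field_char_0, 'v::ab_group_add) gvs" and A :: "('k, 'a::ab_group_add) gvs"
  assumes V: "graded_space V" and A: "graded_space A"
begin

lemma cogen_linear: "linear_map (So V A) (scl V) (\<lambda>t. ger_proj V (so_rho V A t))"
  by (rule linear_map_comp[OF so_rho(1)[OF V] HomD(1)[OF ger_proj(1)[OF V]] vs_So vs_Ger graded_vs[OF V]])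

context
  fixes q :: "'v list \<Rightarrow> 'v" and u :: "'v list \<Rightarrow> 'a list \<Rightarrow> 'a"
  assumes q: "corestriction V q" and u: "hoch_family V A u"
begin

lemma so_coder_proj:
  assumes g: "(vs, as) \<in> so_gens V A"
  shows "so_proj V A (so_coder V A q u (so_mon V A (vs, as))) = u vs as"
proof -
  let ?H = "\<lambda>vs as. if vs = [] then case as of [a] \<Rightarrow> a | _ \<Rightarrow> 0 else 0"
  have "so_proj V A (so_coder V A q u (so_mon V A (vs, as))) =
      so_lift V A q u (\<lambda>vs as. so_proj V A (so_mon V A (vs, as))) vs as"
    by (rule so_coder_linear[OF V A q u HomD(1)[OF so_proj(1)[OF V A]] graded_vs[OF A] g])
  also have "\<dots> = so_lift V A q u ?H vs as"
    by (rule so_lift_cong[OF V A q u g]) (auto simp: so_proj(2)[OF V A] split: list.splits)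
  also have "\<dots> = unshuffle_sum (sdeg2 V) (\<lambda>l r. if l = [] then u r as else 0) vs"
  proof -
    have "ksign (wt (sdeg2 V) l) (Ins (sdeg1 A) (wt (sdeg2 V) r + 1) (u r) (?H l) as) = (if l = [] then u r as else 0)" for l r
      by (cases "l = []") (simp_all add: Ins_cogenerators)
    then show ?thesis by (simp add: so_lift_def[OF V A] coder_def)
  qed
  also have "\<dots> = u vs as" by (rule unsh_right_all)
  finally show ?thesis .
qed

lemma so_coder_proj2:
  assumes g: "(vs, as) \<in> so_gens V A"
  shows "so_proj V A (so_coder V A q u (so_coder V A q u (so_mon V A (vs, as)))) = so_lift V A q u u vs as"
proof -
  note lin = linear_map_comp[OF so_coder(1)[OF V A q u] HomD(1)[OF so_proj(1)[OF V A]] vs_So vs_So graded_vs[OF A]]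
  show ?thesis
    unfolding so_coder_linear[OF V A q u lin graded_vs[OF A] g]
    by (rule so_lift_cong[OF V A q u g]) (rule so_coder_proj)
qed

text \<open>An insertion leaves at least one letter from \<open>A\<close>, so a function supported
  on words without such letters sees only the \<open>q\<close>-part.\<close>

lemma so_lift_rho: "so_lift V A q u (\<lambda>vs as. if as = [] then h vs else 0) vs as =
    (if as = [] then - coder (sdeg2 V) q h vs else 0)"
proof -
  have "Ins (sdeg1 A) p g (\<lambda>as. if as = [] then h l else 0) as = 0" for p g l
    by (rule Ins_zeroI) simp
  then show ?thesis by (simp add: so_lift_def[OF V A] coder_def)
qed

lemma so_coder_rho:
  assumes g: "(vs, as) \<in> so_gens V A"
  shows "so_rho V A (so_coder V A q u (so_mon V A (vs, as))) =
    (if as = [] then - coder (sdeg2 V) q (\<lambda>vs. ger_mon V (map (\<lambda>v. [v]) vs)) vs else 0)"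
  unfolding so_coder_linear[OF V A q u HomD(1)[OF so_rho(1)[OF V]] vs_Ger g] so_lift_rho[symmetric]
  by (rule so_lift_cong[OF V A q u g]) (rule so_rho(2)[OF V])

lemma so_coder_cogen:
  assumes g: "(vs, as) \<in> so_gens V A"
  shows "ger_proj V (so_rho V A (so_coder V A q u (so_mon V A (vs, as)))) = (if as = [] then - q vs else 0)"
proof -
  have "ger_proj V (so_rho V A (so_coder V A q u (so_mon V A (vs, as)))) =
      so_lift V A q u (\<lambda>vs as. if as = [] then case vs of [v] \<Rightarrow> v | _ \<Rightarrow> 0 else 0) vs as"
    unfolding so_coder_linear[OF V A q u cogen_linear graded_vs[OF V] g]
    by (rule so_lift_cong[OF V A q u g]) (rule cogen_mon[OF V A])
  then show ?thesis by (simp add: so_lift_rho coder_cogenerators[where q = q] q_words(2)[OF V A q u])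
qed

text \<open>The minus sign in front of the \<open>q\<close>-part of \<open>so_lift\<close> occurs
  twice and cancels, so the condition on \<open>q\<close> is the one for a square-zero coderivation
  of \<open>cocomm V\<close>.\<close>

lemma so_coder_cogen2:
  assumes g: "(vs, as) \<in> so_gens V A"
  shows "ger_proj V (so_rho V A (so_coder V A q u (so_coder V A q u (so_mon V A (vs, as))))) =
    (if as = [] then coder (sdeg2 V) q q vs else 0)"
proof -
  note lin = linear_map_comp[OF so_coder(1)[OF V A q u] cogen_linear vs_So vs_So graded_vs[OF V]]
  have "ger_proj V (so_rho V A (so_coder V A q u (so_coder V A q u (so_mon V A (vs, as))))) =
      so_lift V A q u (\<lambda>vs as. if as = [] then - q vs else 0) vs as"
    unfolding so_coder_linear[OF V A q u lin graded_vs[OF V] g]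
    by (rule so_lift_cong[OF V A q u g]) (rule so_coder_cogen)
  then show ?thesis unfolding so_lift_rho by (simp add: coder_def unsh_uminus)
qed

lemma so_coder_square:
  assumes "\<And>vs. vs \<in> cocomm_gens V \<Longrightarrow> coder (sdeg2 V) q q vs = 0"
    and "\<And>vs as. (vs, as) \<in> so_gens V A \<Longrightarrow> so_lift V A q u u vs as = 0"
  shows "so_coder V A q u (so_coder V A q u t) = 0"
proof (rule so_square_zero[OF V A so_coder(1)[OF V A q u] so_coder_coderivation[OF V A q u]])
  fix g assume g: "g \<in> so_gens V A"
  obtain vs as where g': "g = (vs, as)" by (cases g)
  note g'' = g[unfolded g']
  show "so_proj V A (so_coder V A q u (so_coder V A q u (so_mon V A g))) = 0"
    unfolding g' so_coder_proj2[OF g''] by (rule assms(2)[OF g''])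
  show "ger_proj V (so_rho V A (so_coder V A q u (so_coder V A q u (so_mon V A g)))) = 0"
    unfolding g' so_coder_cogen2[OF g''] using assms(1)[of vs] g'' by (auto simp: so_gens_iff cocomm_gens_iff)
qed

section \<open>The Maurer-Cartan equation\<close>

lemma hoch_family_cofamily: "cofamily V (hoch A) u"
  using u by (simp add: hoch_family_def[OF V A] cofamily_def[OF V graded_hoch[OF A]])

text \<open>The Maurer-Cartan equation that both \<open>Qo (Qo t) = 0\<close> and \<open>F (Qs t) = Q' (F t)\<close> amount to.\<close>

definition MC :: "'v list \<Rightarrow> bool" where
  "MC vs \<longleftrightarrow> unshuffle_sum (sdeg2 V) (\<lambda>l r. u (q l # r)) vs =
     unshuffle_sum (sdeg2 V) (\<lambda>l r. ksign (wt (sdeg2 V) l) (insertion A (u l) (u r))) vs"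

lemma insertion_family:
  assumes "l \<in> words V" "r \<in> words V"
  shows "insertion A (u l) (u r) = Ins (sdeg1 A) (wt (sdeg2 V) r + 1) (u r) (u l)"
  using insertion_Ins[OF A u_words(1)[OF V A q u assms(1)] u_words(1)[OF V A q u assms(2)]]
  by (simp add: add.commute)

lemma so_lift_MC:
  assumes vs: "vs \<in> words V"
  shows "so_lift V A q u u vs as =
    (unshuffle_sum (sdeg2 V) (\<lambda>l r. ksign (wt (sdeg2 V) l) (insertion A (u l) (u r))) vs -
     unshuffle_sum (sdeg2 V) (\<lambda>l r. u (q l # r)) vs) as"
proof -
  have "unshuffle_sum (sdeg2 V) (\<lambda>l r. ksign (wt (sdeg2 V) l) (insertion A (u l) (u r))) vs as =
      unshuffle_sum (sdeg2 V) (\<lambda>l r. ksign (wt (sdeg2 V) l) (Ins (sdeg1 A) (wt (sdeg2 V) r + 1) (u r) (u l) as)) vs"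
    unfolding unsh_apply ksign_apply
  proof (rule unsh_cong)
    fix l r assume "usplit (sdeg2 V) vs l r"
    with usplit_lists[OF this vs] have "l \<in> words V" "r \<in> words V" by simp_all
    from insertion_family[OF this]
    show "ksign (wt (sdeg2 V) l) (insertion A (u l) (u r) as) =
      ksign (wt (sdeg2 V) l) (Ins (sdeg1 A) (wt (sdeg2 V) r + 1) (u r) (u l) as)" by simp
  qed
  then show ?thesis by (simp add: so_lift_def[OF V A] coder_def unsh_apply)
qed

text \<open>\<open>MC\<close> compares cochains as functions, while the square-zero condition
  concerns their values at monomials of \<open>So V A\<close>. Elsewhere both sides are 0: cochains
  vanish on lists with inhomogeneous letters, and for the empty pair one has \<open>q [] = 0\<close>
  and \<open>u [] [] = 0\<close>.\<close>

lemma MC_iff: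
  assumes vs: "vs \<in> words V"
  shows "MC vs \<longleftrightarrow> (\<forall>as\<in>words A. (vs, as) \<in> so_gens V A \<longrightarrow> so_lift V A q u u vs as = 0)"
proof -
  note H = graded_hoch[OF A]
  let ?S = "unshuffle_sum (sdeg2 V) (\<lambda>l r. ksign (wt (sdeg2 V) l) (insertion A (u l) (u r))) vs"
    and ?T = "unshuffle_sum (sdeg2 V) (\<lambda>l r. u (q l # r)) vs"
  have out: "?S as = 0 \<and> ?T as = 0" if as: "as \<notin> words A \<or> vs = [] \<and> as = []" for as
  proof -
    have z: "u l [0] = 0" if "l \<in> words V" for l
      using hoch_zero_letter[OF A u_words(1)[OF V A q u that], of "[]" "[]"] by simp
    have u0: "u [0] = 0"
      using vmult_letter_zero[OF V graded_vs[OF H] vsym_vmult, of u "[]" "[]"] u by (simp add: hoch_family_def[OF V A])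
    have s: "insertion A (u l) (u r) as = 0 \<and> u (q l # r) as = 0" if lr: "usplit (sdeg2 V) vs l r" for l r
    proof -
      have w: "l \<in> words V" "r \<in> words V" using usplit_lists[OF lr vs] by simp_all
      have c: "q l # r \<in> words V" using w q_words(1)[OF V A q u w(1)] by (auto intro: cmp_hmg)
      show ?thesis
      proof (cases "as \<in> words A")
        case False
        then show ?thesis
          using hochD(1)[OF A u_words(1)[OF V A q u c] False]
            hochD(1)[OF A Ins_hoch[OF A u_words(1)[OF V A q u w(1)] u_words(1)[OF V A q u w(2)]] False]
            insertion_family[OF w] by simp
      next
        case True
        then have "vs = []" "as = []" using as by auto
        then have "l = []" "r = []" using lr by (simp_all add: usplit_def)
        then show ?thesis
          using \<open>as = []\<close> insertion_family[OF w] z[of "[]"] u_words(2)[OF V A q u] q_words(2)[OF V A q u] u0 by simp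
      qed
    qed
    show ?thesis unfolding unsh_apply ksign_apply using s by (auto intro: unsh_zeroI)
  qed
  show ?thesis
  proof
    assume "MC vs"
    then show "\<forall>as\<in>words A. (vs, as) \<in> so_gens V A \<longrightarrow> so_lift V A q u u vs as = 0"
      by (simp add: so_lift_MC[OF vs] MC_def)
  next
    assume *: "\<forall>as\<in>words A. (vs, as) \<in> so_gens V A \<longrightarrow> so_lift V A q u u vs as = 0"
    show "MC vs"
      unfolding MC_def
    proof
      fix as
      show "?T as = ?S as"
      proof (cases "as \<in> words A \<and> (vs, as) \<in> so_gens V A")
        case True
        then have "so_lift V A q u u vs as = 0" using * by blast
        then show ?thesis by (simp add: so_lift_MC[OF vs])
      next
        case False
        then have "as \<notin> words A \<or> vs = [] \<and> as = []" using vs by (auto simp: so_gens_iff)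
        from out[OF this] show ?thesis by simp
      qed
    qed
  qed
qed

text \<open>\<open>u []\<close> has odd shifted degree, so its bracket with itself is twice its
  insertion into itself, and 2 is invertible.\<close>

lemma MC_Nil: "MC [] \<longleftrightarrow> gerst_bracket A (u []) (u []) = 0"
proof -
  note H = graded_hoch[OF A]
  have m: "u [] \<in> cmp (hoch A) 2" using u_words(1)[OF V A q u, of "[]"] by simp
  let ?X = "insertion A (u []) (u [])"
  have u0: "u [0] = 0"
    using vmult_letter_zero[OF V graded_vs[OF H] vsym_vmult, of u "[]" "[]"] u by (simp add: hoch_family_def[OF V A])
  have "MC [] \<longleftrightarrow> ?X = 0" by (auto simp: MC_def q_words(2)[OF V A q u] u0)
  also have "\<dots> \<longleftrightarrow> ?X + ?X = 0"
  proof
    assume "?X + ?X = 0"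
    then have "scl (hoch A) (1 / 2 + 1 / 2) ?X = 0"
      using vector_space_scale(1,2,7)[OF graded_vs[OF H]] by metis
    then show "?X = 0" using vector_space_scale(3)[OF graded_vs[OF H]] by simp
  qed simp
  also have "?X + ?X = gerst_bracket A (u []) (u [])"
    unfolding gerst_eq[OF A m m] insertion_Ins[OF A m m] by (simp add: ksign_def)
  finally show ?thesis .
qed

text \<open>Only partitions into one or two blocks survive the corestriction of the codifferential.
  Two blocks give a bracket, that is, both ordered insertions of the pair, which
  \<open>Fw_pair\<close> resums over proper unshuffles. One block gives \<open>[u [], u vs]\<close>,
  which supplies the two unshuffles with an empty part.\<close>

lemma exp_codiff_proj:
  assumes vs: "vs \<in> cocomm_gens V"
  shows "cocomm_proj (hoch A) (hoch_codiff A (u []) (cocomm_exp V (hoch A) u (cocomm_mon V vs))) =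
     unshuffle_sum (sdeg2 V) (\<lambda>l r. ksign (wt (sdeg2 V) l) (insertion A (u l) (u r))) vs"
proof -
  note H = graded_hoch[OF A]
  note sH = graded_vs[OF H]
  let ?d = "sdeg2 V" and ?m = "u []"
  have w: "vs \<in> words V" "vs \<noteq> []" using vs by (simp_all add: cocomm_gens_iff)
  have m: "?m \<in> cmp (hoch A) 2" using u_words(1)[OF V A q u, of "[]"] by simp
  note hc = hoch_cores[OF A m]
  note C = cocomm_coder[OF H hc]
  let ?g = "\<lambda>l r. ksign (wt ?d l) (insertion A (u l) (u r))"
  note lin = linear_map_comp[OF C(1) HomD(1)[OF cocomm_proj(1)[OF H]] vs_cocomm vs_cocomm sH]
  note bw = bpart_words[OF V H hoch_family_cofamily]
  have "cocomm_proj (hoch A) (hoch_codiff A ?m (cocomm_exp V (hoch A) u (cocomm_mon V vs))) =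
      Fw (scl (hoch A)) ?d (\<lambda>P. cocomm_proj (hoch A) (cocomm_coder (hoch A) (hoch_cores A ?m) (cocomm_mon (hoch A) (map u P)))) vs"
    unfolding hoch_codiff_coder[OF A m]
    by (rule cocomm_exp_linear[OF V H hoch_family_cofamily lin sH vs])
  also have "\<dots> = Fw (scl (hoch A)) ?d (\<lambda>P. (case P of [l] \<Rightarrow> gerst_bracket A ?m (u l) | _ \<Rightarrow> 0) +
      (case P of [l, r] \<Rightarrow> ?g l r + ksign (wt ?d l * wt ?d r) (?g r l) | _ \<Rightarrow> 0)) vs"
  proof (rule Fw_cong)
    fix P assume P: "bpart ?d vs P"
    have gen: "map u P \<in> cocomm_gens (hoch A)" by (rule bpart_mon_cmp(2)[OF V H hoch_family_cofamily P vs])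
    have two: "ksign (deg (hoch A) (u l)) (gerst_bracket A (u l) (u r)) = ?g l r + ksign (wt ?d l * wt ?d r) (?g r l)"
      if "P = [l, r]" for l r
    proof -
      have lr: "l \<in> words V" "r \<in> words V" using bw(1)[OF P w(1), of l] bw(1)[OF P w(1), of r] that by simp_all
      note ul = u_words(1)[OF V A q u lr(1)] and ur = u_words(1)[OF V A q u lr(2)]
      show ?thesis
        unfolding sign_gerst[OF A ul ur]
        unfolding gerst_eq[OF A ul ur] insertion_Ins[OF A ul ur] insertion_Ins[OF A ur ul]
        by (cases "even (wt ?d l)"; cases "even (wt ?d r)") (simp_all add: ksign_def)
    qed
    show "cocomm_proj (hoch A) (cocomm_coder (hoch A) (hoch_cores A ?m) (cocomm_mon (hoch A) (map u P))) =
      (case P of [l] \<Rightarrow> gerst_bracket A ?m (u l) | _ \<Rightarrow> 0) +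
      (case P of [l, r] \<Rightarrow> ?g l r + ksign (wt ?d l * wt ?d r) (?g r l) | _ \<Rightarrow> 0)"
      unfolding C(5)[OF gen] using two by (auto simp: hoch_cores_def split: list.splits)
  qed
  also have "\<dots> = gerst_bracket A ?m (u vs) + unshuffle_sum ?d (\<lambda>l r. if l = [] \<or> r = [] then 0 else ?g l r) vs"
    unfolding Fw_plus[OF sH] Fw_single[OF sH w(2)] Fw_pair[OF sH w(2)] ..
  also have "gerst_bracket A ?m (u vs) = ?g [] vs + ?g vs []"
  proof -
    note uv = u_words(1)[OF V A q u w(1)]
    show ?thesis
      unfolding gerst_eq[OF A m uv] insertion_Ins[OF A m uv] insertion_Ins[OF A uv m]
      by (cases "even (wt ?d vs)") (simp_all add: ksign_def)
  qed
  also have "?g [] vs + ?g vs [] + unshuffle_sum ?d (\<lambda>l r. if l = [] \<or> r = [] then 0 else ?g l r) vs =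
      unshuffle_sum ?d ?g vs"
    by (rule unsh_proper[OF w(2), symmetric])
  finally show ?thesis .
qed

lemma exp_coder_proj:
  assumes vs: "vs \<in> cocomm_gens V"
  shows "cocomm_proj (hoch A) (cocomm_exp V (hoch A) u (cocomm_coder V q (cocomm_mon V vs))) =
     unshuffle_sum (sdeg2 V) (\<lambda>l r. u (q l # r)) vs"
proof -
  note H = graded_hoch[OF A]
  note E = cocomm_exp[OF V H hoch_family_cofamily]
  have w: "vs \<in> words V" using vs by (simp add: cocomm_gens_iff)
  have gen: "q l # r \<in> cocomm_gens V" if "usplit (sdeg2 V) vs l r" for l r
    using q_words(1)[OF V A q u, of l] usplit_lists[OF that w] by (auto simp: cocomm_gens_iff intro: cmp_hmg)
  note lin = linear_map_comp[OF E(1) HomD(1)[OF cocomm_proj(1)[OF H]] vs_cocomm vs_cocomm graded_vs[OF H]]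
  have "cocomm_proj (hoch A) (cocomm_exp V (hoch A) u (cocomm_coder V q (cocomm_mon V vs))) =
      unshuffle_sum (sdeg2 V) (\<lambda>l r. cocomm_proj (hoch A) (cocomm_exp V (hoch A) u (cocomm_mon V (q l # r)))) vs"
    unfolding cocomm_coder(2)[OF V q vs] coder_def
    by (rule unsh_additive_on[OF linear_map_additive_on[OF vs_cocomm graded_vs[OF H] lin], THEN conjunct2])
      (rule cocomm_mon_tot[OF gen])
  also have "\<dots> = unshuffle_sum (sdeg2 V) (\<lambda>l r. u (q l # r)) vs"
    by (rule unsh_cong) (rule cocomm_exp_proj[OF V H hoch_family_cofamily gen])
  finally show ?thesis .
qed

end

text \<open>The converse of the construction: the components \<open>u\<close> read off by
  \<open>so_proj\<close> form a \<open>hoch_family\<close>, and \<open>so_coder\<close> for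
  \<open>q\<close> and \<open>u\<close> has the same two corestrictions as \<open>Q\<close>, hence
  equals it.\<close>

lemma so_coderivation_coder:
  assumes q: "corestriction V q"
    and Q: "Q \<in> Hom (So V A) (So V A) 1" "coderivation (So V A) 1 (so_Delta V A) Q"
    and r: "\<And>vs as. (vs, as) \<in> so_gens V A \<Longrightarrow>
      ger_proj V (so_rho V A (Q (so_mon V A (vs, as)))) = (if as = [] then - q vs else 0)"
  defines "u \<equiv> \<lambda>vs as. if (vs, as) \<in> so_gens V A then so_proj V A (Q (so_mon V A (vs, as))) else 0"
  shows "hoch_family V A u" "Q = so_coder V A q u"
proof -
  note G = graded_So[OF V A]
  have "slot_linear A (scl A) (\<lambda>x. x)" by (simp add: slot_linear_def)
  from slot_linear_comp_Hom[OF so_proj(1)[OF V A] this vs_So graded_vs[OF A]]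
  have "slot_linear (So V A) (scl A) (so_proj V A)" .
  from slot_linear_comp_Hom[OF Q(1) this vs_So vs_So]
  have sl: "slot_linear (So V A) (scl A) (\<lambda>t. so_proj V A (Q t))" .
  have vso: "vso V A (scl A) u"
    by (rule vso_cong[OF V A so_univ[OF V A graded_vs[OF A] sl]]) (simp add: u_def)
  have out: "u vs as = 0" if "as \<notin> words A" for vs as using that by (simp add: u_def so_gens_iff)
  show u: "hoch_family V A u"
    unfolding hoch_family_def[OF V A]
  proof (intro conjI ballI)
    show "vsym V (scl (hoch A)) u"
    proof (rule vsymI)
      fix xs ys assume xy: "xs \<in> words V" "ys \<in> words V"
      have v: "vsym V (scl A) (\<lambda>vs. u vs as)" for as
        using vso out vsym_sums(6)[OF graded_vs[OF A]] by (cases "as \<in> words A") (simp_all add: vso_def)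
      show "slot_linear V (scl (hoch A)) (\<lambda>a. u (xs @ a # ys))"
        unfolding slot_linear_def
      proof (intro allI ballI)
        fix n a b c assume ab: "a \<in> cmp V n" "b \<in> cmp V n"
        show "u (xs @ (a + scl V c b) # ys) = u (xs @ a # ys) + scl (hoch A) c (u (xs @ b # ys))"
        proof
          fix as
          show "u (xs @ (a + scl V c b) # ys) as = (u (xs @ a # ys) + scl (hoch A) c (u (xs @ b # ys))) as"
            using vsym_slot[OF v xy, of as] ab by (simp add: slot_linear_def)
        qed
      qed
      fix a b assume ab: "a \<in> hmg V" "b \<in> hmg V"
      show "u (xs @ a # b # ys) = ksign (sdeg2 V a * sdeg2 V b) (u (xs @ b # a # ys))"
      proof
        fix as
        show "u (xs @ a # b # ys) as = ksign (sdeg2 V a * sdeg2 V b) (u (xs @ b # a # ys)) as"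
          unfolding ksign_apply by (rule vsym_swap[OF v xy ab])
      qed
    qed
    fix vs assume vs: "vs \<in> words V"
    show "u vs \<in> cmp (hoch A) (wt (sdeg2 V) vs + 2)"
      unfolding hoch_cmp[OF A]
    proof (intro conjI allI impI ballI)
      show "vmult A (scl A) (u vs)" using vso vs by (simp add: vso_def)
      fix as assume as: "as \<in> words A"
      show "u vs as \<in> cmp A (wt (sdeg1 A) as + (wt (sdeg2 V) vs + 2))"
      proof (cases "(vs, as) \<in> so_gens V A")
        case True
        from HomD(2)[OF so_proj(1)[OF V A] HomD(2)[OF Q(1) so_mon_cmp[OF True]]]
        show ?thesis using True by (simp add: u_def algebra_simps)
      qed (simp add: u_def cmp_0[OF A])
    qed (rule out)
  qed (simp add: u_def so_gens_iff)
  show "Q = so_coder V A q u"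
  proof (rule so_coder_unique[OF V A Q so_coder(1)[OF V A q u] so_coder_coderivation[OF V A q u]])
    fix g assume g: "g \<in> so_gens V A"
    obtain vs as where g': "g = (vs, as)" by (cases g)
    note g'' = g[unfolded g']
    show "so_proj V A (Q (so_mon V A g)) = so_proj V A (so_coder V A q u (so_mon V A g))"
      unfolding g' so_coder_proj[OF q u g''] using g'' by (simp add: u_def)
    show "ger_proj V (so_rho V A (Q (so_mon V A g))) = ger_proj V (so_rho V A (so_coder V A q u (so_mon V A g)))"
      unfolding g' so_coder_cogen[OF q u g''] by (rule r[OF g''])
  qed
qed

end

section \<open>The correspondence\<close>

text \<open>The components of \<open>Q\<close> on \<open>cocomm V\<close>, the \<open>q\<close> of
  the Maurer-Cartan equation; the value 0 at the empty word follows the convention in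
  \<open>corestriction\<close>.\<close>

definition ger_cores ::
  "('k::field_char_0, 'v::ab_group_add) gvs \<Rightarrow> (('v list list, 'k) functional \<Rightarrow> ('v list list, 'k) functional) \<Rightarrow>
   'v list \<Rightarrow> 'v" where
  "ger_cores V Q l = (if l = [] then 0 else ger_proj V (Q (ger_mon V (map (\<lambda>v. [v]) l))))"

section \<open>Restriction of the colour-c component to \<open>cocomm V\<close>\<close>

context
  fixes V :: "('k::field_char_0, 'v::ab_group_add) gvs"
  assumes V: "graded_space V"
begin

lemma ger_corestriction:
  assumes Q: "Q \<in> Hom (Ger_dual V) (Ger_dual V) 1"
  shows "corestriction V (ger_cores V Q)"
  unfolding corestriction_def[OF V]
proof (intro conjI ballI)
  have "slot_linear V (scl V) (\<lambda>x. x)" by (simp add: slot_linear_def)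
  from slot_linear_comp_Hom[OF ger_proj(1)[OF V] this vs_Ger graded_vs[OF V]]
  have "slot_linear (Ger_dual V) (scl V) (ger_proj V)" .
  from slot_linear_comp_Hom[OF Q this vs_Ger vs_Ger]
  have "slot_linear (Ger_dual V) (scl V) (\<lambda>t. ger_proj V (Q t))" .
  from slot_linear_comp_Hom[OF cocomm_incl(1)[OF V] this vs_cocomm vs_Ger]
  have sl: "slot_linear (cocomm V) (scl V) (\<lambda>t. ger_proj V (Q (cocomm_incl V t)))" .
  show "vsym V (scl V) (ger_cores V Q)"
    by (rule vsym_cong[OF V cocomm_univ[OF V graded_vs[OF V] sl]])
      (simp add: ger_cores_def cocomm_incl(2)[OF V] cocomm_gens_iff)
  fix l assume l: "l \<in> words V"
  show "ger_cores V Q l \<in> cmp V (wt (sdeg2 V) l + 3)"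
  proof (cases "l = []")
    case False
    from HomD(2)[OF ger_proj(1)[OF V] HomD(2)[OF Q ger_mon_cmp[OF l False]]]
    show ?thesis using False by (simp add: ger_cores_def add.commute)
  qed (simp add: ger_cores_def cmp_0[OF V])
qed (simp add: ger_cores_def)

lemma ger_proj_incl: "ger_proj V (cocomm_incl V t) = cocomm_proj V t"
proof -
  have "(\<lambda>t. ger_proj V (cocomm_incl V t)) = cocomm_proj V"
  proof (rule cocomm_linear_eq[OF graded_vs[OF V] _ HomD(1)[OF cocomm_proj(1)[OF V]]])
    show "linear_map (cocomm V) (scl V) (\<lambda>t. ger_proj V (cocomm_incl V t))"
      by (rule linear_map_comp[OF cocomm_incl(1)[OF V] HomD(1)[OF ger_proj(1)[OF V]] vs_cocomm vs_Ger graded_vs[OF V]])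
    fix vs assume vs: "vs \<in> cocomm_gens V"
    then have "map (\<lambda>v. [v]) vs \<in> ger_gens V" using ger_gens_singletons[of vs V] by (simp add: cocomm_gens_iff)
    from ger_proj(2)[OF V this]
    show "ger_proj V (cocomm_incl V (cocomm_mon V vs)) = cocomm_proj V (cocomm_mon V vs)"
      unfolding cocomm_incl(2)[OF V vs] cocomm_proj(2)[OF V vs] by (simp split: list.splits)
  qed
  then show ?thesis by (rule fun_cong)
qed

lemma incl_coder:
  assumes q: "corestriction V q" and vs: "vs \<in> cocomm_gens V"
  shows "cocomm_incl V (cocomm_coder V q (cocomm_mon V vs)) = coder (sdeg2 V) q (\<lambda>vs. ger_mon V (map (\<lambda>v. [v]) vs)) vs"
proof -
  have w: "vs \<in> words V" using vs by (simp add: cocomm_gens_iff)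
  have gen: "q l # r \<in> cocomm_gens V" if "usplit (sdeg2 V) vs l r" for l r
    using q usplit_lists[OF that w] by (auto simp: corestriction_def[OF V] cocomm_gens_iff intro: cmp_hmg)
  have "cocomm_incl V (cocomm_coder V q (cocomm_mon V vs)) =
      unshuffle_sum (sdeg2 V) (\<lambda>l r. cocomm_incl V (cocomm_mon V (q l # r))) vs"
    unfolding cocomm_coder(2)[OF V q vs] coder_def
    by (rule unsh_additive_on[OF linear_map_additive_on[OF vs_cocomm vs_Ger HomD(1)[OF cocomm_incl(1)[OF V]]], THEN conjunct2])
      (rule cocomm_mon_tot[OF gen])
  also have "\<dots> = coder (sdeg2 V) q (\<lambda>vs. ger_mon V (map (\<lambda>v. [v]) vs)) vs"
    unfolding coder_def by (rule unsh_cong) (rule cocomm_incl(2)[OF V gen])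
  finally show ?thesis .
qed

lemma restricts_coder:
  assumes Q: "Q \<in> Hom (Ger_dual V) (Ger_dual V) 1" and q: "corestriction V q"
    and e: "\<And>vs. vs \<in> cocomm_gens V \<Longrightarrow>
      Q (ger_mon V (map (\<lambda>v. [v]) vs)) = coder (sdeg2 V) q (\<lambda>vs. ger_mon V (map (\<lambda>v. [v]) vs)) vs"
  shows "restricts_to_cocomm V Q (cocomm_coder V q)"
proof -
  have "(\<lambda>t. cocomm_incl V (cocomm_coder V q t)) = (\<lambda>t. Q (cocomm_incl V t))"
  proof (rule cocomm_linear_eq[OF vector_space_fscl])
    show "linear_map (cocomm V) fscl (\<lambda>t. cocomm_incl V (cocomm_coder V q t))"
      by (rule linear_map_comp[OF cocomm_coder(1)[OF V q] HomD(1)[OF cocomm_incl(1)[OF V], unfolded scl_Ger] vs_cocomm vs_cocomm vector_space_fscl])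
    show "linear_map (cocomm V) fscl (\<lambda>t. Q (cocomm_incl V t))"
      by (rule linear_map_comp[OF cocomm_incl(1)[OF V] HomD(1)[OF Q, unfolded scl_Ger] vs_cocomm vs_Ger vector_space_fscl])
    show "cocomm_incl V (cocomm_coder V q (cocomm_mon V vs)) = Q (cocomm_incl V (cocomm_mon V vs))" if "vs \<in> cocomm_gens V" for vs
      unfolding incl_coder[OF q that] cocomm_incl(2)[OF V that] e[OF that] ..
  qed
  from fun_cong[OF this] show ?thesis
    unfolding restricts_to_cocomm_def using cocomm_coder(1)[OF V q] by simp
qed

text \<open>The corestriction of the square vanishes because \<open>ger_proj\<close> and
  \<open>cocomm_proj\<close> agree along the inclusion, and a square of a coderivation is determined
  by its corestriction.\<close>

lemma restricts_LambdaLie: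
  assumes r: "restricts_to_cocomm V Q Qs" and Q: "\<And>t. Q (Q t) = 0"
    and c: "coderivation (cocomm V) 2 (cocomm_Delta V) Qs"
  shows "LambdaLie_infinity V Qs"
proof -
  have H: "Qs \<in> Hom (cocomm V) (cocomm V) 1" and e: "\<And>t. t \<in> tot (cocomm V) \<Longrightarrow> cocomm_incl V (Qs t) = Q (cocomm_incl V t)"
    using r by (simp_all add: restricts_to_cocomm_def)
  have "Qs (Qs t) = 0" for t
  proof (rule cocomm_square_zero[OF V H c])
    fix vs assume "vs \<in> cocomm_gens V"
    note t = cocomm_mon_tot[OF this]
    show "cocomm_proj V (Qs (Qs (cocomm_mon V vs))) = 0"
      unfolding ger_proj_incl[symmetric] e[OF Hom_tot[OF H vs_cocomm vs_cocomm t]] e[OF t] Q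
      by (rule linear_map_0[OF vs_Ger graded_vs[OF V] HomD(1)[OF ger_proj(1)[OF V]]])
  qed
  then show ?thesis unfolding LambdaLie_infinity_def using H c by simp
qed

text \<open>Uniqueness of coderivations forces the restriction to be the one built from
  \<open>ger_cores V Q\<close>. The second clause is the resulting formula for \<open>Q\<close> on
  the image of \<open>cocomm V\<close>, which is what anticommutation with \<open>so_rho\<close>
  refers to.\<close>

lemma restricts_cores:
  assumes r: "restricts_to_cocomm V Q Qs" and Q: "Q \<in> Hom (Ger_dual V) (Ger_dual V) 1"
    and c: "coderivation (cocomm V) 2 (cocomm_Delta V) Qs"
  shows "Qs = cocomm_coder V (ger_cores V Q)"
    and "vs \<in> cocomm_gens V \<Longrightarrow> Q (ger_mon V (map (\<lambda>v. [v]) vs)) =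
      coder (sdeg2 V) (ger_cores V Q) (\<lambda>vs. ger_mon V (map (\<lambda>v. [v]) vs)) vs"
proof -
  note q = ger_corestriction[OF Q]
  have H: "Qs \<in> Hom (cocomm V) (cocomm V) 1" and e: "\<And>t. t \<in> tot (cocomm V) \<Longrightarrow> cocomm_incl V (Qs t) = Q (cocomm_incl V t)"
    using r by (simp_all add: restricts_to_cocomm_def)
  show 1: "Qs = cocomm_coder V (ger_cores V Q)"
  proof (rule cocomm_coder_unique[OF V H c cocomm_coder(1,4)[OF V q]])
    fix vs assume vs: "vs \<in> cocomm_gens V"
    show "cocomm_proj V (Qs (cocomm_mon V vs)) = cocomm_proj V (cocomm_coder V (ger_cores V Q) (cocomm_mon V vs))"
      unfolding cocomm_coder(5)[OF V q vs] unfolding ger_proj_incl[symmetric] e[OF cocomm_mon_tot[OF vs]] cocomm_incl(2)[OF V vs]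
      using vs by (simp add: ger_cores_def cocomm_gens_iff)
  qed
  show "Q (ger_mon V (map (\<lambda>v. [v]) vs)) = coder (sdeg2 V) (ger_cores V Q) (\<lambda>vs. ger_mon V (map (\<lambda>v. [v]) vs)) vs"
    if vs: "vs \<in> cocomm_gens V"
    using e[OF cocomm_mon_tot[OF vs]] unfolding 1 incl_coder[OF q vs] cocomm_incl(2)[OF V vs] by simp
qed

end

section \<open>Existence and uniqueness of the corresponding structure, in both directions\<close>

context
  fixes V :: "('k::field_char_0, 'v::ab_group_add) gvs" and A :: "('k, 'a::ab_group_add) gvs"
    and dV :: "'v \<Rightarrow> 'v" and dA :: "'a \<Rightarrow> 'a"
  assumes V: "graded_space V" and A: "graded_space A"
begin

abbreviation (input) so_cores ::
  "(('v list \<times> 'a list, 'k) functional \<Rightarrow> ('v list \<times> 'a list, 'k) functional) \<Rightarrow> 'v list \<Rightarrow> 'a list \<Rightarrow> 'a" where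
  "so_cores Q \<equiv> \<lambda>vs as. if (vs, as) \<in> so_gens V A then so_proj V A (Q (so_mon V A (vs, as))) else 0"

text \<open>Anticommutation with \<open>so_rho\<close> fixes the projection of \<open>Qo\<close> to
  \<open>V\<close> as \<open>- ger_cores V Qc\<close> on words without letters from \<open>A\<close>
  and as 0 otherwise, so \<open>so_coderivation_coder\<close> applies.\<close>

lemma plus_coder:
  assumes P: "Ger_infinity_plus V dV A dA (Qc, Qo)"
  shows "corestriction V (ger_cores V Qc)" "hoch_family V A (so_cores Qo)"
    and "Qo = so_coder V A (ger_cores V Qc) (so_cores Qo)"
proof -
  have Qc: "Qc \<in> Hom (Ger_dual V) (Ger_dual V) 1"
    and Qo: "Qo \<in> Hom (So V A) (So V A) 1" "coderivation (So V A) 1 (so_Delta V A) Qo"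
    and rho: "\<And>t. t \<in> tot (So V A) \<Longrightarrow> so_rho V A (Qo t) = - Qc (so_rho V A t)"
    using P by (simp_all add: Ger_infinity_plus_def)
  show q: "corestriction V (ger_cores V Qc)" by (rule ger_corestriction[OF V Qc])
  have r: "ger_proj V (so_rho V A (Qo (so_mon V A (vs, as)))) = (if as = [] then - ger_cores V Qc vs else 0)"
    if g: "(vs, as) \<in> so_gens V A" for vs as
  proof (cases "as = []")
    case True
    have vs: "vs \<in> words V" "vs \<noteq> []" using g True by (simp_all add: so_gens_iff)
    have "Qc (ger_mon V (map (\<lambda>v. [v]) vs)) \<in> tot (Ger_dual V)"
      by (rule hmg_tot[OF vs_Ger cmp_hmg[OF HomD(2)[OF Qc ger_mon_cmp[OF vs]]]])
    from linear_map_uminus[OF vs_Ger graded_vs[OF V] HomD(1)[OF ger_proj(1)[OF V]] this]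
    show ?thesis unfolding rho[OF so_mon_tot[OF g]] so_rho(2)[OF V g] using True vs by (simp add: ger_cores_def)
  next
    case False
    then show ?thesis
      unfolding rho[OF so_mon_tot[OF g]] so_rho(2)[OF V g]
      using linear_map_0[OF vs_Ger vs_Ger HomD(1)[OF Qc]] linear_map_0[OF vs_Ger graded_vs[OF V] HomD(1)[OF ger_proj(1)[OF V]]]
      by simp
  qed
  show "hoch_family V A (so_cores Qo)" "Qo = so_coder V A (ger_cores V Qc) (so_cores Qo)"
    by (rule so_coderivation_coder[OF V A q Qo r]; assumption)+
qed

lemma plus_triple:
  assumes P: "Ger_infinity_plus V dV A dA Q"
  shows "\<exists>T. Ger_Ainf_morphism_triple V dV A dA T \<and> corresponds V A Q T"
proof -
  obtain Qc Qo where Q: "Q = (Qc, Qo)" by (cases Q)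
  define q where "q = ger_cores V Qc"
  define u where "u = so_cores Qo"
  note pc = plus_coder[OF P[unfolded Q], folded u_def, folded q_def]
  note q = pc(1) and u = pc(2) and Qo = pc(3)
  note H = graded_hoch[OF A]
  let ?Qs = "cocomm_coder V q" and ?F = "cocomm_exp V (hoch A) u" and ?m = "u []"
  note cof = hoch_family_cofamily[OF V A q u]
  have G: "Ger_infinity V dV Qc" and Qc: "Qc \<in> Hom (Ger_dual V) (Ger_dual V) 1" "\<And>t. Qc (Qc t) = 0"
    and rho: "\<And>t. t \<in> tot (So V A) \<Longrightarrow> so_rho V A (Qo t) = - Qc (so_rho V A t)"
    and sq: "\<And>t. Qo (Qo t) = 0" and dA: "\<And>a. a \<in> hmg A \<Longrightarrow> so_proj V A (Qo (so_mon V A ([], [a]))) = dA a"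
    using P unfolding Q by (simp_all add: Ger_infinity_plus_def Ger_infinity_def)
  \<comment> \<open>That \<open>Qc\<close> preserves \<open>cocomm V\<close> is read off from
    \<open>so_rho\<close> applied to \<open>Qo\<close> on monomials without letters from
    \<open>A\<close>.\<close>
  have restr: "restricts_to_cocomm V Qc ?Qs"
  proof (rule restricts_coder[OF V Qc(1) q])
    fix vs assume vs: "vs \<in> cocomm_gens V"
    then have g: "(vs, []) \<in> so_gens V A" by (simp add: so_gens_iff cocomm_gens_iff)
    have "- Qc (ger_mon V (map (\<lambda>v. [v]) vs)) = so_rho V A (Qo (so_mon V A (vs, [])))"
      unfolding rho[OF so_mon_tot[OF g]] so_rho(2)[OF V g] by simp
    also have "\<dots> = - coder (sdeg2 V) q (\<lambda>vs. ger_mon V (map (\<lambda>v. [v]) vs)) vs"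
      by (subst Qo) (simp add: so_coder_rho[OF V A q u g])
    finally show "Qc (ger_mon V (map (\<lambda>v. [v]) vs)) = coder (sdeg2 V) q (\<lambda>vs. ger_mon V (map (\<lambda>v. [v]) vs)) vs" by simp
  qed
  have L: "LambdaLie_infinity V ?Qs"
    by (rule restricts_LambdaLie[OF V restr Qc(2) cocomm_coder(4)[OF V q]])
  have MC: "MC V A q u vs" if "vs \<in> words V" for vs
    unfolding MC_iff[OF V A q u that]
  proof (intro ballI impI)
    fix as assume g: "(vs, as) \<in> so_gens V A"
    have "so_proj V A (Qo (Qo (so_mon V A (vs, as)))) = 0"
      unfolding sq by (rule Hom_0[OF graded_So[OF V A] A so_proj(1)[OF V A]])
    then show "so_lift V A q u u vs as = 0"
      unfolding so_coder_proj2[OF V A q u g, symmetric] Qo[symmetric] .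
  qed
  have m: "?m \<in> cmp (hoch A) 2" using u_words(1)[OF V A q u, of "[]"] by simp
  have mm: "gerst_bracket A ?m ?m = 0" using MC[of "[]"] MC_Nil[OF V A q u] by simp
  have Ainf: "A_infinity A dA ?m"
    unfolding A_infinity_def using m mm u_words(2)[OF V A q u] dA by (simp add: u_def so_gens_iff)
  note L' = hoch_LambdaLie[OF A m mm]
  note F = cocomm_exp_coalgebra_map[OF V H cof]
  have "?F (?Qs t) = hoch_codiff A ?m (?F t)" for t
  proof (rule coalgebra_map_intertwines[OF V H F cocomm_coder(1,4)[OF V q]])
    show "hoch_codiff A ?m \<in> Hom (cocomm (hoch A)) (cocomm (hoch A)) 1"
      "coderivation (cocomm (hoch A)) 2 (cocomm_Delta (hoch A)) (hoch_codiff A ?m)"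
      using L' by (simp_all add: LambdaLie_infinity_def)
    fix vs assume vs: "vs \<in> cocomm_gens V"
    then show "cocomm_proj (hoch A) (?F (?Qs (cocomm_mon V vs))) = cocomm_proj (hoch A) (hoch_codiff A ?m (?F (cocomm_mon V vs)))"
      unfolding exp_coder_proj[OF V A q u vs] exp_codiff_proj[OF V A q u vs]
      using MC[of vs] by (simp add: MC_def[OF V A q u] cocomm_gens_iff)
  qed
  then have "Linfinity_morphism V ?Qs (hoch A) (hoch_codiff A ?m) ?F"
    using L L' F by (simp add: Linfinity_morphism_def coalgebra_map_def)
  then have "Ger_Ainf_morphism_triple V dV A dA (Qc, ?m, ?F)"
    unfolding Ger_Ainf_morphism_triple_def prod.case using G Ainf restr by blast
  moreover have "corresponds V A Q (Qc, ?m, ?F)"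
    unfolding corresponds_def Q prod.case
  proof (intro conjI ballI refl)
    fix as assume "as \<in> words A - {[]}"
    then show "?m as = so_proj V A (Qo (so_mon V A ([], as)))" by (simp add: u_def so_gens_iff)
  next
    fix vs as assume va: "vs \<in> words V - {[]}" "as \<in> words A"
    then have "vs \<in> cocomm_gens V" by (simp add: cocomm_gens_iff)
    from cocomm_exp_proj[OF V H cof this]
    show "cocomm_proj (hoch A) (?F (cocomm_mon V vs)) as = so_proj V A (Qo (so_mon V A (vs, as)))"
      using va by (simp add: u_def so_gens_iff)
  qed
  ultimately show ?thesis by blast
qed

lemma triple_plus:
  assumes T: "Ger_Ainf_morphism_triple V dV A dA T"
  shows "\<exists>Q. Ger_infinity_plus V dV A dA Q \<and> corresponds V A Q T"
proof -
  obtain Qc m F where T': "T = (Qc, m, F)" by (cases T)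
  note H = graded_hoch[OF A]
  obtain Qs where G: "Ger_infinity V dV Qc" and Ainf: "A_infinity A dA m"
    and restr: "restricts_to_cocomm V Qc Qs" and mor: "Linfinity_morphism V Qs (hoch A) (hoch_codiff A m) F"
    using T unfolding Ger_Ainf_morphism_triple_def T' prod.case by blast
  have Qc: "Qc \<in> Hom (Ger_dual V) (Ger_dual V) 1" using G by (simp add: Ger_infinity_def)
  have L: "LambdaLie_infinity V Qs" and F: "coalgebra_map V (hoch A) F"
    and FQ: "\<And>t. t \<in> tot (cocomm V) \<Longrightarrow> F (Qs t) = hoch_codiff A m (F t)"
    using mor by (simp_all add: Linfinity_morphism_def coalgebra_map_def)
  define q where "q = ger_cores V Qc"
  have q: "corestriction V q" unfolding q_def by (rule ger_corestriction[OF V Qc])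
  have "coderivation (cocomm V) 2 (cocomm_Delta V) Qs" using L by (simp add: LambdaLie_infinity_def)
  note rc = restricts_cores[OF V restr Qc this, folded q_def]
  \<comment> \<open>The structure \<open>m\<close> is put into the slot \<open>u []\<close>, at
    which the exponential never evaluates \<open>u\<close>, so \<open>F\<close> is still the
    exponential of this family.\<close>
  define u where "u vs = (if vs = [] then m else cocomm_proj (hoch A) (F (cocomm_mon V vs)))" for vs
  have m: "m \<in> cmp (hoch A) 2" "m [] = 0" "gerst_bracket A m m = 0" using Ainf by (simp_all add: A_infinity_def)
  have u: "hoch_family V A u"
  proof -
    note ce = coalgebra_map_exp(1)[OF V H F, unfolded cofamily_def[OF V H]]
    have "vsym V (scl (hoch A)) u"
      by (rule vsym_cong[OF V ce[THEN conjunct1]]) (simp add: u_def)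
    then show ?thesis using ce m by (auto simp: hoch_family_def[OF V A] u_def)
  qed
  have um: "u [] = m" by (simp add: u_def)
  note cof = hoch_family_cofamily[OF V A q u]
  have FE: "F = cocomm_exp V (hoch A) u"
    by (rule coalgebra_map_unique[OF V H F cocomm_exp_coalgebra_map[OF V H cof]])
      (simp add: cocomm_exp_proj[OF V H cof], simp add: u_def cocomm_gens_iff)
  have MC: "MC V A q u vs" if vs: "vs \<in> words V" for vs
  proof (cases "vs = []")
    case True
    then show ?thesis using MC_Nil[OF V A q u] m(3) um by simp
  next
    case False
    then have g: "vs \<in> cocomm_gens V" using vs by (simp add: cocomm_gens_iff)
    have "cocomm_proj (hoch A) (F (Qs (cocomm_mon V vs))) = cocomm_proj (hoch A) (hoch_codiff A m (F (cocomm_mon V vs)))"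
      unfolding FQ[OF cocomm_mon_tot[OF g]] ..
    then show ?thesis
      using exp_coder_proj[OF V A q u g] exp_codiff_proj[OF V A q u g]
      unfolding MC_def[OF V A q u] FE rc(1) um by simp
  qed
  let ?Qo = "so_coder V A q u"
  note Hom = so_coder(1)[OF V A q u]
  have sq: "?Qo (?Qo t) = 0" for t
  proof (rule so_coder_square[OF V A q u])
    fix vs assume vs: "vs \<in> cocomm_gens V"
    have "Qs (Qs (cocomm_mon V vs)) = 0" using L by (simp add: LambdaLie_infinity_def)
    then have "cocomm_proj V (cocomm_coder V q (cocomm_coder V q (cocomm_mon V vs))) = 0"
      using Hom_0[OF graded_cocomm[OF V] V cocomm_proj(1)[OF V]] unfolding rc(1) by simp
    then show "coder (sdeg2 V) q q vs = 0" unfolding cocomm_coder_proj2[OF V q vs] by (simp add: coder_def)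
  next
    fix vs as assume g: "(vs, as) \<in> so_gens V A"
    then have "vs \<in> words V" "as \<in> words A" by (simp_all add: so_gens_iff)
    then show "so_lift V A q u u vs as = 0" using MC MC_iff[OF V A q u] g by blast
  qed
  \<comment> \<open>Both sides vanish as soon as a letter from \<open>A\<close> is present;
    otherwise this is the formula for \<open>Qc\<close> on the image of
    \<open>cocomm V\<close>.\<close>
  have rho: "so_rho V A (?Qo t) = - Qc (so_rho V A t)" for t
  proof -
    have "(\<lambda>t. so_rho V A (?Qo t)) = (\<lambda>t. - Qc (so_rho V A t))"
    proof (rule so_linear_eq[OF vector_space_fscl])
      show "linear_map (So V A) fscl (\<lambda>t. so_rho V A (?Qo t))"
        by (rule linear_map_comp[OF Hom HomD(1)[OF so_rho(1)[OF V], unfolded scl_Ger] vs_So vs_So vector_space_fscl])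
      have "linear_map (So V A) fscl (\<lambda>t. Qc (so_rho V A t))"
        by (rule linear_map_comp[OF so_rho(1)[OF V] HomD(1)[OF Qc, unfolded scl_Ger] vs_So vs_Ger vector_space_fscl])
      then show "linear_map (So V A) fscl (\<lambda>t. - Qc (so_rho V A t))"
        unfolding linear_map_def by simp
      fix g :: "'v list \<times> 'a list" assume g: "g \<in> so_gens V A"
      obtain vs as where g': "g = (vs, as)" by (cases g)
      note g'' = g[unfolded g']
      show "so_rho V A (?Qo (so_mon V A g)) = - Qc (so_rho V A (so_mon V A g))"
        unfolding g' so_coder_rho[OF V A q u g''] so_rho(2)[OF V g'']
        using rc(2)[of vs] g'' linear_map_0[OF vs_Ger vs_Ger HomD(1)[OF Qc]] by (auto simp: so_gens_iff cocomm_gens_iff)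
    qed
    then show ?thesis by (rule fun_cong)
  qed
  have proj: "so_proj V A (?Qo (so_mon V A (vs, as))) = u vs as" if "vs \<in> words V" "as \<in> words A" "vs \<noteq> [] \<or> as \<noteq> []" for vs as
    by (rule so_coder_proj[OF V A q u]) (use that in \<open>simp add: so_gens_iff\<close>)
  have "Ger_infinity_plus V dV A dA (Qc, ?Qo)"
    unfolding Ger_infinity_plus_def prod.case
    using G Hom so_coder_coderivation[OF V A q u] sq rho proj[of "[]"] Ainf
    by (simp add: Ger_infinity_def A_infinity_def um)
  moreover have "corresponds V A (Qc, ?Qo) T"
    unfolding corresponds_def T' prod.case using proj by (simp add: u_def)
  ultimately show ?thesis by blast
qed

text \<open>The correspondence prescribes \<open>m\<close> and the corestriction of \<open>F\<close>
  on words of homogeneous letters, except for \<open>m []\<close>, which is 0. Cochains vanish on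
  all other lists, and \<open>F\<close> is determined by its corestriction.\<close>

lemma corresponds_unique_triple:
  assumes T: "Ger_Ainf_morphism_triple V dV A dA T" and T': "Ger_Ainf_morphism_triple V dV A dA T'"
    and c: "corresponds V A Q T" "corresponds V A Q T'"
  shows "T = T'"
proof -
  obtain Qc Qo where Q: "Q = (Qc, Qo)" by (cases Q)
  obtain G m F where t: "T = (G, m, F)" by (cases T)
  obtain G' m' F' where t': "T' = (G', m', F')" by (cases T')
  note H = graded_hoch[OF A]
  have m: "m \<in> cmp (hoch A) 2" "m [] = 0" "m' \<in> cmp (hoch A) 2" "m' [] = 0"
    using T T' by (simp_all add: Ger_Ainf_morphism_triple_def t t' A_infinity_def)
  have F: "coalgebra_map V (hoch A) F" "coalgebra_map V (hoch A) F'"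
    using T T' by (auto simp: Ger_Ainf_morphism_triple_def t t' Linfinity_morphism_def coalgebra_map_def)
  note c' = c[unfolded corresponds_def Q t t' prod.case]
  have "m = m'"
  proof
    fix as
    show "m as = m' as"
      using hochD(1)[OF A m(1), of as] hochD(1)[OF A m(3), of as] m(2,4) c' by (cases "as \<in> words A"; cases "as = []") simp_all
  qed
  moreover have "F = F'"
  proof (rule coalgebra_map_unique[OF V H F])
    fix vs assume vs: "vs \<in> cocomm_gens V"
    have out: "cocomm_proj (hoch A) (f (cocomm_mon V vs)) as = 0" if "coalgebra_map V (hoch A) f" "as \<notin> words A" for f as
    proof (rule hochD(1)[OF A _ that(2)])
      have "f \<in> Hom (cocomm V) (cocomm (hoch A)) 0" using that(1) by (simp add: coalgebra_map_def)
      from HomD(2)[OF cocomm_proj(1)[OF H] HomD(2)[OF this cocomm_mon_deg[OF vs]]]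
      show "cocomm_proj (hoch A) (f (cocomm_mon V vs)) \<in> cmp (hoch A) (wt (sdeg2 V) vs + 2 + 0 + 0)" .
    qed
    show "cocomm_proj (hoch A) (F (cocomm_mon V vs)) = cocomm_proj (hoch A) (F' (cocomm_mon V vs))"
    proof
      fix as
      show "cocomm_proj (hoch A) (F (cocomm_mon V vs)) as = cocomm_proj (hoch A) (F' (cocomm_mon V vs)) as"
        using out[OF F(1), of as] out[OF F(2), of as] c' vs by (cases "as \<in> words A") (simp_all add: cocomm_gens_iff)
    qed
  qed
  ultimately show ?thesis using c' by (simp add: t t')
qed

text \<open>By \<open>plus_coder\<close>, \<open>Qo\<close> is rebuilt from \<open>Qc\<close> and
  its components, all of which can be read off from the triple.\<close>

lemma corresponds_unique_plus:
  assumes P: "Ger_infinity_plus V dV A dA Q" and P': "Ger_infinity_plus V dV A dA Q'"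
    and c: "corresponds V A Q T" "corresponds V A Q' T"
  shows "Q = Q'"
proof -
  obtain Qc Qo where Q: "Q = (Qc, Qo)" by (cases Q)
  obtain Qc' Qo' where Q': "Q' = (Qc', Qo')" by (cases Q')
  obtain G m F where t: "T = (G, m, F)" by (cases T)
  note c' = c[unfolded corresponds_def Q Q' t prod.case]
  have QQ: "Qc = Qc'" using c' by simp
  have "so_proj V A (Qo (so_mon V A (vs, as))) = so_proj V A (Qo' (so_mon V A (vs, as)))"
    if "(vs, as) \<in> so_gens V A" for vs as
    using that c' by (cases "vs = []") (simp_all add: so_gens_iff)
  then have "so_cores Qo = so_cores Qo'" by (intro ext) simp
  then have "Qo = Qo'"
    using plus_coder(3)[OF P[unfolded Q]] plus_coder(3)[OF P'[unfolded Q']] QQ by simp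
  then show ?thesis using QQ by (simp add: Q Q')
qed

end

theorem theorem4p1:
  fixes V :: "('k::field_char_0, 'v::ab_group_add) gvs" and dV :: "'v \<Rightarrow> 'v"
    and A :: "('k, 'a::ab_group_add) gvs" and dA :: "'a \<Rightarrow> 'a"
  assumes "cochain_complex V dV" and "cochain_complex A dA"
  shows "\<exists>\<Theta>. bij_betw \<Theta> {Q. Ger_infinity_plus V dV A dA Q} {T. Ger_Ainf_morphism_triple V dV A dA T}
           \<and> (\<forall>Q. Ger_infinity_plus V dV A dA Q \<longrightarrow> corresponds V A Q (\<Theta> Q))"
proof -
  have V: "graded_space V" and A: "graded_space A" using assms by (simp_all add: cochain_complex_def)
  \<comment> \<open>Any choice will do, since \<open>corresponds\<close> determines the triple.
    Injectivity and surjectivity are the uniqueness and the existence of a structure corresponding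
    to a given triple.\<close>
  define \<Theta> where "\<Theta> Q = (SOME T. Ger_Ainf_morphism_triple V dV A dA T \<and> corresponds V A Q T)" for Q
  have \<Theta>: "Ger_Ainf_morphism_triple V dV A dA (\<Theta> Q)" "corresponds V A Q (\<Theta> Q)" if "Ger_infinity_plus V dV A dA Q" for Q
    using someI_ex[OF plus_triple[OF V A that], folded \<Theta>_def] by (rule conjunct1, rule conjunct2)
  have "bij_betw \<Theta> {Q. Ger_infinity_plus V dV A dA Q} {T. Ger_Ainf_morphism_triple V dV A dA T}"
    unfolding bij_betw_def
  proof
    show "inj_on \<Theta> {Q. Ger_infinity_plus V dV A dA Q}"
    proof (rule inj_onI, unfold mem_Collect_eq)
      fix Q Q' assume P: "Ger_infinity_plus V dV A dA Q" "Ger_infinity_plus V dV A dA Q'" and e: "\<Theta> Q = \<Theta> Q'"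
      show "Q = Q'"
        by (rule corresponds_unique_plus[OF V A P \<Theta>(2)[OF P(1)]]) (unfold e, rule \<Theta>(2)[OF P(2)])
    qed
    show "\<Theta> ` {Q. Ger_infinity_plus V dV A dA Q} = {T. Ger_Ainf_morphism_triple V dV A dA T}"
    proof
      show "\<Theta> ` {Q. Ger_infinity_plus V dV A dA Q} \<subseteq> {T. Ger_Ainf_morphism_triple V dV A dA T}"
        using \<Theta>(1) by auto
      show "{T. Ger_Ainf_morphism_triple V dV A dA T} \<subseteq> \<Theta> ` {Q. Ger_infinity_plus V dV A dA Q}"
      proof
        fix T assume "T \<in> {T. Ger_Ainf_morphism_triple V dV A dA T}"
        then have T: "Ger_Ainf_morphism_triple V dV A dA T" by simp
        obtain Q where Q: "Ger_infinity_plus V dV A dA Q" "corresponds V A Q T"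
          using triple_plus[OF V A T] by (elim exE conjE)
        have "T = \<Theta> Q" by (rule corresponds_unique_triple[OF V A T \<Theta>(1)[OF Q(1)] Q(2) \<Theta>(2)[OF Q(1)]])
        then show "T \<in> \<Theta> ` {Q. Ger_infinity_plus V dV A dA Q}" using Q(1) by simp
      qed
    qed
  qed
  then show ?thesis using \<Theta>(2) by (intro exI[of _ \<Theta>]) simp
qed

end
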